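(* Let $\mathcal A$ be a category admitting an initial object $\varnothing$. Then there exists a 2-adjunction $$\mathsf{PrFib}(\mathcal A)\ \rightleftarrows\ \mathsf{PrMnd}(\mathcal A)$$ between the 2-category of pruned fibrations over $\mathcal A$ and the 2-category of pruned parametrized monads with category of parameters $\mathcal A$, whose left adjoint sends $p$ to $T^p$ and whose right adjoint sends $T$ to its Eilenberg--Moore fibration $p^T$. Its unit at a pruned fibration $p:\mathcal E\to\mathcal A$ is a fibred functor $$\eta_p:\mathcal E\longrightarrow \mathcal A\ltimes^{T^p}\mathcal E_\varnothing$$ commuting with $p$ and with $p^{T^p}:\mathcal A\ltimes^{T^p}\mathcal E_\varnothing\to\mathcal A$. This unit is induced by the terminal (universal) property of the Eilenberg--Moore construction, i.e. it is the comparison functor into the Eilenberg--Moore category of the monad on $\mathcal A\times\mathcal E_\varnothing$ generated by the adjunction $(p_L+i)\dashv\langle p,i_R\rangle$. Moreover, $\eta_p$ is an equivalence if and only if $p$ is (up to equivalence over $\mathcal A$) the Eilenberg--Moore fibration $p^T$ of a parametrized monad $T$ for which $T_\varnothing$ is isomorphic to the identity monad.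
   Context: **Parametrized monads.** A parametrized monad with category of parameters $\mathcal A$ and category of carriers $\mathcal X$ is a functor $T:\mathcal A\to\mathsf{Mnd}(\mathcal X)$, $A\mapsto T_A$, into the category of monads on $\mathcal X$ and monad morphisms (natural transformations compatible with units and multiplications); equivalently a functor $T:\mathcal A\times\mathcal X\to\mathcal X$ with each $T_A=T(A,-)$ a monad and each $T_f:T_A\Rightarrow T_B$ ($f:A\to B$) a monad morphism. **Eilenberg--Moore fibration.** $\mathcal A\ltimes^T\mathcal X$ has as objects the triples $(A,X,\xi)$ with $A\in\mathcal A$ and $\xi:T_AX\to X$ an Eilenberg--Moore algebra of $T_A$; a morphism $(A,X,\xi)\to(B,Y,\theta)$ is a pair $(f:A\to B,\ g:X\to Y)$ with $g\circ\xi=\theta\circ T(f,g)$. The functor $p^T:\mathcal A\ltimes^T\mathcal X\to\mathcal A$, $(A,X,\xi)\mapsto A$, is a fibration, with reindexing along $f:A'\to A$ given by $(X,\xi)\mapsto(X,\xi\circ (T_f)_X)$. **Initial fibre.** For a fibration $p:\mathcal E\to\mathcal A$, let $i:\mathcal E_\varnothing\to\mathcal E$ be the inclusion of the fibre over $\varnothing$ (the initial fibre). It has a right adjoint $i_R:\mathcal E\to\mathcal E_\varnothing$, which reindexes $E$ along the unique morphism $\varnothing\to pE$. **Pruned fibrations.** $\mathsf{PrFib}(\mathcal A)$ is the full 2-subcategory of the 2-category $\mathsf{Fib}(\mathcal A)$ (fibrations over $\mathcal A$, cartesian functors over $\mathcal A$, vertical natural transformations) on the fibrations $p:\mathcal E\to\mathcal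 A$ such that: (1) $p$ has a full and faithful left adjoint $p_L$ (so $p_LA=\varnothing_A$ is an initial object of the fibre $\mathcal E_A$); (2) for all $A\in\mathcal A$ and $E_0\in\mathcal E_\varnothing$ the coproduct $\varnothing_A+iE_0=p_LA+iE_0$ exists in $\mathcal E$; (3) $p$ preserves these coproducts. **Pruned monads.** $\mathsf{PrMnd}(\mathcal A)$ is the 2-category whose objects are the parametrized monads $T:\mathcal A\times\mathcal X\to\mathcal X$ such that $\mathcal X$ has an initial object and $T_\varnothing$ is isomorphic to the identity monad. A 1-cell $(\mathcal X,T)\to(\mathcal Y,S)$ is a pair $(V,\delta)$ where $V:\mathcal X\to\mathcal Y$ is a functor and $\delta_{A,X}:S_AVX\to VT_AX$ is natural in $A$ and $X$ and compatible with units and multiplications: $\delta_{A}\circ\eta^{S_A}V=V\eta^{T_A}$ and $\delta_A\circ\mu^{S_A}V=V\mu^{T_A}\circ\delta_AT_A\circ S_A\delta_A$. A 2-cell $(V,\delta)\Rightarrow(V',\delta')$ is a natural transformation $\nu:V\Rightarrow V'$ with $\nu_{T_AX}\circ\delta_{A,X}=\delta'_{A,X}\circ S_A(\nu_X)$. The right adjoint acts on 1-cells by $(A,X,\xi)\mapsto(A,VX,V\xi\circ\delta_{A,X})$. **The monad $T^p$.** For a pruned fibration $p$, the functor $\langle p,i_R\rangle:\mathcal E\to\mathcal A\times\mathcal E_\varnothing$ has left adjoint $(p_L+i):(A,E_0)\mapsto p_LA+iE_0$. The monad generated by this adjunction on $\mathcal A\times\mathcal E_\varnothing$ lies (up to isomorphism)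 over the projection to $\mathcal A$, and so amounts to a parametrized monad $T^p:\mathcal A\to\mathsf{Mnd}(\mathcal E_\varnothing)$ with $T^p_A(E_0)=i_R(p_LA+iE_0)$.
   Formalization: "2-adjunction" is proved as a biadjunction: both adjoints are strict 2-functors, but the unit is pseudonatural and hom-categories are equivalent, not isomorphic; the strict form fails, e.g. for the identity fibration of the arrow category and the identity monad on a two-object chaotic category. *)

theory Defs
  imports "HOL-Library.FuncSet"
begin

section \<open>Categories, functors, natural transformations\<close>

record ('o, 'm) cat =
  Obj :: "'o set"
  Arr :: "'m set"
  Dom :: "'m \<Rightarrow> 'o"
  Cod :: "'m \<Rightarrow> 'o"
  Idn :: "'o \<Rightarrow> 'm"
  Cmp :: "'m \<Rightarrow> 'm \<Rightarrow> 'm"  (infixl "\<cdot>\<index>" 70)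

definition hom :: "('o, 'm, 'z) cat_scheme \<Rightarrow> 'o \<Rightarrow> 'o \<Rightarrow> 'm set" where
  "hom C x y = {f \<in> Arr C. Dom C f = x \<and> Cod C f = y}"

definition category :: "('o, 'm) cat \<Rightarrow> bool" where
  "category C \<longleftrightarrow>
     (\<forall>f\<in>Arr C. Dom C f \<in> Obj C \<and> Cod C f \<in> Obj C) \<and>
     (\<forall>x\<in>Obj C. Idn C x \<in> hom C x x) \<and>
     (\<forall>f\<in>Arr C. \<forall>g\<in>Arr C. Cod C f = Dom C g \<longrightarrow> g \<cdot>\<^bsub>C\<^esub> f \<in> hom C (Dom C f) (Cod C g)) \<and>
     (\<forall>f\<in>Arr C. f \<cdot>\<^bsub>C\<^esub> Idn C (Dom C f) = f \<and> Idn C (Cod C f) \<cdot>\<^bsub>C\<^esub> f = f) \<and>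
     (\<forall>f\<in>Arr C. \<forall>g\<in>Arr C. \<forall>h\<in>Arr C. Cod C f = Dom C g \<longrightarrow> Cod C g = Dom C h \<longrightarrow>
        (h \<cdot>\<^bsub>C\<^esub> g) \<cdot>\<^bsub>C\<^esub> f = h \<cdot>\<^bsub>C\<^esub> (g \<cdot>\<^bsub>C\<^esub> f))"

definition is_iso :: "('o, 'm) cat \<Rightarrow> 'm \<Rightarrow> bool" where
  "is_iso C f \<longleftrightarrow> f \<in> Arr C \<and>
     (\<exists>g \<in> hom C (Cod C f) (Dom C f).
        g \<cdot>\<^bsub>C\<^esub> f = Idn C (Dom C f) \<and> f \<cdot>\<^bsub>C\<^esub> g = Idn C (Cod C f))"

definition isomorphic :: "('o, 'm) cat \<Rightarrow> 'o \<Rightarrow> 'o \<Rightarrow> bool" where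
  "isomorphic C x y \<longleftrightarrow> (\<exists>f \<in> hom C x y. is_iso C f)"

definition initial :: "('o, 'm) cat \<Rightarrow> 'o \<Rightarrow> bool" where
  "initial C z \<longleftrightarrow> z \<in> Obj C \<and> (\<forall>x\<in>Obj C. \<exists>!f. f \<in> hom C z x)"

definition init_arr :: "('o, 'm) cat \<Rightarrow> 'o \<Rightarrow> 'o \<Rightarrow> 'm" where
  "init_arr C z x = (THE f. f \<in> hom C z x)"

definition is_coproduct :: "('o, 'm) cat \<Rightarrow> 'o \<Rightarrow> 'o \<Rightarrow> 'm \<Rightarrow> 'm \<Rightarrow> bool" where
  "is_coproduct C x y i j \<longleftrightarrow>
     i \<in> Arr C \<and> j \<in> Arr C \<and> Dom C i = x \<and> Dom C j = y \<and> Cod C i = Cod C j \<and>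
     (\<forall>f\<in>Arr C. \<forall>g\<in>Arr C. Dom C f = x \<longrightarrow> Dom C g = y \<longrightarrow> Cod C f = Cod C g \<longrightarrow>
        (\<exists>!h. h \<in> hom C (Cod C i) (Cod C f) \<and> h \<cdot>\<^bsub>C\<^esub> i = f \<and> h \<cdot>\<^bsub>C\<^esub> j = g))"

definition copair :: "('o, 'm) cat \<Rightarrow> 'm \<Rightarrow> 'm \<Rightarrow> 'm \<Rightarrow> 'm \<Rightarrow> 'm" where
  "copair C i j f g =
     (THE h. h \<in> hom C (Cod C i) (Cod C f) \<and> h \<cdot>\<^bsub>C\<^esub> i = f \<and> h \<cdot>\<^bsub>C\<^esub> j = g)"

definition prod_cat ::
  "('o, 'm) cat \<Rightarrow> ('p, 'n) cat \<Rightarrow> ('o \<times> 'p, 'm \<times> 'n) cat"  (infixr "\<times>\<^sub>C" 75) where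
  "C \<times>\<^sub>C D =
     \<lparr>Obj = Obj C \<times> Obj D, Arr = Arr C \<times> Arr D,
      Dom = (\<lambda>(f, g). (Dom C f, Dom D g)), Cod = (\<lambda>(f, g). (Cod C f, Cod D g)),
      Idn = (\<lambda>(x, y). (Idn C x, Idn D y)),
      Cmp = (\<lambda>(f', g') (f, g). (f' \<cdot>\<^bsub>C\<^esub> f, g' \<cdot>\<^bsub>D\<^esub> g))\<rparr>"

text \<open>Functors and natural transformations are required to be extensional
  (\<^term>\<open>undefined\<close> off the domain), so that HOL equality of functors is the intended
  equality, and the 2-categories below are strictly associative and unital.\<close>

record ('o, 'm, 'p, 'n) ftor =
  Fo :: "'o \<Rightarrow> 'p"
  Fa :: "'m \<Rightarrow> 'n"

definition is_functor :: "('o, 'm) cat \<Rightarrow> ('p, 'n) cat \<Rightarrow> ('o, 'm, 'p, 'n) ftor \<Rightarrow> bool" where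
  "is_functor C D F \<longleftrightarrow>
     Fo F \<in> Obj C \<rightarrow>\<^sub>E Obj D \<and> Fa F \<in> Arr C \<rightarrow>\<^sub>E Arr D \<and>
     (\<forall>f\<in>Arr C. Dom D (Fa F f) = Fo F (Dom C f) \<and> Cod D (Fa F f) = Fo F (Cod C f)) \<and>
     (\<forall>x\<in>Obj C. Fa F (Idn C x) = Idn D (Fo F x)) \<and>
     (\<forall>f\<in>Arr C. \<forall>g\<in>Arr C. Cod C f = Dom C g \<longrightarrow> Fa F (g \<cdot>\<^bsub>C\<^esub> f) = Fa F g \<cdot>\<^bsub>D\<^esub> Fa F f)"

definition ftor_id :: "('o, 'm) cat \<Rightarrow> ('o, 'm, 'o, 'm) ftor" where
  "ftor_id C = \<lparr>Fo = (\<lambda>x\<in>Obj C. x), Fa = (\<lambda>f\<in>Arr C. f)\<rparr>"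

text \<open>\<open>ftor_comp C G F\<close> is \<open>G \<circ> F\<close> for \<open>F\<close> with source category \<open>C\<close>.\<close>

definition ftor_comp ::
  "('o, 'm) cat \<Rightarrow> ('p, 'n, 'q, 'k) ftor \<Rightarrow> ('o, 'm, 'p, 'n) ftor \<Rightarrow> ('o, 'm, 'q, 'k) ftor" where
  "ftor_comp C G F = \<lparr>Fo = (\<lambda>x\<in>Obj C. Fo G (Fo F x)), Fa = (\<lambda>f\<in>Arr C. Fa G (Fa F f))\<rparr>"

definition ftor_pair ::
  "('o, 'm) cat \<Rightarrow> ('o, 'm, 'p, 'n) ftor \<Rightarrow> ('o, 'm, 'q, 'k) ftor \<Rightarrow>
   ('o, 'm, 'p \<times> 'q, 'n \<times> 'k) ftor" where
  "ftor_pair C F G =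
     \<lparr>Fo = (\<lambda>x\<in>Obj C. (Fo F x, Fo G x)), Fa = (\<lambda>f\<in>Arr C. (Fa F f, Fa G f))\<rparr>"

definition full_faithful ::
  "('o, 'm) cat \<Rightarrow> ('p, 'n) cat \<Rightarrow> ('o, 'm, 'p, 'n) ftor \<Rightarrow> bool" where
  "full_faithful C D F \<longleftrightarrow> is_functor C D F \<and>
     (\<forall>x\<in>Obj C. \<forall>y\<in>Obj C. bij_betw (Fa F) (hom C x y) (hom D (Fo F x) (Fo F y)))"

definition cat_isomorphism ::
  "('o, 'm) cat \<Rightarrow> ('p, 'n) cat \<Rightarrow> ('o, 'm, 'p, 'n) ftor \<Rightarrow> bool" where
  "cat_isomorphism C D F \<longleftrightarrow> is_functor C D F \<and>
     bij_betw (Fo F) (Obj C) (Obj D) \<and> bij_betw (Fa F) (Arr C) (Arr D)"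

definition nat_trans ::
  "('o, 'm) cat \<Rightarrow> ('p, 'n) cat \<Rightarrow> ('o, 'm, 'p, 'n) ftor \<Rightarrow> ('o, 'm, 'p, 'n) ftor \<Rightarrow>
   ('o \<Rightarrow> 'n) \<Rightarrow> bool" where
  "nat_trans C D F G t \<longleftrightarrow>
     is_functor C D F \<and> is_functor C D G \<and> t \<in> extensional (Obj C) \<and>
     (\<forall>x\<in>Obj C. t x \<in> hom D (Fo F x) (Fo G x)) \<and>
     (\<forall>f\<in>Arr C. t (Cod C f) \<cdot>\<^bsub>D\<^esub> Fa F f = Fa G f \<cdot>\<^bsub>D\<^esub> t (Dom C f))"

definition nat_iso ::
  "('o, 'm) cat \<Rightarrow> ('p, 'n) cat \<Rightarrow> ('o, 'm, 'p, 'n) ftor \<Rightarrow> ('o, 'm, 'p, 'n) ftor \<Rightarrow>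
   ('o \<Rightarrow> 'n) \<Rightarrow> bool" where
  "nat_iso C D F G t \<longleftrightarrow> nat_trans C D F G t \<and> (\<forall>x\<in>Obj C. is_iso D (t x))"

definition equivalence_functor ::
  "('o, 'm) cat \<Rightarrow> ('p, 'n) cat \<Rightarrow> ('o, 'm, 'p, 'n) ftor \<Rightarrow> bool" where
  "equivalence_functor C D F \<longleftrightarrow> is_functor C D F \<and>
     (\<exists>G s t. is_functor D C G \<and>
        nat_iso C C (ftor_id C) (ftor_comp C G F) s \<and> nat_iso D D (ftor_comp D F G) (ftor_id D) t)"

text \<open>\<open>adjunction C D L R \<eta> \<epsilon>\<close>: \<open>L : C \<rightarrow> D\<close> is left adjoint to \<open>R : D \<rightarrow> C\<close>.\<close>

definition adjunction ::
  "('o, 'm) cat \<Rightarrow> ('p, 'n) cat \<Rightarrow> ('o, 'm, 'p, 'n) ftor \<Rightarrow> ('p, 'n, 'o, 'm) ftor \<Rightarrow>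
   ('o \<Rightarrow> 'm) \<Rightarrow> ('p \<Rightarrow> 'n) \<Rightarrow> bool" where
  "adjunction C D L R \<eta> \<epsilon> \<longleftrightarrow>
     is_functor C D L \<and> is_functor D C R \<and>
     nat_trans C C (ftor_id C) (ftor_comp C R L) \<eta> \<and>
     nat_trans D D (ftor_comp D L R) (ftor_id D) \<epsilon> \<and>
     (\<forall>x\<in>Obj C. \<epsilon> (Fo L x) \<cdot>\<^bsub>D\<^esub> Fa L (\<eta> x) = Idn D (Fo L x)) \<and>
     (\<forall>y\<in>Obj D. Fa R (\<epsilon> y) \<cdot>\<^bsub>C\<^esub> \<eta> (Fo R y) = Idn C (Fo R y))"


section \<open>Monads and Eilenberg--Moore categories\<close>

record ('o, 'm) monad =
  Fun :: "('o, 'm, 'o, 'm) ftor"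
  Unit :: "'o \<Rightarrow> 'm"
  Mult :: "'o \<Rightarrow> 'm"

definition is_monad :: "('o, 'm) cat \<Rightarrow> ('o, 'm) monad \<Rightarrow> bool" where
  "is_monad C M \<longleftrightarrow>
     nat_trans C C (ftor_id C) (Fun M) (Unit M) \<and>
     nat_trans C C (ftor_comp C (Fun M) (Fun M)) (Fun M) (Mult M) \<and>
     (\<forall>x\<in>Obj C.
        Mult M x \<cdot>\<^bsub>C\<^esub> Unit M (Fo (Fun M) x) = Idn C (Fo (Fun M) x) \<and>
        Mult M x \<cdot>\<^bsub>C\<^esub> Fa (Fun M) (Unit M x) = Idn C (Fo (Fun M) x) \<and>
        Mult M x \<cdot>\<^bsub>C\<^esub> Mult M (Fo (Fun M) x) = Mult M x \<cdot>\<^bsub>C\<^esub> Fa (Fun M) (Mult M x))"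

definition id_monad :: "('o, 'm) cat \<Rightarrow> ('o, 'm) monad" where
  "id_monad C = \<lparr>Fun = ftor_id C, Unit = (\<lambda>x\<in>Obj C. Idn C x), Mult = (\<lambda>x\<in>Obj C. Idn C x)\<rparr>"

definition monad_morphism ::
  "('o, 'm) cat \<Rightarrow> ('o, 'm) monad \<Rightarrow> ('o, 'm) monad \<Rightarrow> ('o \<Rightarrow> 'm) \<Rightarrow> bool" where
  "monad_morphism C M N t \<longleftrightarrow>
     nat_trans C C (Fun M) (Fun N) t \<and>
     (\<forall>x\<in>Obj C. t x \<cdot>\<^bsub>C\<^esub> Unit M x = Unit N x \<and>
        t x \<cdot>\<^bsub>C\<^esub> Mult M x = Mult N x \<cdot>\<^bsub>C\<^esub> (Fa (Fun N) (t x) \<cdot>\<^bsub>C\<^esub> t (Fo (Fun M) x)))"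

definition isomorphic_monads ::
  "('o, 'm) cat \<Rightarrow> ('o, 'm) monad \<Rightarrow> ('o, 'm) monad \<Rightarrow> bool" where
  "isomorphic_monads C M N \<longleftrightarrow>
     (\<exists>t. monad_morphism C M N t \<and> (\<forall>x\<in>Obj C. is_iso C (t x)))"

definition em_algebra :: "('o, 'm) cat \<Rightarrow> ('o, 'm) monad \<Rightarrow> 'o \<Rightarrow> 'm \<Rightarrow> bool" where
  "em_algebra C M x \<xi> \<longleftrightarrow>
     x \<in> Obj C \<and> \<xi> \<in> hom C (Fo (Fun M) x) x \<and>
     \<xi> \<cdot>\<^bsub>C\<^esub> Unit M x = Idn C x \<and> \<xi> \<cdot>\<^bsub>C\<^esub> Fa (Fun M) \<xi> = \<xi> \<cdot>\<^bsub>C\<^esub> Mult M x"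

text \<open>An arrow is stored together with its source and target algebra.\<close>

definition em_cat ::
  "('o, 'm) cat \<Rightarrow> ('o, 'm) monad \<Rightarrow> ('o \<times> 'm, ('o \<times> 'm) \<times> ('o \<times> 'm) \<times> 'm) cat" where
  "em_cat C M =
     \<lparr>Obj = {(x, \<xi>). em_algebra C M x \<xi>},
      Arr = {((x, \<xi>), (y, \<theta>), g) | x \<xi> y \<theta> g.
               em_algebra C M x \<xi> \<and> em_algebra C M y \<theta> \<and> g \<in> hom C x y \<and>
               g \<cdot>\<^bsub>C\<^esub> \<xi> = \<theta> \<cdot>\<^bsub>C\<^esub> Fa (Fun M) g},
      Dom = (\<lambda>(s, t, g). s), Cod = (\<lambda>(s, t, g). t),
      Idn = (\<lambda>s. (s, s, Idn C (fst s))),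
      Cmp = (\<lambda>(s', t', g') (s, t, g). (s, t', g' \<cdot>\<^bsub>C\<^esub> g))\<rparr>"

definition adj_monad ::
  "('o, 'm) cat \<Rightarrow> ('o, 'm, 'p, 'n) ftor \<Rightarrow> ('p, 'n, 'o, 'm) ftor \<Rightarrow>
   ('o \<Rightarrow> 'm) \<Rightarrow> ('p \<Rightarrow> 'n) \<Rightarrow> ('o, 'm) monad" where
  "adj_monad C L R \<eta> \<epsilon> =
     \<lparr>Fun = ftor_comp C R L, Unit = \<eta>, Mult = (\<lambda>x\<in>Obj C. Fa R (\<epsilon> (Fo L x)))\<rparr>"

text \<open>The comparison functor \<open>D \<rightarrow> em_cat C (adj_monad C L R \<eta> \<epsilon>)\<close>.\<close>

definition comparison ::
  "('p, 'n) cat \<Rightarrow> ('p, 'n, 'o, 'm) ftor \<Rightarrow> ('p \<Rightarrow> 'n) \<Rightarrow>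
   ('p, 'n, 'o \<times> 'm, ('o \<times> 'm) \<times> ('o \<times> 'm) \<times> 'm) ftor" where
  "comparison D R \<epsilon> =
     (let alg = (\<lambda>y. (Fo R y, Fa R (\<epsilon> y)))
      in \<lparr>Fo = (\<lambda>y\<in>Obj D. alg y),
          Fa = (\<lambda>u\<in>Arr D. (alg (Dom D u), alg (Cod D u), Fa R u))\<rparr>)"


section \<open>2-categories and 2-adjunctions\<close>

text \<open>A (strict) 2-category: \<open>Hom2 K a b\<close> has the 1-cells \<open>a \<rightarrow> b\<close> as objects and the
  2-cells between them as arrows; \<open>Comp2 K a b c\<close> is the composition functor
  \<open>Hom2 K b c \<times> Hom2 K a b \<rightarrow> Hom2 K a c\<close>.\<close>

record ('o, 'm, 'c) twocat =
  Ob2 :: "'o set"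
  Hom2 :: "'o \<Rightarrow> 'o \<Rightarrow> ('m, 'c) cat"
  Id2 :: "'o \<Rightarrow> 'm"
  Comp2 :: "'o \<Rightarrow> 'o \<Rightarrow> 'o \<Rightarrow> ('m \<times> 'm, 'c \<times> 'c, 'm, 'c) ftor"

definition comp1 :: "('o, 'm, 'c) twocat \<Rightarrow> 'o \<Rightarrow> 'o \<Rightarrow> 'o \<Rightarrow> 'm \<Rightarrow> 'm \<Rightarrow> 'm" where
  "comp1 K a b c g f = Fo (Comp2 K a b c) (g, f)"

definition hcomp :: "('o, 'm, 'c) twocat \<Rightarrow> 'o \<Rightarrow> 'o \<Rightarrow> 'o \<Rightarrow> 'c \<Rightarrow> 'c \<Rightarrow> 'c" where
  "hcomp K a b c \<beta> \<alpha> = Fa (Comp2 K a b c) (\<beta>, \<alpha>)"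

definition id2cell :: "('o, 'm, 'c) twocat \<Rightarrow> 'o \<Rightarrow> 'o \<Rightarrow> 'm \<Rightarrow> 'c" where
  "id2cell K a b f = Idn (Hom2 K a b) f"

definition two_category :: "('o, 'm, 'c) twocat \<Rightarrow> bool" where
  "two_category K \<longleftrightarrow>
     (\<forall>a\<in>Ob2 K. \<forall>b\<in>Ob2 K. category (Hom2 K a b)) \<and>
     (\<forall>a\<in>Ob2 K. Id2 K a \<in> Obj (Hom2 K a a)) \<and>
     (\<forall>a\<in>Ob2 K. \<forall>b\<in>Ob2 K. \<forall>c\<in>Ob2 K.
        is_functor (Hom2 K b c \<times>\<^sub>C Hom2 K a b) (Hom2 K a c) (Comp2 K a b c)) \<and>
     (\<forall>a\<in>Ob2 K. \<forall>b\<in>Ob2 K. \<forall>f\<in>Obj (Hom2 K a b).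
        comp1 K a a b f (Id2 K a) = f \<and> comp1 K a b b (Id2 K b) f = f) \<and>
     (\<forall>a\<in>Ob2 K. \<forall>b\<in>Ob2 K. \<forall>\<alpha>\<in>Arr (Hom2 K a b).
        hcomp K a a b \<alpha> (id2cell K a a (Id2 K a)) = \<alpha> \<and>
        hcomp K a b b (id2cell K b b (Id2 K b)) \<alpha> = \<alpha>) \<and>
     (\<forall>a\<in>Ob2 K. \<forall>b\<in>Ob2 K. \<forall>c\<in>Ob2 K. \<forall>d\<in>Ob2 K.
        (\<forall>f\<in>Obj (Hom2 K a b). \<forall>g\<in>Obj (Hom2 K b c). \<forall>h\<in>Obj (Hom2 K c d).
           comp1 K a b d (comp1 K b c d h g) f = comp1 K a c d h (comp1 K a b c g f)) \<and>
        (\<forall>\<alpha>\<in>Arr (Hom2 K a b). \<forall>\<beta>\<in>Arr (Hom2 K b c). \<forall>\<gamma>\<in>Arr (Hom2 K c d).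
           hcomp K a b d (hcomp K b c d \<gamma> \<beta>) \<alpha> = hcomp K a c d \<gamma> (hcomp K a b c \<beta> \<alpha>)))"

definition internal_equivalence ::
  "('o, 'm, 'c) twocat \<Rightarrow> 'o \<Rightarrow> 'o \<Rightarrow> 'm \<Rightarrow> bool" where
  "internal_equivalence K a b f \<longleftrightarrow>
     f \<in> Obj (Hom2 K a b) \<and>
     (\<exists>g \<in> Obj (Hom2 K b a).
        isomorphic (Hom2 K a a) (comp1 K a b a g f) (Id2 K a) \<and>
        isomorphic (Hom2 K b b) (comp1 K b a b f g) (Id2 K b))"

definition equivalent :: "('o, 'm, 'c) twocat \<Rightarrow> 'o \<Rightarrow> 'o \<Rightarrow> bool" where
  "equivalent K a b \<longleftrightarrow> (\<exists>f. internal_equivalence K a b f)"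

record ('o, 'm, 'c, 'p, 'n, 'd) twoftor =
  F0 :: "'o \<Rightarrow> 'p"
  FH :: "'o \<Rightarrow> 'o \<Rightarrow> ('m, 'c, 'n, 'd) ftor"

text \<open>Strict 2-functors.\<close>

definition two_functor ::
  "('o, 'm, 'c) twocat \<Rightarrow> ('p, 'n, 'd) twocat \<Rightarrow> ('o, 'm, 'c, 'p, 'n, 'd) twoftor \<Rightarrow> bool" where
  "two_functor K M F \<longleftrightarrow>
     (\<forall>a\<in>Ob2 K. F0 F a \<in> Ob2 M) \<and>
     (\<forall>a\<in>Ob2 K. \<forall>b\<in>Ob2 K.
        is_functor (Hom2 K a b) (Hom2 M (F0 F a) (F0 F b)) (FH F a b)) \<and>
     (\<forall>a\<in>Ob2 K. Fo (FH F a a) (Id2 K a) = Id2 M (F0 F a)) \<and>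
     (\<forall>a\<in>Ob2 K. \<forall>b\<in>Ob2 K. \<forall>c\<in>Ob2 K.
        (\<forall>f\<in>Obj (Hom2 K a b). \<forall>g\<in>Obj (Hom2 K b c).
           Fo (FH F a c) (comp1 K a b c g f) =
           comp1 M (F0 F a) (F0 F b) (F0 F c) (Fo (FH F b c) g) (Fo (FH F a b) f)) \<and>
        (\<forall>\<alpha>\<in>Arr (Hom2 K a b). \<forall>\<beta>\<in>Arr (Hom2 K b c).
           Fa (FH F a c) (hcomp K a b c \<beta> \<alpha>) =
           hcomp M (F0 F a) (F0 F b) (F0 F c) (Fa (FH F b c) \<beta>) (Fa (FH F a b) \<alpha>)))"

definition two_id :: "('o, 'm, 'c) twocat \<Rightarrow> ('o, 'm, 'c, 'o, 'm, 'c) twoftor" where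
  "two_id K = \<lparr>F0 = (\<lambda>a. a), FH = (\<lambda>a b. ftor_id (Hom2 K a b))\<rparr>"

definition two_comp ::
  "('o, 'm, 'c) twocat \<Rightarrow> ('p, 'n, 'd, 'q, 'k, 'e) twoftor \<Rightarrow> ('o, 'm, 'c, 'p, 'n, 'd) twoftor \<Rightarrow>
   ('o, 'm, 'c, 'q, 'k, 'e) twoftor" where
  "two_comp K G F =
     \<lparr>F0 = (\<lambda>a. F0 G (F0 F a)),
      FH = (\<lambda>a b. ftor_comp (Hom2 K a b) (FH G (F0 F a) (F0 F b)) (FH F a b))\<rparr>"

text \<open>Pseudonatural transformations \<open>t : F \<Rightarrow> G\<close> of 2-functors \<open>K \<rightarrow> M\<close>: 1-cells
  \<open>N0 t a : F a \<rightarrow> G a\<close> and, for each \<open>f : a \<rightarrow> b\<close>, an invertible 2-cell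
  \<open>N1 t a b f : G f \<circ> N0 t a \<Rightarrow> N0 t b \<circ> F f\<close>, natural in \<open>f\<close> and compatible with
  identity 1-cells and composition of 1-cells.\<close>

record ('o, 'm, 'n, 'd) pnt =
  N0 :: "'o \<Rightarrow> 'n"
  N1 :: "'o \<Rightarrow> 'o \<Rightarrow> 'm \<Rightarrow> 'd"

definition pseudonatural ::
  "('o, 'm, 'c) twocat \<Rightarrow> ('p, 'n, 'd) twocat \<Rightarrow> ('o, 'm, 'c, 'p, 'n, 'd) twoftor \<Rightarrow>
   ('o, 'm, 'c, 'p, 'n, 'd) twoftor \<Rightarrow> ('o, 'm, 'n, 'd) pnt \<Rightarrow> bool" where
  "pseudonatural K M F G t \<longleftrightarrow>
     two_functor K M F \<and> two_functor K M G \<and>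
     (\<forall>a\<in>Ob2 K. N0 t a \<in> Obj (Hom2 M (F0 F a) (F0 G a))) \<and>
     (\<forall>a\<in>Ob2 K. \<forall>b\<in>Ob2 K. \<forall>f\<in>Obj (Hom2 K a b).
        N1 t a b f \<in> hom (Hom2 M (F0 F a) (F0 G b))
          (comp1 M (F0 F a) (F0 G a) (F0 G b) (Fo (FH G a b) f) (N0 t a))
          (comp1 M (F0 F a) (F0 F b) (F0 G b) (N0 t b) (Fo (FH F a b) f)) \<and>
        is_iso (Hom2 M (F0 F a) (F0 G b)) (N1 t a b f)) \<and>
     (\<forall>a\<in>Ob2 K. \<forall>b\<in>Ob2 K. \<forall>\<alpha>\<in>Arr (Hom2 K a b).
        hcomp M (F0 F a) (F0 F b) (F0 G b)
            (id2cell M (F0 F b) (F0 G b) (N0 t b)) (Fa (FH F a b) \<alpha>)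
          \<cdot>\<^bsub>Hom2 M (F0 F a) (F0 G b)\<^esub> N1 t a b (Dom (Hom2 K a b) \<alpha>) =
        N1 t a b (Cod (Hom2 K a b) \<alpha>)
          \<cdot>\<^bsub>Hom2 M (F0 F a) (F0 G b)\<^esub>
          hcomp M (F0 F a) (F0 G a) (F0 G b)
            (Fa (FH G a b) \<alpha>) (id2cell M (F0 F a) (F0 G a) (N0 t a))) \<and>
     (\<forall>a\<in>Ob2 K. N1 t a a (Id2 K a) = id2cell M (F0 F a) (F0 G a) (N0 t a)) \<and>
     (\<forall>a\<in>Ob2 K. \<forall>b\<in>Ob2 K. \<forall>c\<in>Ob2 K. \<forall>f\<in>Obj (Hom2 K a b). \<forall>g\<in>Obj (Hom2 K b c).
        N1 t a c (comp1 K a b c g f) =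
        hcomp M (F0 F a) (F0 F b) (F0 G c)
            (N1 t b c g) (id2cell M (F0 F a) (F0 F b) (Fo (FH F a b) f))
          \<cdot>\<^bsub>Hom2 M (F0 F a) (F0 G c)\<^esub>
          hcomp M (F0 F a) (F0 G b) (F0 G c)
            (id2cell M (F0 G b) (F0 G c) (Fo (FH G b c) g)) (N1 t a b f))"

text \<open>The functor \<open>M(L a, x) \<rightarrow> K(a, R x)\<close>, \<open>g \<mapsto> R g \<circ> \<eta>\<^sub>a\<close>.\<close>

definition transpose ::
  "('o, 'm, 'c) twocat \<Rightarrow> ('p, 'n, 'd) twocat \<Rightarrow> ('o, 'm, 'c, 'p, 'n, 'd) twoftor \<Rightarrow>
   ('p, 'n, 'd, 'o, 'm, 'c) twoftor \<Rightarrow> ('o, 'm, 'm, 'c) pnt \<Rightarrow> 'o \<Rightarrow> 'p \<Rightarrow>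
   ('n, 'd, 'm, 'c) ftor" where
  "transpose K M L R \<eta> a x =
     \<lparr>Fo = (\<lambda>g\<in>Obj (Hom2 M (F0 L a) x).
              comp1 K a (F0 R (F0 L a)) (F0 R x) (Fo (FH R (F0 L a) x) g) (N0 \<eta> a)),
      Fa = (\<lambda>\<beta>\<in>Arr (Hom2 M (F0 L a) x).
              hcomp K a (F0 R (F0 L a)) (F0 R x)
                (Fa (FH R (F0 L a) x) \<beta>) (id2cell K a (F0 R (F0 L a)) (N0 \<eta> a)))\<rparr>"

text \<open>2-adjunctions \<open>L \<stileturn> R\<close> with unit \<open>\<eta>\<close>, in the sense of biadjunctions. Both \<open>L\<close> and \<open>R\<close> are strict 2-functors, but the
  unit is pseudonatural and the comparison of hom-categories
  \<open>M(L a, x) \<rightarrow> K(a, R x)\<close> is an equivalence rather than an isomorphism. The strict variant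
  fails for pruned fibrations: a cartesian functor preserves reindexing along the arrow
  out of the initial object only up to isomorphism. For instance, let \<open>A\<close> be the arrow
  category, \<open>p\<close> the identity fibration of \<open>A\<close>, and \<open>S\<close> the constant identity monad on the
  chaotic category with two objects: there are two 1-cells from \<open>T\<^sup>p\<close> to \<open>S\<close>, but four
  cartesian functors over \<open>A\<close> from \<open>p\<close> to the Eilenberg--Moore fibration of \<open>S\<close>.\<close>

definition biadjunction ::
  "('o, 'm, 'c) twocat \<Rightarrow> ('p, 'n, 'd) twocat \<Rightarrow> ('o, 'm, 'c, 'p, 'n, 'd) twoftor \<Rightarrow>
   ('p, 'n, 'd, 'o, 'm, 'c) twoftor \<Rightarrow> ('o, 'm, 'm, 'c) pnt \<Rightarrow> bool" where
  "biadjunction K M L R \<eta> \<longleftrightarrow>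
     two_category K \<and> two_category M \<and> two_functor K M L \<and> two_functor M K R \<and>
     pseudonatural K K (two_id K) (two_comp K R L) \<eta> \<and>
     (\<forall>a\<in>Ob2 K. \<forall>x\<in>Ob2 M.
        equivalence_functor (Hom2 M (F0 L a) x) (Hom2 K a (F0 R x)) (transpose K M L R \<eta> a x))"


section \<open>A universe closed under pairing\<close>

text \<open>The objects of the 2-categories below are (structures on) categories whose objects and
  arrows are elements of one type, which has to contain the triples \<open>(A, X, \<xi>)\<close> and the
  arrows between them. The type is closed under pairing; since \<open>'u\<close> is arbitrary, every
  category has an isomorphic copy in such a universe.\<close>

datatype 'u univ = Atom 'u | UPair (ufst: "'u univ") (usnd: "'u univ")

type_synonym 'u ucat = "('u univ, 'u univ) cat"
type_synonym 'u uftor = "('u univ, 'u univ, 'u univ, 'u univ) ftor"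

abbreviation utriple :: "'u univ \<Rightarrow> 'u univ \<Rightarrow> 'u univ \<Rightarrow> 'u univ" where
  "utriple a x \<xi> \<equiv> UPair a (UPair x \<xi>)"

text \<open>An arrow \<open>(f, g)\<close>, stored together with its source \<open>s\<close> and target \<open>t\<close>.\<close>

abbreviation uarrow :: "'u univ \<Rightarrow> 'u univ \<Rightarrow> 'u univ \<Rightarrow> 'u univ \<Rightarrow> 'u univ" where
  "uarrow s t f g \<equiv> UPair s (UPair t (UPair f g))"

abbreviation uarr_dom :: "'u univ \<Rightarrow> 'u univ" where "uarr_dom u \<equiv> ufst u"
abbreviation uarr_cod :: "'u univ \<Rightarrow> 'u univ" where "uarr_cod u \<equiv> ufst (usnd u)"
abbreviation uarr_fst :: "'u univ \<Rightarrow> 'u univ" where "uarr_fst u \<equiv> ufst (usnd (usnd u))"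
abbreviation uarr_snd :: "'u univ \<Rightarrow> 'u univ" where "uarr_snd u \<equiv> usnd (usnd (usnd u))"


section \<open>Parametrized monads and their Eilenberg--Moore fibrations\<close>

record 'u pmonad =
  Carr :: "'u ucat"
  PFun :: "('u univ \<times> 'u univ, 'u univ \<times> 'u univ, 'u univ, 'u univ) ftor"
  PUnit :: "'u univ \<times> 'u univ \<Rightarrow> 'u univ"
  PMult :: "'u univ \<times> 'u univ \<Rightarrow> 'u univ"

text \<open>The monad \<open>T\<^sub>a\<close> and the transformation \<open>T\<^sub>f\<close>.\<close>

definition monad_at :: "'u ucat \<Rightarrow> 'u pmonad \<Rightarrow> 'u univ \<Rightarrow> ('u univ, 'u univ) monad" where
  "monad_at A P a =
     \<lparr>Fun = \<lparr>Fo = (\<lambda>x\<in>Obj (Carr P). Fo (PFun P) (a, x)),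
             Fa = (\<lambda>g\<in>Arr (Carr P). Fa (PFun P) (Idn A a, g))\<rparr>,
      Unit = (\<lambda>x\<in>Obj (Carr P). PUnit P (a, x)),
      Mult = (\<lambda>x\<in>Obj (Carr P). PMult P (a, x))\<rparr>"

definition monad_along :: "'u pmonad \<Rightarrow> 'u univ \<Rightarrow> 'u univ \<Rightarrow> 'u univ" where
  "monad_along P f = (\<lambda>x\<in>Obj (Carr P). Fa (PFun P) (f, Idn (Carr P) x))"

definition param_monad :: "'u ucat \<Rightarrow> 'u pmonad \<Rightarrow> bool" where
  "param_monad A P \<longleftrightarrow>
     category (Carr P) \<and> is_functor (A \<times>\<^sub>C Carr P) (Carr P) (PFun P) \<and>
     (\<forall>a\<in>Obj A. is_monad (Carr P) (monad_at A P a)) \<and>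
     (\<forall>f\<in>Arr A. monad_morphism (Carr P)
        (monad_at A P (Dom A f)) (monad_at A P (Cod A f)) (monad_along P f))"

definition emf_obj :: "'u ucat \<Rightarrow> 'u pmonad \<Rightarrow> 'u univ set" where
  "emf_obj A P =
     {utriple a x \<xi> | a x \<xi>. a \<in> Obj A \<and> em_algebra (Carr P) (monad_at A P a) x \<xi>}"

definition emf_cat :: "'u ucat \<Rightarrow> 'u pmonad \<Rightarrow> 'u ucat" where
  "emf_cat A P =
     \<lparr>Obj = emf_obj A P,
      Arr = {uarrow (utriple a x \<xi>) (utriple b y \<theta>) f g | a x \<xi> b y \<theta> f g.
               utriple a x \<xi> \<in> emf_obj A P \<and> utriple b y \<theta> \<in> emf_obj A P \<and>
               f \<in> hom A a b \<and> g \<in> hom (Carr P) x y \<and>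
               g \<cdot>\<^bsub>Carr P\<^esub> \<xi> = \<theta> \<cdot>\<^bsub>Carr P\<^esub> Fa (PFun P) (f, g)},
      Dom = uarr_dom, Cod = uarr_cod,
      Idn = (\<lambda>s. uarrow s s (Idn A (ufst s)) (Idn (Carr P) (ufst (usnd s)))),
      Cmp = (\<lambda>v u. uarrow (uarr_dom u) (uarr_cod v)
               (uarr_fst v \<cdot>\<^bsub>A\<^esub> uarr_fst u) (uarr_snd v \<cdot>\<^bsub>Carr P\<^esub> uarr_snd u))\<rparr>"

definition emf_proj :: "'u ucat \<Rightarrow> 'u pmonad \<Rightarrow> 'u uftor" where
  "emf_proj A P =
     \<lparr>Fo = (\<lambda>s\<in>Obj (emf_cat A P). ufst s), Fa = (\<lambda>u\<in>Arr (emf_cat A P). uarr_fst u)\<rparr>"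

definition emf :: "'u ucat \<Rightarrow> 'u pmonad \<Rightarrow> 'u ucat \<times> 'u uftor" where
  "emf A P = (emf_cat A P, emf_proj A P)"


section \<open>The 2-category of fibrations over \<open>A\<close>\<close>

definition cartesian :: "'u ucat \<Rightarrow> 'u ucat \<Rightarrow> 'u uftor \<Rightarrow> 'u univ \<Rightarrow> bool" where
  "cartesian A E p \<phi> \<longleftrightarrow>
     \<phi> \<in> Arr E \<and>
     (\<forall>\<psi>\<in>Arr E. \<forall>h \<in> hom A (Fo p (Dom E \<psi>)) (Fo p (Dom E \<phi>)).
        Cod E \<psi> = Cod E \<phi> \<longrightarrow> Fa p \<psi> = Fa p \<phi> \<cdot>\<^bsub>A\<^esub> h \<longrightarrow>
        (\<exists>!\<chi>. \<chi> \<in> hom E (Dom E \<psi>) (Dom E \<phi>) \<and> Fa p \<chi> = h \<and> \<phi> \<cdot>\<^bsub>E\<^esub> \<chi> = \<psi>))"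

definition fibration :: "'u ucat \<Rightarrow> 'u ucat \<Rightarrow> 'u uftor \<Rightarrow> bool" where
  "fibration A E p \<longleftrightarrow>
     category E \<and> is_functor E A p \<and>
     (\<forall>e\<in>Obj E. \<forall>f\<in>Arr A. Cod A f = Fo p e \<longrightarrow>
        (\<exists>\<phi>. cartesian A E p \<phi> \<and> Cod E \<phi> = e \<and> Fa p \<phi> = f))"

definition fibre :: "'u ucat \<Rightarrow> 'u ucat \<Rightarrow> 'u uftor \<Rightarrow> 'u univ \<Rightarrow> 'u ucat" where
  "fibre A E p a =
     E\<lparr>Obj := {e \<in> Obj E. Fo p e = a}, Arr := {u \<in> Arr E. Fa p u = Idn A a}\<rparr>"

definition fibred_functor ::
  "'u ucat \<Rightarrow> 'u ucat \<times> 'u uftor \<Rightarrow> 'u ucat \<times> 'u uftor \<Rightarrow> 'u uftor \<Rightarrow> bool" where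
  "fibred_functor A = (\<lambda>(E, p) (E', p') F.
     is_functor E E' F \<and> ftor_comp E p' F = p \<and>
     (\<forall>\<phi>. cartesian A E p \<phi> \<longrightarrow> cartesian A E' p' (Fa F \<phi>)))"

definition vertical_nat_trans ::
  "'u ucat \<Rightarrow> 'u ucat \<times> 'u uftor \<Rightarrow> 'u ucat \<times> 'u uftor \<Rightarrow> 'u uftor \<Rightarrow> 'u uftor \<Rightarrow>
   ('u univ \<Rightarrow> 'u univ) \<Rightarrow> bool" where
  "vertical_nat_trans A = (\<lambda>(E, p) (E', p') F G t.
     nat_trans E E' F G t \<and> (\<forall>e\<in>Obj E. Fa p' (t e) = Idn A (Fo p e)))"

text \<open>2-cells are stored as \<open>(source, target, components)\<close>, here and in the 2-category of
  pruned monads.\<close>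

definition Fib ::
  "'u ucat \<Rightarrow> ('u ucat \<times> 'u uftor, 'u uftor, 'u uftor \<times> 'u uftor \<times> ('u univ \<Rightarrow> 'u univ)) twocat"
  where
  "Fib A =
    (let Hm = (\<lambda>(E, p) (E', p').
       \<lparr>Obj = {F. fibred_functor A (E, p) (E', p') F},
        Arr = {(F, G, t). fibred_functor A (E, p) (E', p') F \<and> fibred_functor A (E, p) (E', p') G \<and>
                 vertical_nat_trans A (E, p) (E', p') F G t},
        Dom = (\<lambda>(F, G, t). F), Cod = (\<lambda>(F, G, t). G),
        Idn = (\<lambda>F. (F, F, \<lambda>e\<in>Obj E. Idn E' (Fo F e))),
        Cmp = (\<lambda>(F', G', t') (F, G, t). (F, G', \<lambda>e\<in>Obj E. t' e \<cdot>\<^bsub>E'\<^esub> t e))\<rparr>)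
     in
     \<lparr>Ob2 = {(E, p). fibration A E p},
      Hom2 = Hm,
      Id2 = (\<lambda>(E, p). ftor_id E),
      Comp2 = (\<lambda>(E, p) (E', p') (E'', p'').
        \<lparr>Fo = (\<lambda>(G, F) \<in> Obj (Hm (E', p') (E'', p'') \<times>\<^sub>C Hm (E, p) (E', p')). ftor_comp E G F),
         Fa = (\<lambda>((G, G', s), (F, F', t)) \<in> Arr (Hm (E', p') (E'', p'') \<times>\<^sub>C Hm (E, p) (E', p')).
                 (ftor_comp E G F, ftor_comp E G' F',
                  \<lambda>e\<in>Obj E. s (Fo F' e) \<cdot>\<^bsub>E''\<^esub> Fa G (t e)))\<rparr>)\<rparr>)"


section \<open>Pruned fibrations and pruned monads\<close>

text \<open>Throughout, \<open>z\<close> is the initial object of \<open>A\<close>.\<close>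

definition pruned :: "'u ucat \<Rightarrow> 'u univ \<Rightarrow> 'u ucat \<Rightarrow> 'u uftor \<Rightarrow> bool" where
  "pruned A z E p \<longleftrightarrow>
     fibration A E p \<and>
     (\<exists>pL \<eta> \<epsilon>. adjunction A E pL p \<eta> \<epsilon> \<and> full_faithful A E pL \<and>
        (\<forall>a\<in>Obj A. \<forall>x\<in>Obj (fibre A E p z).
           (\<exists>i j. is_coproduct E (Fo pL a) x i j) \<and>
           (\<forall>i j. is_coproduct E (Fo pL a) x i j \<longrightarrow>
              is_coproduct A (Fo p (Fo pL a)) (Fo p x) (Fa p i) (Fa p j))))"

definition PrFib ::
  "'u ucat \<Rightarrow> 'u univ \<Rightarrow>
   ('u ucat \<times> 'u uftor, 'u uftor, 'u uftor \<times> 'u uftor \<times> ('u univ \<Rightarrow> 'u univ)) twocat" where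
  "PrFib A z = (Fib A)\<lparr>Ob2 := {(E, p). pruned A z E p}\<rparr>"

definition pruned_monad :: "'u ucat \<Rightarrow> 'u univ \<Rightarrow> 'u pmonad \<Rightarrow> bool" where
  "pruned_monad A z P \<longleftrightarrow>
     param_monad A P \<and> (\<exists>i. initial (Carr P) i) \<and>
     isomorphic_monads (Carr P) (monad_at A P z) (id_monad (Carr P))"

text \<open>The functor \<open>A \<times> V : A \<times> X \<rightarrow> A \<times> Y\<close>.\<close>

definition param_lift ::
  "'u ucat \<Rightarrow> 'u ucat \<Rightarrow> 'u uftor \<Rightarrow>
   ('u univ \<times> 'u univ, 'u univ \<times> 'u univ, 'u univ \<times> 'u univ, 'u univ \<times> 'u univ) ftor" where
  "param_lift A X V =
     \<lparr>Fo = (\<lambda>(a, x) \<in> Obj (A \<times>\<^sub>C X). (a, Fo V x)), Fa = (\<lambda>(f, g) \<in> Arr (A \<times>\<^sub>C X). (f, Fa V g))\<rparr>"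

type_synonym 'u pm1 = "'u uftor \<times> ('u univ \<times> 'u univ \<Rightarrow> 'u univ)"

definition pm_1cell :: "'u ucat \<Rightarrow> 'u pmonad \<Rightarrow> 'u pmonad \<Rightarrow> 'u pm1 \<Rightarrow> bool" where
  "pm_1cell A P Q = (\<lambda>(V, \<delta>).
     let X = Carr P; Y = Carr Q; T = PFun P; S = PFun Q in
     is_functor X Y V \<and>
     nat_trans (A \<times>\<^sub>C X) Y
       (ftor_comp (A \<times>\<^sub>C X) S (param_lift A X V)) (ftor_comp (A \<times>\<^sub>C X) V T) \<delta> \<and>
     (\<forall>a\<in>Obj A. \<forall>x\<in>Obj X.
        \<delta> (a, x) \<cdot>\<^bsub>Y\<^esub> PUnit Q (a, Fo V x) = Fa V (PUnit P (a, x)) \<and>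
        \<delta> (a, x) \<cdot>\<^bsub>Y\<^esub> PMult Q (a, Fo V x) =
          Fa V (PMult P (a, x)) \<cdot>\<^bsub>Y\<^esub> \<delta> (a, Fo T (a, x)) \<cdot>\<^bsub>Y\<^esub> Fa S (Idn A a, \<delta> (a, x))))"

definition pm_2cell ::
  "'u ucat \<Rightarrow> 'u pmonad \<Rightarrow> 'u pmonad \<Rightarrow> 'u pm1 \<Rightarrow> 'u pm1 \<Rightarrow> ('u univ \<Rightarrow> 'u univ) \<Rightarrow> bool" where
  "pm_2cell A P Q = (\<lambda>(V, \<delta>) (V', \<delta>') \<nu>.
     nat_trans (Carr P) (Carr Q) V V' \<nu> \<and>
     (\<forall>a\<in>Obj A. \<forall>x\<in>Obj (Carr P).
        \<nu> (Fo (PFun P) (a, x)) \<cdot>\<^bsub>Carr Q\<^esub> \<delta> (a, x) =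
        \<delta>' (a, x) \<cdot>\<^bsub>Carr Q\<^esub> Fa (PFun Q) (Idn A a, \<nu> x)))"

definition PrMnd ::
  "'u ucat \<Rightarrow> 'u univ \<Rightarrow>
   ('u pmonad, 'u pm1, 'u pm1 \<times> 'u pm1 \<times> ('u univ \<Rightarrow> 'u univ)) twocat" where
  "PrMnd A z =
    (let Hm = (\<lambda>P Q.
       \<lparr>Obj = {w. pm_1cell A P Q w},
        Arr = {(v, w, \<nu>). pm_1cell A P Q v \<and> pm_1cell A P Q w \<and> pm_2cell A P Q v w \<nu>},
        Dom = (\<lambda>(v, w, \<nu>). v), Cod = (\<lambda>(v, w, \<nu>). w),
        Idn = (\<lambda>w. (w, w, \<lambda>x\<in>Obj (Carr P). Idn (Carr Q) (Fo (fst w) x))),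
        Cmp = (\<lambda>(v', w', \<nu>') (v, w, \<nu>). (v, w', \<lambda>x\<in>Obj (Carr P). \<nu>' x \<cdot>\<^bsub>Carr Q\<^esub> \<nu> x))\<rparr>);
      cmp = (\<lambda>P R (W, \<gamma>) (V, \<delta>).
        (ftor_comp (Carr P) W V,
         \<lambda>(a, x) \<in> Obj (A \<times>\<^sub>C Carr P). Fa W (\<delta> (a, x)) \<cdot>\<^bsub>Carr R\<^esub> \<gamma> (a, Fo V x)))
     in
     \<lparr>Ob2 = {P. pruned_monad A z P},
      Hom2 = Hm,
      Id2 = (\<lambda>P. (ftor_id (Carr P),
              \<lambda>c\<in>Obj (A \<times>\<^sub>C Carr P). Idn (Carr P) (Fo (PFun P) c))),
      Comp2 = (\<lambda>P Q R.
        \<lparr>Fo = (\<lambda>(w, v) \<in> Obj (Hm Q R \<times>\<^sub>C Hm P Q). cmp P R w v),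
         Fa = (\<lambda>((w, w', \<mu>), (v, v', \<nu>)) \<in> Arr (Hm Q R \<times>\<^sub>C Hm P Q).
                 (cmp P R w v, cmp P R w' v',
                  \<lambda>x\<in>Obj (Carr P). \<mu> (Fo (fst v') x) \<cdot>\<^bsub>Carr R\<^esub> Fa (fst w) (\<nu> x)))\<rparr>)\<rparr>)"

text \<open>The Eilenberg--Moore 2-functor. The 2-cell \<open>\<nu>\<close> is sent to the transformation with
  component \<open>(id\<^sub>a, \<nu>\<^sub>x)\<close> at \<open>(a, x, \<xi>)\<close>.\<close>

definition emf_1cell :: "'u ucat \<Rightarrow> 'u pmonad \<Rightarrow> 'u pmonad \<Rightarrow> 'u pm1 \<Rightarrow> 'u uftor" where
  "emf_1cell A P Q = (\<lambda>(V, \<delta>).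
     let ob = (\<lambda>s. case s of utriple a x \<xi> \<Rightarrow> utriple a (Fo V x) (Fa V \<xi> \<cdot>\<^bsub>Carr Q\<^esub> \<delta> (a, x)))
     in \<lparr>Fo = (\<lambda>s\<in>Obj (emf_cat A P). ob s),
         Fa = (\<lambda>u\<in>Arr (emf_cat A P).
                 uarrow (ob (uarr_dom u)) (ob (uarr_cod u)) (uarr_fst u) (Fa V (uarr_snd u)))\<rparr>)"

definition emf_2functor ::
  "'u ucat \<Rightarrow> 'u univ \<Rightarrow>
   ('u pmonad, 'u pm1, 'u pm1 \<times> 'u pm1 \<times> ('u univ \<Rightarrow> 'u univ),
    'u ucat \<times> 'u uftor, 'u uftor, 'u uftor \<times> 'u uftor \<times> ('u univ \<Rightarrow> 'u univ)) twoftor" where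
  "emf_2functor A z =
     \<lparr>F0 = emf A,
      FH = (\<lambda>P Q.
        \<lparr>Fo = (\<lambda>w\<in>Obj (Hom2 (PrMnd A z) P Q). emf_1cell A P Q w),
         Fa = (\<lambda>(v, w, \<nu>) \<in> Arr (Hom2 (PrMnd A z) P Q).
           (emf_1cell A P Q v, emf_1cell A P Q w,
            \<lambda>s\<in>Obj (emf_cat A P).
              uarrow (Fo (emf_1cell A P Q v) s) (Fo (emf_1cell A P Q w) s)
                (Idn A (ufst s)) (\<nu> (ufst (usnd s)))))\<rparr>)\<rparr>"


section \<open>The parametrized monad of a pruned fibration\<close>

text \<open>The choices involved: \<open>p\<^sub>L\<close>, a cartesian lift \<open>PLift e\<close> of \<open>\<emptyset> \<rightarrow> p e\<close> with target \<open>e\<close>, and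
  a coproduct cocone \<open>PInl a x\<close>, \<open>PInr a x\<close> of \<open>p\<^sub>L a\<close> and \<open>x\<close>. They can be, and are, made
  such that the unit of \<open>p\<^sub>L \<stileturn> p\<close> and the arrows \<open>p (PInl a x)\<close> are identities; then the
  monad generated by \<open>p\<^sub>L + i \<stileturn> \<langle>p, i\<^sub>R\<rangle>\<close> lies strictly over the projection to \<open>A\<close>.\<close>

record 'u prune_data =
  PL :: "'u uftor"
  PCounit :: "'u univ \<Rightarrow> 'u univ"
  PLift :: "'u univ \<Rightarrow> 'u univ"
  PInl :: "'u univ \<Rightarrow> 'u univ \<Rightarrow> 'u univ"
  PInr :: "'u univ \<Rightarrow> 'u univ \<Rightarrow> 'u univ"

definition is_prune_data ::
  "'u ucat \<Rightarrow> 'u univ \<Rightarrow> 'u ucat \<Rightarrow> 'u uftor \<Rightarrow> 'u prune_data \<Rightarrow> bool" where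
  "is_prune_data A z E p D \<longleftrightarrow>
     adjunction A E (PL D) p (\<lambda>a\<in>Obj A. Idn A a) (PCounit D) \<and>
     (\<forall>e\<in>Obj E. cartesian A E p (PLift D e) \<and> Cod E (PLift D e) = e \<and>
        Fa p (PLift D e) = init_arr A z (Fo p e)) \<and>
     (\<forall>a\<in>Obj A. \<forall>x\<in>Obj (fibre A E p z).
        is_coproduct E (Fo (PL D) a) x (PInl D a x) (PInr D a x) \<and>
        Fa p (PInl D a x) = Idn A a)"

definition prune_choice ::
  "'u ucat \<Rightarrow> 'u univ \<Rightarrow> 'u ucat \<Rightarrow> 'u uftor \<Rightarrow> 'u prune_data" where
  "prune_choice A z E p = (SOME D. is_prune_data A z E p D)"

text \<open>The functor \<open>i\<^sub>R : E \<rightarrow> E\<^sub>\<emptyset>\<close>.\<close>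

definition iR :: "'u ucat \<Rightarrow> 'u univ \<Rightarrow> 'u ucat \<Rightarrow> 'u uftor \<Rightarrow> 'u uftor" where
  "iR A z E p =
     (let lft = PLift (prune_choice A z E p) in
     \<lparr>Fo = (\<lambda>e\<in>Obj E. Dom E (lft e)),
      Fa = (\<lambda>u\<in>Arr E. THE v.
              v \<in> hom (fibre A E p z) (Dom E (lft (Dom E u))) (Dom E (lft (Cod E u))) \<and>
              lft (Cod E u) \<cdot>\<^bsub>E\<^esub> v = u \<cdot>\<^bsub>E\<^esub> lft (Dom E u))\<rparr>)"

text \<open>The functor \<open>\<langle>p, i\<^sub>R\<rangle> : E \<rightarrow> A \<times> E\<^sub>\<emptyset>\<close>, its left adjoint \<open>p\<^sub>L + i\<close>, and the unit and counit
  of the adjunction.\<close>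

definition p_iR ::
  "'u ucat \<Rightarrow> 'u univ \<Rightarrow> 'u ucat \<Rightarrow> 'u uftor \<Rightarrow>
   ('u univ, 'u univ, 'u univ \<times> 'u univ, 'u univ \<times> 'u univ) ftor" where
  "p_iR A z E p = ftor_pair E p (iR A z E p)"

definition pL_plus_i ::
  "'u ucat \<Rightarrow> 'u univ \<Rightarrow> 'u ucat \<Rightarrow> 'u uftor \<Rightarrow>
   ('u univ \<times> 'u univ, 'u univ \<times> 'u univ, 'u univ, 'u univ) ftor" where
  "pL_plus_i A z E p =
     (let D = prune_choice A z E p; B = A \<times>\<^sub>C fibre A E p z in
     \<lparr>Fo = (\<lambda>(a, x) \<in> Obj B. Cod E (PInl D a x)),
      Fa = (\<lambda>(f, g) \<in> Arr B.
              copair E (PInl D (Dom A f) (Dom E g)) (PInr D (Dom A f) (Dom E g))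
                (PInl D (Cod A f) (Cod E g) \<cdot>\<^bsub>E\<^esub> Fa (PL D) f)
                (PInr D (Cod A f) (Cod E g) \<cdot>\<^bsub>E\<^esub> g))\<rparr>)"

definition sum_unit ::
  "'u ucat \<Rightarrow> 'u univ \<Rightarrow> 'u ucat \<Rightarrow> 'u uftor \<Rightarrow> 'u univ \<times> 'u univ \<Rightarrow> 'u univ \<times> 'u univ" where
  "sum_unit A z E p =
     (let D = prune_choice A z E p in
     (\<lambda>(a, x) \<in> Obj (A \<times>\<^sub>C fibre A E p z).
       (Fa p (PInl D a x),
        THE v. v \<in> hom (fibre A E p z) x (Dom E (PLift D (Cod E (PInl D a x)))) \<and>
               PLift D (Cod E (PInl D a x)) \<cdot>\<^bsub>E\<^esub> v = PInr D a x)))"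

definition sum_counit ::
  "'u ucat \<Rightarrow> 'u univ \<Rightarrow> 'u ucat \<Rightarrow> 'u uftor \<Rightarrow> 'u univ \<Rightarrow> 'u univ" where
  "sum_counit A z E p =
     (let D = prune_choice A z E p in
     (\<lambda>e\<in>Obj E. copair E
       (PInl D (Fo p e) (Dom E (PLift D e))) (PInr D (Fo p e) (Dom E (PLift D e)))
       (PCounit D e) (PLift D e)))"

definition sum_monad ::
  "'u ucat \<Rightarrow> 'u univ \<Rightarrow> 'u ucat \<Rightarrow> 'u uftor \<Rightarrow> ('u univ \<times> 'u univ, 'u univ \<times> 'u univ) monad" where
  "sum_monad A z E p =
     adj_monad (A \<times>\<^sub>C fibre A E p z) (pL_plus_i A z E p) (p_iR A z E p)
       (sum_unit A z E p) (sum_counit A z E p)"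

text \<open>The parametrized monad \<open>T\<^sup>p\<close>, read off from the \<open>E\<^sub>\<emptyset>\<close>-component of the monad on
  \<open>A \<times> E\<^sub>\<emptyset>\<close>.\<close>

definition Tp :: "'u ucat \<Rightarrow> 'u univ \<Rightarrow> 'u ucat \<times> 'u uftor \<Rightarrow> 'u pmonad" where
  "Tp A z = (\<lambda>(E, p).
     let B = A \<times>\<^sub>C fibre A E p z; M = sum_monad A z E p in
     \<lparr>Carr = fibre A E p z,
      PFun = \<lparr>Fo = (\<lambda>c\<in>Obj B. snd (Fo (Fun M) c)), Fa = (\<lambda>k\<in>Arr B. snd (Fa (Fun M) k))\<rparr>,
      PUnit = (\<lambda>c\<in>Obj B. snd (Unit M c)),
      PMult = (\<lambda>c\<in>Obj B. snd (Mult M c))\<rparr>)"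

text \<open>The identification of the Eilenberg--Moore fibration of \<open>T\<^sup>p\<close> with the Eilenberg--Moore
  category of the monad on \<open>A \<times> E\<^sub>\<emptyset>\<close>.\<close>

definition emf_to_em ::
  "'u ucat \<Rightarrow> 'u univ \<Rightarrow> 'u ucat \<times> 'u uftor \<Rightarrow>
   ('u univ, 'u univ, ('u univ \<times> 'u univ) \<times> ('u univ \<times> 'u univ),
    (('u univ \<times> 'u univ) \<times> ('u univ \<times> 'u univ)) \<times>
    (('u univ \<times> 'u univ) \<times> ('u univ \<times> 'u univ)) \<times> ('u univ \<times> 'u univ)) ftor" where
  "emf_to_em A z q =
     (let C = emf_cat A (Tp A z q);
          ob = (\<lambda>s. case s of utriple a x \<xi> \<Rightarrow> ((a, x), (Idn A a, \<xi>)))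
      in \<lparr>Fo = (\<lambda>s\<in>Obj C. ob s),
          Fa = (\<lambda>u\<in>Arr C. (ob (uarr_dom u), ob (uarr_cod u), (uarr_fst u, uarr_snd u)))\<rparr>)"

end

theory Submission
  imports Defs
begin

text \<open>A fibration with \<open>p\<^sub>L + i \<stileturn> \<langle>p, i\<^sub>R\<rangle>\<close> and an Eilenberg--Moore fibration both carry an adjunction over
  \<open>A\<close> generating a parametrized monad, and the comparison functor of the second one is the identity.
  A functor \<open>F\<close> over \<open>A\<close> between two such categories that commutes with the right adjoints up to an
  isomorphism \<open>\<sigma>\<close> has a mate, which is a map of the generated monads. Cartesian functors commute with
  reindexing along \<open>\<emptyset> \<rightarrow> p e\<close> in this sense. Between pruned fibrations this gives the left
  adjoint and the pseudonaturality of \<open>\<eta>\<close>; for functors into an Eilenberg--Moore fibration it shows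
  that every one of them factors through \<open>\<eta>\<^sub>p\<close> up to isomorphism. When \<open>F\<close> is an equivalence onto the
  Eilenberg--Moore fibration of \<open>P\<close> with \<open>P\<^sub>\<emptyset>\<close> isomorphic to the identity, an arrow of
  carriers out of an algebra over \<open>\<emptyset>\<close> is automatically an algebra map, hence the functor \<open>V\<close>
  underlying the factorization is full and faithful and its monad map is invertible, which makes
  \<open>\<eta>\<^sub>p\<close> an equivalence.\<close>


text \<open>Two strict equalities fail and shape the proof. A cartesian functor does not preserve
  the chosen lifts, so it commutes with \<open>i\<^sub>R\<close> only through an isomorphism
  \<sigma> between two cartesian lifts of one arrow; and \<open>i\<^sub>R\<close> restricted to the
  initial fibre is the identity only up to the lifts themselves. The left adjoint is nevertheless a
  strict 2-functor: \<sigma> is the unique solution of an equation that can be cancelled against a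
  lift, which forces its values at identities and composites. Transposition is bijective on 2-cells
  because every \<open>x\<close> in the initial fibre is isomorphic to \<open>i\<^sub>R x\<close>,
  so components at the objects \<open>i\<^sub>R e\<close> suffice. When
  \<open>P\<^sub>\<emptyset>\<close> is isomorphic to the identity, its unit is invertible and the
  structure map of an algebra over \<emptyset> is the inverse of it; this is why algebra maps come
  for free there. Conversely, \<open>p\<^sub>L \<emptyset>\<close> is initial in the total category,
  so adding it to \<open>x\<close> changes nothing, and \<open>T\<^sup>p\<close> at \<emptyset> is
  isomorphic to the identity.\<close>

abbreviation arr :: "('o, 'm) cat \<Rightarrow> 'm \<Rightarrow> 'o \<Rightarrow> 'o \<Rightarrow> bool" where
  "arr C f x y \<equiv> f \<in> Arr C \<and> Dom C f = x \<and> Cod C f = y"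

text \<open>Membership in a hom-set is dissolved into equations for \<open>Dom\<close> and
  \<open>Cod\<close>; these are the side conditions which the rewrite rules below have to
  discharge.\<close>

lemma in_hom [simp]: "f \<in> hom C x y \<longleftrightarrow> arr C f x y"
  by (auto simp: hom_def)

text \<open>The unit laws take the object \<open>x\<close> as a separate variable with an equation
  as premise, so that they still fire after \<open>Dom C f\<close> or \<open>Cod C f\<close> has
  been rewritten to something else.\<close>

lemma cat_simps [simp]:
  assumes "category C"
  shows "f \<in> Arr C \<Longrightarrow> Dom C f \<in> Obj C" "f \<in> Arr C \<Longrightarrow> Cod C f \<in> Obj C"
    "x \<in> Obj C \<Longrightarrow> Idn C x \<in> Arr C" "x \<in> Obj C \<Longrightarrow> Dom C (Idn C x) = x"
    "x \<in> Obj C \<Longrightarrow> Cod C (Idn C x) = x"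
    "f \<in> Arr C \<Longrightarrow> g \<in> Arr C \<Longrightarrow> Cod C f = Dom C g \<Longrightarrow> g \<cdot>\<^bsub>C\<^esub> f \<in> Arr C"
    "f \<in> Arr C \<Longrightarrow> g \<in> Arr C \<Longrightarrow> Cod C f = Dom C g \<Longrightarrow> Dom C (g \<cdot>\<^bsub>C\<^esub> f) = Dom C f"
    "f \<in> Arr C \<Longrightarrow> g \<in> Arr C \<Longrightarrow> Cod C f = Dom C g \<Longrightarrow> Cod C (g \<cdot>\<^bsub>C\<^esub> f) = Cod C g"
    "f \<in> Arr C \<Longrightarrow> Dom C f = x \<Longrightarrow> f \<cdot>\<^bsub>C\<^esub> Idn C x = f"
    "f \<in> Arr C \<Longrightarrow> Cod C f = x \<Longrightarrow> Idn C x \<cdot>\<^bsub>C\<^esub> f = f"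
  using assms unfolding category_def by auto

lemma cat_assoc [simp]:
  assumes "category C"
  shows "f \<in> Arr C \<Longrightarrow> g \<in> Arr C \<Longrightarrow> h \<in> Arr C \<Longrightarrow> Cod C f = Dom C g \<Longrightarrow> Cod C g = Dom C h \<Longrightarrow>
    (h \<cdot>\<^bsub>C\<^esub> g) \<cdot>\<^bsub>C\<^esub> f = h \<cdot>\<^bsub>C\<^esub> (g \<cdot>\<^bsub>C\<^esub> f)"
  using assms unfolding category_def by auto

text \<open>Turns an equation of composites into one that rewrites inside a right-nested composite.\<close>

lemma reassoc:
  assumes "g \<cdot>\<^bsub>C\<^esub> f = k"
  shows "category C \<Longrightarrow> f \<in> Arr C \<Longrightarrow> g \<in> Arr C \<Longrightarrow> Cod C f = Dom C g \<Longrightarrow> r \<in> Arr C \<Longrightarrow>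
    Cod C r = Dom C f \<Longrightarrow> g \<cdot>\<^bsub>C\<^esub> (f \<cdot>\<^bsub>C\<^esub> r) = k \<cdot>\<^bsub>C\<^esub> r"
  using assms cat_assoc[of C r f g] by simp

lemma categoryI:
  assumes "\<And>f. f \<in> Arr C \<Longrightarrow> Dom C f \<in> Obj C \<and> Cod C f \<in> Obj C"
    "\<And>x. x \<in> Obj C \<Longrightarrow> arr C (Idn C x) x x"
    "\<And>f g. f \<in> Arr C \<Longrightarrow> g \<in> Arr C \<Longrightarrow> Cod C f = Dom C g \<Longrightarrow> arr C (g \<cdot>\<^bsub>C\<^esub> f) (Dom C f) (Cod C g)"
    "\<And>f. f \<in> Arr C \<Longrightarrow> f \<cdot>\<^bsub>C\<^esub> Idn C (Dom C f) = f"
    "\<And>f. f \<in> Arr C \<Longrightarrow> Idn C (Cod C f) \<cdot>\<^bsub>C\<^esub> f = f"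
    "\<And>f g h. f \<in> Arr C \<Longrightarrow> g \<in> Arr C \<Longrightarrow> h \<in> Arr C \<Longrightarrow> Cod C f = Dom C g \<Longrightarrow> Cod C g = Dom C h \<Longrightarrow>
      (h \<cdot>\<^bsub>C\<^esub> g) \<cdot>\<^bsub>C\<^esub> f = h \<cdot>\<^bsub>C\<^esub> (g \<cdot>\<^bsub>C\<^esub> f)"
  shows "category C"
  unfolding category_def using assms by simp

lemma prod_cat_simps [simp]:
  "Obj (C \<times>\<^sub>C D) = Obj C \<times> Obj D" "Arr (C \<times>\<^sub>C D) = Arr C \<times> Arr D"
  "Dom (C \<times>\<^sub>C D) (f, g) = (Dom C f, Dom D g)" "Cod (C \<times>\<^sub>C D) (f, g) = (Cod C f, Cod D g)"
  "Idn (C \<times>\<^sub>C D) (x, y) = (Idn C x, Idn D y)"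
  "(f', g') \<cdot>\<^bsub>C \<times>\<^sub>C D\<^esub> (f, g) = (f' \<cdot>\<^bsub>C\<^esub> f, g' \<cdot>\<^bsub>D\<^esub> g)"
  by (auto simp: prod_cat_def)

lemma category_prod [simp]: "category C \<Longrightarrow> category D \<Longrightarrow> category (C \<times>\<^sub>C D)"
  by (rule categoryI) (auto simp: split_beta)

subsection \<open>Isomorphisms\<close>

definition inv_arr :: "('o, 'm) cat \<Rightarrow> 'm \<Rightarrow> 'm" where
  "inv_arr C f = (SOME g. arr C g (Cod C f) (Dom C f) \<and>
     g \<cdot>\<^bsub>C\<^esub> f = Idn C (Dom C f) \<and> f \<cdot>\<^bsub>C\<^esub> g = Idn C (Cod C f))"

lemma inv_arr:
  assumes "is_iso C f"
  shows "inv_arr C f \<in> Arr C" "Dom C (inv_arr C f) = Cod C f" "Cod C (inv_arr C f) = Dom C f"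
    "inv_arr C f \<cdot>\<^bsub>C\<^esub> f = Idn C (Dom C f)" "f \<cdot>\<^bsub>C\<^esub> inv_arr C f = Idn C (Cod C f)" "f \<in> Arr C"
proof -
  have "\<exists>g. arr C g (Cod C f) (Dom C f) \<and>
     g \<cdot>\<^bsub>C\<^esub> f = Idn C (Dom C f) \<and> f \<cdot>\<^bsub>C\<^esub> g = Idn C (Cod C f)" and f: "f \<in> Arr C"
    using assms by (auto simp: is_iso_def)
  from someI_ex[OF this(1)] f
  show "inv_arr C f \<in> Arr C" "Dom C (inv_arr C f) = Cod C f" "Cod C (inv_arr C f) = Dom C f"
    "inv_arr C f \<cdot>\<^bsub>C\<^esub> f = Idn C (Dom C f)" "f \<cdot>\<^bsub>C\<^esub> inv_arr C f = Idn C (Cod C f)" "f \<in> Arr C"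
    by (auto simp: inv_arr_def)
qed

lemma is_isoI:
  "arr C f x y \<Longrightarrow> arr C g y x \<Longrightarrow> g \<cdot>\<^bsub>C\<^esub> f = Idn C x \<Longrightarrow> f \<cdot>\<^bsub>C\<^esub> g = Idn C y \<Longrightarrow> is_iso C f"
  by (auto simp: is_iso_def)

lemma is_iso_idn [simp]: "category C \<Longrightarrow> x \<in> Obj C \<Longrightarrow> is_iso C (Idn C x)"
  by (rule is_isoI[of _ _ x x "Idn C x"]) auto

lemma is_iso_inv: "is_iso C f \<Longrightarrow> is_iso C (inv_arr C f)"
  using inv_arr[of C f] by (auto simp: is_iso_def)

lemma iso_mono:
  assumes "category C" "is_iso C f" "g \<in> Arr C" "h \<in> Arr C" "Cod C g = Dom C f" "Cod C h = Dom C f"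
    "f \<cdot>\<^bsub>C\<^esub> g = f \<cdot>\<^bsub>C\<^esub> h"
  shows "g = h"
proof -
  note i = inv_arr[OF assms(2)]
  have "inv_arr C f \<cdot>\<^bsub>C\<^esub> (f \<cdot>\<^bsub>C\<^esub> k) = k" if "k \<in> Arr C" "Cod C k = Dom C f" for k
    using assms(1) i i(4)[THEN reassoc] that by simp
  from this[of g] this[of h] show ?thesis using assms by metis
qed

lemma iso_epi:
  assumes "category C" "is_iso C f" "g \<in> Arr C" "h \<in> Arr C" "Dom C g = Cod C f" "Dom C h = Cod C f"
    "g \<cdot>\<^bsub>C\<^esub> f = h \<cdot>\<^bsub>C\<^esub> f"
  shows "g = h"
proof -
  note i = inv_arr[OF assms(2)]
  have "(k \<cdot>\<^bsub>C\<^esub> f) \<cdot>\<^bsub>C\<^esub> inv_arr C f = k" if "k \<in> Arr C" "Dom C k = Cod C f" for k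
    using assms(1) i that by simp
  from this[of g] this[of h] show ?thesis using assms by metis
qed

lemma is_iso_comp:
  assumes "category C" "is_iso C f" "is_iso C g" "Cod C f = Dom C g"
  shows "is_iso C (g \<cdot>\<^bsub>C\<^esub> f)"
proof -
  note f = inv_arr[OF assms(2)] and g = inv_arr[OF assms(3)]
  show ?thesis
    by (rule is_isoI[of _ _ "Dom C f" "Cod C g" "inv_arr C f \<cdot>\<^bsub>C\<^esub> inv_arr C g"])
      (use assms f g f(4)[THEN reassoc] f(5)[THEN reassoc] g(4)[THEN reassoc] g(5)[THEN reassoc] in simp_all)
qed

lemma iso_left:
  assumes "category C" "is_iso C g" "is_iso C (g \<cdot>\<^bsub>C\<^esub> f)" "f \<in> Arr C" "Cod C f = Dom C g"
  shows "is_iso C f"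
proof -
  note g = inv_arr[OF assms(2)]
  have "is_iso C (inv_arr C g \<cdot>\<^bsub>C\<^esub> (g \<cdot>\<^bsub>C\<^esub> f))"
    by (rule is_iso_comp) (use assms g is_iso_inv in auto)
  then show ?thesis using assms g g(4)[THEN reassoc] by simp
qed

subsection \<open>Functors and natural transformations\<close>

lemma functor_simps:
  assumes "is_functor C D F"
  shows "x \<in> Obj C \<Longrightarrow> Fo F x \<in> Obj D" "f \<in> Arr C \<Longrightarrow> Fa F f \<in> Arr D"
    "f \<in> Arr C \<Longrightarrow> Dom D (Fa F f) = Fo F (Dom C f)" "f \<in> Arr C \<Longrightarrow> Cod D (Fa F f) = Fo F (Cod C f)"
    "x \<in> Obj C \<Longrightarrow> Fa F (Idn C x) = Idn D (Fo F x)"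
    "f \<in> Arr C \<Longrightarrow> g \<in> Arr C \<Longrightarrow> Cod C f = Dom C g \<Longrightarrow> Fa F (g \<cdot>\<^bsub>C\<^esub> f) = Fa F g \<cdot>\<^bsub>D\<^esub> Fa F f"
  using assms by (auto simp: is_functor_def PiE_def Pi_def)

text \<open>Preservation of composites is left out: where that equation is used from right to left,
  keeping it as a rewrite rule in the other direction would loop.\<close>

lemmas functor_base = functor_simps(1-5)

lemma functorI:
  assumes "Fo F \<in> extensional (Obj C)" "Fa F \<in> extensional (Arr C)"
    "\<And>x. x \<in> Obj C \<Longrightarrow> Fo F x \<in> Obj D"
    "\<And>f. f \<in> Arr C \<Longrightarrow> arr D (Fa F f) (Fo F (Dom C f)) (Fo F (Cod C f))"
    "\<And>x. x \<in> Obj C \<Longrightarrow> Fa F (Idn C x) = Idn D (Fo F x)"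
    "\<And>f g. f \<in> Arr C \<Longrightarrow> g \<in> Arr C \<Longrightarrow> Cod C f = Dom C g \<Longrightarrow> Fa F (g \<cdot>\<^bsub>C\<^esub> f) = Fa F g \<cdot>\<^bsub>D\<^esub> Fa F f"
  shows "is_functor C D F"
  using assms by (auto simp: is_functor_def PiE_def Pi_def)

lemma functor_ext:
  assumes "is_functor C D F"
  shows "Fo F \<in> extensional (Obj C)" "Fa F \<in> extensional (Arr C)"
  using assms by (auto simp: is_functor_def PiE_def)

lemma ftor_eqI:
  fixes F G :: "('o, 'm, 'p, 'n) ftor"
  assumes "Fo F \<in> extensional S" "Fo G \<in> extensional S" "Fa F \<in> extensional R" "Fa G \<in> extensional R"
    "\<And>x. x \<in> S \<Longrightarrow> Fo F x = Fo G x" "\<And>f. f \<in> R \<Longrightarrow> Fa F f = Fa G f"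
  shows "F = G"
  using assms by (intro ftor.equality) (auto intro: extensionalityI)

lemma ftor_comp_simps [simp]:
  "x \<in> Obj C \<Longrightarrow> Fo (ftor_comp C G F) x = Fo G (Fo F x)"
  "f \<in> Arr C \<Longrightarrow> Fa (ftor_comp C G F) f = Fa G (Fa F f)"
  "Fo (ftor_comp C G F) \<in> extensional (Obj C)" "Fa (ftor_comp C G F) \<in> extensional (Arr C)"
  by (auto simp: ftor_comp_def)

lemma ftor_id_simps [simp]:
  "x \<in> Obj C \<Longrightarrow> Fo (ftor_id C) x = x" "f \<in> Arr C \<Longrightarrow> Fa (ftor_id C) f = f"
  "Fo (ftor_id C) \<in> extensional (Obj C)" "Fa (ftor_id C) \<in> extensional (Arr C)"
  by (auto simp: ftor_id_def)

lemma is_functor_id [simp]: "category C \<Longrightarrow> is_functor C C (ftor_id C)"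
  by (rule functorI) auto

lemma is_functor_comp:
  assumes "category C" "is_functor C D F" "is_functor D E G"
  shows "is_functor C E (ftor_comp C G F)"
  by (rule functorI) (use assms functor_simps[OF assms(2)] functor_simps[OF assms(3)] in auto)

lemma ftor_comp_id:
  assumes "is_functor C D F"
  shows "ftor_comp C F (ftor_id C) = F" "ftor_comp C (ftor_id D) F = F"
  by (rule ftor_eqI[of _ "Obj C" _ "Arr C"];
      use functor_simps[OF assms] functor_ext[OF assms] in simp)+

lemma ftor_comp_assoc:
  assumes "is_functor C D F"
  shows "ftor_comp C (ftor_comp D H G) F = ftor_comp C H (ftor_comp C G F)"
  by (rule ftor_eqI[of _ "Obj C" _ "Arr C"]; use functor_simps[OF assms] in simp)

lemma functor_iso:
  assumes "category C" "is_functor C D F" "is_iso C f"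
  shows "is_iso D (Fa F f)"
proof -
  note [simp] = functor_base[OF assms(2)] and i = inv_arr[OF assms(3)]
  show ?thesis
    by (rule is_isoI[of _ _ "Fo F (Dom C f)" "Fo F (Cod C f)" "Fa F (inv_arr C f)"])
      (use assms i functor_simps(6)[OF assms(2), symmetric] in auto)
qed

lemma nat_transD:
  assumes "nat_trans C D F G t"
  shows "is_functor C D F" "is_functor C D G" "t \<in> extensional (Obj C)"
    "x \<in> Obj C \<Longrightarrow> t x \<in> Arr D" "x \<in> Obj C \<Longrightarrow> Dom D (t x) = Fo F x" "x \<in> Obj C \<Longrightarrow> Cod D (t x) = Fo G x"
    "f \<in> Arr C \<Longrightarrow> t (Cod C f) \<cdot>\<^bsub>D\<^esub> Fa F f = Fa G f \<cdot>\<^bsub>D\<^esub> t (Dom C f)"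
  using assms by (auto simp: nat_trans_def)

lemma nat_transI:
  assumes "is_functor C D F" "is_functor C D G" "t \<in> extensional (Obj C)"
    "\<And>x. x \<in> Obj C \<Longrightarrow> arr D (t x) (Fo F x) (Fo G x)"
    "\<And>f. f \<in> Arr C \<Longrightarrow> t (Cod C f) \<cdot>\<^bsub>D\<^esub> Fa F f = Fa G f \<cdot>\<^bsub>D\<^esub> t (Dom C f)"
  shows "nat_trans C D F G t"
  using assms by (auto simp: nat_trans_def)

lemma nat_trans_id:
  assumes "category D" "category C" "is_functor C D F"
  shows "nat_trans C D F F (\<lambda>x\<in>Obj C. Idn D (Fo F x))"
  by (rule nat_transI) (use assms functor_simps[OF assms(3)] in auto)

lemma nat_trans_vcomp:
  assumes "category C" "category D" "nat_trans C D F G t" "nat_trans C D G H s"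
  shows "nat_trans C D F H (\<lambda>x\<in>Obj C. s x \<cdot>\<^bsub>D\<^esub> t x)"
proof -
  note t = nat_transD[OF assms(3)] and s = nat_transD[OF assms(4)]
  note [simp] = functor_simps[OF t(1)] functor_simps[OF s(1)] functor_simps[OF s(2)]
    t(4-6) s(4-6) t(7) s(7)[THEN reassoc]
  show ?thesis
    by (rule nat_transI) (use assms(1,2) t(1) s(2) s(7) in auto)
qed

lemma nat_trans_hcomp:
  assumes "category C" "category D" "category E" "nat_trans C D F F' t" "nat_trans D E G G' s"
  shows "nat_trans C E (ftor_comp C G F) (ftor_comp C G' F') (\<lambda>x\<in>Obj C. s (Fo F' x) \<cdot>\<^bsub>E\<^esub> Fa G (t x))"
proof -
  note t = nat_transD[OF assms(4)] and s = nat_transD[OF assms(5)]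
  note [simp] = functor_simps[OF t(1)] functor_simps[OF t(2)] functor_base[OF s(1)] functor_simps[OF s(2)]
    t(4-6) s(4-6)
  show ?thesis
  proof (rule nat_transI)
    fix f assume f: "f \<in> Arr C"
    have "Fa G (t (Cod C f)) \<cdot>\<^bsub>E\<^esub> Fa G (Fa F f) = Fa G (Fa F' f) \<cdot>\<^bsub>E\<^esub> Fa G (t (Dom C f))"
      using f t(7)[OF f] assms(1) by (simp flip: functor_simps(6)[OF s(1)])
    moreover have "s (Fo F' (Cod C f)) \<cdot>\<^bsub>E\<^esub> Fa G (Fa F' f) = Fa G' (Fa F' f) \<cdot>\<^bsub>E\<^esub> s (Fo F' (Dom C f))"
      using s(7)[of "Fa F' f"] f by simp
    note this[THEN reassoc]
    ultimately show "(\<lambda>x\<in>Obj C. s (Fo F' x) \<cdot>\<^bsub>E\<^esub> Fa G (t x)) (Cod C f) \<cdot>\<^bsub>E\<^esub> Fa (ftor_comp C G F) f =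
         Fa (ftor_comp C G' F') f \<cdot>\<^bsub>E\<^esub> (\<lambda>x\<in>Obj C. s (Fo F' x) \<cdot>\<^bsub>E\<^esub> Fa G (t x)) (Dom C f)"
      using f assms(1-3) by simp
  qed (use assms(1-3) is_functor_comp t s in auto)
qed

subsection \<open>Equivalences\<close>

lemma full_faithfulD:
  assumes "full_faithful C D F" "x \<in> Obj C" "y \<in> Obj C" "arr D h (Fo F x) (Fo F y)"
  shows "\<exists>!g. arr C g x y \<and> Fa F g = h"
proof -
  have b: "bij_betw (Fa F) (hom C x y) (hom D (Fo F x) (Fo F y))"
    using assms by (auto simp: full_faithful_def)
  then have "h \<in> Fa F ` hom C x y" using assms(4) by (auto simp: bij_betw_def)
  then obtain g where g: "arr C g x y" "Fa F g = h" by auto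
  have "inj_on (Fa F) (hom C x y)" using b by (simp add: bij_betw_def)
  then show ?thesis using g by (intro ex1I[of _ g]) (auto dest: inj_onD)
qed

lemma full_faithfulI:
  assumes F: "is_functor C D F"
    and "\<And>x y g g'. x \<in> Obj C \<Longrightarrow> y \<in> Obj C \<Longrightarrow> arr C g x y \<Longrightarrow> arr C g' x y \<Longrightarrow> Fa F g = Fa F g' \<Longrightarrow> g = g'"
    and "\<And>x y h. x \<in> Obj C \<Longrightarrow> y \<in> Obj C \<Longrightarrow> arr D h (Fo F x) (Fo F y) \<Longrightarrow> \<exists>g. arr C g x y \<and> Fa F g = h"
  shows "full_faithful C D F"
  unfolding full_faithful_def
proof (intro conjI ballI)
  fix x y assume xy: "x \<in> Obj C" "y \<in> Obj C"
  have "hom D (Fo F x) (Fo F y) \<subseteq> Fa F ` hom C x y"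
  proof
    fix h assume "h \<in> hom D (Fo F x) (Fo F y)"
    then obtain g where "arr C g x y \<and> Fa F g = h" using assms(3)[OF xy, of h] by auto
    then show "h \<in> Fa F ` hom C x y" by auto
  qed
  then show "bij_betw (Fa F) (hom C x y) (hom D (Fo F x) (Fo F y))"
    using xy functor_simps[OF F] assms(2)[OF xy] by (auto simp: bij_betw_def inj_on_def)
qed (rule F)

definition ess_surj :: "('o, 'm) cat \<Rightarrow> ('p, 'n) cat \<Rightarrow> ('o, 'm, 'p, 'n) ftor \<Rightarrow> bool" where
  "ess_surj C D F \<longleftrightarrow> (\<forall>d\<in>Obj D. \<exists>c\<in>Obj C. \<exists>k. arr D k (Fo F c) d \<and> is_iso D k)"

text \<open>The objects \<open>g d\<close> and the isomorphisms \<open>k d\<close> are prescribed,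
  and the conclusion records what \<open>F\<close> does to \<open>G\<close> and \<open>s\<close>.
  Over a base category the \<open>k d\<close> can then be taken vertical, and the quasi-inverse and
  both isomorphisms are seen to lie over the base.\<close>

lemma quasi_inverse:
  assumes C: "category C" and D: "category D" and ff: "full_faithful C D F"
    and g: "\<And>d. d \<in> Obj D \<Longrightarrow> g d \<in> Obj C"
    and k: "\<And>d. d \<in> Obj D \<Longrightarrow> arr D (k d) (Fo F (g d)) d" "\<And>d. d \<in> Obj D \<Longrightarrow> is_iso D (k d)"
  obtains G s where "is_functor D C G" "\<And>d. d \<in> Obj D \<Longrightarrow> Fo G d = g d"
    "\<And>f. f \<in> Arr D \<Longrightarrow> Fa F (Fa G f) = inv_arr D (k (Cod D f)) \<cdot>\<^bsub>D\<^esub> (f \<cdot>\<^bsub>D\<^esub> k (Dom D f))"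
    "nat_iso C C (ftor_id C) (ftor_comp C G F) s"
    "nat_iso D D (ftor_comp D F G) (ftor_id D) (restrict k (Obj D))"
    "\<And>c. c \<in> Obj C \<Longrightarrow> Fa F (s c) = inv_arr D (k (Fo F c))"
proof -
  have F: "is_functor C D F" using ff by (simp add: full_faithful_def)
  note [simp] = C D functor_simps[OF F] g
  have k' [simp]: "d \<in> Obj D \<Longrightarrow> k d \<in> Arr D" "d \<in> Obj D \<Longrightarrow> Dom D (k d) = Fo F (g d)"
    "d \<in> Obj D \<Longrightarrow> Cod D (k d) = d" for d using k by auto
  have i [simp]: "d \<in> Obj D \<Longrightarrow> inv_arr D (k d) \<in> Arr D" "d \<in> Obj D \<Longrightarrow> Cod D (inv_arr D (k d)) = Fo F (g d)"
    "d \<in> Obj D \<Longrightarrow> Dom D (inv_arr D (k d)) = d"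
    "d \<in> Obj D \<Longrightarrow> inv_arr D (k d) \<cdot>\<^bsub>D\<^esub> k d = Idn D (Fo F (g d))"
    "d \<in> Obj D \<Longrightarrow> k d \<cdot>\<^bsub>D\<^esub> inv_arr D (k d) = Idn D d" for d
    using inv_arr[OF k(2)[of d]] by auto
  note i4 [simp] = i(4)[THEN reassoc] and i5 [simp] = i(5)[THEN reassoc]
  \<comment> \<open>\<open>Q x y h\<close> is the preimage of \<open>h\<close> under the bijection
    that \<open>F\<close> induces on arrows from \<open>x\<close> to \<open>y\<close>. The equations
    for \<open>G\<close> and \<open>s\<close> are checked after applying \<open>F\<close>.\<close>
  define Q where "Q x y h = (THE u. arr C u x y \<and> Fa F u = h)" for x y h
  have Q: "arr C (Q x y h) x y" "Fa F (Q x y h) = h"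
    if "x \<in> Obj C" "y \<in> Obj C" "arr D h (Fo F x) (Fo F y)" for x y h
    using theI'[OF full_faithfulD[OF ff that]] by (auto simp: Q_def)
  have inj: "u = v" if "u \<in> Arr C" "v \<in> Arr C" "Dom C u = Dom C v" "Cod C u = Cod C v" "Fa F u = Fa F v" for u v
    using full_faithfulD[OF ff, of "Dom C u" "Cod C u" "Fa F u"] that by auto
  define G where "G = \<lparr>Fo = (\<lambda>d\<in>Obj D. g d), Fa = (\<lambda>f\<in>Arr D. Q (g (Dom D f)) (g (Cod D f))
    (inv_arr D (k (Cod D f)) \<cdot>\<^bsub>D\<^esub> (f \<cdot>\<^bsub>D\<^esub> k (Dom D f))))\<rparr>"
  have GFo [simp]: "d \<in> Obj D \<Longrightarrow> Fo G d = g d" for d by (simp add: G_def)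
  have GFa [simp]: "Fa G f \<in> Arr C" "Dom C (Fa G f) = g (Dom D f)" "Cod C (Fa G f) = g (Cod D f)"
    "Fa F (Fa G f) = inv_arr D (k (Cod D f)) \<cdot>\<^bsub>D\<^esub> (f \<cdot>\<^bsub>D\<^esub> k (Dom D f))" if "f \<in> Arr D" for f
    using Q[of "g (Dom D f)" "g (Cod D f)" "inv_arr D (k (Cod D f)) \<cdot>\<^bsub>D\<^esub> (f \<cdot>\<^bsub>D\<^esub> k (Dom D f))"] that
    by (auto simp: G_def)
  have G: "is_functor D C G"
  proof (rule functorI)
    show "Fo G \<in> extensional (Obj D)" "Fa G \<in> extensional (Arr D)" by (auto simp: G_def)
    show "Fa G (Idn D x) = Idn C (Fo G x)" if "x \<in> Obj D" for x by (rule inj) (use that in auto)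
    show "Fa G (v \<cdot>\<^bsub>D\<^esub> u) = Fa G v \<cdot>\<^bsub>C\<^esub> Fa G u" if "u \<in> Arr D" "v \<in> Arr D" "Cod D u = Dom D v" for u v
      by (rule inj) (use that in auto)
  qed auto
  define s where "s = (\<lambda>c\<in>Obj C. Q c (g (Fo F c)) (inv_arr D (k (Fo F c))))"
  have s [simp]: "s c \<in> Arr C" "Dom C (s c) = c" "Cod C (s c) = g (Fo F c)" "Fa F (s c) = inv_arr D (k (Fo F c))"
    if "c \<in> Obj C" for c using Q[of c "g (Fo F c)" "inv_arr D (k (Fo F c))"] that by (auto simp: s_def)
  have sn: "nat_trans C C (ftor_id C) (ftor_comp C G F) s"
  proof (rule nat_transI)
    show "is_functor C C (ftor_comp C G F)" using is_functor_comp[OF C F G] .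
    show "s \<in> extensional (Obj C)" by (simp add: s_def)
    show "s (Cod C f) \<cdot>\<^bsub>C\<^esub> Fa (ftor_id C) f = Fa (ftor_comp C G F) f \<cdot>\<^bsub>C\<^esub> s (Dom C f)" if "f \<in> Arr C" for f
      by (rule inj) (use that in auto)
  qed auto
  have si: "is_iso C (s c)" if c: "c \<in> Obj C" for c
  proof -
    \<comment> \<open>The inverse of \<open>s c\<close> is the preimage of the isomorphism
      \<open>k (Fo F c)\<close>, just as \<open>s c\<close> is the preimage of its inverse.\<close>
    let ?r = "Q (g (Fo F c)) c (k (Fo F c))"
    have r: "arr C ?r (g (Fo F c)) c" "Fa F ?r = k (Fo F c)" using Q[of "g (Fo F c)" c "k (Fo F c)"] c by auto
    have "?r \<cdot>\<^bsub>C\<^esub> s c = Idn C c" by (rule inj) (use c r in auto)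
    moreover have "s c \<cdot>\<^bsub>C\<^esub> ?r = Idn C (g (Fo F c))" by (rule inj) (use c r in auto)
    ultimately show ?thesis using is_isoI[of "s c" C c "g (Fo F c)" ?r] r c by simp
  qed
  have "nat_trans D D (ftor_comp D F G) (ftor_id D) (restrict k (Obj D))"
    by (rule nat_transI) (use is_functor_comp[OF D G F] in auto)
  with G sn si k show ?thesis by (intro that[of G s]) (auto simp: nat_iso_def)
qed

lemma equivalence_functorI:
  assumes C: "category C" and D: "category D" and ff: "full_faithful C D F" and "ess_surj C D F"
  shows "equivalence_functor C D F"
proof -
  have "\<forall>d\<in>Obj D. \<exists>c k. c \<in> Obj C \<and> arr D k (Fo F c) d \<and> is_iso D k"
    using assms(4) by (fastforce simp: ess_surj_def)
  then obtain g k where "\<forall>d\<in>Obj D. g d \<in> Obj C \<and> arr D (k d) (Fo F (g d)) d \<and> is_iso D (k d)"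
    by metis
  then obtain G s where "is_functor D C G" "nat_iso C C (ftor_id C) (ftor_comp C G F) s"
    "nat_iso D D (ftor_comp D F G) (ftor_id D) (restrict k (Obj D))"
    using quasi_inverse[OF C D ff, of g k] by metis
  then show ?thesis using ff unfolding equivalence_functor_def full_faithful_def by blast
qed

lemma equivalence_functorD:
  assumes C: "category C" and D: "category D" and "equivalence_functor C D F"
  shows "full_faithful C D F" "ess_surj C D F"
proof -
  obtain G s t where F: "is_functor C D F" and G: "is_functor D C G"
    and s: "nat_iso C C (ftor_id C) (ftor_comp C G F) s" and t: "nat_iso D D (ftor_comp D F G) (ftor_id D) t"
    using assms(3) by (auto simp: equivalence_functor_def)
  note [simp] = C D functor_simps[OF F] functor_simps[OF G]
  have sn: "nat_trans C C (ftor_id C) (ftor_comp C G F) s" and si: "\<And>x. x \<in> Obj C \<Longrightarrow> is_iso C (s x)"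
   and tn: "nat_trans D D (ftor_comp D F G) (ftor_id D) t" and ti: "\<And>x. x \<in> Obj D \<Longrightarrow> is_iso D (t x)"
    using s t by (auto simp: nat_iso_def)
  have s' [simp]: "x \<in> Obj C \<Longrightarrow> s x \<in> Arr C" "x \<in> Obj C \<Longrightarrow> Dom C (s x) = x"
    "x \<in> Obj C \<Longrightarrow> Cod C (s x) = Fo G (Fo F x)" for x using nat_transD(4-6)[OF sn, of x] by auto
  have t' [simp]: "x \<in> Obj D \<Longrightarrow> t x \<in> Arr D" "x \<in> Obj D \<Longrightarrow> Dom D (t x) = Fo F (Fo G x)"
    "x \<in> Obj D \<Longrightarrow> Cod D (t x) = x" for x using nat_transD(4-6)[OF tn, of x] by auto
  have s7: "s (Cod C f) \<cdot>\<^bsub>C\<^esub> f = Fa G (Fa F f) \<cdot>\<^bsub>C\<^esub> s (Dom C f)" if "f \<in> Arr C" for f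
    using nat_transD(7)[OF sn that] that by simp
  have t7: "t (Cod D f) \<cdot>\<^bsub>D\<^esub> Fa F (Fa G f) = f \<cdot>\<^bsub>D\<^esub> t (Dom D f)" if "f \<in> Arr D" for f
    using nat_transD(7)[OF tn that] that by simp
  \<comment> \<open>\<open>G\<close> is faithful: naturality of \<open>t\<close> expresses
    \<open>h\<close> after \<open>t x\<close> through \<open>Fa G h\<close>, and the isomorphism
    \<open>t x\<close> is cancelled on the right.\<close>
  have Gf: "h = h'" if "arr D h x y" "arr D h' x y" "Fa G h = Fa G h'" for h h' x y
  proof (rule iso_epi[OF D ti, of x])
    show "h \<cdot>\<^bsub>D\<^esub> t x = h' \<cdot>\<^bsub>D\<^esub> t x" using t7[of h] t7[of h'] that by auto
  qed (use that in auto)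
  show "full_faithful C D F"
  proof (rule full_faithfulI[OF F])
    fix x y g g' assume *: "x \<in> Obj C" "y \<in> Obj C" "arr C g x y" "arr C g' x y" "Fa F g = Fa F g'"
    show "g = g'" by (rule iso_mono[OF C si, of y]) (use * s7[of g] s7[of g'] in auto)
  next
    fix x y h assume *: "x \<in> Obj C" "y \<in> Obj C" "arr D h (Fo F x) (Fo F y)"
    note i = inv_arr[OF si[OF *(2)]]
    \<comment> \<open>If \<open>F g = h\<close>, naturality of \<open>s\<close> says that
      \<open>s y\<close> after \<open>g\<close> is \<open>G h\<close> after \<open>s x\<close>;
      solving for \<open>g\<close> gives the candidate. That it is mapped to \<open>h\<close> is
      seen after applying \<open>G\<close>, which has just been shown faithful.\<close>
    let ?g = "inv_arr C (s y) \<cdot>\<^bsub>C\<^esub> (Fa G h \<cdot>\<^bsub>C\<^esub> s x)"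
    have g: "arr C ?g x y" using * i by simp
    have "Fa G (Fa F ?g) = Fa G h"
      by (rule iso_epi[OF C si[OF *(1)]]) (use * g i s7[of ?g, symmetric] i(5)[THEN reassoc] in auto)
    then have "Fa F ?g = h" using Gf[of "Fa F ?g" "Fo F x" "Fo F y" h] * g by auto
    with g show "\<exists>g. arr C g x y \<and> Fa F g = h" by blast
  qed
  show "ess_surj C D F" unfolding ess_surj_def
  proof
    fix d assume "d \<in> Obj D"
    then show "\<exists>c\<in>Obj C. \<exists>k. arr D k (Fo F c) d \<and> is_iso D k"
      using ti by (intro bexI[of _ "Fo G d"] exI[of _ "t d"]) auto
  qed
qed


section \<open>Parametrized monads and their Eilenberg--Moore fibrations\<close>

lemma cartesianD:
  assumes "cartesian A E p \<phi>"
  shows "\<phi> \<in> Arr E"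
    "\<psi> \<in> Arr E \<Longrightarrow> arr A h (Fo p (Dom E \<psi>)) (Fo p (Dom E \<phi>)) \<Longrightarrow> Cod E \<psi> = Cod E \<phi> \<Longrightarrow>
       Fa p \<psi> = Fa p \<phi> \<cdot>\<^bsub>A\<^esub> h \<Longrightarrow> \<exists>!\<chi>. arr E \<chi> (Dom E \<psi>) (Dom E \<phi>) \<and> Fa p \<chi> = h \<and> \<phi> \<cdot>\<^bsub>E\<^esub> \<chi> = \<psi>"
  using assms by (auto simp: cartesian_def)

lemma cartesianI:
  assumes "\<phi> \<in> Arr E"
    "\<And>\<psi> h. \<psi> \<in> Arr E \<Longrightarrow> arr A h (Fo p (Dom E \<psi>)) (Fo p (Dom E \<phi>)) \<Longrightarrow> Cod E \<psi> = Cod E \<phi> \<Longrightarrow>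
       Fa p \<psi> = Fa p \<phi> \<cdot>\<^bsub>A\<^esub> h \<Longrightarrow> \<exists>\<chi>. arr E \<chi> (Dom E \<psi>) (Dom E \<phi>) \<and> Fa p \<chi> = h \<and> \<phi> \<cdot>\<^bsub>E\<^esub> \<chi> = \<psi>"
    "\<And>\<chi> \<chi>'. \<chi> \<in> Arr E \<Longrightarrow> \<chi>' \<in> Arr E \<Longrightarrow> Dom E \<chi> = Dom E \<chi>' \<Longrightarrow> Cod E \<chi> = Dom E \<phi> \<Longrightarrow> Cod E \<chi>' = Dom E \<phi> \<Longrightarrow>
       Fa p \<chi> = Fa p \<chi>' \<Longrightarrow> \<phi> \<cdot>\<^bsub>E\<^esub> \<chi> = \<phi> \<cdot>\<^bsub>E\<^esub> \<chi>' \<Longrightarrow> \<chi> = \<chi>'"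
  shows "cartesian A E p \<phi>"
  unfolding cartesian_def
proof (intro conjI ballI impI)
  fix \<psi> h assume *: "\<psi> \<in> Arr E" "h \<in> hom A (Fo p (Dom E \<psi>)) (Fo p (Dom E \<phi>))" "Cod E \<psi> = Cod E \<phi>"
       "Fa p \<psi> = Fa p \<phi> \<cdot>\<^bsub>A\<^esub> h"
  then obtain \<chi> where "arr E \<chi> (Dom E \<psi>) (Dom E \<phi>) \<and> Fa p \<chi> = h \<and> \<phi> \<cdot>\<^bsub>E\<^esub> \<chi> = \<psi>"
    using assms(2) by force
  then show "\<exists>!\<chi>. \<chi> \<in> hom E (Dom E \<psi>) (Dom E \<phi>) \<and> Fa p \<chi> = h \<and> \<phi> \<cdot>\<^bsub>E\<^esub> \<chi> = \<psi>"
    by (intro ex1I[of _ \<chi>]) (auto intro: assms(3))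
qed (rule assms(1))

lemma cartesian_mono:
  assumes "category A" "category E" "is_functor E A p" "cartesian A E p \<phi>" "\<chi> \<in> Arr E" "\<chi>' \<in> Arr E"
    "Dom E \<chi> = Dom E \<chi>'" "Cod E \<chi> = Dom E \<phi>" "Cod E \<chi>' = Dom E \<phi>" "Fa p \<chi> = Fa p \<chi>'"
    "\<phi> \<cdot>\<^bsub>E\<^esub> \<chi> = \<phi> \<cdot>\<^bsub>E\<^esub> \<chi>'"
  shows "\<chi> = \<chi>'"
proof -
  have "arr E (\<phi> \<cdot>\<^bsub>E\<^esub> \<chi>) (Dom E \<chi>) (Cod E \<phi>)" "Fa p (\<phi> \<cdot>\<^bsub>E\<^esub> \<chi>) = Fa p \<phi> \<cdot>\<^bsub>A\<^esub> Fa p \<chi>"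
    using assms(2-9) functor_simps[OF assms(3)] cartesianD(1)[OF assms(4)] by auto
  then have "\<exists>!k. arr E k (Dom E \<chi>) (Dom E \<phi>) \<and> Fa p k = Fa p \<chi> \<and> \<phi> \<cdot>\<^bsub>E\<^esub> k = \<phi> \<cdot>\<^bsub>E\<^esub> \<chi>"
    using cartesianD(2)[OF assms(4), of "\<phi> \<cdot>\<^bsub>E\<^esub> \<chi>" "Fa p \<chi>"] assms(5,8) functor_simps[OF assms(3)] by auto
  moreover have "arr E \<chi> (Dom E \<chi>) (Dom E \<phi>) \<and> Fa p \<chi> = Fa p \<chi> \<and> \<phi> \<cdot>\<^bsub>E\<^esub> \<chi> = \<phi> \<cdot>\<^bsub>E\<^esub> \<chi>"
    "arr E \<chi>' (Dom E \<chi>) (Dom E \<phi>) \<and> Fa p \<chi>' = Fa p \<chi> \<and> \<phi> \<cdot>\<^bsub>E\<^esub> \<chi>' = \<phi> \<cdot>\<^bsub>E\<^esub> \<chi>"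
    using assms(5-11) by auto
  ultimately show ?thesis by (metis (no_types))
qed

text \<open>Each lift factors through the other over an identity, and the two factors are inverse to
  each other by uniqueness. The comparisons between different reindexings below come from
  here.\<close>

lemma cartesian_unique:
  assumes A: "category A" and E: "category E" and p: "is_functor E A p"
    and c: "cartesian A E p \<phi>" "cartesian A E p \<phi>'"
    and eq: "Cod E \<phi> = Cod E \<phi>'" "Fa p \<phi> = Fa p \<phi>'"
  obtains v where "arr E v (Dom E \<phi>) (Dom E \<phi>')" "is_iso E v" "Fa p v = Idn A (Fo p (Dom E \<phi>))"
    "\<phi>' \<cdot>\<^bsub>E\<^esub> v = \<phi>"
proof -
  note [simp] = A E functor_simps[OF p] cartesianD(1)[OF c(1)] cartesianD(1)[OF c(2)]
  have d: "Fo p (Dom E \<phi>) = Fo p (Dom E \<phi>')"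
    using eq(2) functor_simps(3)[OF p, of \<phi>] functor_simps(3)[OF p, of \<phi>'] by simp
  obtain v where v: "arr E v (Dom E \<phi>) (Dom E \<phi>')" "Fa p v = Idn A (Fo p (Dom E \<phi>))" "\<phi>' \<cdot>\<^bsub>E\<^esub> v = \<phi>"
    using cartesianD(2)[OF c(2), of \<phi> "Idn A (Fo p (Dom E \<phi>))"] eq d by auto
  obtain w where w: "arr E w (Dom E \<phi>') (Dom E \<phi>)" "Fa p w = Idn A (Fo p (Dom E \<phi>))" "\<phi> \<cdot>\<^bsub>E\<^esub> w = \<phi>'"
    using cartesianD(2)[OF c(1), of \<phi>' "Idn A (Fo p (Dom E \<phi>))"] eq d by auto
  have "w \<cdot>\<^bsub>E\<^esub> v = Idn E (Dom E \<phi>)"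
    by (rule cartesian_mono[OF A E p c(1)]) (use v w w(3)[THEN reassoc] d in auto)
  moreover have "v \<cdot>\<^bsub>E\<^esub> w = Idn E (Dom E \<phi>')"
    by (rule cartesian_mono[OF A E p c(2)]) (use v w v(3)[THEN reassoc] d in auto)
  ultimately have "is_iso E v" using is_isoI v(1) w(1) by metis
  with v that show ?thesis by blast
qed

lemma iso_cartesian:
  assumes "category A" "category E" "is_functor E A p" "is_iso E \<phi>"
  shows "cartesian A E p \<phi>"
proof -
  note [simp] = assms(1,2) functor_simps[OF assms(3)] and i [simp] = inv_arr[OF assms(4)]
  note [simp] = i(4)[THEN reassoc] i(5)[THEN reassoc]
  show ?thesis
  proof (rule cartesianI)
    fix \<psi> h assume *: "\<psi> \<in> Arr E" "arr A h (Fo p (Dom E \<psi>)) (Fo p (Dom E \<phi>))" "Cod E \<psi> = Cod E \<phi>"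
       "Fa p \<psi> = Fa p \<phi> \<cdot>\<^bsub>A\<^esub> h"
    have "Fa p (inv_arr E \<phi>) \<cdot>\<^bsub>A\<^esub> Fa p \<phi> = Idn A (Fo p (Dom E \<phi>))"
      using functor_simps(6)[OF assms(3), of \<phi> "inv_arr E \<phi>"] by simp
    note this[THEN reassoc]
    then show "\<exists>\<chi>. arr E \<chi> (Dom E \<psi>) (Dom E \<phi>) \<and> Fa p \<chi> = h \<and> \<phi> \<cdot>\<^bsub>E\<^esub> \<chi> = \<psi>"
      using * by (intro exI[of _ "inv_arr E \<phi> \<cdot>\<^bsub>E\<^esub> \<psi>"]) auto
  qed (use iso_mono[OF assms(2,4)] in auto)
qed

lemma cartesian_comp:
  assumes "category A" "category E" "is_functor E A p" "cartesian A E p \<phi>" "cartesian A E p \<psi>"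
    "Cod E \<psi> = Dom E \<phi>"
  shows "cartesian A E p (\<phi> \<cdot>\<^bsub>E\<^esub> \<psi>)"
proof -
  note [simp] = assms(1,2,6) functor_simps[OF assms(3)] cartesianD(1)[OF assms(4)] cartesianD(1)[OF assms(5)]
  show ?thesis
  proof (rule cartesianI)
    fix k h assume *: "k \<in> Arr E" "arr A h (Fo p (Dom E k)) (Fo p (Dom E (\<phi> \<cdot>\<^bsub>E\<^esub> \<psi>)))"
      "Cod E k = Cod E (\<phi> \<cdot>\<^bsub>E\<^esub> \<psi>)" "Fa p k = Fa p (\<phi> \<cdot>\<^bsub>E\<^esub> \<psi>) \<cdot>\<^bsub>A\<^esub> h"
    obtain \<chi> where \<chi>: "arr E \<chi> (Dom E k) (Dom E \<phi>)" "Fa p \<chi> = Fa p \<psi> \<cdot>\<^bsub>A\<^esub> h" "\<phi> \<cdot>\<^bsub>E\<^esub> \<chi> = k"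
      using cartesianD(2)[OF assms(4), of k "Fa p \<psi> \<cdot>\<^bsub>A\<^esub> h"] * by auto
    obtain \<chi>' where \<chi>': "arr E \<chi>' (Dom E k) (Dom E \<psi>)" "Fa p \<chi>' = h" "\<psi> \<cdot>\<^bsub>E\<^esub> \<chi>' = \<chi>"
      using cartesianD(2)[OF assms(5), of \<chi> h] * \<chi> by auto
    show "\<exists>\<chi>. arr E \<chi> (Dom E k) (Dom E (\<phi> \<cdot>\<^bsub>E\<^esub> \<psi>)) \<and> Fa p \<chi> = h \<and> (\<phi> \<cdot>\<^bsub>E\<^esub> \<psi>) \<cdot>\<^bsub>E\<^esub> \<chi> = k"
      using \<chi> \<chi>' by (intro exI[of _ \<chi>']) auto
  next
    fix \<chi> \<chi>' assume *: "\<chi> \<in> Arr E" "\<chi>' \<in> Arr E" "Dom E \<chi> = Dom E \<chi>'" "Cod E \<chi> = Dom E (\<phi> \<cdot>\<^bsub>E\<^esub> \<psi>)"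
       "Cod E \<chi>' = Dom E (\<phi> \<cdot>\<^bsub>E\<^esub> \<psi>)" "Fa p \<chi> = Fa p \<chi>'" "(\<phi> \<cdot>\<^bsub>E\<^esub> \<psi>) \<cdot>\<^bsub>E\<^esub> \<chi> = (\<phi> \<cdot>\<^bsub>E\<^esub> \<psi>) \<cdot>\<^bsub>E\<^esub> \<chi>'"
    have "\<psi> \<cdot>\<^bsub>E\<^esub> \<chi> = \<psi> \<cdot>\<^bsub>E\<^esub> \<chi>'"
      by (rule cartesian_mono[OF assms(1-4)]) (use * in auto)
    then show "\<chi> = \<chi>'"
      by (intro cartesian_mono[OF assms(1-3,5), of \<chi> \<chi>']) (use * in auto)
  qed simp
qed

section \<open>The total category of algebras: parameter, carrier and structure map\<close>

abbreviation par :: "'u univ \<Rightarrow> 'u univ" where "par s \<equiv> ufst s"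
abbreviation car :: "'u univ \<Rightarrow> 'u univ" where "car s \<equiv> ufst (usnd s)"
abbreviation str :: "'u univ \<Rightarrow> 'u univ" where "str s \<equiv> usnd (usnd s)"

lemma em_algebra_iff:
  "em_algebra (Carr P) (monad_at A P a) x \<xi> \<longleftrightarrow>
     x \<in> Obj (Carr P) \<and> arr (Carr P) \<xi> (Fo (PFun P) (a, x)) x \<and>
     \<xi> \<cdot>\<^bsub>Carr P\<^esub> PUnit P (a, x) = Idn (Carr P) x \<and>
     \<xi> \<cdot>\<^bsub>Carr P\<^esub> Fa (PFun P) (Idn A a, \<xi>) = \<xi> \<cdot>\<^bsub>Carr P\<^esub> PMult P (a, x)"
  by (auto simp: em_algebra_def monad_at_def)

lemma emf_ObjI [simp]:
  "utriple a x \<xi> \<in> Obj (emf_cat A P) \<longleftrightarrow> a \<in> Obj A \<and>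
     x \<in> Obj (Carr P) \<and> arr (Carr P) \<xi> (Fo (PFun P) (a, x)) x \<and>
     \<xi> \<cdot>\<^bsub>Carr P\<^esub> PUnit P (a, x) = Idn (Carr P) x \<and>
     \<xi> \<cdot>\<^bsub>Carr P\<^esub> Fa (PFun P) (Idn A a, \<xi>) = \<xi> \<cdot>\<^bsub>Carr P\<^esub> PMult P (a, x)"
  unfolding em_algebra_iff[symmetric] by (auto simp: emf_cat_def emf_obj_def)

lemma emf_ObjD:
  assumes "s \<in> Obj (emf_cat A P)"
  shows "par s \<in> Obj A" "car s \<in> Obj (Carr P)" "str s \<in> Arr (Carr P)"
    "Dom (Carr P) (str s) = Fo (PFun P) (par s, car s)" "Cod (Carr P) (str s) = car s"
    "str s \<cdot>\<^bsub>Carr P\<^esub> PUnit P (par s, car s) = Idn (Carr P) (car s)"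
    "str s \<cdot>\<^bsub>Carr P\<^esub> Fa (PFun P) (Idn A (par s), str s) = str s \<cdot>\<^bsub>Carr P\<^esub> PMult P (par s, car s)"
    "utriple (par s) (car s) (str s) = s"
  using assms em_algebra_iff by (auto simp: emf_cat_def emf_obj_def) (fastforce simp: em_algebra_iff)+

lemma emf_ArrI [simp]:
  "uarrow s t f g \<in> Arr (emf_cat A P) \<longleftrightarrow> s \<in> Obj (emf_cat A P) \<and> t \<in> Obj (emf_cat A P) \<and>
     arr A f (par s) (par t) \<and> arr (Carr P) g (car s) (car t) \<and>
     g \<cdot>\<^bsub>Carr P\<^esub> str s = str t \<cdot>\<^bsub>Carr P\<^esub> Fa (PFun P) (f, g)"
proof
  assume "uarrow s t f g \<in> Arr (emf_cat A P)"
  then show "s \<in> Obj (emf_cat A P) \<and> t \<in> Obj (emf_cat A P) \<and>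
     arr A f (par s) (par t) \<and> arr (Carr P) g (car s) (car t) \<and>
     g \<cdot>\<^bsub>Carr P\<^esub> str s = str t \<cdot>\<^bsub>Carr P\<^esub> Fa (PFun P) (f, g)"
    by (auto simp: emf_cat_def)
next
  assume *: "s \<in> Obj (emf_cat A P) \<and> t \<in> Obj (emf_cat A P) \<and>
     arr A f (par s) (par t) \<and> arr (Carr P) g (car s) (car t) \<and>
     g \<cdot>\<^bsub>Carr P\<^esub> str s = str t \<cdot>\<^bsub>Carr P\<^esub> Fa (PFun P) (f, g)"
  then obtain a x \<xi> b y \<theta> where "s = utriple a x \<xi>" "t = utriple b y \<theta>"
    using emf_ObjD(8) by metis
  with * show "uarrow s t f g \<in> Arr (emf_cat A P)" by (auto simp: emf_cat_def)
qed

lemma emf_cat_simps [simp]: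
  "Dom (emf_cat A P) u = uarr_dom u" "Cod (emf_cat A P) u = uarr_cod u"
  "Idn (emf_cat A P) s = uarrow s s (Idn A (par s)) (Idn (Carr P) (car s))"
  "v \<cdot>\<^bsub>emf_cat A P\<^esub> u = uarrow (uarr_dom u) (uarr_cod v)
     (uarr_fst v \<cdot>\<^bsub>A\<^esub> uarr_fst u) (uarr_snd v \<cdot>\<^bsub>Carr P\<^esub> uarr_snd u)"
  by (auto simp: emf_cat_def)

lemma emf_ArrD:
  assumes "u \<in> Arr (emf_cat A P)"
  shows "uarr_dom u \<in> Obj (emf_cat A P)" "uarr_cod u \<in> Obj (emf_cat A P)"
    "uarr_fst u \<in> Arr A" "Dom A (uarr_fst u) = par (uarr_dom u)" "Cod A (uarr_fst u) = par (uarr_cod u)"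
    "uarr_snd u \<in> Arr (Carr P)" "Dom (Carr P) (uarr_snd u) = car (uarr_dom u)"
    "Cod (Carr P) (uarr_snd u) = car (uarr_cod u)"
    "uarr_snd u \<cdot>\<^bsub>Carr P\<^esub> str (uarr_dom u) = str (uarr_cod u) \<cdot>\<^bsub>Carr P\<^esub> Fa (PFun P) (uarr_fst u, uarr_snd u)"
    "uarrow (uarr_dom u) (uarr_cod u) (uarr_fst u) (uarr_snd u) = u"
proof -
  from assms obtain s t f g where u: "u = uarrow s t f g" by (auto simp: emf_cat_def)
  with assms have "uarrow s t f g \<in> Arr (emf_cat A P)" by simp
  with u show "uarr_dom u \<in> Obj (emf_cat A P)" "uarr_cod u \<in> Obj (emf_cat A P)"
    "uarr_fst u \<in> Arr A" "Dom A (uarr_fst u) = par (uarr_dom u)" "Cod A (uarr_fst u) = par (uarr_cod u)"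
    "uarr_snd u \<in> Arr (Carr P)" "Dom (Carr P) (uarr_snd u) = car (uarr_dom u)"
    "Cod (Carr P) (uarr_snd u) = car (uarr_cod u)"
    "uarr_snd u \<cdot>\<^bsub>Carr P\<^esub> str (uarr_dom u) = str (uarr_cod u) \<cdot>\<^bsub>Carr P\<^esub> Fa (PFun P) (uarr_fst u, uarr_snd u)"
    "uarrow (uarr_dom u) (uarr_cod u) (uarr_fst u) (uarr_snd u) = u"
    unfolding emf_ArrI by auto
qed

lemma emf_eqI:
  "u \<in> Arr (emf_cat A P) \<Longrightarrow> v \<in> Arr (emf_cat A P) \<Longrightarrow> uarr_dom u = uarr_dom v \<Longrightarrow> uarr_cod u = uarr_cod v \<Longrightarrow>
    uarr_fst u = uarr_fst v \<Longrightarrow> uarr_snd u = uarr_snd v \<Longrightarrow> u = v"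
  using emf_ArrD(10)[of u A P] emf_ArrD(10)[of v A P] by metis

lemma emf_proj_simps [simp]:
  "s \<in> Obj (emf_cat A P) \<Longrightarrow> Fo (emf_proj A P) s = par s"
  "u \<in> Arr (emf_cat A P) \<Longrightarrow> Fa (emf_proj A P) u = uarr_fst u"
  by (auto simp: emf_proj_def)

text \<open>Together with \<open>emf_proj\<close> this is the right adjoint, with values in the
  product of \<open>A\<close> and the carriers, whose left adjoint forms free algebras.\<close>

definition emf_car :: "'u ucat \<Rightarrow> 'u pmonad \<Rightarrow> 'u uftor" where
  "emf_car A P = \<lparr>Fo = (\<lambda>s\<in>Obj (emf_cat A P). car s), Fa = (\<lambda>u\<in>Arr (emf_cat A P). uarr_snd u)\<rparr>"

lemma emf_car_simps [simp]:
  "s \<in> Obj (emf_cat A P) \<Longrightarrow> Fo (emf_car A P) s = car s"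
  "u \<in> Arr (emf_cat A P) \<Longrightarrow> Fa (emf_car A P) u = uarr_snd u"
  by (auto simp: emf_car_def)

text \<open>An elementary form of \<open>param_monad\<close>. Naturality of the unit and
  multiplication of each \<open>T\<^sub>a\<close> and compatibility of each \<open>T\<^sub>f\<close>
  with them are merged into one equation for an arrow \<open>(f, g)\<close> of the product, so that
  one rewrite rule does the work of two.\<close>

locale param_monad_axioms =
  fixes A :: "'u ucat" and P :: "'u pmonad"
  assumes A [simp]: "category A" and X [simp]: "category (Carr P)"
    and T: "is_functor (A \<times>\<^sub>C Carr P) (Carr P) (PFun P)"
    and unit: "\<lbrakk>a \<in> Obj A; x \<in> Obj (Carr P)\<rbrakk> \<Longrightarrow> arr (Carr P) (PUnit P (a, x)) x (Fo (PFun P) (a, x))"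
    and mult: "\<lbrakk>a \<in> Obj A; x \<in> Obj (Carr P)\<rbrakk> \<Longrightarrow>
      arr (Carr P) (PMult P (a, x)) (Fo (PFun P) (a, Fo (PFun P) (a, x))) (Fo (PFun P) (a, x))"
    and unit_nat: "\<lbrakk>f \<in> Arr A; g \<in> Arr (Carr P); Dom A f = a; Dom (Carr P) g = x\<rbrakk> \<Longrightarrow>
      Fa (PFun P) (f, g) \<cdot>\<^bsub>Carr P\<^esub> PUnit P (a, x) = PUnit P (Cod A f, Cod (Carr P) g) \<cdot>\<^bsub>Carr P\<^esub> g"
    and mult_nat: "\<lbrakk>f \<in> Arr A; g \<in> Arr (Carr P); Dom A f = a; Dom (Carr P) g = x\<rbrakk> \<Longrightarrow>
      Fa (PFun P) (f, g) \<cdot>\<^bsub>Carr P\<^esub> PMult P (a, x) =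
      PMult P (Cod A f, Cod (Carr P) g) \<cdot>\<^bsub>Carr P\<^esub> Fa (PFun P) (f, Fa (PFun P) (f, g))"
    and unit_left: "\<lbrakk>a \<in> Obj A; x \<in> Obj (Carr P)\<rbrakk> \<Longrightarrow>
      PMult P (a, x) \<cdot>\<^bsub>Carr P\<^esub> PUnit P (a, Fo (PFun P) (a, x)) = Idn (Carr P) (Fo (PFun P) (a, x))"
    and unit_right: "\<lbrakk>a \<in> Obj A; x \<in> Obj (Carr P)\<rbrakk> \<Longrightarrow>
      PMult P (a, x) \<cdot>\<^bsub>Carr P\<^esub> Fa (PFun P) (Idn A a, PUnit P (a, x)) = Idn (Carr P) (Fo (PFun P) (a, x))"
    and mult_assoc: "\<lbrakk>a \<in> Obj A; x \<in> Obj (Carr P)\<rbrakk> \<Longrightarrow>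
      PMult P (a, x) \<cdot>\<^bsub>Carr P\<^esub> Fa (PFun P) (Idn A a, PMult P (a, x)) =
      PMult P (a, x) \<cdot>\<^bsub>Carr P\<^esub> PMult P (a, Fo (PFun P) (a, x))"
begin

lemma T_simps [simp]:
  "\<lbrakk>a \<in> Obj A; x \<in> Obj (Carr P)\<rbrakk> \<Longrightarrow> Fo (PFun P) (a, x) \<in> Obj (Carr P)"
  "\<lbrakk>f \<in> Arr A; g \<in> Arr (Carr P)\<rbrakk> \<Longrightarrow> Fa (PFun P) (f, g) \<in> Arr (Carr P)"
  "\<lbrakk>f \<in> Arr A; g \<in> Arr (Carr P)\<rbrakk> \<Longrightarrow> Dom (Carr P) (Fa (PFun P) (f, g)) = Fo (PFun P) (Dom A f, Dom (Carr P) g)"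
  "\<lbrakk>f \<in> Arr A; g \<in> Arr (Carr P)\<rbrakk> \<Longrightarrow> Cod (Carr P) (Fa (PFun P) (f, g)) = Fo (PFun P) (Cod A f, Cod (Carr P) g)"
  "\<lbrakk>a \<in> Obj A; x \<in> Obj (Carr P)\<rbrakk> \<Longrightarrow> Fa (PFun P) (Idn A a, Idn (Carr P) x) = Idn (Carr P) (Fo (PFun P) (a, x))"
  using functor_simps(1,5)[OF T, of "(a, x)"] functor_simps(2-4)[OF T, of "(f, g)"] by auto

lemma T_comp [simp]:
  assumes "f \<in> Arr A" "g \<in> Arr (Carr P)" "f' \<in> Arr A" "g' \<in> Arr (Carr P)"
     "Cod A f = Dom A f'" "Cod (Carr P) g = Dom (Carr P) g'"
  shows "Fa (PFun P) (f', g') \<cdot>\<^bsub>Carr P\<^esub> Fa (PFun P) (f, g) = Fa (PFun P) (f' \<cdot>\<^bsub>A\<^esub> f, g' \<cdot>\<^bsub>Carr P\<^esub> g)"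
  using functor_simps(6)[OF T, of "(f, g)" "(f', g')"] assms by auto

declare unit [simp] mult [simp] unit_nat [simp] mult_nat [simp] unit_left [simp] unit_right [simp]

lemmas [simp] = unit_nat[THEN reassoc] mult_nat[THEN reassoc] unit_left[THEN reassoc] unit_right[THEN reassoc]

lemma param_monad: "param_monad A P"
  unfolding param_monad_def
proof (intro conjI ballI)
  have F: "is_functor (Carr P) (Carr P) (Fun (monad_at A P a))" if "a \<in> Obj A" for a
    by (rule functorI) (use that in \<open>auto simp: monad_at_def\<close>)
  show "is_monad (Carr P) (monad_at A P a)" if "a \<in> Obj A" for a
    unfolding is_monad_def using that F[OF that] mult_assoc
    by (intro conjI nat_transI is_functor_comp) (auto simp: monad_at_def)
  show "monad_morphism (Carr P) (monad_at A P (Dom A f)) (monad_at A P (Cod A f)) (monad_along P f)"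
    if "f \<in> Arr A" for f
    unfolding monad_morphism_def using that F
    by (intro conjI nat_transI) (auto simp: monad_at_def monad_along_def)
qed (use T in auto)

text \<open>\<open>T (f, str s \<cdot> T (f, g))\<close> splits into \<open>T (id, str s)\<close>
  after \<open>T (f, T (f, g))\<close>; then associativity of the algebra and naturality of the
  multiplication apply. It serves reindexing, with \<open>g\<close> an identity, and extension from
  free algebras, with \<open>g\<close> arbitrary.\<close>

lemma algebra_monoD:
  assumes "s \<in> Obj (emf_cat A P)" "f \<in> Arr A" "g \<in> Arr (Carr P)" "Cod A f = par s" "Cod (Carr P) g = car s"
  shows "str s \<cdot>\<^bsub>Carr P\<^esub> Fa (PFun P) (f, str s \<cdot>\<^bsub>Carr P\<^esub> Fa (PFun P) (f, g)) =
    str s \<cdot>\<^bsub>Carr P\<^esub> (Fa (PFun P) (f, g) \<cdot>\<^bsub>Carr P\<^esub> PMult P (Dom A f, Dom (Carr P) g))"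
proof -
  note [simp] = emf_ObjD(1-5)[OF assms(1)]
  have "Fa (PFun P) (f, str s \<cdot>\<^bsub>Carr P\<^esub> Fa (PFun P) (f, g)) =
     Fa (PFun P) (Idn A (par s), str s) \<cdot>\<^bsub>Carr P\<^esub> Fa (PFun P) (f, Fa (PFun P) (f, g))"
    using assms by simp
  then have "str s \<cdot>\<^bsub>Carr P\<^esub> Fa (PFun P) (f, str s \<cdot>\<^bsub>Carr P\<^esub> Fa (PFun P) (f, g)) =
     (str s \<cdot>\<^bsub>Carr P\<^esub> PMult P (par s, car s)) \<cdot>\<^bsub>Carr P\<^esub> Fa (PFun P) (f, Fa (PFun P) (f, g))"
    using emf_ObjD(7)[OF assms(1), THEN reassoc, of "Fa (PFun P) (f, Fa (PFun P) (f, g))"] assms(2-)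
    by (simp del: T_comp)
  then show ?thesis using assms(2-) by simp
qed

lemma emf_category [simp]: "category (emf_cat A P)"
proof (rule categoryI)
  fix u v assume u: "u \<in> Arr (emf_cat A P)" and v: "v \<in> Arr (emf_cat A P)" and c: "Cod (emf_cat A P) u = Dom (emf_cat A P) v"
  note [simp] = emf_ArrD(1-8)[OF u] emf_ArrD(1-8)[OF v] emf_ObjD(1-5)[OF emf_ArrD(1)[OF u]]
     emf_ObjD(1-5)[OF emf_ArrD(2)[OF v]] emf_ObjD(1-5)[OF emf_ArrD(1)[OF v]]
  have "uarr_snd v \<cdot>\<^bsub>Carr P\<^esub> (uarr_snd u \<cdot>\<^bsub>Carr P\<^esub> str (uarr_dom u)) =
     str (uarr_cod v) \<cdot>\<^bsub>Carr P\<^esub> Fa (PFun P) (uarr_fst v \<cdot>\<^bsub>A\<^esub> uarr_fst u, uarr_snd v \<cdot>\<^bsub>Carr P\<^esub> uarr_snd u)"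
    using emf_ArrD(9)[OF u] emf_ArrD(9)[OF v, THEN reassoc] c by simp
  then show "arr (emf_cat A P) (v \<cdot>\<^bsub>emf_cat A P\<^esub> u) (Dom (emf_cat A P) u) (Cod (emf_cat A P) v)"
    using c by simp
next
  fix f assume "f \<in> Arr (emf_cat A P)"
  then show "Dom (emf_cat A P) f \<in> Obj (emf_cat A P) \<and> Cod (emf_cat A P) f \<in> Obj (emf_cat A P)"
    using emf_ArrD(1,2)[of f A P] by simp
next
  fix x assume "x \<in> Obj (emf_cat A P)"
  then show "arr (emf_cat A P) (Idn (emf_cat A P) x) x x"
    using emf_ObjD(1-5)[of x A P] by simp
next
  fix f assume f: "f \<in> Arr (emf_cat A P)"
  show "f \<cdot>\<^bsub>emf_cat A P\<^esub> Idn (emf_cat A P) (Dom (emf_cat A P) f) = f"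
    "Idn (emf_cat A P) (Cod (emf_cat A P) f) \<cdot>\<^bsub>emf_cat A P\<^esub> f = f"
    using emf_ArrD[OF f] by simp_all
next
  fix f g h assume *: "f \<in> Arr (emf_cat A P)" "g \<in> Arr (emf_cat A P)" "h \<in> Arr (emf_cat A P)"
    "Cod (emf_cat A P) f = Dom (emf_cat A P) g" "Cod (emf_cat A P) g = Dom (emf_cat A P) h"
  then show "h \<cdot>\<^bsub>emf_cat A P\<^esub> g \<cdot>\<^bsub>emf_cat A P\<^esub> f = h \<cdot>\<^bsub>emf_cat A P\<^esub> (g \<cdot>\<^bsub>emf_cat A P\<^esub> f)"
    using emf_ArrD(1-8)[OF *(1)] emf_ArrD(1-8)[OF *(2)] emf_ArrD(1-8)[OF *(3)] by simp
qed

lemma emf_proj_functor: "is_functor (emf_cat A P) A (emf_proj A P)"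
proof (rule functorI)
  fix f assume f: "f \<in> Arr (emf_cat A P)"
  show "arr A (Fa (emf_proj A P) f) (Fo (emf_proj A P) (Dom (emf_cat A P) f)) (Fo (emf_proj A P) (Cod (emf_cat A P) f))"
    using emf_ArrD(1-8)[OF f] f by simp
next
  fix f g assume f: "f \<in> Arr (emf_cat A P)" and g: "g \<in> Arr (emf_cat A P)"
    and c: "Cod (emf_cat A P) f = Dom (emf_cat A P) g"
  have "g \<cdot>\<^bsub>emf_cat A P\<^esub> f \<in> Arr (emf_cat A P)" using f g c by (simp del: emf_cat_simps(4))
  then show "Fa (emf_proj A P) (g \<cdot>\<^bsub>emf_cat A P\<^esub> f) = Fa (emf_proj A P) g \<cdot>\<^bsub>A\<^esub> Fa (emf_proj A P) f"
    using f g by simp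
next
  fix x assume x: "x \<in> Obj (emf_cat A P)"
  have "Idn (emf_cat A P) x \<in> Arr (emf_cat A P)" using x by (simp del: emf_cat_simps(3))
  then show "Fa (emf_proj A P) (Idn (emf_cat A P) x) = Idn A (Fo (emf_proj A P) x)" using x by simp
qed (auto simp: emf_proj_def emf_ObjD)

lemma emf_car_functor: "is_functor (emf_cat A P) (Carr P) (emf_car A P)"
proof (rule functorI)
  fix f assume f: "f \<in> Arr (emf_cat A P)"
  show "arr (Carr P) (Fa (emf_car A P) f) (Fo (emf_car A P) (Dom (emf_cat A P) f)) (Fo (emf_car A P) (Cod (emf_cat A P) f))"
    using emf_ArrD(1-8)[OF f] f by simp
next
  fix f g assume f: "f \<in> Arr (emf_cat A P)" and g: "g \<in> Arr (emf_cat A P)"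
    and c: "Cod (emf_cat A P) f = Dom (emf_cat A P) g"
  have "g \<cdot>\<^bsub>emf_cat A P\<^esub> f \<in> Arr (emf_cat A P)" using f g c by (simp del: emf_cat_simps(4))
  then show "Fa (emf_car A P) (g \<cdot>\<^bsub>emf_cat A P\<^esub> f) = Fa (emf_car A P) g \<cdot>\<^bsub>Carr P\<^esub> Fa (emf_car A P) f"
    using f g by simp
next
  fix x assume x: "x \<in> Obj (emf_cat A P)"
  have "Idn (emf_cat A P) x \<in> Arr (emf_cat A P)" using x by (simp del: emf_cat_simps(3))
  then show "Fa (emf_car A P) (Idn (emf_cat A P) x) = Idn (Carr P) (Fo (emf_car A P) x)" using x by simp
qed (auto simp: emf_car_def emf_ObjD)

text \<open>The inverse of the carrier part is again an algebra map: its equation follows from that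
  of \<open>u\<close> by cancelling the isomorphism on the left.\<close>

lemma emf_isoI:
  assumes u: "u \<in> Arr (emf_cat A P)" and f: "is_iso A (uarr_fst u)" and g: "is_iso (Carr P) (uarr_snd u)"
  shows "is_iso (emf_cat A P) u"
proof -
  note [simp] = emf_ArrD(1-8)[OF u] emf_ObjD(1-5)[OF emf_ArrD(1)[OF u]] emf_ObjD(1-5)[OF emf_ArrD(2)[OF u]]
    and i [simp] = inv_arr[OF f] inv_arr[OF g]
  let ?f = "uarr_fst u" and ?g = "uarr_snd u"
  let ?v = "uarrow (uarr_cod u) (uarr_dom u) (inv_arr A ?f) (inv_arr (Carr P) ?g)"
  have "?g \<cdot>\<^bsub>Carr P\<^esub> (inv_arr (Carr P) ?g \<cdot>\<^bsub>Carr P\<^esub> str (uarr_cod u)) =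
    ?g \<cdot>\<^bsub>Carr P\<^esub> (str (uarr_dom u) \<cdot>\<^bsub>Carr P\<^esub> Fa (PFun P) (inv_arr A ?f, inv_arr (Carr P) ?g))"
    using emf_ArrD(9)[OF u, THEN reassoc] i(11)[THEN reassoc] by simp
  then have "inv_arr (Carr P) ?g \<cdot>\<^bsub>Carr P\<^esub> str (uarr_cod u) =
    str (uarr_dom u) \<cdot>\<^bsub>Carr P\<^esub> Fa (PFun P) (inv_arr A ?f, inv_arr (Carr P) ?g)"
    by (rule iso_mono[OF X g, rotated -1]) auto
  then have "?v \<in> Arr (emf_cat A P)" by simp
  then show ?thesis
    by (intro is_isoI[of u _ "uarr_dom u" "uarr_cod u" ?v]) (use u in auto)
qed

text \<open>The carrier part of a factorization is forced: it is the inverse of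
  \<open>uarr_snd \<phi>\<close> after \<open>uarr_snd \<psi>\<close>. It satisfies the algebra-map
  equation over \<open>h\<close> because that equation holds after composing with the invertible
  \<open>uarr_snd \<phi>\<close>.\<close>

lemma emf_cartesianI:
  assumes \<phi>: "\<phi> \<in> Arr (emf_cat A P)" and g: "is_iso (Carr P) (uarr_snd \<phi>)"
  shows "cartesian A (emf_cat A P) (emf_proj A P) \<phi>"
proof (rule cartesianI[OF \<phi>])
  note [simp] = emf_ArrD(1-8)[OF \<phi>] emf_ObjD(1-5)[OF emf_ArrD(1)[OF \<phi>]] emf_ObjD(1-5)[OF emf_ArrD(2)[OF \<phi>]]
    \<phi> and i [simp] = inv_arr[OF g]
  note i5 [simp] = i(5)[THEN reassoc] and i4 [simp] = i(4)[THEN reassoc]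
  let ?g = "uarr_snd \<phi>"
  {
    fix \<psi> h assume *: "\<psi> \<in> Arr (emf_cat A P)"
      "arr A h (Fo (emf_proj A P) (Dom (emf_cat A P) \<psi>)) (Fo (emf_proj A P) (Dom (emf_cat A P) \<phi>))"
      "Cod (emf_cat A P) \<psi> = Cod (emf_cat A P) \<phi>"
      "Fa (emf_proj A P) \<psi> = Fa (emf_proj A P) \<phi> \<cdot>\<^bsub>A\<^esub> h"
    note [simp] = emf_ArrD(1-8)[OF *(1)] emf_ObjD(1-5)[OF emf_ArrD(1)[OF *(1)]]
    let ?k = "inv_arr (Carr P) ?g \<cdot>\<^bsub>Carr P\<^esub> uarr_snd \<psi>"
    have "?g \<cdot>\<^bsub>Carr P\<^esub> (?k \<cdot>\<^bsub>Carr P\<^esub> str (uarr_dom \<psi>)) = ?g \<cdot>\<^bsub>Carr P\<^esub> (str (uarr_dom \<phi>) \<cdot>\<^bsub>Carr P\<^esub> Fa (PFun P) (h, ?k))"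
      using emf_ArrD(9)[OF \<phi>, THEN reassoc] emf_ArrD(9)[OF *(1)] * by simp
    then have "?k \<cdot>\<^bsub>Carr P\<^esub> str (uarr_dom \<psi>) = str (uarr_dom \<phi>) \<cdot>\<^bsub>Carr P\<^esub> Fa (PFun P) (h, ?k)"
      by (rule iso_mono[OF X g, rotated -1]) (use * in auto)
    then show "\<exists>\<chi>. arr (emf_cat A P) \<chi> (Dom (emf_cat A P) \<psi>) (Dom (emf_cat A P) \<phi>) \<and>
       Fa (emf_proj A P) \<chi> = h \<and> \<phi> \<cdot>\<^bsub>emf_cat A P\<^esub> \<chi> = \<psi>"
      using * emf_ArrD(10)[OF *(1)]
      by (intro exI[of _ "uarrow (uarr_dom \<psi>) (uarr_dom \<phi>) h ?k"]) auto
  }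
  fix u v assume *: "u \<in> Arr (emf_cat A P)" "v \<in> Arr (emf_cat A P)" "Dom (emf_cat A P) u = Dom (emf_cat A P) v"
    "Cod (emf_cat A P) u = Dom (emf_cat A P) \<phi>" "Cod (emf_cat A P) v = Dom (emf_cat A P) \<phi>"
    "Fa (emf_proj A P) u = Fa (emf_proj A P) v" "\<phi> \<cdot>\<^bsub>emf_cat A P\<^esub> u = \<phi> \<cdot>\<^bsub>emf_cat A P\<^esub> v"
  then have "?g \<cdot>\<^bsub>Carr P\<^esub> uarr_snd u = ?g \<cdot>\<^bsub>Carr P\<^esub> uarr_snd v" by simp
  then have "uarr_snd u = uarr_snd v"
  proof (rule iso_mono[OF X g, rotated -1])
    show "uarr_snd u \<in> Arr (Carr P)" "Cod (Carr P) (uarr_snd u) = Dom (Carr P) ?g"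
      "uarr_snd v \<in> Arr (Carr P)" "Cod (Carr P) (uarr_snd v) = Dom (Carr P) ?g"
      using emf_ArrD(6,8)[OF *(1)] emf_ArrD(6,8)[OF *(2)] *(4,5) by auto
  qed
  with * show "u = v" by (intro emf_eqI[OF *(1,2)]) simp_all
qed

text \<open>Reindexing keeps the carrier and precomposes the structure map with
  \<open>T\<^sub>f\<close>; the lift has an identity as its carrier part, hence is cartesian by
  \<open>emf_cartesianI\<close>.\<close>

lemma emf_lift:
  assumes e: "e \<in> Obj (emf_cat A P)" and f: "f \<in> Arr A" "Cod A f = par e"
  defines "\<phi> \<equiv> uarrow (utriple (Dom A f) (car e) (str e \<cdot>\<^bsub>Carr P\<^esub> Fa (PFun P) (f, Idn (Carr P) (car e)))) e
     f (Idn (Carr P) (car e))"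
  shows "cartesian A (emf_cat A P) (emf_proj A P) \<phi>" "\<phi> \<in> Arr (emf_cat A P)"
proof -
  note [simp] = emf_ObjD[OF e] f e
  show a: "\<phi> \<in> Arr (emf_cat A P)"
    using algebra_monoD[OF e f(1), of "Idn (Carr P) (car e)"] by (simp add: \<phi>_def)
  show "cartesian A (emf_cat A P) (emf_proj A P) \<phi>"
    by (rule emf_cartesianI[OF a]) (simp add: \<phi>_def)
qed

lemma emf_fibration: "fibration A (emf_cat A P) (emf_proj A P)"
  unfolding fibration_def
proof (intro conjI ballI impI)
  fix e f assume *: "e \<in> Obj (emf_cat A P)" "f \<in> Arr A" "Cod A f = Fo (emf_proj A P) e"
  then have l: "Cod A f = par e" by simp
  show "\<exists>\<phi>. cartesian A (emf_cat A P) (emf_proj A P) \<phi> \<and> Cod (emf_cat A P) \<phi> = e \<and> Fa (emf_proj A P) \<phi> = f"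
    by (rule exI, intro conjI, rule emf_lift(1)[OF *(1,2) l]) (use emf_lift(2)[OF *(1,2) l] in simp_all)
qed (use emf_proj_functor in auto)

text \<open>The lift of the same arrow given by \<open>emf_lift\<close> is an identity on carriers.
  The vertical isomorphism to it is sent by the carrier functor to an isomorphism, and this is the
  carrier part of \<phi>.\<close>

lemma emf_cartesianD:
  assumes "cartesian A (emf_cat A P) (emf_proj A P) \<phi>"
  shows "is_iso (Carr P) (uarr_snd \<phi>)"
proof -
  have \<phi>: "\<phi> \<in> Arr (emf_cat A P)" using cartesianD(1)[OF assms] .
  note [simp] = emf_ArrD(1-8)[OF \<phi>] \<phi> emf_ObjD(1-5)[OF emf_ArrD(2)[OF \<phi>]]
  define \<phi>' where "\<phi>' = uarrow (utriple (Dom A (uarr_fst \<phi>)) (car (uarr_cod \<phi>)) (str (uarr_cod \<phi>) \<cdot>\<^bsub>Carr P\<^esub>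
    Fa (PFun P) (uarr_fst \<phi>, Idn (Carr P) (car (uarr_cod \<phi>))))) (uarr_cod \<phi>)
     (uarr_fst \<phi>) (Idn (Carr P) (car (uarr_cod \<phi>)))"
  have \<phi>': "cartesian A (emf_cat A P) (emf_proj A P) \<phi>'" "\<phi>' \<in> Arr (emf_cat A P)"
    using emf_lift[of "uarr_cod \<phi>" "uarr_fst \<phi>"] by (auto simp: \<phi>'_def)
  obtain v where v: "arr (emf_cat A P) v (uarr_dom \<phi>) (uarr_dom \<phi>')" "is_iso (emf_cat A P) v"
      "\<phi>' \<cdot>\<^bsub>emf_cat A P\<^esub> v = \<phi>"
    by (rule cartesian_unique[OF A emf_category emf_proj_functor assms \<phi>'(1)]) (use \<phi>'(2) in \<open>auto simp: \<phi>'_def\<close>)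
  have "uarr_snd \<phi>' \<cdot>\<^bsub>Carr P\<^esub> uarr_snd v = uarr_snd \<phi>" using v(3) by auto
  moreover have "uarr_snd \<phi>' \<cdot>\<^bsub>Carr P\<^esub> uarr_snd v = uarr_snd v"
    using v(1) emf_ArrD[of v A P] by (auto simp: \<phi>'_def)
  moreover have "is_iso (Carr P) (uarr_snd v)"
    using functor_iso[OF emf_category emf_car_functor v(2)] v(1) by simp
  ultimately show ?thesis by simp
qed

end

lemma param_monad_axiomsI:
  assumes A: "category A" and P: "param_monad A P"
  shows "param_monad_axioms A P"
proof -
  let ?X = "Carr P" and ?T = "PFun P"
  have X: "category ?X" and T: "is_functor (A \<times>\<^sub>C ?X) ?X ?T"
   and M: "\<And>a. a \<in> Obj A \<Longrightarrow> is_monad ?X (monad_at A P a)"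
   and mor: "\<And>f. f \<in> Arr A \<Longrightarrow> monad_morphism ?X (monad_at A P (Dom A f)) (monad_at A P (Cod A f)) (monad_along P f)"
    using P by (auto simp: param_monad_def)
  note [simp] = A X
  have Ts [simp]: "Fo ?T (a, x) \<in> Obj ?X" if "a \<in> Obj A" "x \<in> Obj ?X" for a x
    using functor_simps(1)[OF T, of "(a, x)"] that by simp
  have Ta [simp]: "Fa ?T (f, g) \<in> Arr ?X" "Dom ?X (Fa ?T (f, g)) = Fo ?T (Dom A f, Dom ?X g)"
    "Cod ?X (Fa ?T (f, g)) = Fo ?T (Cod A f, Cod ?X g)" if "f \<in> Arr A" "g \<in> Arr ?X" for f g
    using functor_simps(2-4)[OF T, of "(f, g)"] that by auto
  \<comment> \<open>\<open>(f, g)\<close> is \<open>(id, g)\<close> followed by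
    \<open>(f, id)\<close>: the first factor is governed by the monad at \<open>Dom A f\<close>, the
    second by the monad morphism along \<open>f\<close>.\<close>
  have split: "Fa ?T (f, g) = Fa ?T (f, Idn ?X (Cod ?X g)) \<cdot>\<^bsub>?X\<^esub> Fa ?T (Idn A (Dom A f), g)"
    if "f \<in> Arr A" "g \<in> Arr ?X" for f g
    using functor_simps(6)[OF T, of "(Idn A (Dom A f), g)" "(f, Idn ?X (Cod ?X g))"] that by simp
  have u [simp]: "arr ?X (PUnit P (a, x)) x (Fo ?T (a, x))"
    and m [simp]: "arr ?X (PMult P (a, x)) (Fo ?T (a, Fo ?T (a, x))) (Fo ?T (a, x))"
    if "a \<in> Obj A" "x \<in> Obj ?X" for a x
    using M[OF that(1)] that by (auto simp: is_monad_def nat_trans_def monad_at_def)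
  have un: "Fa ?T (Idn A a, g) \<cdot>\<^bsub>?X\<^esub> PUnit P (a, Dom ?X g) = PUnit P (a, Cod ?X g) \<cdot>\<^bsub>?X\<^esub> g"
    and mn: "Fa ?T (Idn A a, g) \<cdot>\<^bsub>?X\<^esub> PMult P (a, Dom ?X g) =
      PMult P (a, Cod ?X g) \<cdot>\<^bsub>?X\<^esub> Fa ?T (Idn A a, Fa ?T (Idn A a, g))"
    if "a \<in> Obj A" "g \<in> Arr ?X" for a g
    using M[OF that(1)] that by (auto simp: is_monad_def nat_trans_def monad_at_def)
  have ua: "Fa ?T (f, Idn ?X x) \<cdot>\<^bsub>?X\<^esub> PUnit P (Dom A f, x) = PUnit P (Cod A f, x)"
    and ma: "Fa ?T (f, Idn ?X x) \<cdot>\<^bsub>?X\<^esub> PMult P (Dom A f, x) = PMult P (Cod A f, x) \<cdot>\<^bsub>?X\<^esub>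
      (Fa ?T (Idn A (Cod A f), Fa ?T (f, Idn ?X x)) \<cdot>\<^bsub>?X\<^esub> Fa ?T (f, Idn ?X (Fo ?T (Dom A f, x))))"
    if "f \<in> Arr A" "x \<in> Obj ?X" for f x
    using mor[OF that(1)] that by (auto simp: monad_morphism_def monad_at_def monad_along_def)
  show ?thesis
  proof
    show "category A" "category ?X" "is_functor (A \<times>\<^sub>C ?X) ?X ?T" using A X T by auto
    show "Fa ?T (f, g) \<cdot>\<^bsub>?X\<^esub> PUnit P (a, x) = PUnit P (Cod A f, Cod ?X g) \<cdot>\<^bsub>?X\<^esub> g"
      if *: "f \<in> Arr A" "g \<in> Arr ?X" "Dom A f = a" "Dom ?X g = x" for f g a x
      using split[OF *(1,2)] un[of a g] ua[of f "Cod ?X g", THEN reassoc] * by auto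
    show "Fa ?T (f, g) \<cdot>\<^bsub>?X\<^esub> PMult P (a, x) = PMult P (Cod A f, Cod ?X g) \<cdot>\<^bsub>?X\<^esub> Fa ?T (f, Fa ?T (f, g))"
      if *: "f \<in> Arr A" "g \<in> Arr ?X" "Dom A f = a" "Dom ?X g = x" for f g a x
    proof -
      have "Fa ?T (f, g) \<cdot>\<^bsub>?X\<^esub> PMult P (a, x) = Fa ?T (f, Idn ?X (Cod ?X g)) \<cdot>\<^bsub>?X\<^esub>
        (PMult P (a, Cod ?X g) \<cdot>\<^bsub>?X\<^esub> Fa ?T (Idn A a, Fa ?T (Idn A a, g)))"
        using split[OF *(1,2)] mn[of a g] * by auto
      also have "\<dots> = PMult P (Cod A f, Cod ?X g) \<cdot>\<^bsub>?X\<^esub>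
       (Fa ?T (Idn A (Cod A f), Fa ?T (f, Idn ?X (Cod ?X g))) \<cdot>\<^bsub>?X\<^esub>
         (Fa ?T (f, Idn ?X (Fo ?T (Dom A f, Cod ?X g))) \<cdot>\<^bsub>?X\<^esub> Fa ?T (Idn A a, Fa ?T (Idn A a, g))))"
        using ma[of f "Cod ?X g", THEN reassoc] * by auto
      also have "Fa ?T (Idn A (Cod A f), Fa ?T (f, Idn ?X (Cod ?X g))) \<cdot>\<^bsub>?X\<^esub>
         (Fa ?T (f, Idn ?X (Fo ?T (Dom A f, Cod ?X g))) \<cdot>\<^bsub>?X\<^esub> Fa ?T (Idn A a, Fa ?T (Idn A a, g))) =
         Fa ?T (f, Fa ?T (f, Idn ?X (Cod ?X g)) \<cdot>\<^bsub>?X\<^esub> Fa ?T (Idn A a, g))"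
        using functor_simps(6)[OF T, of "(Idn A a, Fa ?T (Idn A a, g))" "(f, Idn ?X (Fo ?T (Dom A f, Cod ?X g)))"]
          functor_simps(6)[OF T, of "(f, Fa ?T (Idn A a, g))" "(Idn A (Cod A f), Fa ?T (f, Idn ?X (Cod ?X g)))"] * by auto
      also have "\<dots> = Fa ?T (f, Fa ?T (f, g))" using split[OF *(1,2)] * by auto
      finally show ?thesis .
    qed
  qed (use M u m in \<open>auto simp: is_monad_def monad_at_def\<close>)
qed


section \<open>Adjunctions over the category of parameters\<close>

text \<open>An adjunction between \<open>A \<times> X\<close> and a category \<open>AE\<close> over \<open>A\<close> whose right adjoint is
  \<open>(AP, AU)\<close>. The left adjoint is given by universal arrows \<open>(id\<^sub>a, AN a x)\<close> into \<open>AS a x\<close>, so the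
  generated monad lies over the projection to \<open>A\<close>; \<open>AM\<close> is the corresponding parametrized monad.
  The two instances are \<open>p\<^sub>L + i\<close> for a pruned fibration and the free algebras of a parametrized
  monad.\<close>

record 'u padj =
  AE :: "'u ucat"
  AP :: "'u uftor"
  AU :: "'u uftor"
  AS :: "'u univ \<Rightarrow> 'u univ \<Rightarrow> 'u univ"
  AN :: "'u univ \<Rightarrow> 'u univ \<Rightarrow> 'u univ"
  AM :: "'u pmonad"

abbreviation AX :: "'u padj \<Rightarrow> 'u ucat" where "AX D \<equiv> Carr (AM D)"

text \<open>The transpose of the pair \<open>(f, g)\<close>, as an arrow from
  \<open>AS D a x\<close> to \<open>e\<close>.\<close>

definition pext :: "'u padj \<Rightarrow> 'u univ \<Rightarrow> 'u univ \<Rightarrow> 'u univ \<Rightarrow> 'u univ \<Rightarrow> 'u univ \<Rightarrow> 'u univ" where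
  "pext D a x e f g = (THE h. arr (AE D) h (AS D a x) e \<and> Fa (AP D) h = f \<and>
     Fa (AU D) h \<cdot>\<^bsub>AX D\<^esub> AN D a x = g)"

text \<open>The left adjoint on arrows; for a pruned fibration it is
  \<open>p\<^sub>L f + g\<close>.\<close>

definition psum :: "'u ucat \<Rightarrow> 'u padj \<Rightarrow> 'u univ \<Rightarrow> 'u univ \<Rightarrow> 'u univ" where
  "psum A D f g = pext D (Dom A f) (Dom (AX D) g) (AS D (Cod A f) (Cod (AX D) g)) f
     (AN D (Cod A f) (Cod (AX D) g) \<cdot>\<^bsub>AX D\<^esub> g)"

definition pcounit :: "'u ucat \<Rightarrow> 'u padj \<Rightarrow> 'u univ \<Rightarrow> 'u univ" where
  "pcounit A D e = pext D (Fo (AP D) e) (Fo (AU D) e) e (Idn A (Fo (AP D) e)) (Idn (AX D) (Fo (AU D) e))"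

text \<open>The left adjoint is specified by universal arrows alone; its action on arrows, the
  counit and the triangle identities are derived from unique transposition.\<close>

locale par_adj_core =
  fixes A :: "'u ucat" and D :: "'u padj"
  assumes A [simp]: "category A" and E [simp]: "category (AE D)" and X [simp]: "category (AX D)"
    and p: "is_functor (AE D) A (AP D)" and U: "is_functor (AE D) (AX D) (AU D)"
    and S [simp]: "\<lbrakk>a \<in> Obj A; x \<in> Obj (AX D)\<rbrakk> \<Longrightarrow> AS D a x \<in> Obj (AE D)"
      "\<lbrakk>a \<in> Obj A; x \<in> Obj (AX D)\<rbrakk> \<Longrightarrow> Fo (AP D) (AS D a x) = a"
    and N [simp]: "\<lbrakk>a \<in> Obj A; x \<in> Obj (AX D)\<rbrakk> \<Longrightarrow> arr (AX D) (AN D a x) x (Fo (AU D) (AS D a x))"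
    and univ: "\<lbrakk>a \<in> Obj A; x \<in> Obj (AX D); e \<in> Obj (AE D); arr A f a (Fo (AP D) e); arr (AX D) g x (Fo (AU D) e)\<rbrakk>
      \<Longrightarrow> \<exists>!h. arr (AE D) h (AS D a x) e \<and> Fa (AP D) h = f \<and> Fa (AU D) h \<cdot>\<^bsub>AX D\<^esub> AN D a x = g"
begin

lemmas [simp] = functor_simps[OF p] functor_simps[OF U]

lemma pext:
  assumes "a \<in> Obj A" "x \<in> Obj (AX D)" "e \<in> Obj (AE D)" "f \<in> Arr A" "Dom A f = a" "Cod A f = Fo (AP D) e"
    "g \<in> Arr (AX D)" "Dom (AX D) g = x" "Cod (AX D) g = Fo (AU D) e"
  shows "pext D a x e f g \<in> Arr (AE D)" "Dom (AE D) (pext D a x e f g) = AS D a x"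
    "Cod (AE D) (pext D a x e f g) = e" "Fa (AP D) (pext D a x e f g) = f"
    "Fa (AU D) (pext D a x e f g) \<cdot>\<^bsub>AX D\<^esub> AN D a x = g"
  using theI'[OF univ[OF assms(1-3), of f g]] assms unfolding pext_def by auto

lemma pext' [simp]:
  assumes "a \<in> Obj A" "x \<in> Obj (AX D)" "e \<in> Obj (AE D)" "f \<in> Arr A" "Dom A f = a" "Cod A f = Fo (AP D) e"
    "g \<in> Arr (AX D)" "Dom (AX D) g = x" "Cod (AX D) g = Fo (AU D) e" "r \<in> Arr (AX D)" "Cod (AX D) r = x"
  shows "Fa (AU D) (pext D a x e f g) \<cdot>\<^bsub>AX D\<^esub> (AN D a x \<cdot>\<^bsub>AX D\<^esub> r) = g \<cdot>\<^bsub>AX D\<^esub> r"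
  using pext[OF assms(1-9)] pext(5)[OF assms(1-9), THEN reassoc, of r] assms by simp

declare pext [simp]

text \<open>Arrows out of \<open>AS D a x\<close> are compared on the generator
  \<open>AN D a x\<close>. The diagrams about left adjoints, counits and mates below are verified by
  this principle.\<close>

lemma pext_eqI:
  assumes "h \<in> Arr (AE D)" "h' \<in> Arr (AE D)" "a \<in> Obj A" "x \<in> Obj (AX D)" "Dom (AE D) h = AS D a x"
    "Dom (AE D) h' = AS D a x" "Cod (AE D) h = Cod (AE D) h'" "Fa (AP D) h = Fa (AP D) h'"
    "Fa (AU D) h \<cdot>\<^bsub>AX D\<^esub> AN D a x = Fa (AU D) h' \<cdot>\<^bsub>AX D\<^esub> AN D a x"
  shows "h = h'"
proof -
  have 1: "arr A (Fa (AP D) h) a (Fo (AP D) (Cod (AE D) h))" using assms by simp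
  have 2: "arr (AX D) (Fa (AU D) h \<cdot>\<^bsub>AX D\<^esub> AN D a x) x (Fo (AU D) (Cod (AE D) h))" using assms(1-7) by simp
  show ?thesis using univ[OF assms(3,4) _ 1 2] assms by (metis (no_types) cat_simps(2) E)
qed

lemma psum [simp]:
  assumes "f \<in> Arr A" "g \<in> Arr (AX D)"
  shows "psum A D f g \<in> Arr (AE D)" "Dom (AE D) (psum A D f g) = AS D (Dom A f) (Dom (AX D) g)"
    "Cod (AE D) (psum A D f g) = AS D (Cod A f) (Cod (AX D) g)" "Fa (AP D) (psum A D f g) = f"
    "\<lbrakk>a = Dom A f; x = Dom (AX D) g\<rbrakk> \<Longrightarrow>
       Fa (AU D) (psum A D f g) \<cdot>\<^bsub>AX D\<^esub> AN D a x = AN D (Cod A f) (Cod (AX D) g) \<cdot>\<^bsub>AX D\<^esub> g"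
    "\<lbrakk>a = Dom A f; x = Dom (AX D) g; r \<in> Arr (AX D); Cod (AX D) r = x\<rbrakk> \<Longrightarrow>
       Fa (AU D) (psum A D f g) \<cdot>\<^bsub>AX D\<^esub> (AN D a x \<cdot>\<^bsub>AX D\<^esub> r) = AN D (Cod A f) (Cod (AX D) g) \<cdot>\<^bsub>AX D\<^esub> (g \<cdot>\<^bsub>AX D\<^esub> r)"
  using assms by (simp_all add: psum_def)

lemma pcounit [simp]:
  assumes "e \<in> Obj (AE D)"
  shows "pcounit A D e \<in> Arr (AE D)" "Dom (AE D) (pcounit A D e) = AS D (Fo (AP D) e) (Fo (AU D) e)"
    "Cod (AE D) (pcounit A D e) = e" "Fa (AP D) (pcounit A D e) = Idn A (Fo (AP D) e)"
    "\<lbrakk>a = Fo (AP D) e; x = Fo (AU D) e\<rbrakk> \<Longrightarrow> Fa (AU D) (pcounit A D e) \<cdot>\<^bsub>AX D\<^esub> AN D a x = Idn (AX D) x"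
    "\<lbrakk>a = Fo (AP D) e; x = Fo (AU D) e; r \<in> Arr (AX D); Cod (AX D) r = x\<rbrakk> \<Longrightarrow>
       Fa (AU D) (pcounit A D e) \<cdot>\<^bsub>AX D\<^esub> (AN D a x \<cdot>\<^bsub>AX D\<^esub> r) = r"
  using assms by (simp_all add: pcounit_def)

lemma psum_comp:
  assumes "f \<in> Arr A" "g \<in> Arr (AX D)" "f' \<in> Arr A" "g' \<in> Arr (AX D)" "Cod A f = Dom A f'" "Cod (AX D) g = Dom (AX D) g'"
  shows "psum A D (f' \<cdot>\<^bsub>A\<^esub> f) (g' \<cdot>\<^bsub>AX D\<^esub> g) = psum A D f' g' \<cdot>\<^bsub>AE D\<^esub> psum A D f g"
  by (rule pext_eqI[of _ _ "Dom A f" "Dom (AX D) g"]) (use assms in auto)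

lemma psum_id:
  assumes "a \<in> Obj A" "x \<in> Obj (AX D)"
  shows "psum A D (Idn A a) (Idn (AX D) x) = Idn (AE D) (AS D a x)"
  by (rule pext_eqI[of _ _ a x]) (use assms in auto)

lemma pcounit_nat:
  assumes "v \<in> Arr (AE D)"
  shows "pcounit A D (Cod (AE D) v) \<cdot>\<^bsub>AE D\<^esub> psum A D (Fa (AP D) v) (Fa (AU D) v) = v \<cdot>\<^bsub>AE D\<^esub> pcounit A D (Dom (AE D) v)"
  by (rule pext_eqI[of _ _ "Fo (AP D) (Dom (AE D) v)" "Fo (AU D) (Dom (AE D) v)"]) (use assms in auto)

text \<open>The \<open>U\<close>-image of naturality of the counit, oriented as a rewrite rule.
  Associativity of the multiplication and the algebra laws of the comparison are instances of
  it.\<close>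

lemma U_pcounit_psum:
  assumes "v \<in> Arr (AE D)" "e = Cod (AE D) v" "f = Fa (AP D) v"
  shows "Fa (AU D) (pcounit A D e) \<cdot>\<^bsub>AX D\<^esub> Fa (AU D) (psum A D f (Fa (AU D) v)) =
    Fa (AU D) v \<cdot>\<^bsub>AX D\<^esub> Fa (AU D) (pcounit A D (Dom (AE D) v))"
  using arg_cong[OF pcounit_nat[OF assms(1)], of "Fa (AU D)"] assms by simp

lemma adjunction:
  "adjunction (A \<times>\<^sub>C AX D) (AE D)
     \<lparr>Fo = (\<lambda>(a, x)\<in>Obj (A \<times>\<^sub>C AX D). AS D a x), Fa = (\<lambda>(f, g)\<in>Arr (A \<times>\<^sub>C AX D). psum A D f g)\<rparr>
     (ftor_pair (AE D) (AP D) (AU D))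
     (\<lambda>(a, x)\<in>Obj (A \<times>\<^sub>C AX D). (Idn A a, AN D a x)) (\<lambda>e\<in>Obj (AE D). pcounit A D e)"
  (is "adjunction ?B _ ?L ?R ?\<eta> ?\<epsilon>")
proof -
  have L: "is_functor ?B (AE D) ?L"
  proof (rule functorI)
    fix k l assume "k \<in> Arr ?B" "l \<in> Arr ?B" "Cod ?B k = Dom ?B l"
    then show "Fa ?L (l \<cdot>\<^bsub>?B\<^esub> k) = Fa ?L l \<cdot>\<^bsub>AE D\<^esub> Fa ?L k"
      by (cases k; cases l) (auto simp: psum_comp)
  qed (auto simp: psum_id)
  have R: "is_functor (AE D) ?B ?R"
    by (rule functorI) (auto simp: ftor_pair_def)
  show ?thesis
    unfolding adjunction_def
  proof (intro conjI ballI)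
    show "nat_trans ?B ?B (ftor_id ?B) (ftor_comp ?B ?R ?L) ?\<eta>"
      by (rule nat_transI) (use is_functor_comp[OF _ L R] in \<open>auto simp: ftor_pair_def\<close>)
    show "nat_trans (AE D) (AE D) (ftor_comp (AE D) ?L ?R) (ftor_id (AE D)) ?\<epsilon>"
      by (rule nat_transI) (use is_functor_comp[OF _ R L] in \<open>auto simp: ftor_pair_def pcounit_nat\<close>)
    fix c assume "c \<in> Obj ?B"
    then obtain a x where c: "c = (a, x)" "a \<in> Obj A" "x \<in> Obj (AX D)" by auto
    have "pcounit A D (AS D a x) \<cdot>\<^bsub>AE D\<^esub> psum A D (Idn A a) (AN D a x) = Idn (AE D) (AS D a x)"
      by (rule pext_eqI[of _ _ a x]) (use c in auto)
    then show "?\<epsilon> (Fo ?L c) \<cdot>\<^bsub>AE D\<^esub> Fa ?L (?\<eta> c) = Idn (AE D) (Fo ?L c)" using c by simp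
  qed (use L R in \<open>auto simp: ftor_pair_def\<close>)
qed

end

text \<open>States that \<open>AM D\<close> is the monad generated by the adjunction. The monad laws
  are added only in \<open>par_adj\<close>: for \<open>T\<^sup>p\<close> they are derived from these
  equations, for an Eilenberg--Moore adjunction they are given beforehand.\<close>

locale par_adj_data = par_adj_core A D for A D +
  assumes M_Fo: "\<lbrakk>a \<in> Obj A; x \<in> Obj (AX D)\<rbrakk> \<Longrightarrow> Fo (PFun (AM D)) (a, x) = Fo (AU D) (AS D a x)"
    and M_Fa: "\<lbrakk>f \<in> Arr A; g \<in> Arr (AX D)\<rbrakk> \<Longrightarrow> Fa (PFun (AM D)) (f, g) = Fa (AU D) (psum A D f g)"
    and M_unit: "\<lbrakk>a \<in> Obj A; x \<in> Obj (AX D)\<rbrakk> \<Longrightarrow> PUnit (AM D) (a, x) = AN D a x"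
    and M_mult: "\<lbrakk>a \<in> Obj A; x \<in> Obj (AX D)\<rbrakk> \<Longrightarrow> PMult (AM D) (a, x) = Fa (AU D) (pcounit A D (AS D a x))"
begin

lemma param_monad_axioms:
  assumes ext: "Fo (PFun (AM D)) \<in> extensional (Obj (A \<times>\<^sub>C AX D))" "Fa (PFun (AM D)) \<in> extensional (Arr (A \<times>\<^sub>C AX D))"
  shows "param_monad_axioms A (AM D)"
proof
  show "is_functor (A \<times>\<^sub>C AX D) (AX D) (PFun (AM D))"
  proof (rule functorI)
    fix k l assume "k \<in> Arr (A \<times>\<^sub>C AX D)" "l \<in> Arr (A \<times>\<^sub>C AX D)" "Cod (A \<times>\<^sub>C AX D) k = Dom (A \<times>\<^sub>C AX D) l"
    then show "Fa (PFun (AM D)) (l \<cdot>\<^bsub>A \<times>\<^sub>C AX D\<^esub> k) = Fa (PFun (AM D)) l \<cdot>\<^bsub>AX D\<^esub> Fa (PFun (AM D)) k"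
      by (cases k; cases l) (auto simp: M_Fa psum_comp)
  qed (use ext in \<open>auto simp: M_Fo M_Fa psum_id\<close>)
next
  fix a x assume *: "a \<in> Obj A" "x \<in> Obj (AX D)"
  show "PMult (AM D) (a, x) \<cdot>\<^bsub>AX D\<^esub> Fa (PFun (AM D)) (Idn A a, PUnit (AM D) (a, x)) = Idn (AX D) (Fo (PFun (AM D)) (a, x))"
  proof -
    have "pcounit A D (AS D a x) \<cdot>\<^bsub>AE D\<^esub> psum A D (Idn A a) (AN D a x) = Idn (AE D) (AS D a x)"
      by (rule pext_eqI[of _ _ a x]) (use * in auto)
    from arg_cong[OF this, of "Fa (AU D)"] show ?thesis
      using * by (simp add: M_Fo M_Fa M_unit M_mult)
  qed
  show "PMult (AM D) (a, x) \<cdot>\<^bsub>AX D\<^esub> Fa (PFun (AM D)) (Idn A a, PMult (AM D) (a, x)) =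
     PMult (AM D) (a, x) \<cdot>\<^bsub>AX D\<^esub> PMult (AM D) (a, Fo (PFun (AM D)) (a, x))"
    using * by (simp add: M_Fo M_Fa M_unit M_mult U_pcounit_psum)
next
  fix f g a x assume *: "f \<in> Arr A" "g \<in> Arr (AX D)" "Dom A f = a" "Dom (AX D) g = x"
  show "Fa (PFun (AM D)) (f, g) \<cdot>\<^bsub>AX D\<^esub> PMult (AM D) (a, x) =
    PMult (AM D) (Cod A f, Cod (AX D) g) \<cdot>\<^bsub>AX D\<^esub> Fa (PFun (AM D)) (f, Fa (PFun (AM D)) (f, g))"
    using * by (auto simp: M_Fo M_Fa M_unit M_mult U_pcounit_psum)
qed (auto simp: M_Fo M_Fa M_unit M_mult)

end

text \<open>The comparison functor written directly with values in triples. An algebra of the monad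
  on the product also has a component in \<open>A\<close>; here it would be an identity, because the
  counit lies over identities.\<close>

definition pcompar :: "'u ucat \<Rightarrow> 'u padj \<Rightarrow> 'u uftor" where
  "pcompar A D = (let ob = (\<lambda>e. utriple (Fo (AP D) e) (Fo (AU D) e) (Fa (AU D) (pcounit A D e))) in
     \<lparr>Fo = (\<lambda>e\<in>Obj (AE D). ob e),
      Fa = (\<lambda>v\<in>Arr (AE D). uarrow (ob (Dom (AE D) v)) (ob (Cod (AE D) v)) (Fa (AP D) v) (Fa (AU D) v))\<rparr>)"

locale par_adj = par_adj_data A D + M: param_monad_axioms A "AM D" for A D
begin

lemma pcompar_simps [simp]:
  "e \<in> Obj (AE D) \<Longrightarrow> Fo (pcompar A D) e = utriple (Fo (AP D) e) (Fo (AU D) e) (Fa (AU D) (pcounit A D e))"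
  "v \<in> Arr (AE D) \<Longrightarrow> Fa (pcompar A D) v =
     uarrow (Fo (pcompar A D) (Dom (AE D) v)) (Fo (pcompar A D) (Cod (AE D) v)) (Fa (AP D) v) (Fa (AU D) v)"
  by (auto simp: pcompar_def Let_def)

lemma pcompar_Obj:
  assumes "e \<in> Obj (AE D)"
  shows "utriple (Fo (AP D) e) (Fo (AU D) e) (Fa (AU D) (pcounit A D e)) \<in> Obj (emf_cat A (AM D))"
  using assms by (simp add: M_Fo M_Fa M_unit M_mult U_pcounit_psum)

lemma pcompar_Arr:
  assumes "v \<in> Arr (AE D)"
  shows "Fa (pcompar A D) v \<in> Arr (emf_cat A (AM D))"
  using assms pcompar_Obj[of "Dom (AE D) v"] pcompar_Obj[of "Cod (AE D) v"]
  by (simp del: emf_ObjI add: M_Fo M_Fa M_unit M_mult U_pcounit_psum)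

lemma pcompar_functor: "is_functor (AE D) (emf_cat A (AM D)) (pcompar A D)"
proof (rule functorI)
  fix v assume v: "v \<in> Arr (AE D)"
  then show "arr (emf_cat A (AM D)) (Fa (pcompar A D) v)
     (Fo (pcompar A D) (Dom (AE D) v)) (Fo (pcompar A D) (Cod (AE D) v))"
    using pcompar_Arr[OF v] by (simp del: emf_ArrI)
next
  show "e \<in> Obj (AE D) \<Longrightarrow> Fo (pcompar A D) e \<in> Obj (emf_cat A (AM D))" for e
    using pcompar_Obj[of e] by (simp del: emf_ObjI)
qed (auto simp: pcompar_def Let_def)

lemma pcompar_proj: "ftor_comp (AE D) (emf_proj A (AM D)) (pcompar A D) = AP D"
proof (rule ftor_eqI[of _ "Obj (AE D)" _ "Arr (AE D)"])
  fix v assume v: "v \<in> Arr (AE D)"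
  show "Fa (ftor_comp (AE D) (emf_proj A (AM D)) (pcompar A D)) v = Fa (AP D) v"
    using v pcompar_Arr[OF v] by (simp del: emf_ArrI)
next
  fix e assume e: "e \<in> Obj (AE D)"
  show "Fo (ftor_comp (AE D) (emf_proj A (AM D)) (pcompar A D)) e = Fo (AP D) e"
    using e pcompar_Obj[OF e] by (simp del: emf_ObjI)
qed (use functor_ext[OF p] in auto)

end

subsection \<open>The Eilenberg--Moore adjunction\<close>

text \<open>\<open>AM\<close> is set to \<open>P\<close> itself rather than to the generated monad,
  so that statements about mates into this adjunction speak literally about 1-cells into
  \<open>P\<close>.\<close>

definition emf_adj :: "'u ucat \<Rightarrow> 'u pmonad \<Rightarrow> 'u padj" where
  "emf_adj A P = \<lparr>AE = emf_cat A P, AP = emf_proj A P, AU = emf_car A P,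
     AS = (\<lambda>a x. utriple a (Fo (PFun P) (a, x)) (PMult P (a, x))), AN = (\<lambda>a x. PUnit P (a, x)), AM = P\<rparr>"

lemma emf_adj_simps [simp]:
  "AE (emf_adj A P) = emf_cat A P" "AP (emf_adj A P) = emf_proj A P" "AU (emf_adj A P) = emf_car A P"
  "AS (emf_adj A P) a x = utriple a (Fo (PFun P) (a, x)) (PMult P (a, x))"
  "AN (emf_adj A P) a x = PUnit P (a, x)" "AM (emf_adj A P) = P"
  by (auto simp: emf_adj_def)

context param_monad_axioms
begin

lemma emf_free:
  assumes "a \<in> Obj A" "x \<in> Obj (Carr P)"
  shows "utriple a (Fo (PFun P) (a, x)) (PMult P (a, x)) \<in> Obj (emf_cat A P)"
  using assms mult_assoc by simp

text \<open>The extension is the structure map after \<open>T (f, g)\<close>, and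
  \<open>algebra_monoD\<close> says that this is an algebra map from the free algebra.\<close>

lemma emf_free_ext:
  assumes s: "s \<in> Obj (emf_cat A P)" and f: "f \<in> Arr A" "Cod A f = par s"
   and g: "g \<in> Arr (Carr P)" "Cod (Carr P) g = car s"
  shows "uarrow (utriple (Dom A f) (Fo (PFun P) (Dom A f, Dom (Carr P) g)) (PMult P (Dom A f, Dom (Carr P) g))) s f
      (str s \<cdot>\<^bsub>Carr P\<^esub> Fa (PFun P) (f, g)) \<in> Arr (emf_cat A P)" (is "?h \<in> _")
    and "(str s \<cdot>\<^bsub>Carr P\<^esub> Fa (PFun P) (f, g)) \<cdot>\<^bsub>Carr P\<^esub> PUnit P (Dom A f, Dom (Carr P) g) = g"
proof -
  note [simp] = emf_ObjD(1-5)[OF s] f g s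
  show "?h \<in> Arr (emf_cat A P)"
    using algebra_monoD[OF s f(1) g(1) f(2) g(2)] emf_free[of "Dom A f" "Dom (Carr P) g"] by (simp del: emf_ObjI)
  show "(str s \<cdot>\<^bsub>Carr P\<^esub> Fa (PFun P) (f, g)) \<cdot>\<^bsub>Carr P\<^esub> PUnit P (Dom A f, Dom (Carr P) g) = g"
    using emf_ObjD(6)[OF s, THEN reassoc, of g] by simp
qed

text \<open>\<open>T\<close> of \<open>u\<close> after the unit splits into \<open>T u\<close> after
  \<open>T\<close> of the unit. The algebra-map law replaces the structure map after
  \<open>T u\<close> by \<open>u\<close> after the multiplication, and the multiplication cancels
  against \<open>T\<close> of the unit.\<close>

lemma emf_free_unique:
  assumes u: "u \<in> Arr (emf_cat A P)" and d: "uarr_dom u = utriple a (Fo (PFun P) (a, x)) (PMult P (a, x))"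
    "a \<in> Obj A" "x \<in> Obj (Carr P)"
  shows "uarr_snd u = str (uarr_cod u) \<cdot>\<^bsub>Carr P\<^esub> Fa (PFun P) (uarr_fst u, uarr_snd u \<cdot>\<^bsub>Carr P\<^esub> PUnit P (a, x))"
proof -
  note [simp] = emf_ArrD(1-8)[OF u] d emf_ObjD(1-5)[OF emf_ArrD(2)[OF u]]
  have *: "Fa (PFun P) (uarr_fst u, uarr_snd u \<cdot>\<^bsub>Carr P\<^esub> PUnit P (a, x)) =
      Fa (PFun P) (uarr_fst u, uarr_snd u) \<cdot>\<^bsub>Carr P\<^esub> Fa (PFun P) (Idn A a, PUnit P (a, x))"
    by simp
  show ?thesis unfolding *
    using emf_ArrD(9)[OF u, symmetric, THEN reassoc, of "Fa (PFun P) (Idn A a, PUnit P (a, x))"]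
    by (simp del: T_comp)
qed

lemma emf_adj_univ:
  assumes "a \<in> Obj A" "x \<in> Obj (Carr P)" "e \<in> Obj (emf_cat A P)" "arr A f a (Fo (emf_proj A P) e)"
     "arr (Carr P) g x (Fo (emf_car A P) e)"
  shows "\<exists>!h. arr (emf_cat A P) h (utriple a (Fo (PFun P) (a, x)) (PMult P (a, x))) e \<and>
    Fa (emf_proj A P) h = f \<and> Fa (emf_car A P) h \<cdot>\<^bsub>Carr P\<^esub> PUnit P (a, x) = g"
proof (rule ex1I)
  let ?h = "uarrow (utriple a (Fo (PFun P) (a, x)) (PMult P (a, x))) e f (str e \<cdot>\<^bsub>Carr P\<^esub> Fa (PFun P) (f, g))"
  have h: "?h \<in> Arr (emf_cat A P)" "(str e \<cdot>\<^bsub>Carr P\<^esub> Fa (PFun P) (f, g)) \<cdot>\<^bsub>Carr P\<^esub> PUnit P (a, x) = g"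
    using emf_free_ext[OF assms(3), of f g] assms by auto
  then show "arr (emf_cat A P) ?h (utriple a (Fo (PFun P) (a, x)) (PMult P (a, x))) e \<and>
    Fa (emf_proj A P) ?h = f \<and> Fa (emf_car A P) ?h \<cdot>\<^bsub>Carr P\<^esub> PUnit P (a, x) = g"
    by (simp del: emf_ArrI)
  fix u assume u: "arr (emf_cat A P) u (utriple a (Fo (PFun P) (a, x)) (PMult P (a, x))) e \<and>
    Fa (emf_proj A P) u = f \<and> Fa (emf_car A P) u \<cdot>\<^bsub>Carr P\<^esub> PUnit P (a, x) = g"
  then have u': "u \<in> Arr (emf_cat A P)" "uarr_dom u = utriple a (Fo (PFun P) (a, x)) (PMult P (a, x))"
    "uarr_cod u = e" "uarr_fst u = f" "uarr_snd u \<cdot>\<^bsub>Carr P\<^esub> PUnit P (a, x) = g" by auto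
  show "u = ?h"
    by (rule emf_eqI[OF u'(1) h(1)]) (use u' emf_free_unique[OF u'(1,2) assms(1,2)] in auto)
qed

lemma emf_adj_pext:
  assumes "a \<in> Obj A" "x \<in> Obj (Carr P)" "e \<in> Obj (emf_cat A P)" "arr A f a (par e)" "arr (Carr P) g x (car e)"
  shows "pext (emf_adj A P) a x e f g =
     uarrow (utriple a (Fo (PFun P) (a, x)) (PMult P (a, x))) e f (str e \<cdot>\<^bsub>Carr P\<^esub> Fa (PFun P) (f, g))" (is "_ = ?h")
proof -
  have h: "?h \<in> Arr (emf_cat A P)" "(str e \<cdot>\<^bsub>Carr P\<^esub> Fa (PFun P) (f, g)) \<cdot>\<^bsub>Carr P\<^esub> PUnit P (a, x) = g"
    using emf_free_ext[OF assms(3), of f g] assms by auto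
  have "\<exists>!h. arr (emf_cat A P) h (utriple a (Fo (PFun P) (a, x)) (PMult P (a, x))) e \<and>
    Fa (emf_proj A P) h = f \<and> Fa (emf_car A P) h \<cdot>\<^bsub>Carr P\<^esub> PUnit P (a, x) = g"
    by (rule emf_adj_univ) (use assms in auto)
  then show ?thesis unfolding pext_def emf_adj_simps
    by (rule the1_equality) (use h in \<open>simp del: emf_ArrI\<close>)
qed

lemma emf_adj_pcounit:
  assumes "s \<in> Obj (emf_cat A P)"
  shows "pcounit A (emf_adj A P) s =
    uarrow (utriple (par s) (Fo (PFun P) (par s, car s)) (PMult P (par s, car s))) s (Idn A (par s)) (str s)"
  using emf_adj_pext[of "par s" "car s" s "Idn A (par s)" "Idn (Carr P) (car s)"] emf_ObjD[OF assms] assms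
  by (simp add: pcounit_def)

lemma par_adj_emf: "par_adj A (emf_adj A P)"
proof (intro par_adj.intro par_adj_data.intro par_adj_data_axioms.intro par_adj_core.intro)
  fix f g assume fg: "f \<in> Arr A" "g \<in> Arr (AX (emf_adj A P))"
  let ?s = "utriple (Cod A f) (Fo (PFun P) (Cod A f, Cod (Carr P) g)) (PMult P (Cod A f, Cod (Carr P) g))"
  have s: "?s \<in> Obj (emf_cat A P)" using fg by (intro emf_free) auto
  have e: "psum A (emf_adj A P) f g = uarrow (utriple (Dom A f) (Fo (PFun P) (Dom A f, Dom (Carr P) g))
     (PMult P (Dom A f, Dom (Carr P) g))) ?s f (str ?s \<cdot>\<^bsub>Carr P\<^esub> Fa (PFun P) (f, PUnit P (Cod A f, Cod (Carr P) g) \<cdot>\<^bsub>Carr P\<^esub> g))"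
    unfolding psum_def emf_adj_simps
    by (rule emf_adj_pext) (use fg s in \<open>auto simp del: emf_ObjI\<close>)
  have "psum A (emf_adj A P) f g \<in> Arr (emf_cat A P)" unfolding e
    using emf_free_ext(1)[OF s, of f "PUnit P (Cod A f, Cod (Carr P) g) \<cdot>\<^bsub>Carr P\<^esub> g"] fg by (simp del: emf_ArrI)
  then have "Fa (emf_car A P) (psum A (emf_adj A P) f g) = uarr_snd (psum A (emf_adj A P) f g)" by simp
  \<comment> \<open>The structure map of the free algebra is the multiplication; it is brought next
    to \<open>T\<close> of the unit, with which it cancels.\<close>
  also have "\<dots> = PMult P (Cod A f, Cod (Carr P) g) \<cdot>\<^bsub>Carr P\<^esub>
      (Fa (PFun P) (Idn A (Cod A f), PUnit P (Cod A f, Cod (Carr P) g)) \<cdot>\<^bsub>Carr P\<^esub> Fa (PFun P) (f, g))"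
    unfolding e using fg by (simp del: unit_right)
  also have "\<dots> = Fa (PFun P) (f, g)" using fg by (simp del: T_comp)
  finally show "Fa (PFun (AM (emf_adj A P))) (f, g) = Fa (AU (emf_adj A P)) (psum A (emf_adj A P) f g)" by simp
next
  fix a x assume *: "a \<in> Obj A" "x \<in> Obj (AX (emf_adj A P))"
  let ?s = "utriple a (Fo (PFun P) (a, x)) (PMult P (a, x))"
  have s: "?s \<in> Obj (emf_cat A P)" using * by (intro emf_free) auto
  have "pcounit A (emf_adj A P) ?s \<in> Arr (emf_cat A P)"
    using emf_free_ext(1)[OF s, of "Idn A a" "Idn (Carr P) (Fo (PFun P) (a, x))"] * 
    by (simp del: emf_ArrI add: emf_adj_pcounit[OF s])
  then show "PMult (AM (emf_adj A P)) (a, x) = Fa (AU (emf_adj A P)) (pcounit A (emf_adj A P) (AS (emf_adj A P) a x))"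
    using s emf_adj_pcounit[OF s] by (simp del: emf_ArrI)
qed (use emf_proj_functor emf_car_functor emf_adj_univ emf_free param_monad_axioms_axioms in \<open>auto simp del: emf_ObjI\<close>)

text \<open>The counit at an algebra is its own structure map. Consequently
  \<open>mate_comparison\<close> with an Eilenberg--Moore fibration as target ends at
  \<open>Fo F e\<close> itself.\<close>

lemma emf_adj_pcompar: "pcompar A (emf_adj A P) = ftor_id (emf_cat A P)"
proof -
  interpret par_adj A "emf_adj A P" by (rule par_adj_emf)
  have o: "Fo (pcompar A (emf_adj A P)) s = s" if "s \<in> Obj (emf_cat A P)" for s
    using that pcounit(1)[of s] emf_ObjD(8)[OF that] by (simp del: emf_ArrI add: emf_adj_pcounit)
  show ?thesis
  proof (rule ftor_eqI[of _ "Obj (emf_cat A P)" _ "Arr (emf_cat A P)"])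
    fix u assume u: "u \<in> Arr (emf_cat A P)"
    show "Fa (pcompar A (emf_adj A P)) u = Fa (ftor_id (emf_cat A P)) u"
      using u o emf_ArrD[OF u] by (simp del: pcompar_simps(1))
  qed (use o functor_ext[OF pcompar_functor] in auto)
qed

end


section \<open>Morphisms of pruned monads\<close>

locale pm2 = P: param_monad_axioms A P + Q: param_monad_axioms A Q for A P Q
begin

lemma pm_1cell_iff:
  "pm_1cell A P Q (V, \<delta>) \<longleftrightarrow> is_functor (Carr P) (Carr Q) V \<and> \<delta> \<in> extensional (Obj (A \<times>\<^sub>C Carr P)) \<and>
    (\<forall>a\<in>Obj A. \<forall>x\<in>Obj (Carr P). arr (Carr Q) (\<delta> (a, x)) (Fo (PFun Q) (a, Fo V x)) (Fo V (Fo (PFun P) (a, x)))) \<and>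
    (\<forall>f\<in>Arr A. \<forall>g\<in>Arr (Carr P). \<delta> (Cod A f, Cod (Carr P) g) \<cdot>\<^bsub>Carr Q\<^esub> Fa (PFun Q) (f, Fa V g) =
       Fa V (Fa (PFun P) (f, g)) \<cdot>\<^bsub>Carr Q\<^esub> \<delta> (Dom A f, Dom (Carr P) g)) \<and>
    (\<forall>a\<in>Obj A. \<forall>x\<in>Obj (Carr P). \<delta> (a, x) \<cdot>\<^bsub>Carr Q\<^esub> PUnit Q (a, Fo V x) = Fa V (PUnit P (a, x)) \<and>
        \<delta> (a, x) \<cdot>\<^bsub>Carr Q\<^esub> PMult Q (a, Fo V x) =
          Fa V (PMult P (a, x)) \<cdot>\<^bsub>Carr Q\<^esub> \<delta> (a, Fo (PFun P) (a, x)) \<cdot>\<^bsub>Carr Q\<^esub> Fa (PFun Q) (Idn A a, \<delta> (a, x)))"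
proof (cases "is_functor (Carr P) (Carr Q) V")
  case True
  note [simp] = functor_simps[OF True]
  have L: "is_functor (A \<times>\<^sub>C Carr P) (A \<times>\<^sub>C Carr Q) (param_lift A (Carr P) V)"
    by (rule functorI) (auto simp: param_lift_def)
  have "is_functor (A \<times>\<^sub>C Carr P) (Carr Q) (ftor_comp (A \<times>\<^sub>C Carr P) (PFun Q) (param_lift A (Carr P) V))"
    using is_functor_comp[OF _ L Q.T] by simp
  moreover have "is_functor (A \<times>\<^sub>C Carr P) (Carr Q) (ftor_comp (A \<times>\<^sub>C Carr P) V (PFun P))"
    using is_functor_comp[OF _ P.T True] by simp
  ultimately show ?thesis
    unfolding pm_1cell_def Let_def nat_trans_def prod.case using True
    by (simp add: param_lift_def)
qed (simp add: pm_1cell_def Let_def)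

end

locale pm1 = pm2 A P Q for A P Q +
  fixes V \<delta>
  assumes cell: "pm_1cell A P Q (V, \<delta>)"
begin

lemmas cellD = cell[unfolded pm_1cell_iff]

lemma V: "is_functor (Carr P) (Carr Q) V" using cellD by blast

lemmas [simp] = functor_simps[OF V]

lemma \<delta> [simp]:
  "\<lbrakk>a \<in> Obj A; x \<in> Obj (Carr P)\<rbrakk> \<Longrightarrow> \<delta> (a, x) \<in> Arr (Carr Q)"
  "\<lbrakk>a \<in> Obj A; x \<in> Obj (Carr P)\<rbrakk> \<Longrightarrow> Dom (Carr Q) (\<delta> (a, x)) = Fo (PFun Q) (a, Fo V x)"
  "\<lbrakk>a \<in> Obj A; x \<in> Obj (Carr P)\<rbrakk> \<Longrightarrow> Cod (Carr Q) (\<delta> (a, x)) = Fo V (Fo (PFun P) (a, x))"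
  using cellD by blast+

lemma \<delta>_ext: "\<delta> \<in> extensional (Obj (A \<times>\<^sub>C Carr P))" using cellD by blast

lemma \<delta>_nat:
  assumes "f \<in> Arr A" "g \<in> Arr (Carr P)" "Dom A f = a" "Dom (Carr P) g = x"
  shows "Fa V (Fa (PFun P) (f, g)) \<cdot>\<^bsub>Carr Q\<^esub> \<delta> (a, x) =
    \<delta> (Cod A f, Cod (Carr P) g) \<cdot>\<^bsub>Carr Q\<^esub> Fa (PFun Q) (f, Fa V g)"
  using cellD assms by fastforce

lemma \<delta>_unit [simp]: "\<lbrakk>a \<in> Obj A; x \<in> Obj (Carr P)\<rbrakk> \<Longrightarrow> \<delta> (a, x) \<cdot>\<^bsub>Carr Q\<^esub> PUnit Q (a, Fo V x) = Fa V (PUnit P (a, x))"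
  using cellD by blast

lemma \<delta>_mult: "\<lbrakk>a \<in> Obj A; x \<in> Obj (Carr P)\<rbrakk> \<Longrightarrow> \<delta> (a, x) \<cdot>\<^bsub>Carr Q\<^esub> PMult Q (a, Fo V x) =
   Fa V (PMult P (a, x)) \<cdot>\<^bsub>Carr Q\<^esub> (\<delta> (a, Fo (PFun P) (a, x)) \<cdot>\<^bsub>Carr Q\<^esub> Fa (PFun Q) (Idn A a, \<delta> (a, x)))"
  using cellD by simp

lemma emf_1cell_Fo [simp]:
  assumes "s \<in> Obj (emf_cat A P)"
  shows "Fo (emf_1cell A P Q (V, \<delta>)) s =
    utriple (par s) (Fo V (car s)) (Fa V (str s) \<cdot>\<^bsub>Carr Q\<^esub> \<delta> (par s, car s))"
proof -
  obtain a x \<xi> where "s = utriple a x \<xi>" using emf_ObjD(8)[OF assms] by metis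
  with assms show ?thesis by (simp add: emf_1cell_def Let_def del: emf_ObjI)
qed

lemma emf_1cell_Fa [simp]:
  assumes u: "u \<in> Arr (emf_cat A P)"
  shows "Fa (emf_1cell A P Q (V, \<delta>)) u = uarrow (Fo (emf_1cell A P Q (V, \<delta>)) (uarr_dom u))
    (Fo (emf_1cell A P Q (V, \<delta>)) (uarr_cod u)) (uarr_fst u) (Fa V (uarr_snd u))"
proof -
  obtain a x \<xi> b y \<theta> where "uarr_dom u = utriple a x \<xi>" "uarr_cod u = utriple b y \<theta>"
    using emf_ObjD(8)[OF emf_ArrD(1)[OF u]] emf_ObjD(8)[OF emf_ArrD(2)[OF u]] by metis
  with u emf_ArrD(1,2)[OF u] show ?thesis
    by (simp add: emf_1cell_def Let_def del: emf_ObjI emf_ArrI emf_1cell_Fo)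
qed

lemma emf_1cell_Obj:
  assumes s: "s \<in> Obj (emf_cat A P)"
  shows "utriple (par s) (Fo V (car s)) (Fa V (str s) \<cdot>\<^bsub>Carr Q\<^esub> \<delta> (par s, car s)) \<in> Obj (emf_cat A Q)"
proof -
  note [simp] = emf_ObjD(1-5)[OF s]
  let ?\<xi> = "Fa V (str s) \<cdot>\<^bsub>Carr Q\<^esub> \<delta> (par s, car s)"
  have "?\<xi> \<cdot>\<^bsub>Carr Q\<^esub> PUnit Q (par s, Fo V (car s)) = Idn (Carr Q) (Fo V (car s))"
    using arg_cong[OF emf_ObjD(6)[OF s], of "Fa V"] by simp
  moreover have "?\<xi> \<cdot>\<^bsub>Carr Q\<^esub> Fa (PFun Q) (Idn A (par s), ?\<xi>) = ?\<xi> \<cdot>\<^bsub>Carr Q\<^esub> PMult Q (par s, Fo V (car s))"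
  proof -
    have "Fa (PFun Q) (Idn A (par s), ?\<xi>) = Fa (PFun Q) (Idn A (par s), Fa V (str s)) \<cdot>\<^bsub>Carr Q\<^esub>
       Fa (PFun Q) (Idn A (par s), \<delta> (par s, car s))" by simp
    \<comment> \<open>\<open>T\<close> of \<delta> is separated from \<open>T\<close> of
      \<open>Fa V (str s)\<close>, so that naturality can exchange the latter with \<delta>;
      associativity of the algebra \<open>s\<close> and the multiplication law of \<delta> then
      finish.\<close>
    then have "?\<xi> \<cdot>\<^bsub>Carr Q\<^esub> Fa (PFun Q) (Idn A (par s), ?\<xi>) =
       Fa V (str s) \<cdot>\<^bsub>Carr Q\<^esub> ((Fa V (Fa (PFun P) (Idn A (par s), str s)) \<cdot>\<^bsub>Carr Q\<^esub>
         \<delta> (par s, Fo (PFun P) (par s, car s))) \<cdot>\<^bsub>Carr Q\<^esub> Fa (PFun Q) (Idn A (par s), \<delta> (par s, car s)))"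
      by (simp del: Q.T_comp cat_assoc add: \<delta>_nat cat_assoc[OF Q.X])
    also have "\<dots> = Fa V (str s \<cdot>\<^bsub>Carr P\<^esub> PMult P (par s, car s)) \<cdot>\<^bsub>Carr Q\<^esub>
         (\<delta> (par s, Fo (PFun P) (par s, car s)) \<cdot>\<^bsub>Carr Q\<^esub> Fa (PFun Q) (Idn A (par s), \<delta> (par s, car s)))"
      unfolding emf_ObjD(7)[OF s, symmetric] by simp
    finally show ?thesis by (simp add: \<delta>_mult)
  qed
  ultimately show ?thesis by simp
qed

lemma emf_1cell_Arr:
  assumes u: "u \<in> Arr (emf_cat A P)"
  shows "Fa (emf_1cell A P Q (V, \<delta>)) u \<in> Arr (emf_cat A Q)"
proof -
  note s = emf_ArrD(1)[OF u] and t = emf_ArrD(2)[OF u]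
  note [simp] = emf_ArrD(1-8)[OF u] emf_ObjD(1-5)[OF s] emf_ObjD(1-5)[OF t]
  have "Fa V (uarr_snd u) \<cdot>\<^bsub>Carr Q\<^esub> Fa V (str (uarr_dom u)) =
    Fa V (str (uarr_cod u)) \<cdot>\<^bsub>Carr Q\<^esub> Fa V (Fa (PFun P) (uarr_fst u, uarr_snd u))"
    using arg_cong[OF emf_ArrD(9)[OF u], of "Fa V"] by simp
  note this[THEN reassoc]
  then show ?thesis using u emf_1cell_Obj[OF s] emf_1cell_Obj[OF t] by (simp del: emf_ObjI add: \<delta>_nat)
qed

lemma emf_1cell_functor: "is_functor (emf_cat A P) (emf_cat A Q) (emf_1cell A P Q (V, \<delta>))"
proof (rule functorI)
  fix u assume u: "u \<in> Arr (emf_cat A P)"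
  show "arr (emf_cat A Q) (Fa (emf_1cell A P Q (V, \<delta>)) u) (Fo (emf_1cell A P Q (V, \<delta>)) (Dom (emf_cat A P) u))
     (Fo (emf_1cell A P Q (V, \<delta>)) (Cod (emf_cat A P) u))"
    using emf_1cell_Arr[OF u] u by (simp del: emf_1cell_Fo emf_ArrI)
next
  fix s assume s: "s \<in> Obj (emf_cat A P)"
  show "Fo (emf_1cell A P Q (V, \<delta>)) s \<in> Obj (emf_cat A Q)"
    using emf_1cell_Obj[OF s] s by (simp del: emf_ObjI)
  have "Idn (emf_cat A P) s \<in> Arr (emf_cat A P)" using s by (simp del: emf_cat_simps(3) emf_ArrI)
  then show "Fa (emf_1cell A P Q (V, \<delta>)) (Idn (emf_cat A P) s) = Idn (emf_cat A Q) (Fo (emf_1cell A P Q (V, \<delta>)) s)"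
    using s emf_ObjD(1-5)[OF s] by (simp del: emf_ArrI)
next
  fix u v assume u: "u \<in> Arr (emf_cat A P)" and v: "v \<in> Arr (emf_cat A P)"
    and c: "Cod (emf_cat A P) u = Dom (emf_cat A P) v"
  have "v \<cdot>\<^bsub>emf_cat A P\<^esub> u \<in> Arr (emf_cat A P)" using u v c by (simp del: emf_cat_simps(4))
  then show "Fa (emf_1cell A P Q (V, \<delta>)) (v \<cdot>\<^bsub>emf_cat A P\<^esub> u) =
     Fa (emf_1cell A P Q (V, \<delta>)) v \<cdot>\<^bsub>emf_cat A Q\<^esub> Fa (emf_1cell A P Q (V, \<delta>)) u"
    using u v c emf_ArrD(1-8)[OF u] emf_ArrD(1-8)[OF v] by (simp del: emf_1cell_Fo emf_ArrI)
qed (auto simp: emf_1cell_def Let_def)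

text \<open>Cartesian arrows are those with invertible carrier part, and \<open>V\<close> preserves
  isomorphisms.\<close>

lemma emf_1cell_fibred: "fibred_functor A (emf A P) (emf A Q) (emf_1cell A P Q (V, \<delta>))"
  unfolding emf_def fibred_functor_def prod.case
proof (intro conjI allI impI)
  note FS = functor_simps[OF emf_1cell_functor]
  show "ftor_comp (emf_cat A P) (emf_proj A Q) (emf_1cell A P Q (V, \<delta>)) = emf_proj A P"
  proof (rule ftor_eqI[of _ "Obj (emf_cat A P)" _ "Arr (emf_cat A P)"])
    fix s assume s: "s \<in> Obj (emf_cat A P)"
    show "Fo (ftor_comp (emf_cat A P) (emf_proj A Q) (emf_1cell A P Q (V, \<delta>))) s = Fo (emf_proj A P) s"
      using s FS(1)[OF s] by (simp del: emf_ObjI)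
  next
    fix s assume s: "s \<in> Arr (emf_cat A P)"
    show "Fa (ftor_comp (emf_cat A P) (emf_proj A Q) (emf_1cell A P Q (V, \<delta>))) s = Fa (emf_proj A P) s"
      using s FS(2)[OF s] by (simp del: emf_ArrI emf_1cell_Fo)
  qed (use functor_ext[OF P.emf_proj_functor] in auto)
  fix \<phi> assume \<phi>: "cartesian A (emf_cat A P) (emf_proj A P) \<phi>"
  note c = cartesianD(1)[OF \<phi>]
  show "cartesian A (emf_cat A Q) (emf_proj A Q) (Fa (emf_1cell A P Q (V, \<delta>)) \<phi>)"
    by (rule Q.emf_cartesianI[OF FS(2)[OF c]])
      (use c functor_iso[OF P.X V P.emf_cartesianD[OF \<phi>]] in \<open>simp del: emf_1cell_Fo\<close>)
qed (rule emf_1cell_functor)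

end

subsection \<open>Mates\<close>

text \<open>Let \<open>F\<close> be a functor over \<open>A\<close> and \<open>\<sigma>\<^sub>e : V (U e) \<cong> U' (F e)\<close>. The arrow \<open>S'(a, V x) \<rightarrow> F (S(a, x))\<close>
  extending \<open>\<sigma> \<cdot> V \<eta>\<close> becomes, under \<open>U'\<close> and \<open>\<sigma>\<inverse>\<close>, a monad map \<open>\<delta>\<close> along \<open>V\<close>, and \<open>\<sigma>\<close> is then an algebra map
  comparing \<open>emf(V, \<delta>)\<close> after one comparison functor with the other comparison functor after \<open>F\<close>.\<close>

definition pcan :: "'u ucat \<Rightarrow> 'u padj \<Rightarrow> 'u padj \<Rightarrow> 'u uftor \<Rightarrow> 'u uftor \<Rightarrow> ('u univ \<Rightarrow> 'u univ) \<Rightarrow>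
    'u univ \<Rightarrow> 'u univ \<Rightarrow> 'u univ" where
  "pcan A D D' F V \<sigma> a x = pext D' a (Fo V x) (Fo F (AS D a x)) (Idn A a)
     (\<sigma> (AS D a x) \<cdot>\<^bsub>AX D'\<^esub> Fa V (AN D a x))"

definition mate :: "'u ucat \<Rightarrow> 'u padj \<Rightarrow> 'u padj \<Rightarrow> 'u uftor \<Rightarrow> 'u uftor \<Rightarrow> ('u univ \<Rightarrow> 'u univ) \<Rightarrow>
    'u univ \<times> 'u univ \<Rightarrow> 'u univ" where
  "mate A D D' F V \<sigma> = (\<lambda>(a, x)\<in>Obj (A \<times>\<^sub>C AX D). inv_arr (AX D') (\<sigma> (AS D a x)) \<cdot>\<^bsub>AX D'\<^esub>
     Fa (AU D') (pcan A D D' F V \<sigma> a x))"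

text \<open>\<open>F\<close> commutes strictly with the projections to \<open>A\<close>, but with
  the functors to the carriers only up to \<sigma>. The instances that matter are cartesian functors
  between pruned fibrations and cartesian functors from a pruned fibration to an Eilenberg--Moore
  fibration.\<close>

locale padj_map = D: par_adj A D + D': par_adj A D' for A D D' +
  fixes F V \<sigma>
  assumes F: "is_functor (AE D) (AE D') F" and V: "is_functor (AX D) (AX D') V"
    and F_Fo [simp]: "e \<in> Obj (AE D) \<Longrightarrow> Fo (AP D') (Fo F e) = Fo (AP D) e"
    and F_Fa [simp]: "v \<in> Arr (AE D) \<Longrightarrow> Fa (AP D') (Fa F v) = Fa (AP D) v"
    and \<sigma> [simp]: "e \<in> Obj (AE D) \<Longrightarrow> \<sigma> e \<in> Arr (AX D')"
      "e \<in> Obj (AE D) \<Longrightarrow> Dom (AX D') (\<sigma> e) = Fo V (Fo (AU D) e)"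
      "e \<in> Obj (AE D) \<Longrightarrow> Cod (AX D') (\<sigma> e) = Fo (AU D') (Fo F e)"
    and \<sigma>_iso: "e \<in> Obj (AE D) \<Longrightarrow> is_iso (AX D') (\<sigma> e)"
    and \<sigma>_nat: "v \<in> Arr (AE D) \<Longrightarrow> \<sigma> (Cod (AE D) v) \<cdot>\<^bsub>AX D'\<^esub> Fa V (Fa (AU D) v) =
       Fa (AU D') (Fa F v) \<cdot>\<^bsub>AX D'\<^esub> \<sigma> (Dom (AE D) v)"
begin

lemmas [simp] = functor_simps[OF F] functor_simps[OF V]

abbreviation can where "can \<equiv> pcan A D D' F V \<sigma>"
abbreviation \<delta> where "\<delta> \<equiv> mate A D D' F V \<sigma>"

lemma can [simp]:
  assumes "a \<in> Obj A" "x \<in> Obj (AX D)"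
  shows "can a x \<in> Arr (AE D')" "Dom (AE D') (can a x) = AS D' a (Fo V x)" "Cod (AE D') (can a x) = Fo F (AS D a x)"
    "Fa (AP D') (can a x) = Idn A a"
    "y = Fo V x \<Longrightarrow> Fa (AU D') (can a x) \<cdot>\<^bsub>AX D'\<^esub> AN D' a y = \<sigma> (AS D a x) \<cdot>\<^bsub>AX D'\<^esub> Fa V (AN D a x)"
    "\<lbrakk>y = Fo V x; r \<in> Arr (AX D'); Cod (AX D') r = y\<rbrakk> \<Longrightarrow>
       Fa (AU D') (can a x) \<cdot>\<^bsub>AX D'\<^esub> (AN D' a y \<cdot>\<^bsub>AX D'\<^esub> r) = \<sigma> (AS D a x) \<cdot>\<^bsub>AX D'\<^esub> (Fa V (AN D a x) \<cdot>\<^bsub>AX D'\<^esub> r)"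
  using assms by (simp_all add: pcan_def)

text \<open>From here on \<delta> is handled through its composite with \<sigma>, which no longer
  mentions an inverse; equations between such arrows are proved by cancelling \<sigma>.\<close>

lemma mate_simps [simp]:
  assumes "a \<in> Obj A" "x \<in> Obj (AX D)"
  shows "\<delta> (a, x) \<in> Arr (AX D')" "Dom (AX D') (\<delta> (a, x)) = Fo (AU D') (AS D' a (Fo V x))"
    "Cod (AX D') (\<delta> (a, x)) = Fo V (Fo (AU D) (AS D a x))"
    "\<sigma> (AS D a x) \<cdot>\<^bsub>AX D'\<^esub> \<delta> (a, x) = Fa (AU D') (can a x)"
    "\<lbrakk>r \<in> Arr (AX D'); Cod (AX D') r = Fo (AU D') (AS D' a (Fo V x))\<rbrakk> \<Longrightarrow>
       \<sigma> (AS D a x) \<cdot>\<^bsub>AX D'\<^esub> (\<delta> (a, x) \<cdot>\<^bsub>AX D'\<^esub> r) = Fa (AU D') (can a x) \<cdot>\<^bsub>AX D'\<^esub> r"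
proof -
  note i = inv_arr[OF \<sigma>_iso[of "AS D a x"]]
  show *: "\<delta> (a, x) \<in> Arr (AX D')" "Dom (AX D') (\<delta> (a, x)) = Fo (AU D') (AS D' a (Fo V x))"
    "Cod (AX D') (\<delta> (a, x)) = Fo V (Fo (AU D) (AS D a x))"
    "\<sigma> (AS D a x) \<cdot>\<^bsub>AX D'\<^esub> \<delta> (a, x) = Fa (AU D') (can a x)"
    using assms i i(5)[THEN reassoc] by (simp_all add: mate_def)
  show "\<lbrakk>r \<in> Arr (AX D'); Cod (AX D') r = Fo (AU D') (AS D' a (Fo V x))\<rbrakk> \<Longrightarrow>
       \<sigma> (AS D a x) \<cdot>\<^bsub>AX D'\<^esub> (\<delta> (a, x) \<cdot>\<^bsub>AX D'\<^esub> r) = Fa (AU D') (can a x) \<cdot>\<^bsub>AX D'\<^esub> r"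
    using *(4)[THEN reassoc, of r] * assms by simp
qed

lemma mate_ext: "\<delta> \<in> extensional (Obj (A \<times>\<^sub>C AX D))"
  unfolding mate_def by (rule restrict_extensional)

lemma \<sigma>_cancel:
  assumes "\<sigma> e \<cdot>\<^bsub>AX D'\<^esub> k = \<sigma> e \<cdot>\<^bsub>AX D'\<^esub> k'" "e \<in> Obj (AE D)" "k \<in> Arr (AX D')" "k' \<in> Arr (AX D')"
    "Cod (AX D') k = Fo V (Fo (AU D) e)" "Cod (AX D') k' = Fo V (Fo (AU D) e)"
  shows "k = k'"
  using iso_mono[OF D'.X \<sigma>_iso[OF assms(2)] assms(3,4)] assms by simp

lemma mate_eqI:
  assumes "a \<in> Obj A" "x \<in> Obj (AX D)" "k \<in> Arr (AX D')" "Cod (AX D') k = Fo V (Fo (AU D) (AS D a x))"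
    "\<sigma> (AS D a x) \<cdot>\<^bsub>AX D'\<^esub> k = Fa (AU D') (can a x)"
  shows "\<delta> (a, x) = k"
  by (rule \<sigma>_cancel[of "AS D a x"]) (use assms in auto)

text \<open>Naturality of \<sigma> turned around, with the source as a variable, so that as a
  rewrite rule it moves \<sigma> to the left past \<open>U'\<close>-images.\<close>

lemma \<sigma>_nat':
  assumes "v \<in> Arr (AE D)" "e = Dom (AE D) v"
  shows "Fa (AU D') (Fa F v) \<cdot>\<^bsub>AX D'\<^esub> \<sigma> e = \<sigma> (Cod (AE D) v) \<cdot>\<^bsub>AX D'\<^esub> Fa V (Fa (AU D) v)"
  using \<sigma>_nat[OF assms(1)] assms(2) by simp

lemma V_psum:
  assumes "f \<in> Arr A" "g \<in> Arr (AX D)" "Dom A f = a" "Dom (AX D) g = x"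
  shows "Fa V (Fa (AU D) (psum A D f g)) \<cdot>\<^bsub>AX D'\<^esub> Fa V (AN D a x) =
    Fa V (AN D (Cod A f) (Cod (AX D) g)) \<cdot>\<^bsub>AX D'\<^esub> Fa V g"
  using assms by (subst functor_simps(6)[OF V, symmetric]) auto

lemma V_pcounit:
  assumes "e \<in> Obj (AE D)" "a = Fo (AP D) e" "x = Fo (AU D) e"
  shows "Fa V (Fa (AU D) (pcounit A D e)) \<cdot>\<^bsub>AX D'\<^esub> Fa V (AN D a x) = Idn (AX D') (Fo V x)"
  using assms by (subst functor_simps(6)[OF V, symmetric]) auto

text \<open>Behind \<sigma> the two sides are \<open>U'\<close>-images of arrows out of a free
  object, namely of the two ways around the naturality square of \<open>can\<close>; that square
  commutes on the generator.\<close>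

lemma mate_nat:
  assumes "f \<in> Arr A" "g \<in> Arr (AX D)"
  shows "\<delta> (Cod A f, Cod (AX D) g) \<cdot>\<^bsub>AX D'\<^esub> Fa (AU D') (psum A D' f (Fa V g)) =
    Fa V (Fa (AU D) (psum A D f g)) \<cdot>\<^bsub>AX D'\<^esub> \<delta> (Dom A f, Dom (AX D) g)"
proof (rule \<sigma>_cancel[of "AS D (Cod A f) (Cod (AX D) g)"])
  note [simp] = assms
  let ?h = "psum A D f g" and ?a = "Dom A f" and ?x = "Dom (AX D) g"
  have "can (Cod A f) (Cod (AX D) g) \<cdot>\<^bsub>AE D'\<^esub> psum A D' f (Fa V g) = Fa F ?h \<cdot>\<^bsub>AE D'\<^esub> can ?a ?x"
    by (rule D'.pext_eqI[of _ _ ?a "Fo V ?x"])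
      (auto simp: \<sigma>_nat' \<sigma>_nat'[THEN reassoc] V_psum)
  from arg_cong[OF this, of "Fa (AU D')"]
  show "\<sigma> (AS D (Cod A f) (Cod (AX D) g)) \<cdot>\<^bsub>AX D'\<^esub>
      (\<delta> (Cod A f, Cod (AX D) g) \<cdot>\<^bsub>AX D'\<^esub> Fa (AU D') (psum A D' f (Fa V g))) =
    \<sigma> (AS D (Cod A f) (Cod (AX D) g)) \<cdot>\<^bsub>AX D'\<^esub> (Fa V (Fa (AU D) ?h) \<cdot>\<^bsub>AX D'\<^esub> \<delta> (?a, ?x))"
    using \<sigma>_nat[of ?h, THEN reassoc, of "\<delta> (?a, ?x)"] by simp
qed (use assms in auto)

text \<open>The same argument as for naturality, with the square expressing that \<open>can\<close>
  is compatible with the two counits.\<close>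

lemma mate_mult:
  assumes "a \<in> Obj A" "x \<in> Obj (AX D)"
  shows "\<delta> (a, x) \<cdot>\<^bsub>AX D'\<^esub> Fa (AU D') (pcounit A D' (AS D' a (Fo V x))) =
    Fa V (Fa (AU D) (pcounit A D (AS D a x))) \<cdot>\<^bsub>AX D'\<^esub>
      (\<delta> (a, Fo (AU D) (AS D a x)) \<cdot>\<^bsub>AX D'\<^esub> Fa (AU D') (psum A D' (Idn A a) (\<delta> (a, x))))"
proof (rule \<sigma>_cancel[of "AS D a x"])
  note [simp] = assms
  let ?e = "pcounit A D (AS D a x)" and ?t = "Fo (AU D) (AS D a x)"
  let ?r = "\<delta> (a, ?t) \<cdot>\<^bsub>AX D'\<^esub> Fa (AU D') (psum A D' (Idn A a) (\<delta> (a, x)))"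
  have "can a x \<cdot>\<^bsub>AE D'\<^esub> pcounit A D' (AS D' a (Fo V x)) =
    Fa F ?e \<cdot>\<^bsub>AE D'\<^esub> (can a ?t \<cdot>\<^bsub>AE D'\<^esub> psum A D' (Idn A a) (\<delta> (a, x)))"
    by (rule D'.pext_eqI[of _ _ a "Fo (AU D') (AS D' a (Fo V x))"])
      (auto simp: \<sigma>_nat' \<sigma>_nat'[THEN reassoc] V_pcounit V_pcounit[THEN reassoc])
  from arg_cong[OF this, of "Fa (AU D')"]
  show "\<sigma> (AS D a x) \<cdot>\<^bsub>AX D'\<^esub> (\<delta> (a, x) \<cdot>\<^bsub>AX D'\<^esub> Fa (AU D') (pcounit A D' (AS D' a (Fo V x)))) =
    \<sigma> (AS D a x) \<cdot>\<^bsub>AX D'\<^esub> (Fa V (Fa (AU D) ?e) \<cdot>\<^bsub>AX D'\<^esub> ?r)"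
    using \<sigma>_nat[of ?e, THEN reassoc, of ?r] by simp
qed (use assms in auto)

lemma mate_unit:
  assumes "a \<in> Obj A" "x \<in> Obj (AX D)"
  shows "\<delta> (a, x) \<cdot>\<^bsub>AX D'\<^esub> AN D' a (Fo V x) = Fa V (AN D a x)"
  by (rule \<sigma>_cancel[of "AS D a x"]) (use assms in auto)

sublocale pm2 A "AM D" "AM D'" ..

lemma mate_1cell: "pm_1cell A (AM D) (AM D') (V, \<delta>)"
  unfolding pm_1cell_iff
proof (intro conjI ballI)
  show "\<delta> \<in> extensional (Obj (A \<times>\<^sub>C AX D))" by (rule mate_ext)
qed (auto simp: V D.M_Fo D.M_Fa D.M_unit D.M_mult D'.M_Fo D'.M_Fa D'.M_unit D'.M_mult mate_nat mate_mult mate_unit)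

sublocale pm1 A "AM D" "AM D'" V \<delta>
  by unfold_locales (rule mate_1cell)

text \<open>The algebra-map equation is the \<open>U'\<close>-image of an equation in
  \<open>AE D'\<close>: \<open>F\<close> of the counit after \<open>can\<close> is the counit after
  the left adjoint applied to \<open>(id, \<sigma> e)\<close>. On the generator both composites
  equal \<open>\<sigma> e\<close>.\<close>

lemma mate_comparison:
  assumes e: "e \<in> Obj (AE D)"
  shows "uarrow (Fo (emf_1cell A (AM D) (AM D') (V, \<delta>)) (Fo (pcompar A D) e)) (Fo (pcompar A D') (Fo F e))
    (Idn A (Fo (AP D) e)) (\<sigma> e) \<in> Arr (emf_cat A (AM D'))"
proof -
  note [simp] = e and o = D.pcompar_Obj[OF e]
  have o': "utriple (Fo (AP D) e) (Fo (AU D') (Fo F e)) (Fa (AU D') (pcounit A D' (Fo F e))) \<in> Obj (emf_cat A (AM D'))"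
    using D'.pcompar_Obj[of "Fo F e"] by (simp del: emf_ObjI)
  let ?a = "Fo (AP D) e" and ?x = "Fo (AU D) e"
  have "Fa F (pcounit A D e) \<cdot>\<^bsub>AE D'\<^esub> can ?a ?x = pcounit A D' (Fo F e) \<cdot>\<^bsub>AE D'\<^esub> psum A D' (Idn A ?a) (\<sigma> e)"
    by (rule D'.pext_eqI[of _ _ ?a "Fo V ?x"])
      (auto simp: \<sigma>_nat' \<sigma>_nat'[THEN reassoc] V_pcounit V_pcounit[THEN reassoc])
  from arg_cong[OF this, of "Fa (AU D')"]
  have "\<sigma> e \<cdot>\<^bsub>AX D'\<^esub> (Fa V (Fa (AU D) (pcounit A D e)) \<cdot>\<^bsub>AX D'\<^esub> \<delta> (?a, ?x)) =
     Fa (AU D') (pcounit A D' (Fo F e)) \<cdot>\<^bsub>AX D'\<^esub> Fa (AU D') (psum A D' (Idn A ?a) (\<sigma> e))"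
    using \<sigma>_nat[of "pcounit A D e", THEN reassoc, of "\<delta> (?a, ?x)"] by simp
  then show ?thesis using o o' emf_1cell_Obj[OF o] by (simp del: emf_ObjI add: D.M_Fo D'.M_Fa)
qed

end

lemma padj_map_id:
  assumes "par_adj A D"
  shows "padj_map A D D (ftor_id (AE D)) (ftor_id (AX D)) (\<lambda>e. Idn (AX D) (Fo (AU D) e))"
    "mate A D D (ftor_id (AE D)) (ftor_id (AX D)) (\<lambda>e. Idn (AX D) (Fo (AU D) e)) =
      (\<lambda>c\<in>Obj (A \<times>\<^sub>C AX D). Idn (AX D) (Fo (PFun (AM D)) c))"
proof -
  interpret D: par_adj A D by fact
  show *: "padj_map A D D (ftor_id (AE D)) (ftor_id (AX D)) (\<lambda>e. Idn (AX D) (Fo (AU D) e))"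
    by unfold_locales auto
  interpret padj_map A D D "ftor_id (AE D)" "ftor_id (AX D)" "\<lambda>e. Idn (AX D) (Fo (AU D) e)" by fact
  have "\<delta> (a, x) = Idn (AX D) (Fo (AU D) (AS D a x))" if "a \<in> Obj A" "x \<in> Obj (AX D)" for a x
  proof (rule mate_eqI)
    have "can a x = Idn (AE D) (AS D a x)"
      by (rule D.pext_eqI[of _ _ a x]) (use that in auto)
    then show "Idn (AX D) (Fo (AU D) (AS D a x)) \<cdot>\<^bsub>AX D\<^esub> Idn (AX D) (Fo (AU D) (AS D a x)) = Fa (AU D) (can a x)"
      using that by simp
  qed (use that in auto)
  then show "mate A D D (ftor_id (AE D)) (ftor_id (AX D)) (\<lambda>e. Idn (AX D) (Fo (AU D) e)) =
      (\<lambda>c\<in>Obj (A \<times>\<^sub>C AX D). Idn (AX D) (Fo (PFun (AM D)) c))"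
    by (intro extensionalityI[OF mate_ext restrict_extensional]) (auto simp: D.M_Fo)
qed

text \<open>The \<open>can\<close> of the composite is \<open>F'\<close> of the first one after the
  second one, since they agree on the generator. On mates this becomes the composition of 1-cells in
  \<open>PrMnd\<close>.\<close>

lemma padj_map_comp:
  assumes "padj_map A D D' F V \<sigma>" "padj_map A D' D'' F' V' \<sigma>'"
  shows "padj_map A D D'' (ftor_comp (AE D) F' F) (ftor_comp (AX D) V' V) (\<lambda>e. \<sigma>' (Fo F e) \<cdot>\<^bsub>AX D''\<^esub> Fa V' (\<sigma> e))"
    "mate A D D'' (ftor_comp (AE D) F' F) (ftor_comp (AX D) V' V) (\<lambda>e. \<sigma>' (Fo F e) \<cdot>\<^bsub>AX D''\<^esub> Fa V' (\<sigma> e)) =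
      (\<lambda>(a, x)\<in>Obj (A \<times>\<^sub>C AX D). Fa V' (mate A D D' F V \<sigma> (a, x)) \<cdot>\<^bsub>AX D''\<^esub> mate A D' D'' F' V' \<sigma>' (a, Fo V x))"
proof -
  interpret L: padj_map A D D' F V \<sigma> by fact
  interpret R: padj_map A D' D'' F' V' \<sigma>' by fact
  let ?F = "ftor_comp (AE D) F' F" and ?V = "ftor_comp (AX D) V' V"
   and ?\<sigma> = "\<lambda>e. \<sigma>' (Fo F e) \<cdot>\<^bsub>AX D''\<^esub> Fa V' (\<sigma> e)"
  show *: "padj_map A D D'' ?F ?V ?\<sigma>"
  proof
    show "is_functor (AE D) (AE D'') ?F" "is_functor (AX D) (AX D'') ?V"
      using is_functor_comp[OF L.D.E L.F R.F] is_functor_comp[OF L.D.X L.V R.V] by auto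
    show "is_iso (AX D'') (?\<sigma> e)" if "e \<in> Obj (AE D)" for e
      by (rule is_iso_comp) (use that R.\<sigma>_iso functor_iso[OF L.D'.X R.V L.\<sigma>_iso] in auto)
    fix v assume v: "v \<in> Arr (AE D)"
    have "Fa V' (\<sigma> (Cod (AE D) v)) \<cdot>\<^bsub>AX D''\<^esub> Fa V' (Fa V (Fa (AU D) v)) =
      Fa V' (Fa (AU D') (Fa F v)) \<cdot>\<^bsub>AX D''\<^esub> Fa V' (\<sigma> (Dom (AE D) v))"
      using arg_cong[OF L.\<sigma>_nat[OF v], of "Fa V'"] v by simp
    then show "?\<sigma> (Cod (AE D) v) \<cdot>\<^bsub>AX D''\<^esub> Fa ?V (Fa (AU D) v) = Fa (AU D'') (Fa ?F v) \<cdot>\<^bsub>AX D''\<^esub> ?\<sigma> (Dom (AE D) v)"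
      using v R.\<sigma>_nat[of "Fa F v", THEN reassoc] by simp
  qed auto
  interpret LR: padj_map A D D'' ?F ?V ?\<sigma> by fact
  note [simp] = L.D.M_Fo L.D'.M_Fo R.D'.M_Fo
  have "LR.\<delta> (a, x) = Fa V' (L.\<delta> (a, x)) \<cdot>\<^bsub>AX D''\<^esub> R.\<delta> (a, Fo V x)" if that [simp]: "a \<in> Obj A" "x \<in> Obj (AX D)" for a x
  proof (rule LR.mate_eqI)
    have 1: "Fa V' (\<sigma> (AS D a x)) \<cdot>\<^bsub>AX D''\<^esub> Fa V' (Fa V (AN D a x)) =
      Fa V' (Fa (AU D') (L.can a x)) \<cdot>\<^bsub>AX D''\<^esub> Fa V' (AN D' a (Fo V x))"
      by (simp del: functor_simps(6)[OF R.V] flip: functor_simps(6)[OF R.V])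
    have 2: "Fa V' (\<sigma> (AS D a x)) \<cdot>\<^bsub>AX D''\<^esub> Fa V' (L.\<delta> (a, x)) = Fa V' (Fa (AU D') (L.can a x))"
      by (subst functor_simps(6)[OF R.V, symmetric]) (auto simp: L.D.M_Fo)
    have "LR.can a x = Fa F' (L.can a x) \<cdot>\<^bsub>AE D''\<^esub> R.can a (Fo V x)"
      by (rule R.D'.pext_eqI[of _ _ a "Fo ?V x"]) (auto simp: 1 R.\<sigma>_nat' R.\<sigma>_nat'[THEN reassoc])
    then show "?\<sigma> (AS D a x) \<cdot>\<^bsub>AX D''\<^esub> (Fa V' (L.\<delta> (a, x)) \<cdot>\<^bsub>AX D''\<^esub> R.\<delta> (a, Fo V x)) = Fa (AU D'') (LR.can a x)"
      using 2[THEN reassoc, of "R.\<delta> (a, Fo V x)"]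
        R.\<sigma>_nat[of "L.can a x", THEN reassoc, of "R.\<delta> (a, Fo V x)"] by simp
  qed auto
  then show "mate A D D'' ?F ?V ?\<sigma> = (\<lambda>(a, x)\<in>Obj (A \<times>\<^sub>C AX D). Fa V' (L.\<delta> (a, x)) \<cdot>\<^bsub>AX D''\<^esub> R.\<delta> (a, Fo V x))"
    by (intro extensionalityI[OF LR.mate_ext restrict_extensional]) auto
qed

text \<open>The last hypothesis says that \<open>t\<close> and \<nu> correspond to each other under
  \<sigma> and \<tau>. Compatibility of \<open>can\<close> with \<open>t\<close> then holds on the
  generator, and cancelling \<tau> gives the law of a 2-cell.\<close>

lemma mate_2cell:
  assumes "padj_map A D D' F V \<sigma>" "padj_map A D D' G W \<tau>" and \<nu>: "nat_trans (AX D) (AX D') V W \<nu>"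
    and t: "\<And>e. e \<in> Obj (AE D) \<Longrightarrow> arr (AE D') (t e) (Fo F e) (Fo G e)"
      "\<And>e. e \<in> Obj (AE D) \<Longrightarrow> Fa (AP D') (t e) = Idn A (Fo (AP D) e)"
    and eq: "\<And>e. e \<in> Obj (AE D) \<Longrightarrow> \<tau> e \<cdot>\<^bsub>AX D'\<^esub> \<nu> (Fo (AU D) e) = Fa (AU D') (t e) \<cdot>\<^bsub>AX D'\<^esub> \<sigma> e"
  shows "pm_2cell A (AM D) (AM D') (V, mate A D D' F V \<sigma>) (W, mate A D D' G W \<tau>) \<nu>"
proof -
  interpret L: padj_map A D D' F V \<sigma> by fact
  interpret R: padj_map A D D' G W \<tau> by fact
  note n = nat_transD[OF \<nu>]
  note [simp] = n(4-6) L.D.M_Fo L.D'.M_Fo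
  have t' [simp]: "t e \<in> Arr (AE D')" "Dom (AE D') (t e) = Fo F e" "Cod (AE D') (t e) = Fo G e"
    "Fa (AP D') (t e) = Idn A (Fo (AP D) e)" if "e \<in> Obj (AE D)" for e using t that by auto
  have "\<nu> (Fo (AU D) (AS D a x)) \<cdot>\<^bsub>AX D'\<^esub> L.\<delta> (a, x) =
    R.\<delta> (a, x) \<cdot>\<^bsub>AX D'\<^esub> Fa (AU D') (psum A D' (Idn A a) (\<nu> x))" if that [simp]: "a \<in> Obj A" "x \<in> Obj (AX D)" for a x
  proof (rule R.\<sigma>_cancel[of "AS D a x"])
    have 1: "\<nu> (Fo (AU D) (AS D a x)) \<cdot>\<^bsub>AX D'\<^esub> Fa V (AN D a x) = Fa W (AN D a x) \<cdot>\<^bsub>AX D'\<^esub> \<nu> x"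
      using n(7)[of "AN D a x"] by simp
    have "t (AS D a x) \<cdot>\<^bsub>AE D'\<^esub> L.can a x = R.can a x \<cdot>\<^bsub>AE D'\<^esub> psum A D' (Idn A a) (\<nu> x)"
      by (rule L.D'.pext_eqI[of _ _ a "Fo V x"])
       (auto simp: eq[symmetric, THEN reassoc] 1)
    from arg_cong[OF this, of "Fa (AU D')"]
    show "\<tau> (AS D a x) \<cdot>\<^bsub>AX D'\<^esub> (\<nu> (Fo (AU D) (AS D a x)) \<cdot>\<^bsub>AX D'\<^esub> L.\<delta> (a, x)) =
      \<tau> (AS D a x) \<cdot>\<^bsub>AX D'\<^esub> (R.\<delta> (a, x) \<cdot>\<^bsub>AX D'\<^esub> Fa (AU D') (psum A D' (Idn A a) (\<nu> x)))"
      using eq[of "AS D a x", THEN reassoc, of "L.\<delta> (a, x)"] by simp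
  qed auto
  then show ?thesis unfolding pm_2cell_def using \<nu>
    by (auto simp: L.D.M_Fo L.D'.M_Fa)
qed


section \<open>Pruned fibrations\<close>

lemma init_arr:
  assumes "initial C z" "x \<in> Obj C"
  shows "init_arr C z x \<in> Arr C" "Dom C (init_arr C z x) = z" "Cod C (init_arr C z x) = x"
  using theI'[of "\<lambda>f. f \<in> hom C z x"] assms by (auto simp: initial_def init_arr_def)

lemma initialD: "initial C z \<Longrightarrow> z \<in> Obj C"
  by (simp add: initial_def)

lemma initial_unique:
  assumes "initial C z" "category C" "f \<in> Arr C" "g \<in> Arr C" "Dom C f = z" "Dom C g = z" "Cod C f = Cod C g"
  shows "f = g"
proof -
  have "\<exists>!f. f \<in> hom C z (Cod C g)" using assms by (auto simp: initial_def)
  then show ?thesis using assms unfolding in_hom by (metis (no_types))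
qed

lemma is_coproductD:
  assumes "is_coproduct C x y i j"
  shows "i \<in> Arr C" "j \<in> Arr C" "Dom C i = x" "Dom C j = y" "Cod C j = Cod C i"
    "\<lbrakk>f \<in> Arr C; g \<in> Arr C; Dom C f = x; Dom C g = y; Cod C f = Cod C g\<rbrakk> \<Longrightarrow>
      \<exists>!h. arr C h (Cod C i) (Cod C f) \<and> h \<cdot>\<^bsub>C\<^esub> i = f \<and> h \<cdot>\<^bsub>C\<^esub> j = g"
proof -
  have *: "\<forall>f\<in>Arr C. \<forall>g\<in>Arr C. Dom C f = x \<longrightarrow> Dom C g = y \<longrightarrow> Cod C f = Cod C g \<longrightarrow>
        (\<exists>!h. arr C h (Cod C i) (Cod C f) \<and> h \<cdot>\<^bsub>C\<^esub> i = f \<and> h \<cdot>\<^bsub>C\<^esub> j = g)"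
    using assms unfolding is_coproduct_def in_hom by (elim conjE)
  show "\<lbrakk>f \<in> Arr C; g \<in> Arr C; Dom C f = x; Dom C g = y; Cod C f = Cod C g\<rbrakk> \<Longrightarrow>
      \<exists>!h. arr C h (Cod C i) (Cod C f) \<and> h \<cdot>\<^bsub>C\<^esub> i = f \<and> h \<cdot>\<^bsub>C\<^esub> j = g"
    by (rule *[rule_format])
qed (use assms in \<open>simp_all add: is_coproduct_def\<close>)

lemma is_coproductI:
  assumes "arr C i x c" "arr C j y c"
    "\<And>f g. \<lbrakk>f \<in> Arr C; g \<in> Arr C; Dom C f = x; Dom C g = y; Cod C f = Cod C g\<rbrakk> \<Longrightarrow>
      \<exists>h. arr C h c (Cod C f) \<and> h \<cdot>\<^bsub>C\<^esub> i = f \<and> h \<cdot>\<^bsub>C\<^esub> j = g"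
    "\<And>h h'. \<lbrakk>h \<in> Arr C; h' \<in> Arr C; Dom C h = c; Dom C h' = c; Cod C h = Cod C h';
       h \<cdot>\<^bsub>C\<^esub> i = h' \<cdot>\<^bsub>C\<^esub> i; h \<cdot>\<^bsub>C\<^esub> j = h' \<cdot>\<^bsub>C\<^esub> j\<rbrakk> \<Longrightarrow> h = h'"
  shows "is_coproduct C x y i j"
  unfolding is_coproduct_def
proof (intro conjI ballI impI)
  fix f g assume *: "f \<in> Arr C" "g \<in> Arr C" "Dom C f = x" "Dom C g = y" "Cod C f = Cod C g"
  obtain h where "arr C h c (Cod C f) \<and> h \<cdot>\<^bsub>C\<^esub> i = f \<and> h \<cdot>\<^bsub>C\<^esub> j = g" using assms(3)[OF *] by blast
  then show "\<exists>!h. h \<in> hom C (Cod C i) (Cod C f) \<and> h \<cdot>\<^bsub>C\<^esub> i = f \<and> h \<cdot>\<^bsub>C\<^esub> j = g"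
    using assms(1) by (intro ex1I[of _ h]) (auto intro!: assms(4))
qed (use assms in auto)

lemma coproduct_ext:
  assumes "category C" "is_coproduct C x y i j" "h \<in> Arr C" "h' \<in> Arr C" "Dom C h = Cod C i" "Dom C h' = Cod C i"
    "Cod C h = Cod C h'" "h \<cdot>\<^bsub>C\<^esub> i = h' \<cdot>\<^bsub>C\<^esub> i" "h \<cdot>\<^bsub>C\<^esub> j = h' \<cdot>\<^bsub>C\<^esub> j"
  shows "h = h'"
proof -
  note i = is_coproductD[OF assms(2)]
  have "\<exists>!k. arr C k (Cod C i) (Cod C h) \<and> k \<cdot>\<^bsub>C\<^esub> i = h \<cdot>\<^bsub>C\<^esub> i \<and> k \<cdot>\<^bsub>C\<^esub> j = h \<cdot>\<^bsub>C\<^esub> j"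
    using i(6)[of "h \<cdot>\<^bsub>C\<^esub> i" "h \<cdot>\<^bsub>C\<^esub> j"] i(1-5) assms(1,3-7) by auto
  moreover have "arr C h (Cod C i) (Cod C h) \<and> h \<cdot>\<^bsub>C\<^esub> i = h \<cdot>\<^bsub>C\<^esub> i \<and> h \<cdot>\<^bsub>C\<^esub> j = h \<cdot>\<^bsub>C\<^esub> j"
    "arr C h' (Cod C i) (Cod C h) \<and> h' \<cdot>\<^bsub>C\<^esub> i = h \<cdot>\<^bsub>C\<^esub> i \<and> h' \<cdot>\<^bsub>C\<^esub> j = h \<cdot>\<^bsub>C\<^esub> j" using assms by auto
  ultimately show ?thesis by (metis (no_types))
qed

lemma copair:
  assumes "is_coproduct C x y i j" "f \<in> Arr C" "g \<in> Arr C" "Dom C f = x" "Dom C g = y" "Cod C f = Cod C g"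
  shows "copair C i j f g \<in> Arr C" "Dom C (copair C i j f g) = Cod C i" "Cod C (copair C i j f g) = Cod C f"
    "copair C i j f g \<cdot>\<^bsub>C\<^esub> i = f" "copair C i j f g \<cdot>\<^bsub>C\<^esub> j = g"
  using theI'[OF is_coproductD(6)[OF assms]] by (auto simp: copair_def)

lemma coproduct_unique:
  assumes C: "category C" and c: "is_coproduct C x y i j" "is_coproduct C x y i' j'"
  obtains v where "arr C v (Cod C i) (Cod C i')" "is_iso C v" "v \<cdot>\<^bsub>C\<^esub> i = i'" "v \<cdot>\<^bsub>C\<^esub> j = j'"
proof -
  note [simp] = C is_coproductD(1-5)[OF c(1)] is_coproductD(1-5)[OF c(2)]
  let ?v = "copair C i j i' j'" and ?w = "copair C i' j' i j"
  note v [simp] = copair[OF c(1), of i' j'] copair[OF c(2), of i j]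
  have "?w \<cdot>\<^bsub>C\<^esub> ?v = Idn C (Cod C i)"
    by (rule coproduct_ext[OF C c(1)]) auto
  moreover have "?v \<cdot>\<^bsub>C\<^esub> ?w = Idn C (Cod C i')"
    by (rule coproduct_ext[OF C c(2)]) auto
  ultimately have "is_iso C ?v" by (intro is_isoI[of _ _ "Cod C i" "Cod C i'" ?w]) auto
  then show ?thesis by (intro that[of ?v]) auto
qed

lemma coproduct_iso_cod:
  assumes C: "category C" and c: "is_coproduct C x y i j" and v: "is_iso C v" "Dom C v = Cod C i"
  shows "is_coproduct C x y (v \<cdot>\<^bsub>C\<^esub> i) (v \<cdot>\<^bsub>C\<^esub> j)"
proof -
  note [simp] = C is_coproductD(1-5)[OF c] v(2) and w [simp] = inv_arr[OF v(1)]
  note [simp] = w(4)[THEN reassoc]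
  show ?thesis
  proof (rule is_coproductI[of _ _ _ "Cod C v"])
    fix f g assume fg: "f \<in> Arr C" "g \<in> Arr C" "Dom C f = x" "Dom C g = y" "Cod C f = Cod C g"
    note [simp] = copair[OF c fg] fg
    show "\<exists>h. arr C h (Cod C v) (Cod C f) \<and> h \<cdot>\<^bsub>C\<^esub> (v \<cdot>\<^bsub>C\<^esub> i) = f \<and> h \<cdot>\<^bsub>C\<^esub> (v \<cdot>\<^bsub>C\<^esub> j) = g"
      by (intro exI[of _ "copair C i j f g \<cdot>\<^bsub>C\<^esub> inv_arr C v"]) auto
  next
    fix h h' assume *: "h \<in> Arr C" "h' \<in> Arr C" "Dom C h = Cod C v" "Dom C h' = Cod C v" "Cod C h = Cod C h'"
       "h \<cdot>\<^bsub>C\<^esub> (v \<cdot>\<^bsub>C\<^esub> i) = h' \<cdot>\<^bsub>C\<^esub> (v \<cdot>\<^bsub>C\<^esub> i)" "h \<cdot>\<^bsub>C\<^esub> (v \<cdot>\<^bsub>C\<^esub> j) = h' \<cdot>\<^bsub>C\<^esub> (v \<cdot>\<^bsub>C\<^esub> j)"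
    have "h \<cdot>\<^bsub>C\<^esub> v = h' \<cdot>\<^bsub>C\<^esub> v" by (rule coproduct_ext[OF C c]) (use * in auto)
    from iso_epi[OF C v(1) _ _ _ _ this] show "h = h'" using *(1-5) by auto
  qed auto
qed

lemma coproduct_iso_dom:
  assumes C: "category C" and c: "is_coproduct C x y i j" and v: "is_iso C v" "Cod C v = x"
  shows "is_coproduct C (Dom C v) y (i \<cdot>\<^bsub>C\<^esub> v) j"
proof -
  note [simp] = C is_coproductD(1-5)[OF c] v(2) and w [simp] = inv_arr[OF v(1)]
  note [simp] = w(4)[THEN reassoc]
  show ?thesis
  proof (rule is_coproductI[of _ _ _ "Cod C i"])
    fix f g assume fg: "f \<in> Arr C" "g \<in> Arr C" "Dom C f = Dom C v" "Dom C g = y" "Cod C f = Cod C g"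
    then have "f \<cdot>\<^bsub>C\<^esub> inv_arr C v \<in> Arr C" "Dom C (f \<cdot>\<^bsub>C\<^esub> inv_arr C v) = x" "Cod C (f \<cdot>\<^bsub>C\<^esub> inv_arr C v) = Cod C g"
      by auto
    note k = copair[OF c this(1) fg(2) this(2) fg(4) this(3)] 
    note [simp] = k fg k(4)[THEN reassoc]
    show "\<exists>h. arr C h (Cod C i) (Cod C f) \<and> h \<cdot>\<^bsub>C\<^esub> (i \<cdot>\<^bsub>C\<^esub> v) = f \<and> h \<cdot>\<^bsub>C\<^esub> j = g"
      by (intro exI[of _ "copair C i j (f \<cdot>\<^bsub>C\<^esub> inv_arr C v) g"]) auto
  next
    fix h h' assume *: "h \<in> Arr C" "h' \<in> Arr C" "Dom C h = Cod C i" "Dom C h' = Cod C i" "Cod C h = Cod C h'"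
       "h \<cdot>\<^bsub>C\<^esub> (i \<cdot>\<^bsub>C\<^esub> v) = h' \<cdot>\<^bsub>C\<^esub> (i \<cdot>\<^bsub>C\<^esub> v)" "h \<cdot>\<^bsub>C\<^esub> j = h' \<cdot>\<^bsub>C\<^esub> j"
    have "h \<cdot>\<^bsub>C\<^esub> i = h' \<cdot>\<^bsub>C\<^esub> i"
      by (rule iso_epi[OF C v(1)]) (use *(1-6) in simp_all)
    from coproduct_ext[OF C c _ _ _ _ _ this *(7)] show "h = h'" using *(1-5) by auto
  qed auto
qed

text \<open>The inverse of the injection is the copairing of the identity with the unique arrow from
  \<open>z\<close>. It is applied in \<open>A\<close> to the image of a sum, and in the total
  category to a sum with \<open>p\<^sub>L z\<close>.\<close>

lemma coproduct_initial:
  assumes C: "category C" and z: "initial C z" and c: "is_coproduct C x z i j"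
  shows "is_iso C i"
proof -
  note [simp] = C is_coproductD(1-5)[OF c]
  have x: "x \<in> Obj C" using cat_simps(1)[OF C is_coproductD(1)[OF c]] by simp
  note [simp] = x init_arr[OF z x]
  note r [simp] = copair[OF c, of "Idn C x" "init_arr C z x", simplified]
  let ?r = "copair C i j (Idn C x) (init_arr C z x)"
  have "i \<cdot>\<^bsub>C\<^esub> ?r = Idn C (Cod C i)"
    by (rule coproduct_ext[OF C c]) (use initial_unique[OF z C, of "i \<cdot>\<^bsub>C\<^esub> init_arr C z x" j] in auto)
  then show ?thesis by (intro is_isoI[of _ _ x "Cod C i" ?r]) auto
qed

text \<open>The converse of \<open>coproduct_initial\<close>. It yields preservation of sums by the
  projection of an Eilenberg--Moore fibration, since in \<open>A\<close> the second summand is the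
  initial object.\<close>

lemma coproduct_initialI:
  assumes C: "category C" and z: "initial C z" and i: "is_iso C i" and j: "arr C j z (Cod C i)"
  shows "is_coproduct C (Dom C i) z i j"
proof -
  note [simp] = C inv_arr[OF i] j
  show ?thesis
  proof (rule is_coproductI[of _ _ _ "Cod C i"])
    fix f g assume *: "f \<in> Arr C" "g \<in> Arr C" "Dom C f = Dom C i" "Dom C g = z" "Cod C f = Cod C g"
    then have "(f \<cdot>\<^bsub>C\<^esub> inv_arr C i) \<cdot>\<^bsub>C\<^esub> j = g" by (intro initial_unique[OF z C]) auto
    then show "\<exists>h. arr C h (Cod C i) (Cod C f) \<and> h \<cdot>\<^bsub>C\<^esub> i = f \<and> h \<cdot>\<^bsub>C\<^esub> j = g"
      using * by (intro exI[of _ "f \<cdot>\<^bsub>C\<^esub> inv_arr C i"]) auto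
  qed (use iso_epi[OF C i] in auto)
qed

subsection \<open>Left adjoints with identity unit\<close>

text \<open>Because \<open>q a\<close> lies over \<open>a\<close> exactly, the unit is an identity,
  and arrows between objects \<open>q a\<close> are determined by their images in \<open>A\<close>,
  which gives full faithfulness.\<close>

lemma left_adjoint_of_universal:
  assumes A: "category A" and E: "category E" and p: "is_functor E A p"
    and q: "\<And>a. a \<in> Obj A \<Longrightarrow> q a \<in> Obj E" "\<And>a. a \<in> Obj A \<Longrightarrow> Fo p (q a) = a"
    and univ: "\<And>a e f. \<lbrakk>a \<in> Obj A; e \<in> Obj E; arr A f a (Fo p e)\<rbrakk> \<Longrightarrow> \<exists>!h. arr E h (q a) e \<and> Fa p h = f"
  obtains L \<epsilon> where "adjunction A E L p (\<lambda>a\<in>Obj A. Idn A a) \<epsilon>" "full_faithful A E L" "\<And>a. a \<in> Obj A \<Longrightarrow> Fo L a = q a"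
proof -
  note [simp] = A E q functor_simps[OF p]
  define w where "w a e f = (THE h. arr E h (q a) e \<and> Fa p h = f)" for a e f
  have w [simp]: "w a e f \<in> Arr E" "Dom E (w a e f) = q a" "Cod E (w a e f) = e" "Fa p (w a e f) = f"
    if "a \<in> Obj A" "e \<in> Obj E" "f \<in> Arr A" "Dom A f = a" "Cod A f = Fo p e" for a e f
    using theI'[OF univ[of a e f]] that by (auto simp: w_def)
  have inj: "h = h'" if "h \<in> Arr E" "h' \<in> Arr E" "a \<in> Obj A" "Dom E h = q a" "Dom E h' = q a" "Cod E h = Cod E h'"
    "Fa p h = Fa p h'" for h h' a
    using univ[of a "Cod E h" "Fa p h"] that by auto
  define L where "L = \<lparr>Fo = (\<lambda>a\<in>Obj A. q a), Fa = (\<lambda>f\<in>Arr A. w (Dom A f) (q (Cod A f)) f)\<rparr>"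
  define \<epsilon> where "\<epsilon> = (\<lambda>e\<in>Obj E. w (Fo p e) e (Idn A (Fo p e)))"
  have L: "is_functor A E L"
  proof (rule functorI)
    show "x \<in> Obj A \<Longrightarrow> Fa L (Idn A x) = Idn E (Fo L x)" for x
      by (rule inj[of _ _ x]) (auto simp: L_def)
    show "\<lbrakk>f \<in> Arr A; g \<in> Arr A; Cod A f = Dom A g\<rbrakk> \<Longrightarrow> Fa L (g \<cdot>\<^bsub>A\<^esub> f) = Fa L g \<cdot>\<^bsub>E\<^esub> Fa L f" for f g
      by (rule inj[of _ _ "Dom A f"]) (auto simp: L_def)
  qed (auto simp: L_def)
  have ff: "full_faithful A E L"
  proof (rule full_faithfulI[OF L])
    fix x y g g' assume *: "x \<in> Obj A" "y \<in> Obj A" "arr A g x y" "arr A g' x y" "Fa L g = Fa L g'"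
    have "Fa p (Fa L k) = k" if "k \<in> Arr A" for k using that by (simp add: L_def)
    with * show "g = g'" by metis
  next
    fix x y h assume *: "x \<in> Obj A" "y \<in> Obj A" "arr E h (Fo L x) (Fo L y)"
    have "Fa L (Fa p h) = h"
      by (rule inj[of _ _ x]) (use * in \<open>auto simp: L_def\<close>)
    with * show "\<exists>g. arr A g x y \<and> Fa L g = h"
      by (intro exI[of _ "Fa p h"]) (auto simp: L_def)
  qed
  have "adjunction A E L p (\<lambda>a\<in>Obj A. Idn A a) \<epsilon>"
    unfolding adjunction_def
  proof (intro conjI ballI)
    show "nat_trans A A (ftor_id A) (ftor_comp A p L) (\<lambda>a\<in>Obj A. Idn A a)"
      by (rule nat_transI) (use is_functor_comp[OF A L p] in \<open>auto simp: L_def\<close>)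
    show "nat_trans E E (ftor_comp E L p) (ftor_id E) \<epsilon>"
    proof (rule nat_transI)
      fix f assume "f \<in> Arr E"
      then show "\<epsilon> (Cod E f) \<cdot>\<^bsub>E\<^esub> Fa (ftor_comp E L p) f = Fa (ftor_id E) f \<cdot>\<^bsub>E\<^esub> \<epsilon> (Dom E f)"
        by (intro inj[of _ _ "Fo p (Dom E f)"]) (auto simp: \<epsilon>_def L_def)
    qed (use is_functor_comp[OF E p L] in \<open>auto simp: \<epsilon>_def L_def\<close>)
    fix a assume a: "a \<in> Obj A"
    show "\<epsilon> (Fo L a) \<cdot>\<^bsub>E\<^esub> Fa L ((\<lambda>a\<in>Obj A. Idn A a) a) = Idn E (Fo L a)"
      by (rule inj[of _ _ a]) (use a in \<open>auto simp: \<epsilon>_def L_def\<close>)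
  qed (use L p in \<open>auto simp: \<epsilon>_def\<close>)
  with ff show ?thesis by (intro that[of L \<epsilon>]) (auto simp: L_def)
qed

text \<open>The last clause rests on the fact that \<open>h\<close> is the counit after
  \<open>L (p h)\<close>: this is naturality of the counit at \<open>h\<close> combined with the
  triangle identity, in which the unit is an identity.\<close>

lemma identity_unit_adjunction:
  assumes A: "category A" and E: "category E" and adj: "adjunction A E L p (\<lambda>a\<in>Obj A. Idn A a) \<epsilon>"
  shows "is_functor A E L" "is_functor E A p"
    "a \<in> Obj A \<Longrightarrow> Fo p (Fo L a) = a" "f \<in> Arr A \<Longrightarrow> Fa p (Fa L f) = f"
    "e \<in> Obj E \<Longrightarrow> \<epsilon> e \<in> Arr E" "e \<in> Obj E \<Longrightarrow> Dom E (\<epsilon> e) = Fo L (Fo p e)" "e \<in> Obj E \<Longrightarrow> Cod E (\<epsilon> e) = e"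
    "e \<in> Obj E \<Longrightarrow> Fa p (\<epsilon> e) = Idn A (Fo p e)"
    "\<lbrakk>h \<in> Arr E; h' \<in> Arr E; a \<in> Obj A; Dom E h = Fo L a; Dom E h' = Fo L a; Cod E h = Cod E h'; Fa p h = Fa p h'\<rbrakk>
      \<Longrightarrow> h = h'"
proof -
  have L: "is_functor A E L" and p: "is_functor E A p" and \<eta>: "nat_trans A A (ftor_id A) (ftor_comp A p L) (\<lambda>a\<in>Obj A. Idn A a)"
    and \<epsilon>: "nat_trans E E (ftor_comp E L p) (ftor_id E) \<epsilon>"
    and t1: "\<And>x. x \<in> Obj A \<Longrightarrow> \<epsilon> (Fo L x) \<cdot>\<^bsub>E\<^esub> Fa L (Idn A x) = Idn E (Fo L x)"
    and t2: "\<And>y. y \<in> Obj E \<Longrightarrow> Fa p (\<epsilon> y) \<cdot>\<^bsub>A\<^esub> (\<lambda>a\<in>Obj A. Idn A a) (Fo p y) = Idn A (Fo p y)"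
    using adj by (auto simp: adjunction_def)
  note [simp] = A E functor_simps[OF L] functor_simps[OF p]
  note e = nat_transD[OF \<epsilon>]
  show "is_functor A E L" "is_functor E A p" using L p .
  show pL [simp]: "Fo p (Fo L a) = a" if "a \<in> Obj A" for a using nat_transD(6)[OF \<eta> that] that by simp
  show pL' [simp]: "Fa p (Fa L f) = f" if "f \<in> Arr A" for f using nat_transD(7)[OF \<eta> that] that by simp
  show e' [simp]: "\<epsilon> e \<in> Arr E" "Dom E (\<epsilon> e) = Fo L (Fo p e)" "Cod E (\<epsilon> e) = e" if "e \<in> Obj E" for e
    using e(4-6)[OF that] that by auto
  show "Fa p (\<epsilon> e) = Idn A (Fo p e)" if "e \<in> Obj E" for e using t2[OF that] that by simp
  have "h = \<epsilon> (Cod E h) \<cdot>\<^bsub>E\<^esub> Fa L (Fa p h)" if "h \<in> Arr E" "a \<in> Obj A" "Dom E h = Fo L a" for h a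
    using e(7)[OF that(1)] that t1[OF that(2)] by simp
  then show "\<lbrakk>h \<in> Arr E; h' \<in> Arr E; a \<in> Obj A; Dom E h = Fo L a; Dom E h' = Fo L a; Cod E h = Cod E h'; Fa p h = Fa p h'\<rbrakk>
      \<Longrightarrow> h = h'" by metis
qed

lemma unit_iso_of_full_faithful:
  assumes A: "category A" and E: "category E" and adj: "adjunction A E L p \<eta> \<epsilon>" and ff: "full_faithful A E L" and a: "a \<in> Obj A"
  shows "is_iso A (\<eta> a)"
proof -
  have L: "is_functor A E L" and p: "is_functor E A p" and \<eta>: "nat_trans A A (ftor_id A) (ftor_comp A p L) \<eta>"
    and \<epsilon>: "nat_trans E E (ftor_comp E L p) (ftor_id E) \<epsilon>"
    and t1: "\<And>x. x \<in> Obj A \<Longrightarrow> \<epsilon> (Fo L x) \<cdot>\<^bsub>E\<^esub> Fa L (\<eta> x) = Idn E (Fo L x)"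
    and t2: "\<And>y. y \<in> Obj E \<Longrightarrow> Fa p (\<epsilon> y) \<cdot>\<^bsub>A\<^esub> \<eta> (Fo p y) = Idn A (Fo p y)"
    using adj by (auto simp: adjunction_def)
  note [simp] = A E functor_simps[OF L] functor_simps[OF p] a
  have h [simp]: "\<eta> x \<in> Arr A" "Dom A (\<eta> x) = x" "Cod A (\<eta> x) = Fo p (Fo L x)" if "x \<in> Obj A" for x
    using nat_transD(4-6)[OF \<eta> that] that by auto
  have e [simp]: "\<epsilon> x \<in> Arr E" "Dom E (\<epsilon> x) = Fo L (Fo p x)" "Cod E (\<epsilon> x) = x" if "x \<in> Obj E" for x
    using nat_transD(4-6)[OF \<epsilon> that] that by auto
  \<comment> \<open>The inverse of the unit is the preimage under \<open>L\<close> of the counit at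
    \<open>L a\<close>.\<close>
  obtain r where r: "arr A r (Fo p (Fo L a)) a" "Fa L r = \<epsilon> (Fo L a)"
    using full_faithfulD[OF ff, of "Fo p (Fo L a)" a "\<epsilon> (Fo L a)"] by auto
  have "r \<cdot>\<^bsub>A\<^esub> \<eta> a = Idn A a"
    using full_faithfulD[OF ff a a, of "Fa L (Idn A a)"] t1[OF a] r by auto
  moreover have "\<eta> a \<cdot>\<^bsub>A\<^esub> r = Idn A (Fo p (Fo L a))"
    using nat_transD(7)[OF \<eta>, of r] r t2[of "Fo L a"] by simp
  ultimately show ?thesis using r by (intro is_isoI[of _ _ a "Fo p (Fo L a)" r]) auto
qed

lemma cartesian_iso:
  assumes A: "category A" and E: "category E" and p: "is_functor E A p"
    and c: "cartesian A E p \<phi>" and i: "is_iso A (Fa p \<phi>)"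
  shows "is_iso E \<phi>"
proof -
  note [simp] = A E functor_simps[OF p] cartesianD(1)[OF c] and j [simp] = inv_arr[OF i]
  obtain \<chi> where \<chi>: "arr E \<chi> (Cod E \<phi>) (Dom E \<phi>)" "Fa p \<chi> = inv_arr A (Fa p \<phi>)" "\<phi> \<cdot>\<^bsub>E\<^esub> \<chi> = Idn E (Cod E \<phi>)"
    using cartesianD(2)[OF c, of "Idn E (Cod E \<phi>)" "inv_arr A (Fa p \<phi>)"] by auto
  have "\<chi> \<cdot>\<^bsub>E\<^esub> \<phi> = Idn E (Dom E \<phi>)"
    by (rule cartesian_mono[OF A E p c]) (use \<chi> \<chi>(3)[THEN reassoc] in auto)
  with \<chi> show ?thesis by (intro is_isoI[of _ _ "Dom E \<phi>" "Cod E \<phi>" \<chi>]) auto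
qed

subsection \<open>Choices\<close>

text \<open>The given left adjoint and sums lie over \<open>A\<close> only up to isomorphism. Both
  are moved along cartesian lifts of the isomorphisms in question; a cartesian arrow over an
  isomorphism is invertible, so the universal properties survive, and the new objects lie over
  \<open>a\<close> on the nose.\<close>

lemma prune_data_exist:
  assumes A: "category A" and z: "initial A z" and pr: "pruned A z E p"
  shows "\<exists>D. is_prune_data A z E p D"
proof -
  from pr obtain pL \<eta> \<epsilon> where fib: "fibration A E p" and adj: "adjunction A E pL p \<eta> \<epsilon>" and ff: "full_faithful A E pL"
    and cop: "\<And>a x. a \<in> Obj A \<Longrightarrow> x \<in> Obj (fibre A E p z) \<Longrightarrow> \<exists>i j. is_coproduct E (Fo pL a) x i j"
    and pcop: "\<And>a x i j. a \<in> Obj A \<Longrightarrow> x \<in> Obj (fibre A E p z) \<Longrightarrow> is_coproduct E (Fo pL a) x i j \<Longrightarrow>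
        is_coproduct A (Fo p (Fo pL a)) (Fo p x) (Fa p i) (Fa p j)"
    unfolding pruned_def by blast
  have E: "category E" and p: "is_functor E A p"
    and lift: "\<And>e f. e \<in> Obj E \<Longrightarrow> f \<in> Arr A \<Longrightarrow> Cod A f = Fo p e \<Longrightarrow> \<exists>\<phi>. cartesian A E p \<phi> \<and> Cod E \<phi> = e \<and> Fa p \<phi> = f"
    using fib by (auto simp: fibration_def)
  have L: "is_functor A E pL" and hn: "nat_trans A A (ftor_id A) (ftor_comp A p pL) \<eta>"
    and en: "nat_trans E E (ftor_comp E pL p) (ftor_id E) \<epsilon>"
    and t1: "\<And>x. x \<in> Obj A \<Longrightarrow> \<epsilon> (Fo pL x) \<cdot>\<^bsub>E\<^esub> Fa pL (\<eta> x) = Idn E (Fo pL x)"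
    and t2: "\<And>y. y \<in> Obj E \<Longrightarrow> Fa p (\<epsilon> y) \<cdot>\<^bsub>A\<^esub> \<eta> (Fo p y) = Idn A (Fo p y)"
    using adj by (auto simp: adjunction_def)
  note [simp] = A E functor_simps[OF L] functor_simps[OF p]
  have h [simp]: "\<eta> x \<in> Arr A" "Dom A (\<eta> x) = x" "Cod A (\<eta> x) = Fo p (Fo pL x)" if "x \<in> Obj A" for x
    using nat_transD(4-6)[OF hn that] that by auto
  have e [simp]: "\<epsilon> x \<in> Arr E" "Dom E (\<epsilon> x) = Fo pL (Fo p x)" "Cod E (\<epsilon> x) = x" if "x \<in> Obj E" for x
    using nat_transD(4-6)[OF en that] that by auto
  \<comment> \<open>The unit is invertible since \<open>pL\<close> is full and faithful. The source
    of the lift of \<open>\<eta> a\<close> ending in \<open>pL a\<close> will replace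
    \<open>pL a\<close>.\<close>
  have "\<forall>a\<in>Obj A. \<exists>\<phi>. cartesian A E p \<phi> \<and> Cod E \<phi> = Fo pL a \<and> Fa p \<phi> = \<eta> a"
    using lift by simp
  then obtain \<phi> where \<phi>: "\<And>a. a \<in> Obj A \<Longrightarrow> cartesian A E p (\<phi> a)" "\<And>a. a \<in> Obj A \<Longrightarrow> Cod E (\<phi> a) = Fo pL a"
    "\<And>a. a \<in> Obj A \<Longrightarrow> Fa p (\<phi> a) = \<eta> a" by metis
  have \<phi>i: "is_iso E (\<phi> a)" if "a \<in> Obj A" for a
    using cartesian_iso[OF A E p \<phi>(1)] \<phi>(3) unit_iso_of_full_faithful[OF A E adj ff] that by simp
  note \<phi>' [simp] = inv_arr[OF \<phi>i] \<phi>(2,3)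
  define q where "q a = Dom E (\<phi> a)" for a
  have q [simp]: "q a \<in> Obj E" "Fo p (q a) = a" if "a \<in> Obj A" for a
    using that functor_simps(3)[OF p, of "\<phi> a"] by (auto simp: q_def)
  have univ: "\<exists>!h. arr E h (q a) e \<and> Fa p h = f" if a: "a \<in> Obj A" and ee: "e \<in> Obj E" and f: "arr A f a (Fo p e)" for a e f
  proof (rule ex1I)
    have "Fa p (Fa pL f) \<cdot>\<^bsub>A\<^esub> \<eta> a = \<eta> (Fo p e) \<cdot>\<^bsub>A\<^esub> f" using nat_transD(7)[OF hn, of f] f by simp
    then show "arr E (\<epsilon> e \<cdot>\<^bsub>E\<^esub> (Fa pL f \<cdot>\<^bsub>E\<^esub> \<phi> a)) (q a) e \<and> Fa p (\<epsilon> e \<cdot>\<^bsub>E\<^esub> (Fa pL f \<cdot>\<^bsub>E\<^esub> \<phi> a)) = f"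
      using a ee f t2[OF ee, THEN reassoc] by (simp add: q_def)
    fix k assume k: "arr E k (q a) e \<and> Fa p k = f"
    let ?i = "inv_arr E (\<phi> a)"
    \<comment> \<open>The image of \<open>\<phi> a\<close> in \<open>A\<close> is
      \<open>\<eta> a\<close>, so the image of its inverse cancels against
      \<open>\<eta> a\<close>.\<close>
    have "f \<cdot>\<^bsub>A\<^esub> (Fa p ?i \<cdot>\<^bsub>A\<^esub> \<eta> a) = f"
      using a f functor_simps(6)[OF p, of "\<phi> a" ?i, symmetric] by (simp add: q_def[symmetric] del: functor_simps(6)[OF p])
    then have pm: "Fa p (k \<cdot>\<^bsub>E\<^esub> ?i) \<cdot>\<^bsub>A\<^esub> \<eta> a = f"
      using k a f q(2)[OF a] by (simp add: q_def)
    have m: "k \<cdot>\<^bsub>E\<^esub> ?i \<in> Arr E" "Dom E (k \<cdot>\<^bsub>E\<^esub> ?i) = Fo pL a" "Cod E (k \<cdot>\<^bsub>E\<^esub> ?i) = e"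
      using k a by (auto simp: q_def)
    \<comment> \<open>Uniqueness of transposes for the given adjunction, to be applied to
      \<open>k\<close> transported to \<open>pL a\<close> along the inverse of
      \<open>\<phi> a\<close>.\<close>
    have key: "m = \<epsilon> e \<cdot>\<^bsub>E\<^esub> Fa pL (Fa p m \<cdot>\<^bsub>A\<^esub> \<eta> a)" if m: "m \<in> Arr E" "Dom E m = Fo pL a" "Cod E m = e" for m
    proof -
      have "\<epsilon> e \<cdot>\<^bsub>E\<^esub> Fa pL (Fa p m) = m \<cdot>\<^bsub>E\<^esub> \<epsilon> (Fo pL a)" using nat_transD(7)[OF en m(1)] m by simp
      from this[THEN reassoc, of "Fa pL (\<eta> a)"] show ?thesis using m a ee t1[OF a] by simp
    qed
    have "k \<cdot>\<^bsub>E\<^esub> ?i = \<epsilon> e \<cdot>\<^bsub>E\<^esub> Fa pL f" using key[OF m] unfolding pm .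
    then have "(\<epsilon> e \<cdot>\<^bsub>E\<^esub> Fa pL f) \<cdot>\<^bsub>E\<^esub> \<phi> a = (k \<cdot>\<^bsub>E\<^esub> ?i) \<cdot>\<^bsub>E\<^esub> \<phi> a" by simp
    then show "k = \<epsilon> e \<cdot>\<^bsub>E\<^esub> (Fa pL f \<cdot>\<^bsub>E\<^esub> \<phi> a)" using k a ee f by (simp add: q_def)
  qed
  obtain PL PC where PL: "adjunction A E PL p (\<lambda>a\<in>Obj A. Idn A a) PC" "\<And>a. a \<in> Obj A \<Longrightarrow> Fo PL a = q a"
    by (rule left_adjoint_of_universal[OF A E p q univ]) blast+
  have "\<exists>i j. is_coproduct E (q a) x i j \<and> Fa p i = Idn A a" if a: "a \<in> Obj A" and x: "x \<in> Obj (fibre A E p z)" for a x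
  proof -
    obtain i j where ij: "is_coproduct E (Fo pL a) x i j" using cop[OF a x] by blast
    have c: "is_coproduct A (Fo p (Fo pL a)) z (Fa p i) (Fa p j)" using pcop[OF a x ij] x by (simp add: fibre_def)
    note [simp] = is_coproductD(1-5)[OF ij] a
    \<comment> \<open>Preservation makes the image of the sum a sum with \<open>p x = z\<close>,
      which is initial; so \<open>p i\<close> is invertible.\<close>
    have ii: "is_iso A (Fa p (i \<cdot>\<^bsub>E\<^esub> \<phi> a))"
      using is_iso_comp[OF A functor_iso[OF E p \<phi>i[OF a]] coproduct_initial[OF A z c]] by simp
    \<comment> \<open>A lift of the image of \<open>i\<close> after \<open>\<phi> a\<close>, ending
      at the vertex of the sum. Composing the injections with its inverse makes the first one lie
      over an identity.\<close>
    obtain \<psi> where \<psi>: "cartesian A E p \<psi>" "Cod E \<psi> = Cod E i" "Fa p \<psi> = Fa p (i \<cdot>\<^bsub>E\<^esub> \<phi> a)"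
      using lift[of "Cod E i" "Fa p (i \<cdot>\<^bsub>E\<^esub> \<phi> a)"] by auto
    have \<psi>i: "is_iso E \<psi>" using cartesian_iso[OF A E p \<psi>(1)] \<psi>(3) ii by simp
    note [simp] = inv_arr[OF \<psi>i]
    have "is_coproduct E (q a) x (inv_arr E \<psi> \<cdot>\<^bsub>E\<^esub> (i \<cdot>\<^bsub>E\<^esub> \<phi> a)) (inv_arr E \<psi> \<cdot>\<^bsub>E\<^esub> j)"
      using coproduct_iso_cod[OF E coproduct_iso_dom[OF E ij \<phi>i[OF a]] is_iso_inv[OF \<psi>i]] \<psi>(2) by (simp add: q_def)
    moreover have "Fa p (inv_arr E \<psi> \<cdot>\<^bsub>E\<^esub> (i \<cdot>\<^bsub>E\<^esub> \<phi> a)) = Fa p (inv_arr E \<psi>) \<cdot>\<^bsub>A\<^esub> Fa p \<psi>"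
      using \<psi>(2,3) by simp
    moreover have "Fa p (inv_arr E \<psi>) \<cdot>\<^bsub>A\<^esub> Fa p \<psi> = Idn A (Fo p (Dom E \<psi>))"
      using functor_simps(6)[OF p, of \<psi> "inv_arr E \<psi>"] by simp
    moreover have "Fo p (Dom E \<psi>) = a" 
      using functor_simps(3)[OF p, of \<psi>] \<psi>(3) by simp
    ultimately show ?thesis by auto
  qed
  then obtain I J where IJ: "\<And>a x. a \<in> Obj A \<Longrightarrow> x \<in> Obj (fibre A E p z) \<Longrightarrow> is_coproduct E (q a) x (I a x) (J a x) \<and> Fa p (I a x) = Idn A a"
    by metis
  have "\<forall>e\<in>Obj E. \<exists>\<phi>. cartesian A E p \<phi> \<and> Cod E \<phi> = e \<and> Fa p \<phi> = init_arr A z (Fo p e)"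
    using lift init_arr[OF z] by simp
  then obtain l where l: "\<forall>e\<in>Obj E. cartesian A E p (l e) \<and> Cod E (l e) = e \<and> Fa p (l e) = init_arr A z (Fo p e)"
    by metis
  have "is_prune_data A z E p \<lparr>PL = PL, PCounit = PC, PLift = l, PInl = I, PInr = J\<rparr>"
    unfolding is_prune_data_def using PL IJ l by simp
  then show ?thesis by blast
qed

subsection \<open>The Eilenberg--Moore fibration of a pruned monad\<close>

context param_monad_axioms
begin

text \<open>The unit of the identity monad is an identity, so compatibility of \<open>t\<close> with
  the units makes the invertible \<open>t x\<close> a left inverse of the unit.\<close>

lemma unit_iso:
  assumes z: "z \<in> Obj A" and i: "isomorphic_monads (Carr P) (monad_at A P z) (id_monad (Carr P))" and x: "x \<in> Obj (Carr P)"
  shows "is_iso (Carr P) (PUnit P (z, x))"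
proof -
  obtain t where t: "monad_morphism (Carr P) (monad_at A P z) (id_monad (Carr P)) t" "is_iso (Carr P) (t x)"
    using i x by (auto simp: isomorphic_monads_def)
  have "t x \<cdot>\<^bsub>Carr P\<^esub> PUnit P (z, x) = Idn (Carr P) x" "Dom (Carr P) (t x) = Fo (PFun P) (z, x)"
    using t(1) x by (auto simp: monad_morphism_def monad_at_def id_monad_def nat_trans_def)
  then show ?thesis using iso_left[OF X t(2), of "PUnit P (z, x)"] x z by simp
qed

text \<open>The algebra-map equation can be tested after precomposing with the invertible unit at
  \<open>car s\<close>, where both sides reduce to \<open>g\<close> by the unit laws of the two
  algebras.\<close>

lemma initial_algebra_morphism:
  assumes z: "initial A z" and i: "\<And>x. x \<in> Obj (Carr P) \<Longrightarrow> is_iso (Carr P) (PUnit P (z, x))"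
    and s: "s \<in> Obj (emf_cat A P)" "par s = z" and t: "t \<in> Obj (emf_cat A P)"
    and g: "arr (Carr P) g (car s) (car t)"
  shows "uarrow s t (init_arr A z (par t)) g \<in> Arr (emf_cat A P)"
proof -
  note [simp] = emf_ObjD(1-5)[OF s(1)] emf_ObjD(1-5)[OF t] s t init_arr[OF z]
  have [simp]: "z \<in> Obj A" using z by (simp add: initial_def)
  have "g \<cdot>\<^bsub>Carr P\<^esub> str s = str t \<cdot>\<^bsub>Carr P\<^esub> Fa (PFun P) (init_arr A z (par t), g)"
    by (rule iso_epi[OF X i, of "car s"])
      (use g emf_ObjD(6)[OF s(1)] emf_ObjD(6)[OF t, THEN reassoc] in auto)
  then show ?thesis using g by simp
qed

text \<open>\<open>p\<^sub>L a\<close> is the free algebra over \<open>a\<close> on the initial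
  carrier, and its sum with an algebra \<open>x\<close> over \<open>z\<close> is the free algebra
  over \<open>a\<close> on \<open>car x\<close>: a map out of the latter consists of an arrow of
  parameters and an arrow out of \<open>car x\<close>, and out of an algebra over \<open>z\<close>
  every arrow of carriers is an algebra map.\<close>

lemma emf_pruned:
  assumes z: "initial A z" and o: "initial (Carr P) o0" and i: "\<And>x. x \<in> Obj (Carr P) \<Longrightarrow> is_iso (Carr P) (PUnit P (z, x))"
  shows "pruned A z (emf_cat A P) (emf_proj A P)"
proof -
  interpret D: par_adj A "emf_adj A P" by (rule par_adj_emf)
  let ?M = "emf_cat A P" and ?p = "emf_proj A P"
  let ?S = "\<lambda>a x. utriple a (Fo (PFun P) (a, x)) (PMult P (a, x))"
  have o0: "o0 \<in> Obj (Carr P)" and zA: "z \<in> Obj A" using o z by (auto simp: initial_def)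
  have S: "a \<in> Obj A \<Longrightarrow> x \<in> Obj (Carr P) \<Longrightarrow> ?S a x \<in> Obj ?M" for a x by (rule emf_free)
  have ia: "init_arr (Carr P) o0 x \<in> Arr (Carr P)" "Dom (Carr P) (init_arr (Carr P) o0 x) = o0"
    "Cod (Carr P) (init_arr (Carr P) o0 x) = x" if "x \<in> Obj (Carr P)" for x
    using init_arr[OF o that] .
  \<comment> \<open>The condition on carriers in the universal property of a free algebra holds
    automatically here, because both arrows in it start at the initial carrier.\<close>
  have univ: "\<exists>!h. arr ?M h (?S a o0) e \<and> Fa ?p h = f" if a: "a \<in> Obj A" and e: "e \<in> Obj ?M" and f: "arr A f a (Fo ?p e)" for a e f
  proof -
    let ?g = "init_arr (Carr P) o0 (car e)"
    have g: "arr (Carr P) ?g o0 (Fo (emf_car A P) e)" using ia[of "car e"] e emf_ObjD[OF e] by simp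
    have "Fa (emf_car A P) h \<cdot>\<^bsub>Carr P\<^esub> PUnit P (a, o0) = ?g" if h: "arr ?M h (?S a o0) e" for h
    proof (rule initial_unique[OF o X])
      have h': "h \<in> Arr ?M" "uarr_dom h = ?S a o0" "uarr_cod h = e" using h by auto
      note [simp] = emf_ArrD(6-8)[OF h'(1)] h' a o0 ia emf_ObjD(2)[OF e]
      show "Fa (emf_car A P) h \<cdot>\<^bsub>Carr P\<^esub> PUnit P (a, o0) \<in> Arr (Carr P)"
        "Dom (Carr P) (Fa (emf_car A P) h \<cdot>\<^bsub>Carr P\<^esub> PUnit P (a, o0)) = o0"
        "?g \<in> Arr (Carr P)" "Dom (Carr P) ?g = o0"
        "Cod (Carr P) (Fa (emf_car A P) h \<cdot>\<^bsub>Carr P\<^esub> PUnit P (a, o0)) = Cod (Carr P) ?g" by simp_all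
    qed
    then show ?thesis using emf_adj_univ[OF a o0 e f g] by (metis (no_types, lifting))
  qed
  obtain L \<epsilon> where L: "adjunction A ?M L ?p (\<lambda>a\<in>Obj A. Idn A a) \<epsilon>" "full_faithful A ?M L" "\<And>a. a \<in> Obj A \<Longrightarrow> Fo L a = ?S a o0"
  proof (rule left_adjoint_of_universal[OF A emf_category emf_proj_functor, of "\<lambda>a. ?S a o0"])
    show "a \<in> Obj A \<Longrightarrow> Fo ?p (?S a o0) = a" for a using S[of a o0] o0 by (simp del: emf_ObjI)
  qed (use S o0 univ that in blast)+
  have main: "\<exists>i j. is_coproduct ?M (?S a o0) x i j \<and> is_iso A (Fa ?p i)" if a: "a \<in> Obj A" and x: "x \<in> Obj (fibre A ?M ?p z)" for a x
  proof -
    have xM: "x \<in> Obj ?M" and px: "par x = z" using x by (auto simp: fibre_def)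
    note xs = emf_ObjD[OF xM]
    \<comment> \<open>The left injection is the free functor applied to the arrow from the initial
      carrier to \<open>car x\<close>; the right one is carried by the unit and lies over the arrow
      from \<open>z\<close> to \<open>a\<close>.\<close>
    let ?i = "psum A (emf_adj A P) (Idn A a) (init_arr (Carr P) o0 (car x))"
    let ?j = "uarrow x (?S a (car x)) (init_arr A z a) (PUnit P (a, car x))"
    note [simp] = a o0 zA ia S xM xs(1-5) px
    have i: "?i \<in> Arr ?M" "uarr_dom ?i = ?S a o0" "uarr_cod ?i = ?S a (car x)" "Fa ?p ?i = Idn A a"
      using D.psum(1-4)[of "Idn A a" "init_arr (Carr P) o0 (car x)"] by (auto simp del: emf_ArrI emf_ObjI)
    have j: "?j \<in> Arr ?M"
      using initial_algebra_morphism[OF z assms(3) xM px S[of a "car x"], of "PUnit P (a, car x)"] by (simp del: emf_ArrI emf_ObjI)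
    have "is_coproduct ?M (?S a o0) x ?i ?j"
    proof (rule is_coproductI[of _ _ _ "?S a (car x)"])
      fix f g assume *: "f \<in> Arr ?M" "g \<in> Arr ?M" "Dom ?M f = ?S a o0" "Dom ?M g = x" "Cod ?M f = Cod ?M g"
      note f = emf_ArrD[OF *(1)] and g = emf_ArrD[OF *(2)]
      let ?h = "pext (emf_adj A P) a (car x) (uarr_cod f) (uarr_fst f) (uarr_snd g)"
      have h: "?h \<in> Arr ?M" "uarr_dom ?h = ?S a (car x)" "uarr_cod ?h = uarr_cod f" "uarr_fst ?h = uarr_fst f"
        "uarr_snd ?h \<cdot>\<^bsub>Carr P\<^esub> PUnit P (a, car x) = uarr_snd g"
      proof -
        have e: "uarr_cod f \<in> Obj ?M" using f by blast
        note k = D.pext[of a "car x" "uarr_cod f" "uarr_fst f" "uarr_snd g"]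
        have k1: "?h \<in> Arr (AE (emf_adj A P))" by (rule k) (use e f g * in \<open>simp_all del: emf_ObjI\<close>)
        then have k2: "?h \<in> Arr ?M" by simp
        show "?h \<in> Arr ?M" by (rule k2)
        have "Dom (AE (emf_adj A P)) ?h = AS (emf_adj A P) a (car x)" by (rule k) (use e f g * in \<open>simp_all del: emf_ObjI\<close>)
        then show "uarr_dom ?h = ?S a (car x)" by simp
        have "Cod (AE (emf_adj A P)) ?h = uarr_cod f" by (rule k) (use e f g * in \<open>simp_all del: emf_ObjI\<close>)
        then show "uarr_cod ?h = uarr_cod f" by simp
        have "Fa (AP (emf_adj A P)) ?h = uarr_fst f" by (rule k) (use e f g * in \<open>simp_all del: emf_ObjI\<close>)
        then show "uarr_fst ?h = uarr_fst f" using k2 by simp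
        have "Fa (AU (emf_adj A P)) ?h \<cdot>\<^bsub>AX (emf_adj A P)\<^esub> AN (emf_adj A P) a (car x) = uarr_snd g"
          by (rule k) (use e f g * in \<open>simp_all del: emf_ObjI\<close>)
        then show "uarr_snd ?h \<cdot>\<^bsub>Carr P\<^esub> PUnit P (a, car x) = uarr_snd g" using k2 by simp
      qed
      have hi: "?h \<cdot>\<^bsub>?M\<^esub> ?i = f"
      proof -
        have 1: "arr ?M (?h \<cdot>\<^bsub>?M\<^esub> ?i) (?S a o0) (uarr_cod f)"
          using cat_simps(6-8)[OF emf_category i(1) h(1)] i h by (simp del: emf_cat_simps(4) emf_ArrI)
        have "Fa ?p (?h \<cdot>\<^bsub>?M\<^esub> ?i) = uarr_fst f"
          using functor_simps(6)[OF emf_proj_functor i(1) h(1)] i h f * by (simp del: emf_cat_simps(4) emf_ArrI)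
        moreover have "arr ?M f (?S a o0) (uarr_cod f) \<and> Fa ?p f = uarr_fst f" using * by simp
        moreover have "\<exists>!k. arr ?M k (?S a o0) (uarr_cod f) \<and> Fa ?p k = uarr_fst f"
          by (rule univ) (use f * in auto)
        ultimately show ?thesis using 1 by blast
      qed
      have hj: "?h \<cdot>\<^bsub>?M\<^esub> ?j = g"
      proof -
        have "?h \<cdot>\<^bsub>?M\<^esub> ?j \<in> Arr ?M" using cat_simps(6)[OF emf_category j h(1)] h by (simp del: emf_cat_simps(4) emf_ArrI)
        then show ?thesis
        proof (rule emf_eqI[OF _ *(2)])
          have "uarr_fst f \<cdot>\<^bsub>A\<^esub> init_arr A z a = uarr_fst g"
            by (rule initial_unique[OF z A]) (use f g * init_arr[OF z] in auto)
          then show "uarr_fst (?h \<cdot>\<^bsub>?M\<^esub> ?j) = uarr_fst g" using h by simp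
        qed (use h * in simp_all)
      qed
      show "\<exists>h. arr ?M h (?S a (car x)) (Cod ?M f) \<and> h \<cdot>\<^bsub>?M\<^esub> ?i = f \<and> h \<cdot>\<^bsub>?M\<^esub> ?j = g"
        using h(1-3) hi hj by (intro exI[of _ ?h]) (simp del: emf_cat_simps(4) emf_ArrI)
    next
      fix h h' assume *: "h \<in> Arr ?M" "h' \<in> Arr ?M" "Dom ?M h = ?S a (car x)" "Dom ?M h' = ?S a (car x)" "Cod ?M h = Cod ?M h'"
        "h \<cdot>\<^bsub>?M\<^esub> ?i = h' \<cdot>\<^bsub>?M\<^esub> ?i" "h \<cdot>\<^bsub>?M\<^esub> ?j = h' \<cdot>\<^bsub>?M\<^esub> ?j"
      have "uarr_fst h \<cdot>\<^bsub>A\<^esub> uarr_fst ?i = uarr_fst h' \<cdot>\<^bsub>A\<^esub> uarr_fst ?i" using *(6) by simp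
      then have p: "uarr_fst h = uarr_fst h'" using i emf_ArrD(3,4)[OF *(1)] emf_ArrD(3,4)[OF *(2)] * by simp
      have s: "uarr_snd h \<cdot>\<^bsub>Carr P\<^esub> PUnit P (a, car x) = uarr_snd h' \<cdot>\<^bsub>Carr P\<^esub> PUnit P (a, car x)" using *(7) by simp
      show "h = h'"
        by (rule D.pext_eqI[of _ _ a "car x"]) (use * p s in \<open>simp_all del: emf_ArrI emf_cat_simps(4)\<close>)
    qed (use i j in \<open>simp_all del: emf_ArrI\<close>)
    moreover have "is_iso A (Fa ?p ?i)" unfolding i(4) by simp
    ultimately show ?thesis by blast
  qed
  \<comment> \<open>The sum constructed above has its left injection over an isomorphism. Any other
    sum differs from it by an isomorphism, so its left injection lies over an isomorphism as well,
    which suffices since \<open>x\<close> lies over the initial object.\<close>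
  have pres: "is_coproduct A (Fo ?p (Fo L a)) (Fo ?p x) (Fa ?p i) (Fa ?p j)"
    if a: "a \<in> Obj A" and x: "x \<in> Obj (fibre A ?M ?p z)" and c: "is_coproduct ?M (Fo L a) x i j" for a x i j
  proof -
    obtain i' j' where ij: "is_coproduct ?M (Fo L a) x i' j'" "is_iso A (Fa ?p i')" using main[OF a x] L(3)[OF a] by auto
    obtain v where v: "arr ?M v (Cod ?M i') (Cod ?M i)" "is_iso ?M v" "v \<cdot>\<^bsub>?M\<^esub> i' = i"
      by (rule coproduct_unique[OF emf_category ij(1) c]) blast
    note cc = is_coproductD(1-5)[OF c] and dd = is_coproductD(1-5)[OF ij(1)]
    note fs = functor_simps[OF emf_proj_functor]
    have "Fa ?p i = Fa ?p v \<cdot>\<^bsub>A\<^esub> Fa ?p i'" using fs(6)[of i' v] v dd by (simp del: emf_cat_simps)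
    then have "is_iso A (Fa ?p i)"
      using is_iso_comp[OF A ij(2) functor_iso[OF emf_category emf_proj_functor v(2)]] fs(3)[of v] fs(4)[of i'] v dd
      by (simp del: emf_cat_simps)
    moreover have "Fo ?p x = z" using x by (simp add: fibre_def)
    moreover have "Dom A (Fa ?p i) = Fo ?p (Fo L a)" using fs(3)[of i] cc by (simp del: emf_cat_simps)
    moreover have "arr A (Fa ?p j) (Fo ?p x) (Cod A (Fa ?p i))"
      using fs(2)[of j] fs(3)[of j] fs(4)[of j] fs(4)[of i] cc by (simp del: emf_cat_simps)
    ultimately show ?thesis using coproduct_initialI[OF A z, of "Fa ?p i" "Fa ?p j"] by (simp del: emf_cat_simps)
  qed
  show ?thesis unfolding pruned_def
  proof (rule conjI, rule emf_fibration, rule exI[of _ L], rule exI[of _ "\<lambda>a\<in>Obj A. Idn A a"], rule exI[of _ \<epsilon>], intro conjI ballI allI impI)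
    show "adjunction A ?M L ?p (\<lambda>a\<in>Obj A. Idn A a) \<epsilon>" "full_faithful A ?M L" using L by auto
    fix a x assume ax: "a \<in> Obj A" "x \<in> Obj (fibre A ?M ?p z)"
    obtain i j where ij: "is_coproduct ?M (Fo L a) x i j" using main[OF ax] L(3)[OF ax(1)] by auto
    show "\<exists>i j. is_coproduct ?M (Fo L a) x i j" using ij by blast
  qed (use pres emf_fibration in auto)
qed

end


section \<open>The parametrized monad of a pruned fibration\<close>

lemma fibre_simps [simp]:
  "x \<in> Obj (fibre A E p a) \<longleftrightarrow> x \<in> Obj E \<and> Fo p x = a"
  "u \<in> Arr (fibre A E p a) \<longleftrightarrow> u \<in> Arr E \<and> Fa p u = Idn A a"
  "Dom (fibre A E p a) = Dom E" "Cod (fibre A E p a) = Cod E" "Idn (fibre A E p a) = Idn E"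
  "Cmp (fibre A E p a) = Cmp E"
  by (auto simp: fibre_def)

lemma category_fibre:
  assumes A: "category A" and E: "category E" and p: "is_functor E A p" and a: "a \<in> Obj A"
  shows "category (fibre A E p a)"
proof (rule categoryI)
  note [simp] = A E functor_simps[OF p] a
  show "f \<in> Arr (fibre A E p a) \<Longrightarrow> Dom (fibre A E p a) f \<in> Obj (fibre A E p a) \<and>
     Cod (fibre A E p a) f \<in> Obj (fibre A E p a)" for f
    using functor_simps(3,4)[OF p, of f] by simp
qed (use assms functor_simps[OF p] in auto)

definition pruned_adj :: "'u ucat \<Rightarrow> 'u univ \<Rightarrow> 'u ucat \<Rightarrow> 'u uftor \<Rightarrow> 'u padj" where
  "pruned_adj A z E p = \<lparr>AE = E, AP = p, AU = iR A z E p,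
     AS = (\<lambda>a x. Cod E (PInl (prune_choice A z E p) a x)),
     AN = (\<lambda>a x. snd (sum_unit A z E p (a, x))), AM = Tp A z (E, p)\<rparr>"

lemma pruned_adj_simps [simp]:
  "AE (pruned_adj A z E p) = E" "AP (pruned_adj A z E p) = p" "AU (pruned_adj A z E p) = iR A z E p"
  "AS (pruned_adj A z E p) a x = Cod E (PInl (prune_choice A z E p) a x)"
  "AM (pruned_adj A z E p) = Tp A z (E, p)" "Carr (Tp A z (E, p)) = fibre A E p z"
  by (auto simp: pruned_adj_def Tp_def Let_def)

locale pruned_fib =
  fixes A :: "'u ucat" and z E p
  assumes A [simp]: "category A" and z: "initial A z" and pr: "pruned A z E p"
begin

abbreviation "D \<equiv> prune_choice A z E p"
abbreviation "lft \<equiv> PLift D"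
abbreviation "inl \<equiv> PInl D"
abbreviation "inr \<equiv> PInr D"
abbreviation "I \<equiv> iR A z E p"
abbreviation "E0 \<equiv> fibre A E p z"
abbreviation "PD \<equiv> pruned_adj A z E p"
abbreviation "T \<equiv> Tp A z (E, p)"

lemma zA [simp]: "z \<in> Obj A" using z by (simp add: initial_def)

lemma E [simp]: "category E" and p: "is_functor E A p" and fib: "fibration A E p"
  using pr by (auto simp: pruned_def fibration_def)

lemma E0 [simp]: "category E0" using category_fibre[OF A E p zA] .

lemma prune_data: "is_prune_data A z E p D"
  unfolding prune_choice_def using someI_ex[OF prune_data_exist[OF A z pr]] .

lemma adj: "adjunction A E (PL D) p (\<lambda>a\<in>Obj A. Idn A a) (PCounit D)"
  using prune_data by (simp add: is_prune_data_def)

lemma L: "is_functor A E (PL D)"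
  using identity_unit_adjunction(1)[OF A E adj] .

lemmas adj_simps [simp] = functor_simps[OF p] functor_simps[OF L] identity_unit_adjunction(3-8)[OF A E adj]

lemmas PL_unique = identity_unit_adjunction(9)[OF A E adj]

section \<open>Reindexing to the initial fibre\<close>

lemma lft_cartesian: "e \<in> Obj E \<Longrightarrow> cartesian A E p (lft e)"
  using prune_data by (auto simp: is_prune_data_def)

lemma iR_Fo: "e \<in> Obj E \<Longrightarrow> Fo I e = Dom E (lft e)" by (simp add: iR_def Let_def)

lemma iR_Fa_The:
  assumes "u \<in> Arr E"
  shows "Fa I u = (THE v. v \<in> hom E0 (Dom E (lft (Dom E u))) (Dom E (lft (Cod E u))) \<and>
    lft (Cod E u) \<cdot>\<^bsub>E\<^esub> v = u \<cdot>\<^bsub>E\<^esub> lft (Dom E u))"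
  using assms by (simp add: iR_def Let_def)

lemma lft [simp]:
  assumes "e \<in> Obj E"
  shows "lft e \<in> Arr E" "Dom E (lft e) = Fo I e" "Cod E (lft e) = e" "Fa p (lft e) = init_arr A z (Fo p e)"
    "Fo I e \<in> Obj E" "Fo p (Fo I e) = z"
proof -
  show 1: "lft e \<in> Arr E" "Dom E (lft e) = Fo I e" "Cod E (lft e) = e" "Fa p (lft e) = init_arr A z (Fo p e)"
    using prune_data assms cartesianD(1)[OF lft_cartesian[OF assms]] by (auto simp: is_prune_data_def iR_Fo)
  show "Fo I e \<in> Obj E" using 1(1) cat_simps(1)[OF E 1(1)] 1(2) by simp
  show "Fo p (Fo I e) = z" using functor_simps(3)[OF p 1(1)] init_arr[OF z] assms 1 by simp
qed

text \<open>\<open>z\<close> has no endomorphism but the identity, so the initial fibre is a full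
  subcategory of \<open>E\<close>.\<close>

lemma vertical:
  assumes "u \<in> Arr E" "Fo p (Dom E u) = z" "Fo p (Cod E u) = z"
  shows "Fa p u = Idn A z"
  by (rule initial_unique[OF z A]) (use assms in auto)

text \<open>Uniqueness of factorizations through a cartesian arrow, where agreement of the images in
  \<open>A\<close> is automatic over \<open>z\<close>. This is the standard way to prove equations
  in the initial fibre.\<close>

lemma lft_cancel:
  assumes "lft e \<cdot>\<^bsub>E\<^esub> v = lft e \<cdot>\<^bsub>E\<^esub> v'" "e \<in> Obj E" "v \<in> Arr E" "v' \<in> Arr E" "Dom E v = Dom E v'" "Fo p (Dom E v) = z"
    "Cod E v = Fo I e" "Cod E v' = Fo I e"
  shows "v = v'"
  by (rule cartesian_mono[OF A E p lft_cartesian[OF assms(2)]])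
    (use assms vertical[of v] vertical[of v'] in auto)

text \<open>For \<open>u\<close> starting over \<open>z\<close>, the transpose of \<open>u\<close>
  under the adjunction between the inclusion of the initial fibre and
  \<open>i\<^sub>R\<close>.\<close>

definition lfac where "lfac u = (THE v. arr E v (Dom E u) (Fo I (Cod E u)) \<and> lft (Cod E u) \<cdot>\<^bsub>E\<^esub> v = u)"

lemma lft_factor:
  assumes u: "u \<in> Arr E" "Fo p (Dom E u) = z"
  shows "\<exists>!v. arr E v (Dom E u) (Fo I (Cod E u)) \<and> lft (Cod E u) \<cdot>\<^bsub>E\<^esub> v = u"
proof -
  have "Fa p u = init_arr A z (Fo p (Cod E u))"
    by (rule initial_unique[OF z A]) (use u init_arr[OF z] in auto)
  then have "\<exists>!v. arr E v (Dom E u) (Dom E (lft (Cod E u))) \<and> Fa p v = Idn A z \<and> lft (Cod E u) \<cdot>\<^bsub>E\<^esub> v = u"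
    by (intro cartesianD(2)[OF lft_cartesian]) (use u init_arr[OF z] in auto)
  then obtain v where "arr E v (Dom E u) (Dom E (lft (Cod E u)))" and v2: "lft (Cod E u) \<cdot>\<^bsub>E\<^esub> v = u"
    by blast
  then have v: "arr E v (Dom E u) (Fo I (Cod E u))" using u(1) by simp
  show ?thesis
  proof (rule ex1I[of _ v])
    fix w assume "arr E w (Dom E u) (Fo I (Cod E u)) \<and> lft (Cod E u) \<cdot>\<^bsub>E\<^esub> w = u"
    then have w: "arr E w (Dom E u) (Fo I (Cod E u))" "lft (Cod E u) \<cdot>\<^bsub>E\<^esub> w = lft (Cod E u) \<cdot>\<^bsub>E\<^esub> v"
      using v2 by auto
    from lft_cancel[OF w(2)] w(1) v u show "w = v" by simp
  qed (use v v2 in simp)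
qed

lemma lfac [simp]:
  assumes u: "u \<in> Arr E" "Fo p (Dom E u) = z"
  shows "lfac u \<in> Arr E" "Dom E (lfac u) = Dom E u" "Cod E (lfac u) = Fo I (Cod E u)" "Fa p (lfac u) = Idn A z"
    "e = Cod E u \<Longrightarrow> lft e \<cdot>\<^bsub>E\<^esub> lfac u = u"
    "\<lbrakk>e = Cod E u; r \<in> Arr E; Cod E r = Dom E u\<rbrakk> \<Longrightarrow> lft e \<cdot>\<^bsub>E\<^esub> (lfac u \<cdot>\<^bsub>E\<^esub> r) = u \<cdot>\<^bsub>E\<^esub> r"
proof -
  have 12: "arr E (lfac u) (Dom E u) (Fo I (Cod E u)) \<and> lft (Cod E u) \<cdot>\<^bsub>E\<^esub> lfac u = u"
    using theI'[OF lft_factor[OF u]] unfolding lfac_def[of u, symmetric] .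
  note 1 = conjunct1[OF 12] and 2 = conjunct2[OF 12]
  have 3: "Fa p (lfac u) = Idn A z" by (rule vertical) (use 1 u in auto)
  show "lfac u \<in> Arr E" "Dom E (lfac u) = Dom E u" "Cod E (lfac u) = Fo I (Cod E u)" "Fa p (lfac u) = Idn A z"
    using 1 3 by auto
  show "lft e \<cdot>\<^bsub>E\<^esub> lfac u = u" if "e = Cod E u" unfolding that by (rule 2)
  show "lft e \<cdot>\<^bsub>E\<^esub> (lfac u \<cdot>\<^bsub>E\<^esub> r) = u \<cdot>\<^bsub>E\<^esub> r" if "e = Cod E u" "r \<in> Arr E" "Cod E r = Dom E u"
    unfolding that(1) by (rule reassoc[OF 2]) (use 1 u that in simp_all)
qed

lemma iR_Fa:
  assumes "u \<in> Arr E"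
  shows "Fa I u = lfac (u \<cdot>\<^bsub>E\<^esub> lft (Dom E u))"
proof -
  note [simp] = assms
  have "Fa I u = (THE v. v \<in> hom E0 (Fo I (Dom E u)) (Fo I (Cod E u)) \<and> lft (Cod E u) \<cdot>\<^bsub>E\<^esub> v = u \<cdot>\<^bsub>E\<^esub> lft (Dom E u))"
    by (simp add: iR_Fa_The)
  also have "\<dots> = lfac (u \<cdot>\<^bsub>E\<^esub> lft (Dom E u))"
  proof (rule the_equality)
    fix v assume "v \<in> hom E0 (Fo I (Dom E u)) (Fo I (Cod E u)) \<and> lft (Cod E u) \<cdot>\<^bsub>E\<^esub> v = u \<cdot>\<^bsub>E\<^esub> lft (Dom E u)"
    then have v: "v \<in> Arr E" "Dom E v = Fo I (Dom E u)" "Cod E v = Fo I (Cod E u)"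
      "lft (Cod E u) \<cdot>\<^bsub>E\<^esub> v = lft (Cod E u) \<cdot>\<^bsub>E\<^esub> lfac (u \<cdot>\<^bsub>E\<^esub> lft (Dom E u))" by simp_all
    from lft_cancel[OF v(4)] v(1-3) show "v = lfac (u \<cdot>\<^bsub>E\<^esub> lft (Dom E u))" by simp
  qed simp
  finally show ?thesis .
qed

lemma iR_simps [simp]:
  assumes "u \<in> Arr E"
  shows "Fa I u \<in> Arr E" "Dom E (Fa I u) = Fo I (Dom E u)" "Cod E (Fa I u) = Fo I (Cod E u)" "Fa p (Fa I u) = Idn A z"
    "e = Cod E u \<Longrightarrow> lft e \<cdot>\<^bsub>E\<^esub> Fa I u = u \<cdot>\<^bsub>E\<^esub> lft (Dom E u)"
    "\<lbrakk>e = Cod E u; r \<in> Arr E; Cod E r = Fo I (Dom E u)\<rbrakk> \<Longrightarrow> lft e \<cdot>\<^bsub>E\<^esub> (Fa I u \<cdot>\<^bsub>E\<^esub> r) = u \<cdot>\<^bsub>E\<^esub> (lft (Dom E u) \<cdot>\<^bsub>E\<^esub> r)"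
  using assms by (simp_all add: iR_Fa)

lemma iR: "is_functor E E0 I"
proof (rule functorI)
  show "Fo I \<in> extensional (Obj E)" "Fa I \<in> extensional (Arr E)" by (auto simp: iR_def Let_def)
  show "Fa I (Idn E x) = Idn E0 (Fo I x)" if "x \<in> Obj E" for x
    by (rule lft_cancel[of x]) (use that in auto)
  show "Fa I (g \<cdot>\<^bsub>E\<^esub> f) = Fa I g \<cdot>\<^bsub>E0\<^esub> Fa I f" if "f \<in> Arr E" "g \<in> Arr E" "Cod E f = Dom E g" for f g
    by (rule lft_cancel[of "Cod E g"]) (use that in auto)
qed auto

lemma fibre_iso:
  assumes "is_iso E v" "Fo p (Dom E v) = z" "Fo p (Cod E v) = z"
  shows "is_iso E0 v"
  using inv_arr[OF assms(1)] assms vertical[of v] vertical[of "inv_arr E v"]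
  by (intro is_isoI[of v _ "Dom E v" "Cod E v" "inv_arr E v"]) auto

text \<open>\<open>u\<close> after the lift at its source and the lift at its target are cartesian
  over the same arrow out of \<open>z\<close>; \<open>Fa I u\<close> is the comparison between
  them.\<close>

lemma iR_cartesian:
  assumes c: "cartesian A E p u"
  shows "is_iso E0 (Fa I u)"
proof -
  note u [simp] = cartesianD(1)[OF c]
  have c1: "cartesian A E p (u \<cdot>\<^bsub>E\<^esub> lft (Dom E u))"
    by (rule cartesian_comp[OF A E p c lft_cartesian]) auto
  have eq: "Fa p (u \<cdot>\<^bsub>E\<^esub> lft (Dom E u)) = Fa p (lft (Cod E u))"
    by (rule initial_unique[OF z A]) (use init_arr[OF z] in auto)
  obtain v where v: "arr E v (Fo I (Dom E u)) (Fo I (Cod E u))" "is_iso E v"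
    "lft (Cod E u) \<cdot>\<^bsub>E\<^esub> v = u \<cdot>\<^bsub>E\<^esub> lft (Dom E u)"
    by (rule cartesian_unique[OF A E p c1 lft_cartesian[of "Cod E u"] _ eq]) auto
  have "Fa I u = v" by (rule lft_cancel[of "Cod E u"]) (use v in auto)
  with v fibre_iso[OF v(2)] show ?thesis by simp
qed

text \<open>The lift lies over an endomorphism of \<open>z\<close>, hence over an identity. It is
  the isomorphism by which \<open>i\<^sub>R\<close> on the initial fibre differs from the
  identity.\<close>

lemma lft_iso:
  assumes "x \<in> Obj E" "Fo p x = z"
  shows "is_iso E0 (lft x)"
proof -
  have "Fa p (lft x) = Idn A z" by (rule vertical) (use assms in auto)
  then have "is_iso E (lft x)" by (intro cartesian_iso[OF A E p lft_cartesian]) (use assms in auto)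
  then show ?thesis by (rule fibre_iso) (use assms in auto)
qed

section \<open>Sums with \<open>p\<^sub>L a\<close> and the adjunction they define\<close>

lemma coproduct:
  assumes "a \<in> Obj A" "x \<in> Obj E" "Fo p x = z"
  shows "is_coproduct E (Fo (PL D) a) x (inl a x) (inr a x)"
  using prune_data assms by (auto simp: is_prune_data_def)

lemma coproduct_simps [simp]:
  assumes "a \<in> Obj A" "x \<in> Obj E" "Fo p x = z"
  shows "inl a x \<in> Arr E" "inr a x \<in> Arr E" "Dom E (inl a x) = Fo (PL D) a" "Dom E (inr a x) = x"
    "Cod E (inr a x) = Cod E (inl a x)" "Fa p (inl a x) = Idn A a" "Fo p (Cod E (inl a x)) = a"
    "Cod E (inl a x) \<in> Obj E"
proof -
  note c = is_coproductD(1-5)[OF coproduct[OF assms]]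
  show "inl a x \<in> Arr E" "inr a x \<in> Arr E" "Dom E (inl a x) = Fo (PL D) a" "Dom E (inr a x) = x"
    "Cod E (inr a x) = Cod E (inl a x)" "Cod E (inl a x) \<in> Obj E" using c by auto
  show 1: "Fa p (inl a x) = Idn A a" using prune_data assms by (auto simp: is_prune_data_def)
  show "Fo p (Cod E (inl a x)) = a" using functor_simps(4)[OF p c(1)] 1 assms by simp
qed

lemma AN [simp]:
  assumes "a \<in> Obj A" "x \<in> Obj E" "Fo p x = z"
  shows "AN PD a x = lfac (inr a x)"
proof -
  have "AN PD a x = (THE v. v \<in> hom E0 x (Fo I (Cod E (inl a x))) \<and> lft (Cod E (inl a x)) \<cdot>\<^bsub>E\<^esub> v = inr a x)"
    using assms by (simp add: pruned_adj_def sum_unit_def Let_def)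
  also have "\<dots> = lfac (inr a x)"
  proof (rule the_equality)
    fix v assume "v \<in> hom E0 x (Fo I (Cod E (inl a x))) \<and> lft (Cod E (inl a x)) \<cdot>\<^bsub>E\<^esub> v = inr a x"
    then have v: "v \<in> Arr E" "Dom E v = x" "Cod E v = Fo I (Cod E (inl a x))"
      "lft (Cod E (inl a x)) \<cdot>\<^bsub>E\<^esub> v = lft (Cod E (inl a x)) \<cdot>\<^bsub>E\<^esub> lfac (inr a x)" using assms by simp_all
    from lft_cancel[OF v(4)] v(1-3) assms show "v = lfac (inr a x)" by simp
  qed (use assms in simp)
  finally show ?thesis .
qed

lemma copair_simps [simp]:
  assumes "a \<in> Obj A" "x \<in> Obj E" "Fo p x = z" "f \<in> Arr E" "g \<in> Arr E" "Dom E f = Fo (PL D) a" "Dom E g = x" "Cod E f = Cod E g"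
  shows "copair E (inl a x) (inr a x) f g \<in> Arr E" "Dom E (copair E (inl a x) (inr a x) f g) = Cod E (inl a x)"
    "Cod E (copair E (inl a x) (inr a x) f g) = Cod E g" "copair E (inl a x) (inr a x) f g \<cdot>\<^bsub>E\<^esub> inl a x = f"
    "copair E (inl a x) (inr a x) f g \<cdot>\<^bsub>E\<^esub> inr a x = g" "Fa p (copair E (inl a x) (inr a x) f g) = Fa p f"
proof -
  note c = copair[OF coproduct[OF assms(1-3)] assms(4-8)]
  show "copair E (inl a x) (inr a x) f g \<in> Arr E" "Dom E (copair E (inl a x) (inr a x) f g) = Cod E (inl a x)"
    "Cod E (copair E (inl a x) (inr a x) f g) = Cod E g" "copair E (inl a x) (inr a x) f g \<cdot>\<^bsub>E\<^esub> inl a x = f"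
    "copair E (inl a x) (inr a x) f g \<cdot>\<^bsub>E\<^esub> inr a x = g" using c assms by auto
  have "Fa p (copair E (inl a x) (inr a x) f g \<cdot>\<^bsub>E\<^esub> inl a x) = Fa p (copair E (inl a x) (inr a x) f g)"
    using c(1-3) assms by simp
  then show "Fa p (copair E (inl a x) (inr a x) f g) = Fa p f" using c by simp
qed

text \<open>On the summand \<open>p\<^sub>L a\<close> an arrow is determined by its image in
  \<open>A\<close>, so only the component on \<open>x\<close> has to be compared.\<close>

lemma sum_ext:
  assumes "h \<in> Arr E" "h' \<in> Arr E" "a \<in> Obj A" "x \<in> Obj E" "Fo p x = z" "Dom E h = Cod E (inl a x)" "Dom E h' = Cod E (inl a x)"
    "Cod E h = Cod E h'" "Fa p h = Fa p h'" "h \<cdot>\<^bsub>E\<^esub> inr a x = h' \<cdot>\<^bsub>E\<^esub> inr a x"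
  shows "h = h'"
proof (rule coproduct_ext[OF E coproduct[OF assms(3-5)]])
  show "h \<cdot>\<^bsub>E\<^esub> inl a x = h' \<cdot>\<^bsub>E\<^esub> inl a x"
    by (rule PL_unique[of _ _ a]) (use assms in auto)
qed (use assms in auto)

text \<open>An arrow from the sum to \<open>e\<close> is an arrow out of \<open>p\<^sub>L a\<close>,
  which amounts to \<open>f\<close>, together with an arrow out of \<open>x\<close>, which factors
  through the lift at \<open>e\<close> and so amounts to \<open>g\<close>.\<close>

lemma core: "par_adj_core A PD"
proof
  fix a x assume "a \<in> Obj A" "x \<in> Obj (AX PD)"
  then show "AS PD a x \<in> Obj (AE PD)" "Fo (AP PD) (AS PD a x) = a" by auto
  show "arr (AX PD) (AN PD a x) x (Fo (AU PD) (AS PD a x))" using \<open>a \<in> Obj A\<close> \<open>x \<in> Obj (AX PD)\<close> by auto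
next
  fix a x e f g assume *: "a \<in> Obj A" "x \<in> Obj (AX PD)" "e \<in> Obj (AE PD)" "arr A f a (Fo (AP PD) e)" "arr (AX PD) g x (Fo (AU PD) e)"
  note [simp] = functor_simps(5,6)[OF iR, simplified]
  let ?h = "copair E (inl a x) (inr a x) (PCounit D e \<cdot>\<^bsub>E\<^esub> Fa (PL D) f) (lft e \<cdot>\<^bsub>E\<^esub> g)"
  show "\<exists>!h. arr (AE PD) h (AS PD a x) e \<and> Fa (AP PD) h = f \<and> Fa (AU PD) h \<cdot>\<^bsub>AX PD\<^esub> AN PD a x = g"
  proof (rule ex1I[of _ ?h])
    have "Fa I ?h \<cdot>\<^bsub>E\<^esub> lfac (inr a x) = g"
      by (rule lft_cancel[of e]) (use * in auto)
    then show "arr (AE PD) ?h (AS PD a x) e \<and> Fa (AP PD) ?h = f \<and> Fa (AU PD) ?h \<cdot>\<^bsub>AX PD\<^esub> AN PD a x = g"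
      using * by simp
    fix h assume h: "arr (AE PD) h (AS PD a x) e \<and> Fa (AP PD) h = f \<and> Fa (AU PD) h \<cdot>\<^bsub>AX PD\<^esub> AN PD a x = g"
    then have h': "h \<in> Arr E" "Dom E h = Cod E (inl a x)" "Cod E h = e" and g: "Fa I h \<cdot>\<^bsub>E\<^esub> lfac (inr a x) = g"
      using * by simp_all
    have "lft e \<cdot>\<^bsub>E\<^esub> (Fa I h \<cdot>\<^bsub>E\<^esub> lfac (inr a x)) = h \<cdot>\<^bsub>E\<^esub> inr a x" using * h' by simp
    then have "h \<cdot>\<^bsub>E\<^esub> inr a x = lft e \<cdot>\<^bsub>E\<^esub> g" unfolding g by simp
    note hi = this
    have hp: "Fa p h = f" using h by simp
    show "h = ?h"
    proof (rule sum_ext[of _ _ a x])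
      show "h \<cdot>\<^bsub>E\<^esub> inr a x = ?h \<cdot>\<^bsub>E\<^esub> inr a x" unfolding hi using * by simp
    qed (use * h' hp in simp_all)
  qed
qed (use p iR in auto)

interpretation K: par_adj_core A PD by (rule core)

text \<open>A dictionary: the definitions of the sum functor and its counit speak of copairings, the
  calculus of adjunctions over \<open>A\<close> speaks of transposes.\<close>

lemma copair_pext:
  assumes "a \<in> Obj A" "x \<in> Obj E" "Fo p x = z" "f \<in> Arr E" "g \<in> Arr E" "Dom E f = Fo (PL D) a" "Dom E g = x" "Cod E f = Cod E g"
  shows "copair E (inl a x) (inr a x) f g = pext PD a x (Cod E g) (Fa p f) (lfac g)"
proof -
  have x: "x \<in> Obj (AX PD)" "Cod E g \<in> Obj (AE PD)" using assms by auto
  have 0: "Cod A (Fa p f) = Fo (AP PD) (Cod E g)" "Cod (AX PD) (lfac g) = Fo (AU PD) (Cod E g)" "lfac g \<in> Arr (AX PD)"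
    "Fa p f \<in> Arr A" "Dom A (Fa p f) = a" "Dom (AX PD) (lfac g) = x"
    using assms by auto
  define P where "P = pext PD a x (Cod E g) (Fa p f) (lfac g)"
  note k = K.pext[OF assms(1) x 0(4,5,1,3,6,2), folded P_def]
  have k': "P \<in> Arr E" "Dom E P = Cod E (inl a x)" "Cod E P = Cod E g" "Fa p P = Fa p f"
    using k(1-4) by auto
  have k5: "Fa I P \<cdot>\<^bsub>E\<^esub> lfac (inr a x) = lfac g" using k(5) assms by simp
  have "lft (Cod E g) \<cdot>\<^bsub>E\<^esub> (Fa I P \<cdot>\<^bsub>E\<^esub> lfac (inr a x)) = P \<cdot>\<^bsub>E\<^esub> inr a x" using assms k' by simp
  then have Pi: "P \<cdot>\<^bsub>E\<^esub> inr a x = g" unfolding k5 using assms by simp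
  show ?thesis unfolding P_def[symmetric]
  proof (rule sum_ext[of _ _ a x])
    show "copair E (inl a x) (inr a x) f g \<cdot>\<^bsub>E\<^esub> inr a x = P \<cdot>\<^bsub>E\<^esub> inr a x"
      unfolding Pi using assms by simp
  qed (use assms k' in simp_all)
qed

lemma lfac_comp_lft: "g \<in> Arr E \<Longrightarrow> Fo p (Dom E g) = z \<Longrightarrow> e \<in> Obj E \<Longrightarrow> Cod E g = Fo I e \<Longrightarrow> lfac (lft e \<cdot>\<^bsub>E\<^esub> g) = g"
  by (rule lft_cancel[of e]) auto

lemma sum_functor: "pL_plus_i A z E p =
  \<lparr>Fo = (\<lambda>(a, x)\<in>Obj (A \<times>\<^sub>C AX PD). AS PD a x), Fa = (\<lambda>(f, g)\<in>Arr (A \<times>\<^sub>C AX PD). psum A PD f g)\<rparr>"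
proof -
  have "copair E (inl (Dom A f) (Dom E g)) (inr (Dom A f) (Dom E g))
         (inl (Cod A f) (Cod E g) \<cdot>\<^bsub>E\<^esub> Fa (PL D) f) (inr (Cod A f) (Cod E g) \<cdot>\<^bsub>E\<^esub> g) = psum A PD f g"
    if f: "f \<in> Arr A" and g: "g \<in> Arr E" "Fa p g = Idn A z" for f g
  proof -
    have [simp]: "Fo p (Dom E g) = z" "Fo p (Cod E g) = z"
      using functor_simps(3,4)[OF p g(1)] g by auto
    have e: "lfac (inr (Cod A f) (Cod E g) \<cdot>\<^bsub>E\<^esub> g) = lfac (inr (Cod A f) (Cod E g)) \<cdot>\<^bsub>E\<^esub> g"
      by (rule lft_cancel[of "Cod E (inl (Cod A f) (Cod E g))"]) (use f g in auto)
    show ?thesis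
      by (subst copair_pext) (use f g in \<open>auto simp: psum_def e\<close>)
  qed
  then show ?thesis
    unfolding pL_plus_i_def Let_def by (auto simp: restrict_def fun_eq_iff)
qed

lemma sum_unit: "sum_unit A z E p = (\<lambda>(a, x)\<in>Obj (A \<times>\<^sub>C AX PD). (Idn A a, AN PD a x))"
  by (auto simp: sum_unit_def pruned_adj_def restrict_def fun_eq_iff Let_def)

lemma sum_counit: "sum_counit A z E p = (\<lambda>e\<in>Obj (AE PD). pcounit A PD e)"
proof -
  have "copair E (inl (Fo p e) (Fo I e)) (inr (Fo p e) (Fo I e)) (PCounit D e) (lft e) = pcounit A PD e"
    if e: "e \<in> Obj E" for e
  proof -
    have "lfac (lft e) = Idn E (Fo I e)" using lfac_comp_lft[of "Idn E (Fo I e)" e] e by simp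
    then show ?thesis
      by (subst copair_pext) (use e in \<open>auto simp: pcounit_def\<close>)
  qed
  then show ?thesis by (auto simp: sum_counit_def restrict_def fun_eq_iff Let_def)
qed

lemma sum_adjunction:
  "adjunction (A \<times>\<^sub>C E0) E (pL_plus_i A z E p) (p_iR A z E p) (sum_unit A z E p) (sum_counit A z E p)"
  using K.adjunction unfolding sum_functor sum_unit sum_counit p_iR_def pruned_adj_simps(1-3,5,6) .

lemma sum_monad_simps:
  assumes "a \<in> Obj A" "x \<in> Obj E" "Fo p x = z"
  shows "Fo (Fun (sum_monad A z E p)) (a, x) = (a, Fo I (AS PD a x))"
    "Unit (sum_monad A z E p) (a, x) = (Idn A a, AN PD a x)"
    "Mult (sum_monad A z E p) (a, x) = (Idn A a, Fa I (pcounit A PD (AS PD a x)))"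
  using assms K.pcounit[of "AS PD a x"]
  by (simp_all add: sum_monad_def adj_monad_def p_iR_def sum_functor sum_unit sum_counit ftor_pair_def)

lemma sum_monad_Fa:
  assumes "f \<in> Arr A" "g \<in> Arr E" "Fa p g = Idn A z"
  shows "Fa (Fun (sum_monad A z E p)) (f, g) = (f, Fa I (psum A PD f g))"
  using assms K.psum[of f g]
  by (simp add: sum_monad_def adj_monad_def p_iR_def sum_functor ftor_pair_def)

lemma data: "par_adj_data A PD"
proof (rule par_adj_data.intro[OF core], unfold_locales)
  fix a x assume "a \<in> Obj A" "x \<in> Obj (AX PD)"
  then show "Fo (PFun (AM PD)) (a, x) = Fo (AU PD) (AS PD a x)" "PUnit (AM PD) (a, x) = AN PD a x"
    "PMult (AM PD) (a, x) = Fa (AU PD) (pcounit A PD (AS PD a x))"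
    using sum_monad_simps[of a x] by (auto simp: Tp_def Let_def)
next
  fix f g assume "f \<in> Arr A" "g \<in> Arr (AX PD)"
  then show "Fa (PFun (AM PD)) (f, g) = Fa (AU PD) (psum A PD f g)"
    using sum_monad_Fa[of f g] by (simp add: Tp_def Let_def)
qed

lemma T_axioms: "param_monad_axioms A T"
proof -
  interpret par_adj_data A PD by (rule data)
  show ?thesis using param_monad_axioms by (simp add: Tp_def Let_def)
qed

lemma par_adj: "par_adj A PD"
  using data T_axioms by (simp add: par_adj_def)

end

sublocale pruned_fib \<subseteq> K: par_adj A "pruned_adj A z E p" by (rule par_adj)

sublocale pruned_fib \<subseteq> T: param_monad_axioms A "Tp A z (E, p)" by (rule T_axioms)

context pruned_fib
begin

section \<open>\<open>T\<^sup>p\<close> over the initial object\<close>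

lemma T_simps:
  assumes "a \<in> Obj A" "x \<in> Obj E" "Fo p x = z"
  shows "Fo (PFun T) (a, x) = Fo I (AS PD a x)" "PUnit T (a, x) = AN PD a x"
    "PMult T (a, x) = Fa I (pcounit A PD (AS PD a x))"
  using K.M_Fo[of a x] K.M_unit[of a x] K.M_mult[of a x] assms by auto

text \<open>A left adjoint preserves initial objects, so the first summand
  \<open>p\<^sub>L z\<close> is initial in all of \<open>E\<close> and adds nothing to
  \<open>x\<close>.\<close>

lemma inr_iso:
  assumes "x \<in> Obj E" "Fo p x = z"
  shows "is_iso E (inr z x)"
proof -
  have i: "initial E (Fo (PL D) z)"
    unfolding initial_def
  proof (intro conjI ballI)
    fix e assume e: "e \<in> Obj E"
    show "\<exists>!f. f \<in> hom E (Fo (PL D) z) e"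
    proof (rule ex1I[of _ "PCounit D e \<cdot>\<^bsub>E\<^esub> Fa (PL D) (init_arr A z (Fo p e))"])
      fix f assume f: "f \<in> hom E (Fo (PL D) z) e"
      show "f = PCounit D e \<cdot>\<^bsub>E\<^esub> Fa (PL D) (init_arr A z (Fo p e))"
        by (rule PL_unique[of _ _ z]) (use f e init_arr[OF z] initial_unique[OF z A, of "Fa p f"] in auto)
    qed (use e init_arr[OF z] in auto)
  qed auto
  \<comment> \<open>The summands are exchanged so that the initial one comes second, as in
    \<open>coproduct_initial\<close>.\<close>
  have "is_coproduct E x (Fo (PL D) z) (inr z x) (inl z x)"
  proof (rule is_coproductI)
    note c = coproduct[OF zA assms]
    fix f g assume *: "f \<in> Arr E" "g \<in> Arr E" "Dom E f = x" "Dom E g = Fo (PL D) z" "Cod E f = Cod E g"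
    then show "\<exists>h. arr E h (Cod E (inl z x)) (Cod E f) \<and> h \<cdot>\<^bsub>E\<^esub> inr z x = f \<and> h \<cdot>\<^bsub>E\<^esub> inl z x = g"
      using assms by (intro exI[of _ "copair E (inl z x) (inr z x) g f"]) simp
  next
    fix h h' assume *: "h \<in> Arr E" "h' \<in> Arr E" "Dom E h = Cod E (inl z x)" "Dom E h' = Cod E (inl z x)" "Cod E h = Cod E h'"
      "h \<cdot>\<^bsub>E\<^esub> inr z x = h' \<cdot>\<^bsub>E\<^esub> inr z x" "h \<cdot>\<^bsub>E\<^esub> inl z x = h' \<cdot>\<^bsub>E\<^esub> inl z x"
    show "h = h'" by (rule coproduct_ext[OF E coproduct[OF zA assms] *(1-5) *(7) *(6)])
  qed (use assms in auto)
  then show ?thesis by (rule coproduct_initial[OF E i])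
qed

lemma initial_fibre: "initial E0 (Fo (PL D) z)"
  unfolding initial_def
proof (intro conjI ballI)
  fix e assume e: "e \<in> Obj E0"
  show "\<exists>!f. f \<in> hom E0 (Fo (PL D) z) e"
  proof (rule ex1I[of _ "PCounit D e"])
    fix f assume f: "f \<in> hom E0 (Fo (PL D) z) e"
    show "f = PCounit D e"
      by (rule PL_unique[of _ _ z]) (use f e in simp_all)
  qed (use e in simp)
qed auto

text \<open>The unit at \<open>x\<close> is the factor of \<open>inr z x\<close> through a lift, and
  over \<open>z\<close> both of these are invertible.\<close>

lemma T_unit_iso:
  assumes "x \<in> Obj E" "Fo p x = z"
  shows "is_iso E0 (PUnit T (z, x))"
proof -
  have 1: "is_iso E0 (inr z x)" by (rule fibre_iso[OF inr_iso[OF assms]]) (use assms in auto)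
  have "is_iso E0 (lfac (inr z x))"
    by (rule iso_left[OF E0 lft_iso[of "Cod E (inl z x)"]]) (use assms 1 in auto)
  then show ?thesis using T_simps[of z x] assms by simp
qed

lemma T_pruned: "pruned_monad A z T"
  unfolding pruned_monad_def
proof (intro conjI)
  show "param_monad A T" by (rule T.param_monad)
  show "\<exists>i. initial (Carr T) i" using initial_fibre by auto
  let ?t = "\<lambda>x\<in>Obj E0. inv_arr E0 (PUnit T (z, x))"
  have i: "is_iso (Carr T) (PUnit T (z, x))" if "x \<in> Obj E0" for x using T_unit_iso that by simp
  show "isomorphic_monads (Carr T) (monad_at A T z) (id_monad (Carr T))"
  proof -
    let ?X = "Carr T" and ?\<eta> = "\<lambda>x. PUnit T (z, x)"
    have X: "category ?X" by simp
    have i': "is_iso ?X (?\<eta> x)" if "x \<in> Obj ?X" for x using i that by simp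
    note inv [simp] = inv_arr[OF i'] 
    have invd [simp]: "Dom ?X (inv_arr ?X (?\<eta> x)) = Fo (PFun T) (z, x)" "Cod ?X (inv_arr ?X (?\<eta> x)) = x" if "x \<in> Obj ?X" for x
      using inv[OF that] T.unit[OF zA that] by auto
    \<comment> \<open>Compatibility with units leaves no choice: an isomorphism to the identity
      monad has to be inverse to the unit.\<close>
    let ?t = "\<lambda>x\<in>Obj ?X. inv_arr ?X (?\<eta> x)"
    have F: "is_functor ?X ?X (Fun (monad_at A T z))"
      using T.param_monad by (auto simp: param_monad_def is_monad_def nat_trans_def)
    have nat: "inv_arr ?X (?\<eta> (Cod ?X g)) \<cdot>\<^bsub>?X\<^esub> Fa (PFun T) (Idn A z, g) = g \<cdot>\<^bsub>?X\<^esub> inv_arr ?X (?\<eta> (Dom ?X g))"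
      if g: "g \<in> Arr ?X" for g
    proof (rule iso_epi[OF X i'[of "Dom ?X g"]])
      show "(inv_arr ?X (?\<eta> (Cod ?X g)) \<cdot>\<^bsub>?X\<^esub> Fa (PFun T) (Idn A z, g)) \<cdot>\<^bsub>?X\<^esub> ?\<eta> (Dom ?X g) =
        (g \<cdot>\<^bsub>?X\<^esub> inv_arr ?X (?\<eta> (Dom ?X g))) \<cdot>\<^bsub>?X\<^esub> ?\<eta> (Dom ?X g)"
        using g X inv(4)[of "Cod ?X g", THEN reassoc, of g] inv(4)[of "Dom ?X g"] T.unit[OF zA, of "Dom ?X g"] T.unit[OF zA, of "Cod ?X g"]
        by (simp del: pruned_adj_simps(6) fibre_simps)
    qed (use g X in \<open>simp_all del: pruned_adj_simps(6) fibre_simps\<close>)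
    \<comment> \<open>By the unit law the multiplication at \<open>x\<close> is the inverse of the
      unit at \<open>T x\<close>. With the inverse of the unit at \<open>x\<close> in front, this is
      compatibility with the multiplication of the identity monad.\<close>
    have mult: "inv_arr ?X (?\<eta> x) \<cdot>\<^bsub>?X\<^esub> PMult T (z, x) = inv_arr ?X (?\<eta> x) \<cdot>\<^bsub>?X\<^esub> inv_arr ?X (?\<eta> (Fo (PFun T) (z, x)))"
      if x: "x \<in> Obj ?X" for x
    proof -
      have "PMult T (z, x) = inv_arr ?X (?\<eta> (Fo (PFun T) (z, x)))"
        by (rule iso_epi[OF X i'[of "Fo (PFun T) (z, x)"]])
          (use x X inv(4)[of "Fo (PFun T) (z, x)"] in \<open>simp_all del: pruned_adj_simps(6) fibre_simps\<close>)
      then show ?thesis by simp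
    qed
    have "monad_morphism ?X (monad_at A T z) (id_monad ?X) ?t"
      unfolding monad_morphism_def
    proof (intro conjI ballI nat_transI)
      show "is_functor ?X ?X (Fun (id_monad ?X))" using X by (simp add: id_monad_def)
    qed (use F X nat mult in \<open>simp_all del: pruned_adj_simps(6) fibre_simps add: monad_at_def id_monad_def\<close>)
    then show ?thesis unfolding isomorphic_monads_def
      using is_iso_inv[OF i'] by (intro exI[of _ ?t]) (simp del: pruned_adj_simps(6) fibre_simps)
  qed
qed

section \<open>The unit and the monad on the product with the initial fibre\<close>

lemma unit_fibred: "fibred_functor A (E, p) (emf A T) (pcompar A PD)"
  unfolding emf_def fibred_functor_def prod.case
proof (intro conjI allI impI)
  show "is_functor E (emf_cat A T) (pcompar A PD)" using K.pcompar_functor by simp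
  show "ftor_comp E (emf_proj A T) (pcompar A PD) = p" using K.pcompar_proj by simp
  fix \<phi> assume c: "cartesian A E p \<phi>"
  \<comment> \<open>The carrier part of the image is \<open>i\<^sub>R \<phi>\<close>, which is
    invertible because \<phi> is cartesian.\<close>
  show "cartesian A (emf_cat A T) (emf_proj A T) (Fa (pcompar A PD) \<phi>)"
    by (rule T.emf_cartesianI)
      (use K.pcompar_Arr[of \<phi>] cartesianD(1)[OF c] iR_cartesian[OF c] in \<open>simp_all del: emf_ArrI K.pcompar_simps(1)\<close>)
qed

lemma unit_comparison:
  "ftor_comp E (emf_to_em A z (E, p)) (pcompar A PD) = comparison E (p_iR A z E p) (sum_counit A z E p)"
proof -
  have o: "Fo (ftor_comp E (emf_to_em A z (E, p)) (pcompar A PD)) e = Fo (comparison E (p_iR A z E p) (sum_counit A z E p)) e"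
    if e: "e \<in> Obj E" for e
    using e K.pcompar_Obj[of e] K.pcounit[of e]
    by (simp del: emf_ObjI add: emf_to_em_def Let_def comparison_def p_iR_def sum_counit ftor_pair_def)
  show ?thesis
  proof (rule ftor_eqI[of _ "Obj E" _ "Arr E"])
    fix u assume u: "u \<in> Arr E"
    have "Fa (ftor_comp E (emf_to_em A z (E, p)) (pcompar A PD)) u =
      (Fo (ftor_comp E (emf_to_em A z (E, p)) (pcompar A PD)) (Dom E u),
       Fo (ftor_comp E (emf_to_em A z (E, p)) (pcompar A PD)) (Cod E u), (Fa p u, Fa I u))"
      using u K.pcompar_Arr[of u] K.pcompar_Obj[of "Dom E u"] K.pcompar_Obj[of "Cod E u"]
      by (simp del: emf_ObjI emf_ArrI add: emf_to_em_def Let_def)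
    then show "Fa (ftor_comp E (emf_to_em A z (E, p)) (pcompar A PD)) u = Fa (comparison E (p_iR A z E p) (sum_counit A z E p)) u"
      using o u by (simp add: comparison_def Let_def p_iR_def ftor_pair_def del: ftor_comp_simps)
  qed (use o in \<open>auto simp: comparison_def Let_def\<close>)
qed

lemma sum_monad_T:
  assumes "a \<in> Obj A" "x \<in> Obj E0"
  shows "Fo (Fun (sum_monad A z E p)) (a, x) = (a, Fo (PFun T) (a, x))"
    "Unit (sum_monad A z E p) (a, x) = (Idn A a, PUnit T (a, x))"
    "Mult (sum_monad A z E p) (a, x) = (Idn A a, PMult T (a, x))"
  using sum_monad_simps[of a x] T_simps[of a x] assms by auto

lemma sum_monad_T_Fa:
  assumes "f \<in> Arr A" "g \<in> Arr E0"
  shows "Fa (Fun (sum_monad A z E p)) (f, g) = (f, Fa (PFun T) (f, g))"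
  using sum_monad_Fa[of f g] K.M_Fa[of f g] assms by auto

text \<open>The unit of the monad on the product has identities as its components in
  \<open>A\<close>, so the unit law forces \<open>h\<close> to be an identity; what remains are the
  algebra laws of \<open>T\<^sup>p\<close> at \<open>a\<close>.\<close>

lemma em_algebra_sum_monad:
  "em_algebra (A \<times>\<^sub>C E0) (sum_monad A z E p) (a, x) (h, \<xi>) \<longleftrightarrow>
     h = Idn A a \<and> utriple a x \<xi> \<in> Obj (emf_cat A T)"
\<comment> \<open>If the pair is not typed as an action on \<open>(a, x)\<close>, both sides are
  false.\<close>
proof (cases "a \<in> Obj A \<and> x \<in> Obj E0 \<and> arr A h a a \<and> arr E0 \<xi> (Fo (PFun T) (a, x)) x")
  case True
  then have "a \<in> Obj A" "x \<in> Obj E0" "h \<in> Arr A" "Dom A h = a" "Cod A h = a" "\<xi> \<in> Arr E0" by auto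
  note s = sum_monad_T[OF this(1,2)] sum_monad_T_Fa[OF this(3,6)] this True
  show ?thesis
  proof (cases "h = Idn A a")
    case h: True
    then show ?thesis unfolding em_algebra_def using s by (simp del: fibre_simps(1,2))
  next
    case h: False
    then show ?thesis unfolding em_algebra_def using s by (simp del: fibre_simps(1,2))
  qed
next
  case False
  then show ?thesis unfolding em_algebra_def using sum_monad_T(1)[of a x]
    by (auto simp del: fibre_simps)
qed

lemma emf_to_em_iso:
  "cat_isomorphism (emf_cat A T) (em_cat (A \<times>\<^sub>C E0) (sum_monad A z E p)) (emf_to_em A z (E, p))"
proof -
  let ?M = "emf_cat A T" and ?N = "em_cat (A \<times>\<^sub>C E0) (sum_monad A z E p)" and ?G = "emf_to_em A z (E, p)"
  have Go: "Fo ?G s = ((par s, car s), (Idn A (par s), str s))" if s: "s \<in> Obj ?M" for s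
  proof -
    obtain a x \<xi> where "s = utriple a x \<xi>" using emf_ObjD(8)[OF s] by metis
    then show ?thesis using s by (simp del: emf_ObjI add: emf_to_em_def Let_def)
  qed
  have Ga: "Fa ?G u = (Fo ?G (uarr_dom u), Fo ?G (uarr_cod u), (uarr_fst u, uarr_snd u))" if "u \<in> Arr ?M" for u
    using that emf_ArrD(1,2)[OF that] by (simp del: emf_ObjI emf_ArrI add: emf_to_em_def Let_def)
  have Ob: "Obj ?N = {((a, x), (h, \<xi>)) | a x h \<xi>. h = Idn A a \<and> utriple a x \<xi> \<in> Obj ?M}"
    unfolding em_cat_def using em_algebra_sum_monad by auto
  \<comment> \<open>Both categories have the same arrows up to bracketing: the arrow conditions
    agree because the monad on the product acts as the identity on parameters.\<close>
  have Ar: "((s, t, k) \<in> Arr ?N) \<longleftrightarrow> s \<in> Obj ?N \<and> t \<in> Obj ?N \<and>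
      uarrow (utriple (fst (fst s)) (snd (fst s)) (snd (snd s))) (utriple (fst (fst t)) (snd (fst t)) (snd (snd t))) (fst k) (snd k) \<in> Arr ?M" for s t k
  proof -
    obtain a x h \<xi> b y h' \<theta> f g where s: "s = ((a, x), (h, \<xi>))" and t: "t = ((b, y), (h', \<theta>))" and k: "k = (f, g)"
      by (metis surj_pair)
    have "((s, t, k) \<in> Arr ?N) \<longleftrightarrow> s \<in> Obj ?N \<and> t \<in> Obj ?N \<and> arr (A \<times>\<^sub>C E0) k (a, x) (b, y) \<and>
       k \<cdot>\<^bsub>A \<times>\<^sub>C E0\<^esub> (h, \<xi>) = (h', \<theta>) \<cdot>\<^bsub>A \<times>\<^sub>C E0\<^esub> Fa (Fun (sum_monad A z E p)) k"
      unfolding s t k by (auto simp: em_cat_def)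
    also have "\<dots> \<longleftrightarrow> s \<in> Obj ?N \<and> t \<in> Obj ?N \<and>
      uarrow (utriple (fst (fst s)) (snd (fst s)) (snd (snd s))) (utriple (fst (fst t)) (snd (fst t)) (snd (snd t))) (fst k) (snd k) \<in> Arr ?M"
      unfolding s t k Ob using sum_monad_T_Fa[of f g] by (auto simp del: fibre_simps(1,2) emf_ObjI)
    finally show ?thesis .
  qed
  have D: "Dom ?N (s, t, k) = s" "Cod ?N (s, t, k) = t" "Idn ?N s = (s, s, Idn (A \<times>\<^sub>C E0) (fst s))"
     "(s', t', k') \<cdot>\<^bsub>?N\<^esub> (s, t, k) = (s, t', k' \<cdot>\<^bsub>A \<times>\<^sub>C E0\<^esub> k)" for s t k s' t' k'
    by (auto simp: em_cat_def)
  have GO: "Fo ?G s \<in> Obj ?N" if s: "s \<in> Obj ?M" for s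
    unfolding Go[OF s] Ob using s emf_ObjD(8)[OF s] by (auto simp del: emf_ObjI)
  have GA: "Fa ?G u \<in> Arr ?N" if u: "u \<in> Arr ?M" for u
    unfolding Ga[OF u] Ar using GO[OF emf_ArrD(1)[OF u]] GO[OF emf_ArrD(2)[OF u]] u emf_ArrD(10)[OF u]
      emf_ObjD(8)[OF emf_ArrD(1)[OF u]] emf_ObjD(8)[OF emf_ArrD(2)[OF u]]
    by (simp add: Go emf_ArrD(1,2)[OF u] del: emf_ArrI emf_ObjI)
  have "is_functor ?M ?N ?G"
  proof (rule functorI)
    show "Fo ?G \<in> extensional (Obj ?M)" "Fa ?G \<in> extensional (Arr ?M)" by (auto simp: emf_to_em_def Let_def)
    show "s \<in> Obj ?M \<Longrightarrow> Fo ?G s \<in> Obj ?N" for s by (rule GO)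
    show "u \<in> Arr ?M \<Longrightarrow> arr ?N (Fa ?G u) (Fo ?G (Dom ?M u)) (Fo ?G (Cod ?M u))" for u
      using GA[of u] Ga[of u] D by (simp del: emf_ArrI emf_ObjI)
    fix s assume s: "s \<in> Obj ?M"
    have "Idn ?M s \<in> Arr ?M" using s by (simp del: emf_cat_simps emf_ArrI)
    then show "Fa ?G (Idn ?M s) = Idn ?N (Fo ?G s)"
      using Ga[of "Idn ?M s"] D s by (simp add: Go del: emf_ArrI emf_ObjI)
  next
    fix u v assume u: "u \<in> Arr ?M" and v: "v \<in> Arr ?M" and c: "Cod ?M u = Dom ?M v"
    have "v \<cdot>\<^bsub>?M\<^esub> u \<in> Arr ?M" using u v c by (simp del: emf_cat_simps(4) emf_ArrI)
    then show "Fa ?G (v \<cdot>\<^bsub>?M\<^esub> u) = Fa ?G v \<cdot>\<^bsub>?N\<^esub> Fa ?G u"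
      using u v c Ga[of "v \<cdot>\<^bsub>?M\<^esub> u"] D by (simp add: Ga[OF u] Ga[OF v] del: emf_ArrI emf_ObjI)
  qed
  moreover have "bij_betw (Fo ?G) (Obj ?M) (Obj ?N)"
  proof (rule bij_betw_imageI)
    show "inj_on (Fo ?G) (Obj ?M)"
    proof (rule inj_onI)
      fix s t assume "s \<in> Obj ?M" "t \<in> Obj ?M" "Fo ?G s = Fo ?G t"
      then show "s = t" using emf_ObjD(8)[of s A T] emf_ObjD(8)[of t A T] by (metis Go Pair_inject)
    qed
    show "Fo ?G ` Obj ?M = Obj ?N"
    proof (intro equalityI subsetI)
      fix c assume "c \<in> Obj ?N"
      then obtain a x \<xi> where c: "c = ((a, x), (Idn A a, \<xi>))" "utriple a x \<xi> \<in> Obj ?M" unfolding Ob by blast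
      then have "c = Fo ?G (utriple a x \<xi>)" using Go[OF c(2)] by simp
      with c show "c \<in> Fo ?G ` Obj ?M" by blast
    qed (use GO in blast)
  qed
  moreover have "bij_betw (Fa ?G) (Arr ?M) (Arr ?N)"
  proof (rule bij_betw_imageI)
    show "inj_on (Fa ?G) (Arr ?M)"
    proof (rule inj_onI)
      fix u v assume u: "u \<in> Arr ?M" and v: "v \<in> Arr ?M" and e: "Fa ?G u = Fa ?G v"
      from e have "Fo ?G (uarr_dom u) = Fo ?G (uarr_dom v)" "Fo ?G (uarr_cod u) = Fo ?G (uarr_cod v)"
         "uarr_fst u = uarr_fst v" "uarr_snd u = uarr_snd v"
        unfolding Ga[OF u] Ga[OF v] by auto
      moreover from this have "uarr_dom u = uarr_dom v" "uarr_cod u = uarr_cod v"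
        using calculation(1,2) emf_ObjD(8) emf_ArrD(1,2)[OF u] emf_ArrD(1,2)[OF v] by (metis Go Pair_inject)+
      ultimately show "u = v" by (intro emf_eqI[OF u v])
    qed
    show "Fa ?G ` Arr ?M = Arr ?N"
    proof (intro equalityI subsetI)
      fix c assume c: "c \<in> Arr ?N"
      obtain s t k where stk: "c = (s, t, k)" by (metis surj_pair)
      with c Ar have st: "s \<in> Obj ?N" "t \<in> Obj ?N" and u: "uarrow (utriple (fst (fst s)) (snd (fst s)) (snd (snd s))) (utriple (fst (fst t)) (snd (fst t)) (snd (snd t))) (fst k) (snd k) \<in> Arr ?M"
        by auto
      obtain a x \<xi> where s: "s = ((a, x), (Idn A a, \<xi>))" "utriple a x \<xi> \<in> Obj ?M" using st(1) unfolding Ob by blast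
      obtain b y \<theta> where t: "t = ((b, y), (Idn A b, \<theta>))" "utriple b y \<theta> \<in> Obj ?M" using st(2) unfolding Ob by blast
      have "c = Fa ?G (uarrow (utriple (fst (fst s)) (snd (fst s)) (snd (snd s))) (utriple (fst (fst t)) (snd (fst t)) (snd (snd t))) (fst k) (snd k))"
        unfolding Ga[OF u] stk using s t by (simp add: Go del: emf_ObjI)
      with u show "c \<in> Fa ?G ` Arr ?M" by blast
    qed (use GA in blast)
  qed
  ultimately show ?thesis unfolding cat_isomorphism_def by blast
qed

end


section \<open>Concrete 2-categories\<close>

text \<open>2-categories whose 1-cells \<open>w\<close> have underlying functors \<open>fu w\<close> between the underlying categories
  \<open>Ct\<close> and whose 2-cells are natural transformations of these. Both \<open>Fib\<close> and \<open>PrMnd\<close> are of this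
  form.\<close>

definition conc_hom ::
  "('o \<Rightarrow> ('p, 'n) cat) \<Rightarrow> ('m \<Rightarrow> ('p, 'n, 'p, 'n) ftor) \<Rightarrow> ('o \<Rightarrow> 'o \<Rightarrow> 'm \<Rightarrow> bool) \<Rightarrow>
   ('o \<Rightarrow> 'o \<Rightarrow> 'm \<Rightarrow> 'm \<Rightarrow> ('p \<Rightarrow> 'n) \<Rightarrow> bool) \<Rightarrow> 'o \<Rightarrow> 'o \<Rightarrow> ('m, 'm \<times> 'm \<times> ('p \<Rightarrow> 'n)) cat" where
  "conc_hom Ct fu is1 is2 a b =
     \<lparr>Obj = {w. is1 a b w}, Arr = {(v, w, t). is1 a b v \<and> is1 a b w \<and> is2 a b v w t},
      Dom = (\<lambda>(v, w, t). v), Cod = (\<lambda>(v, w, t). w),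
      Idn = (\<lambda>w. (w, w, \<lambda>x\<in>Obj (Ct a). Idn (Ct b) (Fo (fu w) x))),
      Cmp = (\<lambda>(v', w', t') (v, w, t). (v, w', \<lambda>x\<in>Obj (Ct a). t' x \<cdot>\<^bsub>Ct b\<^esub> t x))\<rparr>"

definition conc ::
  "'o set \<Rightarrow> ('o \<Rightarrow> ('p, 'n) cat) \<Rightarrow> ('m \<Rightarrow> ('p, 'n, 'p, 'n) ftor) \<Rightarrow> ('o \<Rightarrow> 'o \<Rightarrow> 'm \<Rightarrow> bool) \<Rightarrow>
   ('o \<Rightarrow> 'o \<Rightarrow> 'm \<Rightarrow> 'm \<Rightarrow> ('p \<Rightarrow> 'n) \<Rightarrow> bool) \<Rightarrow> ('o \<Rightarrow> 'm) \<Rightarrow> ('o \<Rightarrow> 'o \<Rightarrow> 'o \<Rightarrow> 'm \<Rightarrow> 'm \<Rightarrow> 'm) \<Rightarrow>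
   ('o, 'm, 'm \<times> 'm \<times> ('p \<Rightarrow> 'n)) twocat" where
  "conc Ob Ct fu is1 is2 id1 cmp =
     \<lparr>Ob2 = Ob, Hom2 = conc_hom Ct fu is1 is2, Id2 = id1,
      Comp2 = (\<lambda>a b c.
        \<lparr>Fo = (\<lambda>(g, f) \<in> Obj (conc_hom Ct fu is1 is2 b c \<times>\<^sub>C conc_hom Ct fu is1 is2 a b). cmp a b c g f),
         Fa = (\<lambda>((g, g', s), (f, f', t)) \<in> Arr (conc_hom Ct fu is1 is2 b c \<times>\<^sub>C conc_hom Ct fu is1 is2 a b).
                 (cmp a b c g f, cmp a b c g' f', \<lambda>x\<in>Obj (Ct a). s (Fo (fu f') x) \<cdot>\<^bsub>Ct c\<^esub> Fa (fu g) (t x)))\<rparr>)\<rparr>"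

lemma conc_hom_simps [simp]:
  "w \<in> Obj (conc_hom Ct fu is1 is2 a b) \<longleftrightarrow> is1 a b w"
  "(v, w, t) \<in> Arr (conc_hom Ct fu is1 is2 a b) \<longleftrightarrow> is1 a b v \<and> is1 a b w \<and> is2 a b v w t"
  "Dom (conc_hom Ct fu is1 is2 a b) (v, w, t) = v" "Cod (conc_hom Ct fu is1 is2 a b) (v, w, t) = w"
  "Idn (conc_hom Ct fu is1 is2 a b) w = (w, w, \<lambda>x\<in>Obj (Ct a). Idn (Ct b) (Fo (fu w) x))"
  "(v', w', t') \<cdot>\<^bsub>conc_hom Ct fu is1 is2 a b\<^esub> (v, w, t) = (v, w', \<lambda>x\<in>Obj (Ct a). t' x \<cdot>\<^bsub>Ct b\<^esub> t x)"
  by (auto simp: conc_hom_def)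

lemma conc_simps [simp]:
  "Ob2 (conc Ob Ct fu is1 is2 id1 cmp) = Ob"
  "Hom2 (conc Ob Ct fu is1 is2 id1 cmp) = conc_hom Ct fu is1 is2"
  "Id2 (conc Ob Ct fu is1 is2 id1 cmp) = id1"
  "\<lbrakk>is1 b c g; is1 a b f\<rbrakk> \<Longrightarrow> comp1 (conc Ob Ct fu is1 is2 id1 cmp) a b c g f = cmp a b c g f"
  "\<lbrakk>is1 b c g; is1 b c g'; is2 b c g g' s; is1 a b f; is1 a b f'; is2 a b f f' t\<rbrakk> \<Longrightarrow>
     hcomp (conc Ob Ct fu is1 is2 id1 cmp) a b c (g, g', s) (f, f', t) =
       (cmp a b c g f, cmp a b c g' f', \<lambda>x\<in>Obj (Ct a). s (Fo (fu f') x) \<cdot>\<^bsub>Ct c\<^esub> Fa (fu g) (t x))"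
  "id2cell (conc Ob Ct fu is1 is2 id1 cmp) a b w = (w, w, \<lambda>x\<in>Obj (Ct a). Idn (Ct b) (Fo (fu w) x))"
  by (auto simp: conc_def comp1_def hcomp_def id2cell_def)

text \<open>What has to be checked for a particular 2-category is closure of its 1-cells and 2-cells
  under the operations on functors and transformations, and the laws for composing 1-cells. The laws
  for 2-cells are inherited from natural transformations.\<close>

locale conc2 =
  fixes Ob :: "'o set" and Ct :: "'o \<Rightarrow> ('p, 'n) cat" and fu :: "'m \<Rightarrow> ('p, 'n, 'p, 'n) ftor"
    and is1 is2 id1 cmp
  assumes cat [simp]: "a \<in> Ob \<Longrightarrow> category (Ct a)"
    and fu: "\<lbrakk>a \<in> Ob; b \<in> Ob; is1 a b w\<rbrakk> \<Longrightarrow> is_functor (Ct a) (Ct b) (fu w)"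
    and nat: "\<lbrakk>a \<in> Ob; b \<in> Ob; is1 a b v; is1 a b w; is2 a b v w t\<rbrakk> \<Longrightarrow> nat_trans (Ct a) (Ct b) (fu v) (fu w) t"
    and id1: "a \<in> Ob \<Longrightarrow> is1 a a (id1 a)" "a \<in> Ob \<Longrightarrow> fu (id1 a) = ftor_id (Ct a)"
    and cmp: "\<lbrakk>a \<in> Ob; b \<in> Ob; c \<in> Ob; is1 a b f; is1 b c g\<rbrakk> \<Longrightarrow> is1 a c (cmp a b c g f)"
      "\<lbrakk>a \<in> Ob; b \<in> Ob; c \<in> Ob; is1 a b f; is1 b c g\<rbrakk> \<Longrightarrow> fu (cmp a b c g f) = ftor_comp (Ct a) (fu g) (fu f)"
    and id2: "\<lbrakk>a \<in> Ob; b \<in> Ob; is1 a b w\<rbrakk> \<Longrightarrow> is2 a b w w (\<lambda>x\<in>Obj (Ct a). Idn (Ct b) (Fo (fu w) x))"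
    and vc: "\<lbrakk>a \<in> Ob; b \<in> Ob; is1 a b u; is1 a b v; is1 a b w; is2 a b u v s; is2 a b v w t\<rbrakk> \<Longrightarrow>
      is2 a b u w (\<lambda>x\<in>Obj (Ct a). t x \<cdot>\<^bsub>Ct b\<^esub> s x)"
    and hc: "\<lbrakk>a \<in> Ob; b \<in> Ob; c \<in> Ob; is1 a b f; is1 a b f'; is1 b c g; is1 b c g'; is2 a b f f' t; is2 b c g g' s\<rbrakk> \<Longrightarrow>
      is2 a c (cmp a b c g f) (cmp a b c g' f') (\<lambda>x\<in>Obj (Ct a). s (Fo (fu f') x) \<cdot>\<^bsub>Ct c\<^esub> Fa (fu g) (t x))"
    and unit_cmp: "\<lbrakk>a \<in> Ob; b \<in> Ob; is1 a b f\<rbrakk> \<Longrightarrow> cmp a a b f (id1 a) = f"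
      "\<lbrakk>a \<in> Ob; b \<in> Ob; is1 a b f\<rbrakk> \<Longrightarrow> cmp a b b (id1 b) f = f"
    and assoc_cmp: "\<lbrakk>a \<in> Ob; b \<in> Ob; c \<in> Ob; d \<in> Ob; is1 a b f; is1 b c g; is1 c d h\<rbrakk> \<Longrightarrow>
      cmp a b d (cmp b c d h g) f = cmp a c d h (cmp a b c g f)"
begin

abbreviation "H \<equiv> conc_hom Ct fu is1 is2"
abbreviation "K \<equiv> conc Ob Ct fu is1 is2 id1 cmp"

lemma nat_simps:
  assumes "a \<in> Ob" "b \<in> Ob" "is1 a b v" "is1 a b w" "is2 a b v w t"
  shows "x \<in> Obj (Ct a) \<Longrightarrow> t x \<in> Arr (Ct b)" "x \<in> Obj (Ct a) \<Longrightarrow> Dom (Ct b) (t x) = Fo (fu v) x"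
    "x \<in> Obj (Ct a) \<Longrightarrow> Cod (Ct b) (t x) = Fo (fu w) x" "t \<in> extensional (Obj (Ct a))"
    "f \<in> Arr (Ct a) \<Longrightarrow> t (Cod (Ct a) f) \<cdot>\<^bsub>Ct b\<^esub> Fa (fu v) f = Fa (fu w) f \<cdot>\<^bsub>Ct b\<^esub> t (Dom (Ct a) f)"
  using nat_transD(3-)[OF nat[OF assms]] by blast+

lemma category_hom: assumes "a \<in> Ob" "b \<in> Ob" shows "category (H a b)"
proof (rule categoryI)
  fix \<alpha> assume "\<alpha> \<in> Arr (H a b)"
  then obtain v w t where \<alpha>: "\<alpha> = (v, w, t)" "is1 a b v" "is1 a b w" "is2 a b v w t" by (cases \<alpha>) auto
  note [simp] = nat_simps(1-3)[OF assms \<alpha>(2-4)] assms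
  note t = nat_simps(4)[OF assms \<alpha>(2-4)]
  show "Dom (H a b) \<alpha> \<in> Obj (H a b) \<and> Cod (H a b) \<alpha> \<in> Obj (H a b)" using \<alpha> by simp
  have "(\<lambda>x\<in>Obj (Ct a). t x \<cdot>\<^bsub>Ct b\<^esub> (\<lambda>x\<in>Obj (Ct a). Idn (Ct b) (Fo (fu v) x)) x) = t"
    "(\<lambda>x\<in>Obj (Ct a). (\<lambda>x\<in>Obj (Ct a). Idn (Ct b) (Fo (fu w) x)) x \<cdot>\<^bsub>Ct b\<^esub> t x) = t"
    by (rule extensionalityI[OF restrict_extensional t]; simp)+
  then show "\<alpha> \<cdot>\<^bsub>H a b\<^esub> Idn (H a b) (Dom (H a b) \<alpha>) = \<alpha>" "Idn (H a b) (Cod (H a b) \<alpha>) \<cdot>\<^bsub>H a b\<^esub> \<alpha> = \<alpha>"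
    using \<alpha> by simp_all
next
  fix w assume "w \<in> Obj (H a b)"
  then show "arr (H a b) (Idn (H a b) w) w w" using assms id2 by simp
next
  fix \<alpha> \<beta> assume *: "\<alpha> \<in> Arr (H a b)" "\<beta> \<in> Arr (H a b)" "Cod (H a b) \<alpha> = Dom (H a b) \<beta>"
  obtain v w t v' w' t' where "\<alpha> = (v, w, t)" "\<beta> = (v', w', t')" by (metis surj_pair)
  with * show "arr (H a b) (\<beta> \<cdot>\<^bsub>H a b\<^esub> \<alpha>) (Dom (H a b) \<alpha>) (Cod (H a b) \<beta>)"
    using vc[OF assms] by auto
next
  fix \<alpha> \<beta> \<gamma> assume *: "\<alpha> \<in> Arr (H a b)" "\<beta> \<in> Arr (H a b)" "\<gamma> \<in> Arr (H a b)"
    "Cod (H a b) \<alpha> = Dom (H a b) \<beta>" "Cod (H a b) \<beta> = Dom (H a b) \<gamma>"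
  obtain v1 w1 t1 v2 w2 t2 v3 w3 t3 where e: "\<alpha> = (v1, w1, t1)" "\<beta> = (v2, w2, t2)" "\<gamma> = (v3, w3, t3)" by (metis surj_pair)
  have 1: "is1 a b v1" "is1 a b w1" "is2 a b v1 w1 t1" "is1 a b v2" "is1 a b w2" "is2 a b v2 w2 t2"
    "is1 a b v3" "is1 a b w3" "is2 a b v3 w3 t3" "w1 = v2" "w2 = v3" using * e by auto
  show "\<gamma> \<cdot>\<^bsub>H a b\<^esub> \<beta> \<cdot>\<^bsub>H a b\<^esub> \<alpha> = \<gamma> \<cdot>\<^bsub>H a b\<^esub> (\<beta> \<cdot>\<^bsub>H a b\<^esub> \<alpha>)"
    using e assms 1(10,11) nat_simps(1-3)[OF assms 1(1-3)] nat_simps(1-3)[OF assms 1(4-6)] nat_simps(1-3)[OF assms 1(7-9)]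
    by (simp cong: restrict_cong)
qed

lemma comp2_simps [simp]:
  "\<lbrakk>is1 b c g; is1 a b f\<rbrakk> \<Longrightarrow> Fo (Comp2 K a b c) (g, f) = cmp a b c g f"
  "\<lbrakk>is1 b c g; is1 b c g'; is2 b c g g' s; is1 a b f; is1 a b f'; is2 a b f f' t\<rbrakk> \<Longrightarrow>
     Fa (Comp2 K a b c) ((g, g', s), (f, f', t)) =
       (cmp a b c g f, cmp a b c g' f', \<lambda>x\<in>Obj (Ct a). s (Fo (fu f') x) \<cdot>\<^bsub>Ct c\<^esub> Fa (fu g) (t x))"
  by (auto simp: conc_def)

lemma comp2_functor:
  assumes abc [simp]: "a \<in> Ob" "b \<in> Ob" "c \<in> Ob"
  shows "is_functor (H b c \<times>\<^sub>C H a b) (H a c) (Comp2 K a b c)"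
proof (rule functorI)
  show "Fo (Comp2 K a b c) \<in> extensional (Obj (H b c \<times>\<^sub>C H a b))"
    "Fa (Comp2 K a b c) \<in> extensional (Arr (H b c \<times>\<^sub>C H a b))" by (simp_all add: conc_def)
next
  fix k assume "k \<in> Obj (H b c \<times>\<^sub>C H a b)"
  then obtain g f where k: "k = (g, f)" "is1 b c g" "is1 a b f" by auto
  note [simp] = functor_simps[OF fu[OF abc(1,2) k(3)]] functor_simps[OF fu[OF abc(2,3) k(2)]]
  show "Fo (Comp2 K a b c) k \<in> Obj (H a c)" using k cmp by simp
  show "Fa (Comp2 K a b c) (Idn (H b c \<times>\<^sub>C H a b) k) = Idn (H a c) (Fo (Comp2 K a b c) k)"
    using k id2 cmp(2)[OF abc k(3,2)] by (simp cong: restrict_cong)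
next
  fix k assume "k \<in> Arr (H b c \<times>\<^sub>C H a b)"
  then obtain g g' s f f' t where k: "k = ((g, g', s), (f, f', t))" "is1 b c g" "is1 b c g'" "is2 b c g g' s" "is1 a b f" "is1 a b f'" "is2 a b f f' t"
    by (cases k) auto
  then show "arr (H a c) (Fa (Comp2 K a b c) k) (Fo (Comp2 K a b c) (Dom (H b c \<times>\<^sub>C H a b) k)) (Fo (Comp2 K a b c) (Cod (H b c \<times>\<^sub>C H a b) k))"
    using cmp hc by simp
next
  fix k l assume *: "k \<in> Arr (H b c \<times>\<^sub>C H a b)" "l \<in> Arr (H b c \<times>\<^sub>C H a b)" "Cod (H b c \<times>\<^sub>C H a b) k = Dom (H b c \<times>\<^sub>C H a b) l"
  obtain g1 g2 s1 f1 f2 t1 where k: "k = ((g1, g2, s1), (f1, f2, t1))" by (metis surj_pair)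
  obtain g2' g3 s2 f2' f3 t2 where l': "l = ((g2', g3, s2), (f2', f3, t2))" by (metis surj_pair)
  have l: "l = ((g2, g3, s2), (f2, f3, t2))" using * k l' by simp
  have i: "is1 b c g1" "is1 b c g2" "is1 b c g3" "is1 a b f1" "is1 a b f2" "is1 a b f3"
     "is2 b c g1 g2 s1" "is2 b c g2 g3 s2" "is2 a b f1 f2 t1" "is2 a b f2 f3 t2"
    using * k l by auto
  note fs = functor_simps[OF fu[OF abc(2,3) i(1)]] functor_simps[OF fu[OF abc(2,3) i(2)]]
    functor_base[OF fu[OF abc(1,2) i(4)]] functor_base[OF fu[OF abc(1,2) i(5)]] functor_base[OF fu[OF abc(1,2) i(6)]]
    functor_base[OF fu[OF abc(2,3) i(3)]]
  note ns = nat_simps(1-3)[OF abc(2,3) i(1,2,7)] nat_simps(1-3)[OF abc(2,3) i(2,3,8)]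
    nat_simps(1-3)[OF abc(1,2) i(4,5,9)] nat_simps(1-3)[OF abc(1,2) i(5,6,10)]
  have v: "is2 b c g1 g3 (\<lambda>x\<in>Obj (Ct b). s2 x \<cdot>\<^bsub>Ct c\<^esub> s1 x)" "is2 a b f1 f3 (\<lambda>x\<in>Obj (Ct a). t2 x \<cdot>\<^bsub>Ct b\<^esub> t1 x)"
    using vc[OF abc(2,3) i(1-3,7,8)] vc[OF abc(1,2) i(4-6,9,10)] by auto
  have "(s2 (Fo (fu f3) x) \<cdot>\<^bsub>Ct c\<^esub> s1 (Fo (fu f3) x)) \<cdot>\<^bsub>Ct c\<^esub> Fa (fu g1) (t2 x \<cdot>\<^bsub>Ct b\<^esub> t1 x) =
     (s2 (Fo (fu f3) x) \<cdot>\<^bsub>Ct c\<^esub> Fa (fu g2) (t2 x)) \<cdot>\<^bsub>Ct c\<^esub> (s1 (Fo (fu f2) x) \<cdot>\<^bsub>Ct c\<^esub> Fa (fu g1) (t1 x))"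
    if x: "x \<in> Obj (Ct a)" for x
  proof -
    \<comment> \<open>Interchange amounts to naturality of \<open>s1\<close> at the arrow
      \<open>t2 x\<close>.\<close>
    have "s1 (Fo (fu f3) x) \<cdot>\<^bsub>Ct c\<^esub> Fa (fu g1) (t2 x) = Fa (fu g2) (t2 x) \<cdot>\<^bsub>Ct c\<^esub> s1 (Fo (fu f2) x)"
      using nat_simps(5)[OF abc(2,3) i(1,2,7), of "t2 x"] x ns(10-12)[of x] by simp
    from this[THEN reassoc, of "Fa (fu g1) (t1 x)"] show ?thesis
      using x by (simp add: fs ns)
  qed
  then show "Fa (Comp2 K a b c) (l \<cdot>\<^bsub>H b c \<times>\<^sub>C H a b\<^esub> k) = Fa (Comp2 K a b c) l \<cdot>\<^bsub>H a c\<^esub> Fa (Comp2 K a b c) k"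
    unfolding k l using i v fs(13)[of] by (simp add: fs ns cong: restrict_cong)
qed

lemma two_category: "two_category K"
  unfolding two_category_def conc_simps(1-3)
proof (intro conjI ballI)
  fix a b assume ab [simp]: "a \<in> Ob" "b \<in> Ob"
  show "category (H a b)" by (rule category_hom) auto
  {
    fix f assume "f \<in> Obj (H a b)"
    then show "comp1 K a a b f (id1 a) = f" "comp1 K a b b (id1 b) f = f" using id1 unit_cmp by auto
  }
  fix \<alpha> assume "\<alpha> \<in> Arr (H a b)"
  then obtain v w t where \<alpha>: "\<alpha> = (v, w, t)" "is1 a b v" "is1 a b w" "is2 a b v w t" by (cases \<alpha>) auto
  note [simp] = functor_simps[OF fu[OF ab \<alpha>(2)]] functor_simps[OF fu[OF ab \<alpha>(3)]] nat_simps(1-3)[OF ab \<alpha>(2-4)]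
  have "(\<lambda>x\<in>Obj (Ct a). t (Fo (fu (id1 a)) x) \<cdot>\<^bsub>Ct b\<^esub> Fa (fu v) ((\<lambda>x\<in>Obj (Ct a). Idn (Ct a) (Fo (fu (id1 a)) x)) x)) = t"
    "(\<lambda>x\<in>Obj (Ct a). (\<lambda>x\<in>Obj (Ct b). Idn (Ct b) (Fo (fu (id1 b)) x)) (Fo (fu w) x) \<cdot>\<^bsub>Ct b\<^esub> Fa (fu (id1 b)) (t x)) = t"
    by (rule extensionalityI[OF restrict_extensional nat_simps(4)[OF ab \<alpha>(2-4)]]; simp add: id1)+
  then show "hcomp K a a b \<alpha> (id2cell K a a (id1 a)) = \<alpha>" "hcomp K a b b (id2cell K b b (id1 b)) \<alpha> = \<alpha>"
    using \<alpha> id1 id2[OF ab(1,1) id1(1)] id2[OF ab(2,2) id1(1)] unit_cmp by simp_all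
next
  fix a assume "a \<in> Ob"
  then show "id1 a \<in> Obj (H a a)" using id1 by simp
next
  fix a b c assume "a \<in> Ob" "b \<in> Ob" "c \<in> Ob"
  then show "is_functor (H b c \<times>\<^sub>C H a b) (H a c) (Comp2 K a b c)" by (rule comp2_functor)
next
  fix a b c d f g h assume *: "a \<in> Ob" "b \<in> Ob" "c \<in> Ob" "d \<in> Ob" "f \<in> Obj (H a b)" "g \<in> Obj (H b c)" "h \<in> Obj (H c d)"
  then show "comp1 K a b d (comp1 K b c d h g) f = comp1 K a c d h (comp1 K a b c g f)"
    using cmp(1) assoc_cmp by simp
next
  fix a b c d \<alpha> \<beta> \<gamma> assume o [simp]: "a \<in> Ob" "b \<in> Ob" "c \<in> Ob" "d \<in> Ob" and *: "\<alpha> \<in> Arr (H a b)" "\<beta> \<in> Arr (H b c)" "\<gamma> \<in> Arr (H c d)"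
  obtain f f' t g g' s h h' r where e: "\<alpha> = (f, f', t)" "\<beta> = (g, g', s)" "\<gamma> = (h, h', r)" by (metis surj_pair)
  have i: "is1 a b f" "is1 a b f'" "is2 a b f f' t" "is1 b c g" "is1 b c g'" "is2 b c g g' s" "is1 c d h" "is1 c d h'" "is2 c d h h' r"
    using * e by auto
  note [simp] = functor_simps[OF fu[OF o(1,2) i(1)]] functor_simps[OF fu[OF o(1,2) i(2)]] functor_simps[OF fu[OF o(2,3) i(4)]]
    functor_simps[OF fu[OF o(2,3) i(5)]] functor_simps[OF fu[OF o(3,4) i(7)]]
    nat_simps(1-3)[OF o(1,2) i(1-3)] nat_simps(1-3)[OF o(2,3) i(4-6)] nat_simps(1-3)[OF o(3,4) i(7-9)]
  show "hcomp K a b d (hcomp K b c d \<gamma> \<beta>) \<alpha> = hcomp K a c d \<gamma> (hcomp K a b c \<beta> \<alpha>)"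
    unfolding e using i cmp hc[OF o(1-3) i(1,2,4,5,3,6)] hc[OF o(2-4) i(4,5,7,8,6,9)] assoc_cmp
    by (simp cong: restrict_cong)
qed

end

text \<open>\<open>m\<close> is the action on 1-cells and \<open>n\<close> gives the components of
  the image of a 2-cell. Strict 2-functoriality is reduced to equations between these component
  functions and between 1-cells.\<close>

lemma conc_two_functor:
  assumes "conc2 Ob Ct fu is1 is2 id1 cmp" and "conc2 Ob' Ct' fu' is1' is2' id1' cmp'"
    and F: "F = \<lparr>F0 = f0, FH = (\<lambda>a b. \<lparr>Fo = (\<lambda>w\<in>{w. is1 a b w}. m a b w),
       Fa = (\<lambda>(v, w, t)\<in>Arr (conc_hom Ct fu is1 is2 a b). (m a b v, m a b w, n a b v w t))\<rparr>)\<rparr>"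
    and f0: "\<And>a. a \<in> Ob \<Longrightarrow> f0 a \<in> Ob'"
    and m: "\<And>a b w. \<lbrakk>a \<in> Ob; b \<in> Ob; is1 a b w\<rbrakk> \<Longrightarrow> is1' (f0 a) (f0 b) (m a b w)"
    and n: "\<And>a b v w t. \<lbrakk>a \<in> Ob; b \<in> Ob; is1 a b v; is1 a b w; is2 a b v w t\<rbrakk> \<Longrightarrow>
      is2' (f0 a) (f0 b) (m a b v) (m a b w) (n a b v w t)"
    and n_id: "\<And>a b w. \<lbrakk>a \<in> Ob; b \<in> Ob; is1 a b w\<rbrakk> \<Longrightarrow> n a b w w (\<lambda>x\<in>Obj (Ct a). Idn (Ct b) (Fo (fu w) x)) =
      (\<lambda>x\<in>Obj (Ct' (f0 a)). Idn (Ct' (f0 b)) (Fo (fu' (m a b w)) x))"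
    and n_comp: "\<And>a b u v w s t. \<lbrakk>a \<in> Ob; b \<in> Ob; is1 a b u; is1 a b v; is1 a b w; is2 a b u v s; is2 a b v w t\<rbrakk> \<Longrightarrow>
      n a b u w (\<lambda>x\<in>Obj (Ct a). t x \<cdot>\<^bsub>Ct b\<^esub> s x) = (\<lambda>x\<in>Obj (Ct' (f0 a)). n a b v w t x \<cdot>\<^bsub>Ct' (f0 b)\<^esub> n a b u v s x)"
    and m_id: "\<And>a. a \<in> Ob \<Longrightarrow> m a a (id1 a) = id1' (f0 a)"
    and m_cmp: "\<And>a b c f g. \<lbrakk>a \<in> Ob; b \<in> Ob; c \<in> Ob; is1 a b f; is1 b c g\<rbrakk> \<Longrightarrow>
      m a c (cmp a b c g f) = cmp' (f0 a) (f0 b) (f0 c) (m b c g) (m a b f)"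
    and n_hcomp: "\<And>a b c f f' g g' s t. \<lbrakk>a \<in> Ob; b \<in> Ob; c \<in> Ob; is1 a b f; is1 a b f'; is1 b c g; is1 b c g'; is2 a b f f' t; is2 b c g g' s\<rbrakk> \<Longrightarrow>
      n a c (cmp a b c g f) (cmp a b c g' f') (\<lambda>x\<in>Obj (Ct a). s (Fo (fu f') x) \<cdot>\<^bsub>Ct c\<^esub> Fa (fu g) (t x)) =
      (\<lambda>x\<in>Obj (Ct' (f0 a)). n b c g g' s (Fo (fu' (m a b f')) x) \<cdot>\<^bsub>Ct' (f0 c)\<^esub> Fa (fu' (m b c g)) (n a b f f' t x))"
  shows "two_functor (conc Ob Ct fu is1 is2 id1 cmp) (conc Ob' Ct' fu' is1' is2' id1' cmp') F"
proof -
  interpret K: conc2 Ob Ct fu is1 is2 id1 cmp by fact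
  interpret M: conc2 Ob' Ct' fu' is1' is2' id1' cmp' by fact
  have F0 [simp]: "F0 F = f0" by (simp add: F)
  have Fo [simp]: "is1 a b w \<Longrightarrow> Fo (FH F a b) w = m a b w" for a b w by (simp add: F)
  have Fa [simp]: "\<lbrakk>is1 a b v; is1 a b w; is2 a b v w t\<rbrakk> \<Longrightarrow> Fa (FH F a b) (v, w, t) = (m a b v, m a b w, n a b v w t)" for a b v w t
    by (simp add: F)
  show ?thesis
    unfolding two_functor_def conc_simps(1-3) F0
  proof (intro conjI ballI)
    fix a b assume ab [simp]: "a \<in> Ob" "b \<in> Ob"
    show "is_functor (K.H a b) (M.H (f0 a) (f0 b)) (FH F a b)"
    proof (rule functorI)
      show "Fo (FH F a b) \<in> extensional (Obj (K.H a b))" "Fa (FH F a b) \<in> extensional (Arr (K.H a b))"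
        by (simp_all add: F conc_hom_def)
      fix w assume "w \<in> Obj (K.H a b)"
      then show "Fo (FH F a b) w \<in> Obj (M.H (f0 a) (f0 b))"
        "Fa (FH F a b) (Idn (K.H a b) w) = Idn (M.H (f0 a) (f0 b)) (Fo (FH F a b) w)"
        using m n_id K.id2 by simp_all
    next
      fix \<alpha> assume "\<alpha> \<in> Arr (K.H a b)"
      then show "arr (M.H (f0 a) (f0 b)) (Fa (FH F a b) \<alpha>) (Fo (FH F a b) (Dom (K.H a b) \<alpha>)) (Fo (FH F a b) (Cod (K.H a b) \<alpha>))"
        using m n by (cases \<alpha>) auto
    next
      fix \<alpha> \<beta> assume *: "\<alpha> \<in> Arr (K.H a b)" "\<beta> \<in> Arr (K.H a b)" "Cod (K.H a b) \<alpha> = Dom (K.H a b) \<beta>"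
      obtain v w t v' w' t' where e: "\<alpha> = (v, w, t)" "\<beta> = (v', w', t')" by (metis surj_pair)
      with * have i: "is1 a b v" "is1 a b w" "is1 a b w'" "is2 a b v w t" "is2 a b w w' t'" "v' = w" by auto
      show "Fa (FH F a b) (\<beta> \<cdot>\<^bsub>K.H a b\<^esub> \<alpha>) = Fa (FH F a b) \<beta> \<cdot>\<^bsub>M.H (f0 a) (f0 b)\<^esub> Fa (FH F a b) \<alpha>"
        unfolding e i(6) using i(1-5) K.vc[OF ab i(1-5)] n_comp[OF ab i(1-5)] by simp
    qed
  next
    fix a b c f g assume "a \<in> Ob" "b \<in> Ob" "c \<in> Ob" "f \<in> Obj (K.H a b)" "g \<in> Obj (K.H b c)"
    then show "Fo (FH F a c) (comp1 K.K a b c g f) = comp1 M.K (f0 a) (f0 b) (f0 c) (Fo (FH F b c) g) (Fo (FH F a b) f)"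
      using K.cmp m m_cmp by simp
  next
    fix a b c \<alpha> \<beta> assume o: "a \<in> Ob" "b \<in> Ob" "c \<in> Ob" and *: "\<alpha> \<in> Arr (K.H a b)" "\<beta> \<in> Arr (K.H b c)"
    obtain f f' t g g' s where e: "\<alpha> = (f, f', t)" "\<beta> = (g, g', s)" by (metis surj_pair)
    with * have i: "is1 a b f" "is1 a b f'" "is1 b c g" "is1 b c g'" "is2 a b f f' t" "is2 b c g g' s" by auto
    show "Fa (FH F a c) (hcomp K.K a b c \<beta> \<alpha>) = hcomp M.K (f0 a) (f0 b) (f0 c) (Fa (FH F b c) \<beta>) (Fa (FH F a b) \<alpha>)"
      unfolding e using i o K.cmp K.hc[OF o i] m n m_cmp n_hcomp[OF o i] by simp
  qed (use f0 m_id K.id1 in auto)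
qed

subsection \<open>Fibrations and pruned monads as concrete 2-categories\<close>

lemma fibred_functor_iff:
  "fibred_functor A q q' F \<longleftrightarrow> is_functor (fst q) (fst q') F \<and> ftor_comp (fst q) (snd q') F = snd q \<and>
     (\<forall>\<phi>. cartesian A (fst q) (snd q) \<phi> \<longrightarrow> cartesian A (fst q') (snd q') (Fa F \<phi>))"
  by (simp add: fibred_functor_def split_beta)

lemma vertical_nat_trans_iff:
  "vertical_nat_trans A q q' F G t \<longleftrightarrow> nat_trans (fst q) (fst q') F G t \<and>
     (\<forall>e\<in>Obj (fst q). Fa (snd q') (t e) = Idn A (Fo (snd q) e))"
  by (simp add: vertical_nat_trans_def split_beta)

lemma fibred_functorD:
  assumes "fibred_functor A q q' F"
  shows "is_functor (fst q) (fst q') F"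
    "e \<in> Obj (fst q) \<Longrightarrow> Fo (snd q') (Fo F e) = Fo (snd q) e" "u \<in> Arr (fst q) \<Longrightarrow> Fa (snd q') (Fa F u) = Fa (snd q) u"
    "cartesian A (fst q) (snd q) \<phi> \<Longrightarrow> cartesian A (fst q') (snd q') (Fa F \<phi>)"
  using assms ftor_comp_simps(1)[of e "fst q" "snd q'" F] ftor_comp_simps(2)[of u "fst q" "snd q'" F]
  by (auto simp: fibred_functor_iff simp del: ftor_comp_simps)

text \<open>The set of objects is left open, so that all fibrations and the full sub-2-category of
  pruned ones are treated at once.\<close>

definition fib_conc where
  "fib_conc A Ob = conc Ob fst (\<lambda>F. F) (fibred_functor A) (vertical_nat_trans A) (\<lambda>q. ftor_id (fst q))
     (\<lambda>a b c g f. ftor_comp (fst a) g f)"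

lemma Fib_conc: "Fib A = fib_conc A {(E, p). fibration A E p}"
  unfolding Fib_def fib_conc_def conc_def conc_hom_def Let_def by (simp add: split_beta')

lemma PrFib_conc: "PrFib A z = fib_conc A {(E, p). pruned A z E p}"
  unfolding PrFib_def Fib_conc fib_conc_def conc_def by simp

lemma fib_conc2:
  assumes A: "category A" and Ob: "\<And>q. q \<in> Ob \<Longrightarrow> fibration A (fst q) (snd q)"
  shows "conc2 Ob fst (\<lambda>F. F) (fibred_functor A) (vertical_nat_trans A) (\<lambda>q. ftor_id (fst q))
     (\<lambda>a b c g f. ftor_comp (fst a) g f)"
proof
  have E: "category (fst a)" and p: "is_functor (fst a) A (snd a)" if "a \<in> Ob" for a
    using Ob[OF that] by (auto simp: fibration_def)
  show "category (fst a)" if "a \<in> Ob" for a by (rule E[OF that])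
  show "fibred_functor A a a (ftor_id (fst a))" if a: "a \<in> Ob" for a
    using E[OF a] ftor_comp_id(1)[OF p[OF a]] by (auto simp: fibred_functor_iff cartesian_def)
  show "fibred_functor A a c (ftor_comp (fst a) g f)"
    if "a \<in> Ob" "b \<in> Ob" "c \<in> Ob" "fibred_functor A a b f" "fibred_functor A b c g" for a b c f g
    using that is_functor_comp[OF E[OF that(1)], of "fst b" f "fst c" g] ftor_comp_assoc[of "fst a" "fst b" f "snd c" g]
    by (auto simp: fibred_functor_iff cartesian_def[of A "fst a"])
  show "vertical_nat_trans A a b w w (\<lambda>x\<in>Obj (fst a). Idn (fst b) (Fo w x))"
    if "a \<in> Ob" "b \<in> Ob" "fibred_functor A a b w" for a b w
    using that nat_trans_id[OF E E, of b a w] fibred_functorD[OF that(3)] functor_simps[OF p[OF that(2)]]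
      functor_simps[of "fst a" "fst b" w]
    by (auto simp: vertical_nat_trans_iff)
  show "vertical_nat_trans A a b u w (\<lambda>x\<in>Obj (fst a). t x \<cdot>\<^bsub>fst b\<^esub> s x)"
    if "a \<in> Ob" "b \<in> Ob" "fibred_functor A a b u" "fibred_functor A a b v" "fibred_functor A a b w"
     "vertical_nat_trans A a b u v s" "vertical_nat_trans A a b v w t" for a b u v w s t
    using that nat_trans_vcomp[OF E E, of a b u v s w t] functor_simps[OF p[OF that(1)]] functor_simps[OF p[OF that(2)]]
      nat_transD(4-6)[of "fst a" "fst b" u v s] nat_transD(4-6)[of "fst a" "fst b" v w t] A
    by (auto simp: vertical_nat_trans_iff)
  show "vertical_nat_trans A a c (ftor_comp (fst a) g f) (ftor_comp (fst a) g' f') (\<lambda>x\<in>Obj (fst a). s (Fo f' x) \<cdot>\<^bsub>fst c\<^esub> Fa g (t x))"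
    if o: "a \<in> Ob" "b \<in> Ob" "c \<in> Ob" and i: "fibred_functor A a b f" "fibred_functor A a b f'" "fibred_functor A b c g" "fibred_functor A b c g'"
     and v: "vertical_nat_trans A a b f f' t" "vertical_nat_trans A b c g g' s" for a b c f f' g g' t s
  proof -
    have n: "nat_trans (fst a) (fst b) f f' t" "nat_trans (fst b) (fst c) g g' s"
      and ve: "\<And>e. e \<in> Obj (fst a) \<Longrightarrow> Fa (snd b) (t e) = Idn A (Fo (snd a) e)"
         "\<And>e. e \<in> Obj (fst b) \<Longrightarrow> Fa (snd c) (s e) = Idn A (Fo (snd b) e)"
      using v by (auto simp: vertical_nat_trans_iff)
    note [simp] = functor_simps[OF p[OF o(1)]] functor_simps[OF p[OF o(2)]] functor_simps[OF p[OF o(3)]]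
      fibred_functorD(2,3)[OF i(1)] fibred_functorD(2,3)[OF i(2)] fibred_functorD(2,3)[OF i(3)] fibred_functorD(2,3)[OF i(4)]
      functor_simps[OF fibred_functorD(1)[OF i(1)]] functor_simps[OF fibred_functorD(1)[OF i(2)]]
      functor_simps[OF fibred_functorD(1)[OF i(3)]] functor_simps[OF fibred_functorD(1)[OF i(4)]]
      nat_transD(4-6)[OF n(1)] nat_transD(4-6)[OF n(2)] ve A
    show ?thesis unfolding vertical_nat_trans_iff
      using nat_trans_hcomp[OF E[OF o(1)] E[OF o(2)] E[OF o(3)] n] by simp
  qed
qed (use ftor_comp_id ftor_comp_assoc in \<open>auto simp: fibred_functor_iff vertical_nat_trans_iff\<close>)

definition mnd_cmp :: "'u ucat \<Rightarrow> 'u pmonad \<Rightarrow> 'u pmonad \<Rightarrow> 'u pmonad \<Rightarrow> 'u pm1 \<Rightarrow> 'u pm1 \<Rightarrow> 'u pm1" where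
  "mnd_cmp A P Q R w v = (ftor_comp (Carr P) (fst w) (fst v),
     \<lambda>(a, x) \<in> Obj (A \<times>\<^sub>C Carr P). Fa (fst w) (snd v (a, x)) \<cdot>\<^bsub>Carr R\<^esub> snd w (a, Fo (fst v) x))"

definition mnd_id :: "'u ucat \<Rightarrow> 'u pmonad \<Rightarrow> 'u pm1" where
  "mnd_id A P = (ftor_id (Carr P), \<lambda>c\<in>Obj (A \<times>\<^sub>C Carr P). Idn (Carr P) (Fo (PFun P) c))"

lemma PrMnd_conc: "PrMnd A z = conc {P. pruned_monad A z P} Carr fst (pm_1cell A) (pm_2cell A) (mnd_id A) (mnd_cmp A)"
  unfolding PrMnd_def conc_def conc_hom_def Let_def mnd_id_def[abs_def] mnd_cmp_def[abs_def] by (simp add: split_beta')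

lemma pm_2cell_iff:
  "pm_2cell A P Q v w \<nu> \<longleftrightarrow> nat_trans (Carr P) (Carr Q) (fst v) (fst w) \<nu> \<and>
     (\<forall>a\<in>Obj A. \<forall>x\<in>Obj (Carr P).
        \<nu> (Fo (PFun P) (a, x)) \<cdot>\<^bsub>Carr Q\<^esub> snd v (a, x) =
        snd w (a, x) \<cdot>\<^bsub>Carr Q\<^esub> Fa (PFun Q) (Idn A a, \<nu> x))"
  by (simp add: pm_2cell_def split_beta)

lemma pm1I: "param_monad_axioms A P \<Longrightarrow> param_monad_axioms A Q \<Longrightarrow> pm_1cell A P Q w \<Longrightarrow> pm1 A P Q (fst w) (snd w)"
  by (simp add: pm1_def pm2_def pm1_axioms_def)

lemma mnd_id_1cell:
  assumes "param_monad_axioms A P"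
  shows "pm_1cell A P P (mnd_id A P)"
proof -
  interpret P: param_monad_axioms A P by fact
  interpret pm2 A P P ..
  show ?thesis unfolding mnd_id_def pm_1cell_iff by auto
qed

lemma mnd_cmp_1cell:
  assumes "param_monad_axioms A P" "param_monad_axioms A Q" "param_monad_axioms A R" "pm_1cell A P Q v" "pm_1cell A Q R w"
  shows "pm_1cell A P R (mnd_cmp A P Q R w v)"
proof -
  interpret v: pm1 A P Q "fst v" "snd v" using assms pm1I by blast
  interpret w: pm1 A Q R "fst w" "snd w" using assms pm1I by blast
  interpret pm2 A P R ..
  let ?V = "fst v" and ?W = "fst w" and ?\<delta> = "snd v" and ?\<gamma> = "snd w"
  show ?thesis unfolding mnd_cmp_def pm_1cell_iff
  proof (intro conjI ballI)
    show "is_functor (Carr P) (Carr R) (ftor_comp (Carr P) ?W ?V)"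
      using is_functor_comp[OF v.P.X v.V w.V] .
    show "(\<lambda>(a, x)\<in>Obj (A \<times>\<^sub>C Carr P). Fa ?W (?\<delta> (a, x)) \<cdot>\<^bsub>Carr R\<^esub> ?\<gamma> (a, Fo ?V x)) \<in> extensional (Obj (A \<times>\<^sub>C Carr P))"
      by (rule restrict_extensional)
  next
    fix f g assume [simp]: "f \<in> Arr A" "g \<in> Arr (Carr P)"
    have "Fa ?W (Fa ?V (Fa (PFun P) (f, g))) \<cdot>\<^bsub>Carr R\<^esub> Fa ?W (?\<delta> (Dom A f, Dom (Carr P) g)) =
       Fa ?W (?\<delta> (Cod A f, Cod (Carr P) g)) \<cdot>\<^bsub>Carr R\<^esub> Fa ?W (Fa (PFun Q) (f, Fa ?V g))"
      using arg_cong[OF v.\<delta>_nat[of f g, OF _ _ refl refl], of "Fa ?W"] by simp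
    from this[THEN reassoc, of "?\<gamma> (Dom A f, Fo ?V (Dom (Carr P) g))"]
    show "(\<lambda>(a, x)\<in>Obj (A \<times>\<^sub>C Carr P). Fa ?W (?\<delta> (a, x)) \<cdot>\<^bsub>Carr R\<^esub> ?\<gamma> (a, Fo ?V x)) (Cod A f, Cod (Carr P) g) \<cdot>\<^bsub>Carr R\<^esub>
       Fa (PFun R) (f, Fa (ftor_comp (Carr P) ?W ?V) g) =
       Fa (ftor_comp (Carr P) ?W ?V) (Fa (PFun P) (f, g)) \<cdot>\<^bsub>Carr R\<^esub>
       (\<lambda>(a, x)\<in>Obj (A \<times>\<^sub>C Carr P). Fa ?W (?\<delta> (a, x)) \<cdot>\<^bsub>Carr R\<^esub> ?\<gamma> (a, Fo ?V x)) (Dom A f, Dom (Carr P) g)"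
      by (simp add: w.\<delta>_nat)
  next
    fix a x assume [simp]: "a \<in> Obj A" "x \<in> Obj (Carr P)"
    show "((\<lambda>(a, x)\<in>Obj (A \<times>\<^sub>C Carr P). Fa ?W (?\<delta> (a, x)) \<cdot>\<^bsub>Carr R\<^esub> ?\<gamma> (a, Fo ?V x)) (a, x)) \<in> Arr (Carr R)"
      "Dom (Carr R) ((\<lambda>(a, x)\<in>Obj (A \<times>\<^sub>C Carr P). Fa ?W (?\<delta> (a, x)) \<cdot>\<^bsub>Carr R\<^esub> ?\<gamma> (a, Fo ?V x)) (a, x)) = Fo (PFun R) (a, Fo (ftor_comp (Carr P) ?W ?V) x)"
      "Cod (Carr R) ((\<lambda>(a, x)\<in>Obj (A \<times>\<^sub>C Carr P). Fa ?W (?\<delta> (a, x)) \<cdot>\<^bsub>Carr R\<^esub> ?\<gamma> (a, Fo ?V x)) (a, x)) = Fo (ftor_comp (Carr P) ?W ?V) (Fo (PFun P) (a, x))"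
      by simp_all
    show "(\<lambda>(a, x)\<in>Obj (A \<times>\<^sub>C Carr P). Fa ?W (?\<delta> (a, x)) \<cdot>\<^bsub>Carr R\<^esub> ?\<gamma> (a, Fo ?V x)) (a, x) \<cdot>\<^bsub>Carr R\<^esub>
       PUnit R (a, Fo (ftor_comp (Carr P) ?W ?V) x) = Fa (ftor_comp (Carr P) ?W ?V) (PUnit P (a, x))"
      using arg_cong[OF v.\<delta>_unit[of a x], of "Fa ?W"] functor_simps(6)[OF w.V, of "PUnit Q (a, Fo ?V x)" "?\<delta> (a, x)"] by simp
    \<comment> \<open>The multiplication law of the first 1-cell under \<open>W\<close>, and then,
      as \<open>2\<close>, naturality of the second 1-cell at the first: together they sort the two
      stages of the composite.\<close>
    have 1: "Fa ?W (?\<delta> (a, x)) \<cdot>\<^bsub>Carr R\<^esub> Fa ?W (PMult Q (a, Fo ?V x)) =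
      Fa ?W (Fa ?V (PMult P (a, x))) \<cdot>\<^bsub>Carr R\<^esub> (Fa ?W (?\<delta> (a, Fo (PFun P) (a, x))) \<cdot>\<^bsub>Carr R\<^esub> Fa ?W (Fa (PFun Q) (Idn A a, ?\<delta> (a, x))))"
      using arg_cong[OF v.\<delta>_mult[of a x], of "Fa ?W"] by simp
    have 2: "Fa ?W (Fa (PFun Q) (Idn A a, ?\<delta> (a, x))) \<cdot>\<^bsub>Carr R\<^esub> ?\<gamma> (a, Fo (PFun Q) (a, Fo ?V x)) =
      ?\<gamma> (a, Fo ?V (Fo (PFun P) (a, x))) \<cdot>\<^bsub>Carr R\<^esub> Fa (PFun R) (Idn A a, Fa ?W (?\<delta> (a, x)))"
      using w.\<delta>_nat[of "Idn A a" "?\<delta> (a, x)", OF _ _ refl refl] by simp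
    show "(\<lambda>(a, x)\<in>Obj (A \<times>\<^sub>C Carr P). Fa ?W (?\<delta> (a, x)) \<cdot>\<^bsub>Carr R\<^esub> ?\<gamma> (a, Fo ?V x)) (a, x) \<cdot>\<^bsub>Carr R\<^esub>
       PMult R (a, Fo (ftor_comp (Carr P) ?W ?V) x) =
       Fa (ftor_comp (Carr P) ?W ?V) (PMult P (a, x)) \<cdot>\<^bsub>Carr R\<^esub>
       (\<lambda>(a, x)\<in>Obj (A \<times>\<^sub>C Carr P). Fa ?W (?\<delta> (a, x)) \<cdot>\<^bsub>Carr R\<^esub> ?\<gamma> (a, Fo ?V x)) (a, Fo (PFun P) (a, x)) \<cdot>\<^bsub>Carr R\<^esub>
       Fa (PFun R) (Idn A a, (\<lambda>(a, x)\<in>Obj (A \<times>\<^sub>C Carr P). Fa ?W (?\<delta> (a, x)) \<cdot>\<^bsub>Carr R\<^esub> ?\<gamma> (a, Fo ?V x)) (a, x))"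
      using w.\<delta>_mult[of a "Fo ?V x"] 1[THEN reassoc] 2[THEN reassoc] by simp
  qed
qed

lemma mnd_conc2:
  assumes Ob: "\<And>P. P \<in> Ob \<Longrightarrow> param_monad_axioms A P"
  shows "conc2 Ob Carr fst (pm_1cell A) (pm_2cell A) (mnd_id A) (mnd_cmp A)"
proof
  note X = param_monad_axioms.X[OF Ob]
  show "category (Carr a)" if "a \<in> Ob" for a using X that .
  show "is_functor (Carr a) (Carr b) (fst w)" if "a \<in> Ob" "b \<in> Ob" "pm_1cell A a b w" for a b w
    using pm1.V[OF pm1I[OF Ob Ob]] that by blast
  show "nat_trans (Carr a) (Carr b) (fst v) (fst w) t" if "pm_2cell A a b v w t" for a b v w t
    using that by (simp add: pm_2cell_iff)
  show "pm_1cell A a a (mnd_id A a)" if "a \<in> Ob" for a using mnd_id_1cell Ob that .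
  show "fst (mnd_id A a) = ftor_id (Carr a)" for a by (simp add: mnd_id_def)
  show "pm_1cell A a c (mnd_cmp A a b c g f)" if "a \<in> Ob" "b \<in> Ob" "c \<in> Ob" "pm_1cell A a b f" "pm_1cell A b c g" for a b c f g
    using mnd_cmp_1cell Ob that by blast
  show "fst (mnd_cmp A a b c g f) = ftor_comp (Carr a) (fst g) (fst f)" for a b c g f by (simp add: mnd_cmp_def)
  show "pm_2cell A a b w w (\<lambda>x\<in>Obj (Carr a). Idn (Carr b) (Fo (fst w) x))" if "a \<in> Ob" "b \<in> Ob" "pm_1cell A a b w" for a b w
  proof -
    interpret pm1 A a b "fst w" "snd w" using that Ob pm1I by blast
    show ?thesis unfolding pm_2cell_iff using nat_trans_id[OF Q.X P.X V] by simp
  qed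
  show "pm_2cell A a b u w (\<lambda>x\<in>Obj (Carr a). t x \<cdot>\<^bsub>Carr b\<^esub> s x)"
    if o: "a \<in> Ob" "b \<in> Ob" and i: "pm_1cell A a b u" "pm_1cell A a b v" "pm_1cell A a b w"
     and k: "pm_2cell A a b u v s" "pm_2cell A a b v w t" for a b u v w s t
  proof -
    interpret u: pm1 A a b "fst u" "snd u" using o i Ob pm1I by blast
    interpret v: pm1 A a b "fst v" "snd v" using o i Ob pm1I by blast
    interpret w: pm1 A a b "fst w" "snd w" using o i Ob pm1I by blast
    have n: "nat_trans (Carr a) (Carr b) (fst u) (fst v) s" "nat_trans (Carr a) (Carr b) (fst v) (fst w) t"
      and e: "\<And>c x. c \<in> Obj A \<Longrightarrow> x \<in> Obj (Carr a) \<Longrightarrow> s (Fo (PFun a) (c, x)) \<cdot>\<^bsub>Carr b\<^esub> snd u (c, x) =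
           snd v (c, x) \<cdot>\<^bsub>Carr b\<^esub> Fa (PFun b) (Idn A c, s x)"
        "\<And>c x. c \<in> Obj A \<Longrightarrow> x \<in> Obj (Carr a) \<Longrightarrow> t (Fo (PFun a) (c, x)) \<cdot>\<^bsub>Carr b\<^esub> snd v (c, x) =
           snd w (c, x) \<cdot>\<^bsub>Carr b\<^esub> Fa (PFun b) (Idn A c, t x)"
      using k by (auto simp: pm_2cell_iff)
    note [simp] = nat_transD(4-6)[OF n(1)] nat_transD(4-6)[OF n(2)]
    show ?thesis unfolding pm_2cell_iff
      using nat_trans_vcomp[OF u.P.X u.Q.X n] by (simp add: e e(2)[THEN reassoc])
  qed
  show "pm_2cell A a c (mnd_cmp A a b c g f) (mnd_cmp A a b c g' f') (\<lambda>x\<in>Obj (Carr a). s (Fo (fst f') x) \<cdot>\<^bsub>Carr c\<^esub> Fa (fst g) (t x))"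
    if o: "a \<in> Ob" "b \<in> Ob" "c \<in> Ob" and i: "pm_1cell A a b f" "pm_1cell A a b f'" "pm_1cell A b c g" "pm_1cell A b c g'"
     and k: "pm_2cell A a b f f' t" "pm_2cell A b c g g' s" for a b c f f' g g' t s
  proof -
    interpret f: pm1 A a b "fst f" "snd f" using o i Ob pm1I by blast
    interpret f': pm1 A a b "fst f'" "snd f'" using o i Ob pm1I by blast
    interpret g: pm1 A b c "fst g" "snd g" using o i Ob pm1I by blast
    interpret g': pm1 A b c "fst g'" "snd g'" using o i Ob pm1I by blast
    have n: "nat_trans (Carr a) (Carr b) (fst f) (fst f') t" "nat_trans (Carr b) (Carr c) (fst g) (fst g') s"
      and e: "\<And>d x. d \<in> Obj A \<Longrightarrow> x \<in> Obj (Carr a) \<Longrightarrow> t (Fo (PFun a) (d, x)) \<cdot>\<^bsub>Carr b\<^esub> snd f (d, x) =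
           snd f' (d, x) \<cdot>\<^bsub>Carr b\<^esub> Fa (PFun b) (Idn A d, t x)"
        "\<And>d x. d \<in> Obj A \<Longrightarrow> x \<in> Obj (Carr b) \<Longrightarrow> s (Fo (PFun b) (d, x)) \<cdot>\<^bsub>Carr c\<^esub> snd g (d, x) =
           snd g' (d, x) \<cdot>\<^bsub>Carr c\<^esub> Fa (PFun c) (Idn A d, s x)"
      using k by (auto simp: pm_2cell_iff)
    note [simp] = nat_transD(4-6)[OF n(1)] nat_transD(4-6)[OF n(2)]
    have "s (Fo (fst f') (Fo (PFun a) (d, x))) \<cdot>\<^bsub>Carr c\<^esub> (Fa (fst g) (t (Fo (PFun a) (d, x))) \<cdot>\<^bsub>Carr c\<^esub>
        (Fa (fst g) (snd f (d, x)) \<cdot>\<^bsub>Carr c\<^esub> snd g (d, Fo (fst f) x))) =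
      Fa (fst g') (snd f' (d, x)) \<cdot>\<^bsub>Carr c\<^esub> (snd g' (d, Fo (fst f') x) \<cdot>\<^bsub>Carr c\<^esub>
        Fa (PFun c) (Idn A d, s (Fo (fst f') x) \<cdot>\<^bsub>Carr c\<^esub> Fa (fst g) (t x)))"
      if [simp]: "d \<in> Obj A" "x \<in> Obj (Carr a)" for d x
    proof -
      \<comment> \<open>The four facts are, in turn, the 2-cell law of \<open>t\<close> under
        \<open>g\<close>, naturality of the 1-cell \<open>g\<close> at \<open>t x\<close>,
        naturality of \<open>s\<close> at the component of \<open>f'\<close>, and functoriality of
        the target monad.\<close>
      have 1: "Fa (fst g) (t (Fo (PFun a) (d, x))) \<cdot>\<^bsub>Carr c\<^esub> Fa (fst g) (snd f (d, x)) =
         Fa (fst g) (snd f' (d, x)) \<cdot>\<^bsub>Carr c\<^esub> Fa (fst g) (Fa (PFun b) (Idn A d, t x))"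
        using arg_cong[OF e(1)[of d x], of "Fa (fst g)"] by simp
      have 2: "Fa (fst g) (Fa (PFun b) (Idn A d, t x)) \<cdot>\<^bsub>Carr c\<^esub> snd g (d, Fo (fst f) x) =
         snd g (d, Fo (fst f') x) \<cdot>\<^bsub>Carr c\<^esub> Fa (PFun c) (Idn A d, Fa (fst g) (t x))"
        using g.\<delta>_nat[of "Idn A d" "t x", OF _ _ refl refl] by simp
      have 3: "s (Fo (fst f') (Fo (PFun a) (d, x))) \<cdot>\<^bsub>Carr c\<^esub> Fa (fst g) (snd f' (d, x)) =
         Fa (fst g') (snd f' (d, x)) \<cdot>\<^bsub>Carr c\<^esub> s (Fo (PFun b) (d, Fo (fst f') x))"
        using nat_transD(7)[OF n(2), of "snd f' (d, x)"] by simp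
      have 4: "Fa (PFun c) (Idn A d, s (Fo (fst f') x) \<cdot>\<^bsub>Carr c\<^esub> Fa (fst g) (t x)) =
         Fa (PFun c) (Idn A d, s (Fo (fst f') x)) \<cdot>\<^bsub>Carr c\<^esub> Fa (PFun c) (Idn A d, Fa (fst g) (t x))" by simp
      show ?thesis unfolding 4
        by (simp add: 1[THEN reassoc] 2 3[THEN reassoc] e(2)[THEN reassoc] del: g.Q.T_comp)
    qed
    then show ?thesis unfolding pm_2cell_iff
      using nat_trans_hcomp[OF f.P.X f.Q.X g.Q.X n] by (simp add: mnd_cmp_def)
  qed
  show "mnd_cmp A a a b f (mnd_id A a) = f" "mnd_cmp A a b b (mnd_id A b) f = f" if "a \<in> Ob" "b \<in> Ob" "pm_1cell A a b f" for a b f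
  proof -
    interpret pm1 A a b "fst f" "snd f" using that Ob pm1I by blast
    have 1: "(\<lambda>(d, x) \<in> Obj (A \<times>\<^sub>C Carr a). Fa (fst f) (Idn (Carr a) (Fo (PFun a) (d, x))) \<cdot>\<^bsub>Carr b\<^esub> snd f (d, x)) = snd f"
      by (rule extensionalityI[OF restrict_extensional \<delta>_ext]) auto
    have 2: "(\<lambda>(d, x) \<in> Obj (A \<times>\<^sub>C Carr a). snd f (d, x) \<cdot>\<^bsub>Carr b\<^esub> Idn (Carr b) (Fo (PFun b) (d, Fo (fst f) x))) = snd f"
      by (rule extensionalityI[OF restrict_extensional \<delta>_ext]) auto
    show "mnd_cmp A a a b f (mnd_id A a) = f"
      unfolding mnd_cmp_def mnd_id_def fst_conv snd_conv ftor_comp_id[OF V]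
      by (rule prod_eqI; (subst 1[symmetric])?) (auto simp: restrict_def fun_eq_iff)
    show "mnd_cmp A a b b (mnd_id A b) f = f"
      unfolding mnd_cmp_def mnd_id_def fst_conv snd_conv ftor_comp_id[OF V]
      by (rule prod_eqI; (subst 2[symmetric])?) (auto simp: restrict_def fun_eq_iff)
  qed
  show "mnd_cmp A a b d (mnd_cmp A b c d h g) f = mnd_cmp A a c d h (mnd_cmp A a b c g f)"
    if o: "a \<in> Ob" "b \<in> Ob" "c \<in> Ob" "d \<in> Ob" and i: "pm_1cell A a b f" "pm_1cell A b c g" "pm_1cell A c d h" for a b c d f g h
  proof -
    interpret f: pm1 A a b "fst f" "snd f" using o i Ob pm1I by blast
    interpret g: pm1 A b c "fst g" "snd g" using o i Ob pm1I by blast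
    interpret h: pm1 A c d "fst h" "snd h" using o i Ob pm1I by blast
    show ?thesis unfolding mnd_cmp_def fst_conv snd_conv
      using ftor_comp_assoc[OF f.V] by (auto simp: restrict_def fun_eq_iff)
  qed
qed


section \<open>The two 2-functors\<close>

text \<open>The algebra-map equation combines naturality of \<nu> at the structure map of
  \<open>s\<close> with the 2-cell law at \<open>(par s, car s)\<close>.\<close>

lemma emf_2cell_Arr:
  assumes "pm1 A P Q V \<delta>" "pm1 A P Q W \<gamma>" and k: "pm_2cell A P Q (V, \<delta>) (W, \<gamma>) \<nu>" and s: "s \<in> Obj (emf_cat A P)"
  shows "uarrow (Fo (emf_1cell A P Q (V, \<delta>)) s) (Fo (emf_1cell A P Q (W, \<gamma>)) s) (Idn A (par s)) (\<nu> (car s)) \<in> Arr (emf_cat A Q)"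
proof -
  interpret v: pm1 A P Q V \<delta> by fact
  interpret w: pm1 A P Q W \<gamma> by fact
  have n: "nat_trans (Carr P) (Carr Q) V W \<nu>"
   and e: "\<And>a x. a \<in> Obj A \<Longrightarrow> x \<in> Obj (Carr P) \<Longrightarrow> \<nu> (Fo (PFun P) (a, x)) \<cdot>\<^bsub>Carr Q\<^esub> \<delta> (a, x) =
        \<gamma> (a, x) \<cdot>\<^bsub>Carr Q\<^esub> Fa (PFun Q) (Idn A a, \<nu> x)" using k by (auto simp: pm_2cell_iff)
  note [simp] = nat_transD(4-6)[OF n] emf_ObjD(1-5)[OF s] s
  have 1: "\<nu> (car s) \<cdot>\<^bsub>Carr Q\<^esub> Fa V (str s) = Fa W (str s) \<cdot>\<^bsub>Carr Q\<^esub> \<nu> (Fo (PFun P) (par s, car s))"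
    using nat_transD(7)[OF n, of "str s"] by simp
  show ?thesis using v.emf_1cell_Obj[OF s] w.emf_1cell_Obj[OF s]
    by (simp del: emf_ObjI add: 1[THEN reassoc] e)
qed

lemma emf_2cell_vertical:
  assumes "pm1 A P Q V \<delta>" "pm1 A P Q W \<gamma>" and k: "pm_2cell A P Q (V, \<delta>) (W, \<gamma>) \<nu>"
  shows "vertical_nat_trans A (emf A P) (emf A Q) (emf_1cell A P Q (V, \<delta>)) (emf_1cell A P Q (W, \<gamma>))
     (\<lambda>s\<in>Obj (emf_cat A P). uarrow (Fo (emf_1cell A P Q (V, \<delta>)) s) (Fo (emf_1cell A P Q (W, \<gamma>)) s) (Idn A (par s)) (\<nu> (car s)))"
proof -
  interpret v: pm1 A P Q V \<delta> by fact
  interpret w: pm1 A P Q W \<gamma> by fact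
  have n: "nat_trans (Carr P) (Carr Q) V W \<nu>" using k by (auto simp: pm_2cell_iff)
  note [simp] = nat_transD(4-6)[OF n]
  note arr = emf_2cell_Arr[OF assms]
  let ?R = "emf_1cell A P Q (V, \<delta>)" and ?R' = "emf_1cell A P Q (W, \<gamma>)" and ?M = "emf_cat A P"
  show ?thesis unfolding vertical_nat_trans_iff emf_def fst_conv snd_conv
  proof (intro conjI ballI)
    fix s assume s: "s \<in> Obj ?M"
    show "Fa (emf_proj A Q) ((\<lambda>s\<in>Obj ?M. uarrow (Fo ?R s) (Fo ?R' s) (Idn A (par s)) (\<nu> (car s))) s) =
      Idn A (Fo (emf_proj A P) s)"
      using s arr[OF s] by (simp del: emf_ArrI v.emf_1cell_Fo w.emf_1cell_Fo)
  next
    show "nat_trans ?M (emf_cat A Q) ?R ?R' (\<lambda>s\<in>Obj ?M. uarrow (Fo ?R s) (Fo ?R' s) (Idn A (par s)) (\<nu> (car s)))"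
    proof (rule nat_transI)
    fix s assume s: "s \<in> Obj ?M"
    show "arr (emf_cat A Q) ((\<lambda>s\<in>Obj ?M. uarrow (Fo ?R s) (Fo ?R' s) (Idn A (par s)) (\<nu> (car s))) s) (Fo ?R s) (Fo ?R' s)"
      using s arr[OF s] by (simp del: emf_ArrI v.emf_1cell_Fo w.emf_1cell_Fo)
  next
    fix u assume u: "u \<in> Arr ?M"
    show "(\<lambda>s\<in>Obj ?M. uarrow (Fo ?R s) (Fo ?R' s) (Idn A (par s)) (\<nu> (car s))) (Cod ?M u) \<cdot>\<^bsub>emf_cat A Q\<^esub> Fa ?R u =
       Fa ?R' u \<cdot>\<^bsub>emf_cat A Q\<^esub> (\<lambda>s\<in>Obj ?M. uarrow (Fo ?R s) (Fo ?R' s) (Idn A (par s)) (\<nu> (car s))) (Dom ?M u)"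
      using u emf_ArrD(1-8)[OF u] nat_transD(7)[OF n, of "uarr_snd u"] by simp
  qed (use v.emf_1cell_functor w.emf_1cell_functor in auto)
  qed
qed

lemma emf_1cell_id:
  assumes "param_monad_axioms A P"
  shows "emf_1cell A P P (mnd_id A P) = ftor_id (emf_cat A P)"
proof -
  interpret P: param_monad_axioms A P by fact
  define d where "d = (\<lambda>c\<in>Obj (A \<times>\<^sub>C Carr P). Idn (Carr P) (Fo (PFun P) c))"
  have d [simp]: "\<lbrakk>a \<in> Obj A; x \<in> Obj (Carr P)\<rbrakk> \<Longrightarrow> d (a, x) = Idn (Carr P) (Fo (PFun P) (a, x))" for a x
    by (simp add: d_def)
  interpret pm1 A P P "ftor_id (Carr P)" d
    using mnd_id_1cell[OF assms] by unfold_locales (simp add: mnd_id_def d_def)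
  have o: "Fo (emf_1cell A P P (ftor_id (Carr P), d)) s = s" if s: "s \<in> Obj (emf_cat A P)" for s
    using s emf_ObjD[OF s] by simp
  show ?thesis unfolding mnd_id_def d_def[symmetric]
  proof (rule ftor_eqI[of _ "Obj (emf_cat A P)" _ "Arr (emf_cat A P)"])
    fix u assume u: "u \<in> Arr (emf_cat A P)"
    show "Fa (emf_1cell A P P (ftor_id (Carr P), d)) u = Fa (ftor_id (emf_cat A P)) u"
      using u emf_ArrD[OF u] by (simp add: o del: emf_1cell_Fo)
  qed (use o functor_ext[OF emf_1cell_functor] in auto)
qed

lemma emf_1cell_comp:
  assumes "param_monad_axioms A P" "param_monad_axioms A Q" "param_monad_axioms A R" "pm_1cell A P Q v" "pm_1cell A Q R w"
  shows "emf_1cell A P R (mnd_cmp A P Q R w v) = ftor_comp (emf_cat A P) (emf_1cell A Q R w) (emf_1cell A P Q v)"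
proof -
  interpret v: pm1 A P Q "fst v" "snd v" using assms pm1I by blast
  interpret w: pm1 A Q R "fst w" "snd w" using assms pm1I by blast
  have vw: "(fst v, snd v) = v" "(fst w, snd w) = w" by auto
  define V where "V = fst (mnd_cmp A P Q R w v)"
  define \<delta> where "\<delta> = snd (mnd_cmp A P Q R w v)"
  interpret c: pm1 A P R V \<delta> unfolding V_def \<delta>_def using assms mnd_cmp_1cell pm1I by blast
  have V [simp]: "x \<in> Obj (Carr P) \<Longrightarrow> Fo V x = Fo (fst w) (Fo (fst v) x)" "g \<in> Arr (Carr P) \<Longrightarrow> Fa V g = Fa (fst w) (Fa (fst v) g)" for x g
    by (simp_all add: V_def mnd_cmp_def)
  have d [simp]: "\<lbrakk>a \<in> Obj A; x \<in> Obj (Carr P)\<rbrakk> \<Longrightarrow> \<delta> (a, x) = Fa (fst w) (snd v (a, x)) \<cdot>\<^bsub>Carr R\<^esub> snd w (a, Fo (fst v) x)" for a x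
    by (simp add: \<delta>_def mnd_cmp_def)
  have e: "mnd_cmp A P Q R w v = (V, \<delta>)" by (simp add: V_def \<delta>_def)
  note vs = functor_simps[OF v.emf_1cell_functor, unfolded vw]
  have o: "Fo (emf_1cell A P R (V, \<delta>)) s = Fo (ftor_comp (emf_cat A P) (emf_1cell A Q R w) (emf_1cell A P Q v)) s"
    if s: "s \<in> Obj (emf_cat A P)" for s
    using s emf_ObjD(1-5)[OF s] vs(1)[OF s] v.emf_1cell_Fo[OF s] w.emf_1cell_Fo[of "Fo (emf_1cell A P Q v) s"]
    by (simp del: emf_ObjI)
  show ?thesis unfolding e
  proof (rule ftor_eqI[of _ "Obj (emf_cat A P)" _ "Arr (emf_cat A P)"])
    fix u assume u: "u \<in> Arr (emf_cat A P)"
    show "Fa (emf_1cell A P R (V, \<delta>)) u = Fa (ftor_comp (emf_cat A P) (emf_1cell A Q R w) (emf_1cell A P Q v)) u"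
      using u emf_ArrD(1-8)[OF u] vs(2)[OF u] v.emf_1cell_Fa[OF u] w.emf_1cell_Fa[of "Fa (emf_1cell A P Q v) u"]
      by (simp add: o del: c.emf_1cell_Fo emf_ArrI)
  qed (use o functor_ext[OF c.emf_1cell_functor] in auto)
qed

lemma pruned_monad_axioms: "category A \<Longrightarrow> pruned_monad A z P \<Longrightarrow> param_monad_axioms A P"
  using param_monad_axiomsI by (auto simp: pruned_monad_def)

lemma emf_two_functor:
  assumes A: "category A" and z: "initial A z"
  shows "two_functor (PrMnd A z) (PrFib A z) (emf_2functor A z)"
  unfolding PrMnd_conc PrFib_conc fib_conc_def
proof (rule conc_two_functor)
  note ax = pruned_monad_axioms[OF A, where z = z]
  show "conc2 {P. pruned_monad A z P} Carr fst (pm_1cell A) (pm_2cell A) (mnd_id A) (mnd_cmp A)"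
    by (rule mnd_conc2) (use ax in auto)
  show "conc2 {(E, p). pruned A z E p} fst (\<lambda>F. F) (fibred_functor A) (vertical_nat_trans A) (\<lambda>q. ftor_id (fst q))
     (\<lambda>a b c g f. ftor_comp (fst a) g f)"
    by (rule fib_conc2[OF A]) (auto simp: pruned_def)
  let ?n = "\<lambda>P Q v w \<nu>. \<lambda>s\<in>Obj (emf_cat A P). uarrow (Fo (emf_1cell A P Q v) s) (Fo (emf_1cell A P Q w) s) (Idn A (par s)) (\<nu> (car s))"
  show "emf_2functor A z = \<lparr>F0 = emf A, FH = (\<lambda>P Q. \<lparr>Fo = (\<lambda>w\<in>{w. pm_1cell A P Q w}. emf_1cell A P Q w),
       Fa = (\<lambda>(v, w, t)\<in>Arr (conc_hom Carr fst (pm_1cell A) (pm_2cell A) P Q). (emf_1cell A P Q v, emf_1cell A P Q w, ?n P Q v w t))\<rparr>)\<rparr>"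
    by (simp add: emf_2functor_def PrMnd_conc conc_hom_def)
  show "emf A P \<in> {(E, p). pruned A z E p}" if "P \<in> {P. pruned_monad A z P}" for P
  proof -
    interpret param_monad_axioms A P using ax that by simp
    show ?thesis using that emf_pruned[OF z] unit_iso[OF initialD[OF z]] by (auto simp: pruned_monad_def emf_def)
  qed
  show "fibred_functor A (emf A P) (emf A Q) (emf_1cell A P Q w)"
    if "P \<in> {P. pruned_monad A z P}" "Q \<in> {P. pruned_monad A z P}" "pm_1cell A P Q w" for P Q w
    using pm1.emf_1cell_fibred[OF pm1I[OF ax ax]] that by simp
  show "vertical_nat_trans A (emf A P) (emf A Q) (emf_1cell A P Q v) (emf_1cell A P Q w) (?n P Q v w t)"
    if "P \<in> {P. pruned_monad A z P}" "Q \<in> {P. pruned_monad A z P}" "pm_1cell A P Q v" "pm_1cell A P Q w" "pm_2cell A P Q v w t" for P Q v w t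
  proof -
    interpret v: pm1 A P Q "fst v" "snd v" using that ax pm1I by blast
    interpret w: pm1 A P Q "fst w" "snd w" using that ax pm1I by blast
    show ?thesis using emf_2cell_vertical[OF v.pm1_axioms w.pm1_axioms, of t] that by simp
  qed
  show "?n P Q w w (\<lambda>x\<in>Obj (Carr P). Idn (Carr Q) (Fo (fst w) x)) =
      (\<lambda>s\<in>Obj (fst (emf A P)). Idn (fst (emf A Q)) (Fo (emf_1cell A P Q w) s))"
    if "P \<in> {P. pruned_monad A z P}" "Q \<in> {P. pruned_monad A z P}" "pm_1cell A P Q w" for P Q w
  proof -
    interpret pm1 A P Q "fst w" "snd w" using that ax pm1I by blast
    show ?thesis
    proof (rule extensionalityI[OF restrict_extensional])
      fix s assume "s \<in> Obj (emf_cat A P)"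
      then show "?n P Q w w (\<lambda>x\<in>Obj (Carr P). Idn (Carr Q) (Fo (fst w) x)) s =
        (\<lambda>s\<in>Obj (fst (emf A P)). Idn (fst (emf A Q)) (Fo (emf_1cell A P Q w) s)) s"
        using emf_1cell_Fo[of s] emf_ObjD(2)[of s A P] by (simp add: emf_def)
    qed (simp add: emf_def)
  qed
  show "?n P Q u w (\<lambda>x\<in>Obj (Carr P). t x \<cdot>\<^bsub>Carr Q\<^esub> s x) = (\<lambda>x\<in>Obj (fst (emf A P)). ?n P Q v w t x \<cdot>\<^bsub>fst (emf A Q)\<^esub> ?n P Q u v s x)"
    if "P \<in> {P. pruned_monad A z P}" "Q \<in> {P. pruned_monad A z P}" for P Q u v w s t
  proof (rule extensionalityI[OF restrict_extensional])
    fix x assume "x \<in> Obj (emf_cat A P)"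
    then show "?n P Q u w (\<lambda>x\<in>Obj (Carr P). t x \<cdot>\<^bsub>Carr Q\<^esub> s x) x =
      (\<lambda>x\<in>Obj (fst (emf A P)). ?n P Q v w t x \<cdot>\<^bsub>fst (emf A Q)\<^esub> ?n P Q u v s x) x"
      using A emf_ObjD(1,2)[of x A P] by (simp add: emf_def)
  qed (simp add: emf_def)
  show "emf_1cell A P P (mnd_id A P) = ftor_id (fst (emf A P))" if "P \<in> {P. pruned_monad A z P}" for P
    using emf_1cell_id[OF ax, of P] that by (simp add: emf_def)
  show "emf_1cell A P R (mnd_cmp A P Q R g f) = ftor_comp (fst (emf A P)) (emf_1cell A Q R g) (emf_1cell A P Q f)"
    if "P \<in> {P. pruned_monad A z P}" "Q \<in> {P. pruned_monad A z P}" "R \<in> {P. pruned_monad A z P}" "pm_1cell A P Q f" "pm_1cell A Q R g" for P Q R f g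
    using emf_1cell_comp[OF ax ax ax, of P Q R f g] that by (simp add: emf_def)
  show "?n P R (mnd_cmp A P Q R g f) (mnd_cmp A P Q R g' f') (\<lambda>x\<in>Obj (Carr P). s (Fo (fst f') x) \<cdot>\<^bsub>Carr R\<^esub> Fa (fst g) (t x)) =
      (\<lambda>x\<in>Obj (fst (emf A P)). ?n Q R g g' s (Fo (emf_1cell A P Q f') x) \<cdot>\<^bsub>fst (emf A R)\<^esub> Fa (emf_1cell A Q R g) (?n P Q f f' t x))"
    if o: "P \<in> {P. pruned_monad A z P}" "Q \<in> {P. pruned_monad A z P}" "R \<in> {P. pruned_monad A z P}"
      and i: "pm_1cell A P Q f" "pm_1cell A P Q f'" "pm_1cell A Q R g" "pm_1cell A Q R g'" "pm_2cell A P Q f f' t" "pm_2cell A Q R g g' s" for P Q R f f' g g' s t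
  proof -
    interpret f: pm1 A P Q "fst f" "snd f" using o i ax pm1I by blast
    interpret f': pm1 A P Q "fst f'" "snd f'" using o i ax pm1I by blast
    interpret g: pm1 A Q R "fst g" "snd g" using o i ax pm1I by blast
    interpret g': pm1 A Q R "fst g'" "snd g'" using o i ax pm1I by blast
    have p: "(fst f, snd f) = f" "(fst f', snd f') = f'" "(fst g, snd g) = g" "(fst g', snd g') = g'" by auto
    show ?thesis
    proof (rule extensionalityI[OF restrict_extensional])
      fix x assume "x \<in> Obj (emf_cat A P)"
      note x [simp] = this emf_ObjD(1-5)[OF this]
      have c: "uarrow (Fo (emf_1cell A P Q f) x) (Fo (emf_1cell A P Q f') x) (Idn A (par x)) (t (car x)) \<in> Arr (emf_cat A Q)"
        using emf_2cell_Arr[OF f.pm1_axioms f'.pm1_axioms _ x(1), of t, unfolded p, OF i(5)] .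
      have f'x: "Fo (emf_1cell A P Q f') x \<in> Obj (emf_cat A Q)" "par (Fo (emf_1cell A P Q f') x) = par x"
        "car (Fo (emf_1cell A P Q f') x) = Fo (fst f') (car x)"
        using functor_simps(1)[OF f'.emf_1cell_functor x(1)] f'.emf_1cell_Fo[OF x(1)] by auto
      have q: "Fo (emf_1cell A P R (mnd_cmp A P Q R g f)) x = Fo (emf_1cell A Q R g) (Fo (emf_1cell A P Q f) x)"
        "Fo (emf_1cell A P R (mnd_cmp A P Q R g' f')) x = Fo (emf_1cell A Q R g') (Fo (emf_1cell A P Q f') x)"
        using emf_1cell_comp[OF ax ax ax, of P Q R f g] emf_1cell_comp[OF ax ax ax, of P Q R f' g'] o i x(1) by simp_all
      show "?n P R (mnd_cmp A P Q R g f) (mnd_cmp A P Q R g' f') (\<lambda>x\<in>Obj (Carr P). s (Fo (fst f') x) \<cdot>\<^bsub>Carr R\<^esub> Fa (fst g) (t x)) x =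
        (\<lambda>x\<in>Obj (fst (emf A P)). ?n Q R g g' s (Fo (emf_1cell A P Q f') x) \<cdot>\<^bsub>fst (emf A R)\<^esub> Fa (emf_1cell A Q R g) (?n P Q f f' t x)) x"
        using c f'x g.emf_1cell_Fa[OF c] A unfolding p by (simp add: emf_def q del: emf_ArrI)
    qed (simp add: emf_def)
  qed
qed

subsection \<open>The left adjoint on 1-cells and 2-cells\<close>

definition fib_restr :: "'u ucat \<Rightarrow> 'u univ \<Rightarrow> 'u ucat \<times> 'u uftor \<Rightarrow> 'u uftor \<Rightarrow> 'u uftor" where
  "fib_restr A z q F = \<lparr>Fo = (\<lambda>x\<in>Obj (fibre A (fst q) (snd q) z). Fo F x),
     Fa = (\<lambda>u\<in>Arr (fibre A (fst q) (snd q) z). Fa F u)\<rparr>"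

text \<open>The canonical arrow from \<open>F (i\<^sub>R e)\<close> to
  \<open>i\<^sub>R (F e)\<close>: the image under \<open>F\<close> of the chosen lift at
  \<open>e\<close>, factored through the chosen lift at \<open>F e\<close>.\<close>

definition fib_mate :: "'u ucat \<Rightarrow> 'u univ \<Rightarrow> 'u ucat \<times> 'u uftor \<Rightarrow> 'u ucat \<times> 'u uftor \<Rightarrow> 'u uftor \<Rightarrow> 'u univ \<Rightarrow> 'u univ" where
  "fib_mate A z q q' F e = pruned_fib.lfac A z (fst q') (snd q') (Fa F (PLift (prune_choice A z (fst q) (snd q)) e))"

definition fib_padj :: "'u ucat \<Rightarrow> 'u univ \<Rightarrow> 'u ucat \<times> 'u uftor \<Rightarrow> 'u padj" where
  "fib_padj A z q = pruned_adj A z (fst q) (snd q)"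

definition Tp_1cell :: "'u ucat \<Rightarrow> 'u univ \<Rightarrow> 'u ucat \<times> 'u uftor \<Rightarrow> 'u ucat \<times> 'u uftor \<Rightarrow> 'u uftor \<Rightarrow> 'u pm1" where
  "Tp_1cell A z q q' F = (fib_restr A z q F,
     mate A (fib_padj A z q) (fib_padj A z q') F (fib_restr A z q F) (fib_mate A z q q' F))"

lemma fib_padj_simps [simp]:
  "AE (fib_padj A z q) = fst q" "AP (fib_padj A z q) = snd q" "AU (fib_padj A z q) = iR A z (fst q) (snd q)"
  "AM (fib_padj A z q) = Tp A z q" "Carr (Tp A z q) = fibre A (fst q) (snd q) z"
  by (cases q, simp add: fib_padj_def)+

lemma fib_restr_simps [simp]:
  "\<lbrakk>x \<in> Obj (fst q); Fo (snd q) x = z\<rbrakk> \<Longrightarrow> Fo (fib_restr A z q F) x = Fo F x"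
  "\<lbrakk>u \<in> Arr (fst q); Fa (snd q) u = Idn A z\<rbrakk> \<Longrightarrow> Fa (fib_restr A z q F) u = Fa F u"
  by (simp_all add: fib_restr_def)

lemma (in pruned_fib) fibre_ends [simp]:
  assumes "u \<in> Arr E" "Fa p u = Idn A z"
  shows "Fo p (Dom E u) = z" "Fo p (Cod E u) = z"
  using functor_simps(3,4)[OF p assms(1)] assms by auto

locale pruned_map = S: pruned_fib A z E p + S': pruned_fib A z E' p' for A z E p E' p' +
  fixes F
  assumes F: "fibred_functor A (E, p) (E', p') F"
begin

lemmas FD = fibred_functorD[OF F, simplified]

lemmas [simp] = functor_simps[OF FD(1)] FD(2,3)

abbreviation V where "V \<equiv> fib_restr A z (E, p) F"
abbreviation \<sigma> where "\<sigma> \<equiv> fib_mate A z (E, p) (E', p') F"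

lemma V: "is_functor S.E0 S'.E0 V"
  by (rule functorI) (simp_all add: fib_restr_def)

lemma \<sigma> [simp]:
  assumes "e \<in> Obj E"
  shows "\<sigma> e \<in> Arr E'" "Dom E' (\<sigma> e) = Fo F (Fo S.I e)" "Cod E' (\<sigma> e) = Fo S'.I (Fo F e)" "Fa p' (\<sigma> e) = Idn A z"
    "S'.lft (Fo F e) \<cdot>\<^bsub>E'\<^esub> \<sigma> e = Fa F (S.lft e)"
    "\<lbrakk>r \<in> Arr E'; Cod E' r = Fo F (Fo S.I e)\<rbrakk> \<Longrightarrow> S'.lft (Fo F e) \<cdot>\<^bsub>E'\<^esub> (\<sigma> e \<cdot>\<^bsub>E'\<^esub> r) = Fa F (S.lft e) \<cdot>\<^bsub>E'\<^esub> r"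
  using assms by (simp_all add: fib_mate_def)

text \<open>A cartesian functor sends the lift at \<open>e\<close> to a cartesian arrow, which lies
  over the same arrow as the lift at \<open>F e\<close>; \<sigma> is the comparison of the
  two.\<close>

lemma \<sigma>_iso:
  assumes e: "e \<in> Obj E"
  shows "is_iso S'.E0 (\<sigma> e)"
proof -
  have c: "cartesian A E' p' (Fa F (S.lft e))" using FD(4) S.lft_cartesian[OF e] by simp
  obtain v where v: "arr E' v (Fo F (Fo S.I e)) (Fo S'.I (Fo F e))" "is_iso E' v" "S'.lft (Fo F e) \<cdot>\<^bsub>E'\<^esub> v = Fa F (S.lft e)"
    by (rule cartesian_unique[OF S.A S'.E S'.p c S'.lft_cartesian[of "Fo F e"]]) (use e in auto)
  have "\<sigma> e = v"
    by (rule S'.lft_cancel[of "Fo F e"]) (use v e in auto)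
  with v S'.fibre_iso[of v] e show ?thesis by simp
qed

lemma \<sigma>_nat:
  assumes u: "u \<in> Arr E"
  shows "\<sigma> (Cod E u) \<cdot>\<^bsub>E'\<^esub> Fa F (Fa S.I u) = Fa S'.I (Fa F u) \<cdot>\<^bsub>E'\<^esub> \<sigma> (Dom E u)"
proof (rule S'.lft_cancel[of "Fo F (Cod E u)"])
  have "Fa F (S.lft (Cod E u)) \<cdot>\<^bsub>E'\<^esub> Fa F (Fa S.I u) = Fa F u \<cdot>\<^bsub>E'\<^esub> Fa F (S.lft (Dom E u))"
    using arg_cong[OF S.iR_simps(5)[OF u refl], of "Fa F"] u functor_simps(6)[OF FD(1), of "Fa S.I u" "S.lft (Cod E u)"] by simp
  then show "S'.lft (Fo F (Cod E u)) \<cdot>\<^bsub>E'\<^esub> (\<sigma> (Cod E u) \<cdot>\<^bsub>E'\<^esub> Fa F (Fa S.I u)) =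
    S'.lft (Fo F (Cod E u)) \<cdot>\<^bsub>E'\<^esub> (Fa S'.I (Fa F u) \<cdot>\<^bsub>E'\<^esub> \<sigma> (Dom E u))"
    using u by simp
qed (use u in auto)

lemma map: "padj_map A S.PD S'.PD F V \<sigma>"
proof (intro padj_map.intro padj_map_axioms.intro S.par_adj S'.par_adj)
  show "is_functor (AE S.PD) (AE S'.PD) F" "is_functor (AX S.PD) (AX S'.PD) V" using FD(1) V by simp_all
  show "is_iso (AX S'.PD) (\<sigma> e)" if "e \<in> Obj (AE S.PD)" for e using \<sigma>_iso that by simp
  show "\<sigma> (Cod (AE S.PD) v) \<cdot>\<^bsub>AX S'.PD\<^esub> Fa V (Fa (AU S.PD) v) = Fa (AU S'.PD) (Fa F v) \<cdot>\<^bsub>AX S'.PD\<^esub> \<sigma> (Dom (AE S.PD) v)"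
    if "v \<in> Arr (AE S.PD)" for v using \<sigma>_nat that by simp
qed auto

end

sublocale pruned_map \<subseteq> M: padj_map A "pruned_adj A z E p" "pruned_adj A z E' p'" F "fib_restr A z (E, p) F"
  "fib_mate A z (E, p) (E', p') F"
  by (rule map)

text \<open>For an identity or a composite, \<open>fib_mate\<close> agrees with the expected formula
  at objects of the fibration; the mates have to be identified from this pointwise
  information.\<close>

lemma mate_cong:
  assumes "par_adj A D" "\<And>e. e \<in> Obj (AE D) \<Longrightarrow> \<sigma> e = \<sigma>' e"
  shows "mate A D D' F V \<sigma> = mate A D D' F V \<sigma>'"
proof -
  interpret par_adj A D by fact
  show ?thesis unfolding mate_def pcan_def using assms(2) by (auto simp: restrict_def fun_eq_iff)
qed

lemma pruned_fibI: "category A \<Longrightarrow> initial A z \<Longrightarrow> q \<in> {(E, p). pruned A z E p} \<Longrightarrow> pruned_fib A z (fst q) (snd q)"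
  by (auto simp: pruned_fib_def)

lemma pruned_mapI: "category A \<Longrightarrow> initial A z \<Longrightarrow> q \<in> {(E, p). pruned A z E p} \<Longrightarrow> q' \<in> {(E, p). pruned A z E p} \<Longrightarrow>
    fibred_functor A q q' F \<Longrightarrow> pruned_map A z (fst q) (snd q) (fst q') (snd q') F"
  by (simp add: pruned_map_def pruned_map_axioms_def pruned_fibI)

lemma Tp_1cell_id:
  assumes "pruned_fib A z E p"
  shows "Tp_1cell A z (E, p) (E, p) (ftor_id E) = mnd_id A (Tp A z (E, p))"
    "e \<in> Obj E \<Longrightarrow> fib_mate A z (E, p) (E, p) (ftor_id E) e = Idn E (Fo (iR A z E p) e)"
proof -
  interpret pruned_fib A z E p by fact
  have V: "fib_restr A z (E, p) (ftor_id E) = ftor_id E0"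
    by (rule ftor_eqI[of _ "Obj E0" _ "Arr E0"]) (auto simp: fib_restr_def)
  show s: "fib_mate A z (E, p) (E, p) (ftor_id E) e = Idn E (Fo I e)" if "e \<in> Obj E" for e
    using lfac_comp_lft[of "Idn E (Fo I e)" e] that by (simp add: fib_mate_def)
  have "mate A PD PD (ftor_id E) (ftor_id E0) (fib_mate A z (E, p) (E, p) (ftor_id E)) =
     mate A PD PD (ftor_id E) (ftor_id E0) (\<lambda>e. Idn (AX PD) (Fo (AU PD) e))"
    by (rule mate_cong[OF par_adj]) (use s in auto)
  also have "\<dots> = (\<lambda>c\<in>Obj (A \<times>\<^sub>C AX PD). Idn (AX PD) (Fo (PFun (AM PD)) c))"
    using padj_map_id(2)[OF par_adj] by simp
  finally show "Tp_1cell A z (E, p) (E, p) (ftor_id E) = mnd_id A (Tp A z (E, p))"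
    unfolding Tp_1cell_def mnd_id_def V by (simp add: fib_padj_def)
qed

text \<open>The \<sigma> of the composite and the pasted one have the same composite with the lift,
  hence agree; the mates then compose by \<open>padj_map_comp\<close>. Thus the left adjoint is
  strict on composites although \<sigma> is only an isomorphism.\<close>

lemma Tp_1cell_comp:
  assumes "pruned_map A z E p E' p' F" "pruned_map A z E' p' E'' p'' G"
  shows "Tp_1cell A z (E, p) (E'', p'') (ftor_comp E G F) =
      mnd_cmp A (Tp A z (E, p)) (Tp A z (E', p')) (Tp A z (E'', p'')) (Tp_1cell A z (E', p') (E'', p'') G) (Tp_1cell A z (E, p) (E', p') F)"
    "e \<in> Obj E \<Longrightarrow> fib_mate A z (E, p) (E'', p'') (ftor_comp E G F) e =
       fib_mate A z (E', p') (E'', p'') G (Fo F e) \<cdot>\<^bsub>E''\<^esub> Fa G (fib_mate A z (E, p) (E', p') F e)"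
proof -
  interpret F: pruned_map A z E p E' p' F by fact
  interpret G: pruned_map A z E' p' E'' p'' G by fact
  have V: "fib_restr A z (E, p) (ftor_comp E G F) = ftor_comp F.S.E0 G.V F.V"
    by (rule ftor_eqI[of _ "Obj F.S.E0" _ "Arr F.S.E0"]) (auto simp: fib_restr_def)
  show s: "fib_mate A z (E, p) (E'', p'') (ftor_comp E G F) e = G.\<sigma> (Fo F e) \<cdot>\<^bsub>E''\<^esub> Fa G (F.\<sigma> e)" if e: "e \<in> Obj E" for e
  proof (rule G.S'.lft_cancel[of "Fo G (Fo F e)"])
    have "Fa G (F.S'.lft (Fo F e)) \<cdot>\<^bsub>E''\<^esub> Fa G (F.\<sigma> e) = Fa G (Fa F (F.S.lft e))"
      using functor_simps(6)[OF G.FD(1), of "F.\<sigma> e" "F.S'.lft (Fo F e)"] e by simp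
    then show "G.S'.lft (Fo G (Fo F e)) \<cdot>\<^bsub>E''\<^esub> fib_mate A z (E, p) (E'', p'') (ftor_comp E G F) e =
      G.S'.lft (Fo G (Fo F e)) \<cdot>\<^bsub>E''\<^esub> (G.\<sigma> (Fo F e) \<cdot>\<^bsub>E''\<^esub> Fa G (F.\<sigma> e))"
      using e by (simp add: fib_mate_def[of A z "(E, p)" "(E'', p'')"])
  qed (use e in \<open>auto simp: fib_mate_def[of A z "(E, p)" "(E'', p'')"]\<close>)
  have "mate A F.S.PD G.S'.PD (ftor_comp E G F) (ftor_comp F.S.E0 G.V F.V) (fib_mate A z (E, p) (E'', p'') (ftor_comp E G F)) =
     mate A F.S.PD G.S'.PD (ftor_comp E G F) (ftor_comp F.S.E0 G.V F.V) (\<lambda>e. G.\<sigma> (Fo F e) \<cdot>\<^bsub>AX G.S'.PD\<^esub> Fa G.V (F.\<sigma> e))"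
    by (rule mate_cong[OF F.S.par_adj]) (use s in auto)
  also have "\<dots> = (\<lambda>(a, x)\<in>Obj (A \<times>\<^sub>C AX F.S.PD). Fa G.V (F.M.\<delta> (a, x)) \<cdot>\<^bsub>AX G.S'.PD\<^esub> G.M.\<delta> (a, Fo F.V x))"
    using padj_map_comp(2)[OF F.map G.map] by simp
  finally show "Tp_1cell A z (E, p) (E'', p'') (ftor_comp E G F) =
      mnd_cmp A (Tp A z (E, p)) (Tp A z (E', p')) (Tp A z (E'', p'')) (Tp_1cell A z (E', p') (E'', p'') G) (Tp_1cell A z (E, p) (E', p') F)"
    unfolding Tp_1cell_def mnd_cmp_def V by (simp add: fib_padj_def)
qed

text \<open>Naturality of \<open>t\<close> at the chosen lift, followed by cancelling the lift in
  the target, gives the correspondence between \<open>t\<close> and its restriction to the initial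
  fibre that \<open>mate_2cell\<close> asks for.\<close>

lemma fib_mate_2cell:
  assumes "pruned_map A z E p E' p' F" "pruned_map A z E p E' p' G" and t: "vertical_nat_trans A (E, p) (E', p') F G t"
  shows "e \<in> Obj E \<Longrightarrow> fib_mate A z (E, p) (E', p') G e \<cdot>\<^bsub>E'\<^esub> t (Fo (iR A z E p) e) =
      Fa (iR A z E' p') (t e) \<cdot>\<^bsub>E'\<^esub> fib_mate A z (E, p) (E', p') F e"
    "pm_2cell A (Tp A z (E, p)) (Tp A z (E', p')) (Tp_1cell A z (E, p) (E', p') F) (Tp_1cell A z (E, p) (E', p') G)
      (restrict t (Obj (fibre A E p z)))"
proof -
  interpret F: pruned_map A z E p E' p' F by fact
  interpret G: pruned_map A z E p E' p' G by fact
  have n: "nat_trans E E' F G t" and v: "\<And>e. e \<in> Obj E \<Longrightarrow> Fa p' (t e) = Idn A (Fo p e)"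
    using t by (auto simp: vertical_nat_trans_iff)
  note [simp] = nat_transD(4-6)[OF n] v
  show eq: "G.\<sigma> e \<cdot>\<^bsub>E'\<^esub> t (Fo F.S.I e) = Fa F.S'.I (t e) \<cdot>\<^bsub>E'\<^esub> F.\<sigma> e" if e: "e \<in> Obj E" for e
    by (rule F.S'.lft_cancel[of "Fo G e"]) (use e nat_transD(7)[OF n, of "F.S.lft e"] in auto)
  have n': "nat_trans F.S.E0 F.S'.E0 F.V G.V (restrict t (Obj F.S.E0))"
  proof (rule nat_transI)
    fix u assume u: "u \<in> Arr F.S.E0"
    then have "Fo p (Dom E u) = z" "Fo p (Cod E u) = z"
      using functor_simps(3,4)[OF F.S.p, of u] by auto
    with u show "restrict t (Obj F.S.E0) (Cod F.S.E0 u) \<cdot>\<^bsub>F.S'.E0\<^esub> Fa F.V u =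
      Fa G.V u \<cdot>\<^bsub>F.S'.E0\<^esub> restrict t (Obj F.S.E0) (Dom F.S.E0 u)"
      using nat_transD(7)[OF n, of u] by simp
  qed (use F.V G.V in auto)
  have "pm_2cell A (AM F.S.PD) (AM F.S'.PD) (F.V, F.M.\<delta>) (G.V, G.M.\<delta>) (restrict t (Obj F.S.E0))"
    by (rule mate_2cell[OF F.map G.map, of _ t]) (use n' eq in simp_all)
  then show "pm_2cell A (Tp A z (E, p)) (Tp A z (E', p')) (Tp_1cell A z (E, p) (E', p') F) (Tp_1cell A z (E, p) (E', p') G)
      (restrict t (Obj (fibre A E p z)))"
    by (simp add: Tp_1cell_def fib_padj_def)
qed

definition Tp_2functor ::
  "'u ucat \<Rightarrow> 'u univ \<Rightarrow>
   ('u ucat \<times> 'u uftor, 'u uftor, 'u uftor \<times> 'u uftor \<times> ('u univ \<Rightarrow> 'u univ),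
    'u pmonad, 'u pm1, 'u pm1 \<times> 'u pm1 \<times> ('u univ \<Rightarrow> 'u univ)) twoftor" where
  "Tp_2functor A z = \<lparr>F0 = Tp A z,
     FH = (\<lambda>q q'. \<lparr>Fo = (\<lambda>F\<in>{F. fibred_functor A q q' F}. Tp_1cell A z q q' F),
       Fa = (\<lambda>(F, G, t)\<in>Arr (conc_hom fst (\<lambda>F. F) (fibred_functor A) (vertical_nat_trans A) q q').
         (Tp_1cell A z q q' F, Tp_1cell A z q q' G, restrict t (Obj (fibre A (fst q) (snd q) z))))\<rparr>)\<rparr>"

lemma Tp_two_functor:
  assumes A: "category A" and z: "initial A z"
  shows "two_functor (PrFib A z) (PrMnd A z) (Tp_2functor A z)"
  unfolding PrMnd_conc PrFib_conc fib_conc_def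
proof (rule conc_two_functor[OF _ _ Tp_2functor_def])
  let ?Ob = "{(E, p). pruned A z E p}"
  note ax = pruned_monad_axioms[OF A, where z = z] and qI = pruned_fibI[OF A z] and mI = pruned_mapI[OF A z]
  show "conc2 {P. pruned_monad A z P} Carr fst (pm_1cell A) (pm_2cell A) (mnd_id A) (mnd_cmp A)"
    by (rule mnd_conc2) (use ax in auto)
  show "conc2 ?Ob fst (\<lambda>F. F) (fibred_functor A) (vertical_nat_trans A) (\<lambda>q. ftor_id (fst q))
     (\<lambda>a b c g f. ftor_comp (fst a) g f)"
    by (rule fib_conc2[OF A]) (auto simp: pruned_def)
  show "Tp A z q \<in> {P. pruned_monad A z P}" if "q \<in> ?Ob" for q
    using pruned_fib.T_pruned[OF qI[OF that]] by simp
  show "pm_1cell A (Tp A z q) (Tp A z q') (Tp_1cell A z q q' F)" if "q \<in> ?Ob" "q' \<in> ?Ob" "fibred_functor A q q' F" for q q' F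
    using padj_map.mate_1cell[OF pruned_map.map[OF mI[OF that]]] by (simp add: Tp_1cell_def fib_padj_def)
  show "pm_2cell A (Tp A z q) (Tp A z q') (Tp_1cell A z q q' F) (Tp_1cell A z q q' G) (restrict t (Obj (fibre A (fst q) (snd q) z)))"
    if "q \<in> ?Ob" "q' \<in> ?Ob" "fibred_functor A q q' F" "fibred_functor A q q' G" "vertical_nat_trans A q q' F G t" for q q' F G t
    using fib_mate_2cell(2)[OF mI[OF that(1-3)] mI[OF that(1,2,4)], of t] that(5) by simp
  show "restrict (\<lambda>x\<in>Obj (fst q). Idn (fst q') (Fo F x)) (Obj (fibre A (fst q) (snd q) z)) =
      (\<lambda>x\<in>Obj (Carr (Tp A z q)). Idn (Carr (Tp A z q')) (Fo (fst (Tp_1cell A z q q' F)) x))" for q q' F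
    by (auto simp: restrict_def fun_eq_iff Tp_1cell_def)
  show "restrict (\<lambda>x\<in>Obj (fst q). t x \<cdot>\<^bsub>fst q'\<^esub> s x) (Obj (fibre A (fst q) (snd q) z)) =
     (\<lambda>x\<in>Obj (Carr (Tp A z q)). restrict t (Obj (fibre A (fst q) (snd q) z)) x \<cdot>\<^bsub>Carr (Tp A z q')\<^esub> restrict s (Obj (fibre A (fst q) (snd q) z)) x)" for q q' s t
    by (auto simp: restrict_def fun_eq_iff)
  show "Tp_1cell A z q q (ftor_id (fst q)) = mnd_id A (Tp A z q)" if "q \<in> ?Ob" for q
    using Tp_1cell_id(1)[OF qI[OF that]] by simp
  show "Tp_1cell A z a c (ftor_comp (fst a) g f) = mnd_cmp A (Tp A z a) (Tp A z b) (Tp A z c) (Tp_1cell A z b c g) (Tp_1cell A z a b f)"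
    if "a \<in> ?Ob" "b \<in> ?Ob" "c \<in> ?Ob" "fibred_functor A a b f" "fibred_functor A b c g" for a b c f g
    using Tp_1cell_comp(1)[OF mI[OF that(1,2,4)] mI[OF that(2,3,5)]] by simp
  show "restrict (\<lambda>x\<in>Obj (fst a). s (Fo f' x) \<cdot>\<^bsub>fst c\<^esub> Fa g (t x)) (Obj (fibre A (fst a) (snd a) z)) =
      (\<lambda>x\<in>Obj (Carr (Tp A z a)). restrict s (Obj (fibre A (fst b) (snd b) z)) (Fo (fst (Tp_1cell A z a b f')) x) \<cdot>\<^bsub>Carr (Tp A z c)\<^esub>
         Fa (fst (Tp_1cell A z b c g)) (restrict t (Obj (fibre A (fst a) (snd a) z)) x))"
    if o: "a \<in> ?Ob" "b \<in> ?Ob" "c \<in> ?Ob" and i: "fibred_functor A a b f" "fibred_functor A a b f'" "fibred_functor A b c g" "fibred_functor A b c g'"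
      "vertical_nat_trans A a b f f' t" "vertical_nat_trans A b c g g' s" for a b c f f' g g' s t
  proof (rule extensionalityI[OF restrict_extensional])
    fix x assume x: "x \<in> Obj (fibre A (fst a) (snd a) z)"
    interpret f': pruned_map A z "fst a" "snd a" "fst b" "snd b" f' by (rule mI[OF o(1,2) i(2)])
    have n: "nat_trans (fst a) (fst b) f f' t" and v: "\<And>e. e \<in> Obj (fst a) \<Longrightarrow> Fa (snd b) (t e) = Idn A (Fo (snd a) e)"
      using i(5) by (auto simp: vertical_nat_trans_iff)
    show "restrict (\<lambda>x\<in>Obj (fst a). s (Fo f' x) \<cdot>\<^bsub>fst c\<^esub> Fa g (t x)) (Obj (fibre A (fst a) (snd a) z)) x =
      (\<lambda>x\<in>Obj (Carr (Tp A z a)). restrict s (Obj (fibre A (fst b) (snd b) z)) (Fo (fst (Tp_1cell A z a b f')) x) \<cdot>\<^bsub>Carr (Tp A z c)\<^esub>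
         Fa (fst (Tp_1cell A z b c g)) (restrict t (Obj (fibre A (fst a) (snd a) z)) x)) x"
      using x n v nat_transD(4)[OF n, of x] by (simp add: Tp_1cell_def)
  qed simp
qed


section \<open>The unit\<close>

lemma two_functor_two_id:
  assumes "two_category K"
  shows "two_functor K K (two_id K)"
proof -
  have c: "\<And>a b. \<lbrakk>a \<in> Ob2 K; b \<in> Ob2 K\<rbrakk> \<Longrightarrow> category (Hom2 K a b)" and i: "\<And>a. a \<in> Ob2 K \<Longrightarrow> Id2 K a \<in> Obj (Hom2 K a a)"
    and f: "\<And>a b c. \<lbrakk>a \<in> Ob2 K; b \<in> Ob2 K; c \<in> Ob2 K\<rbrakk> \<Longrightarrow> is_functor (Hom2 K b c \<times>\<^sub>C Hom2 K a b) (Hom2 K a c) (Comp2 K a b c)"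
    using assms by (simp_all add: two_category_def)
  show ?thesis unfolding two_functor_def
    using c i functor_simps(1,2)[OF f] by (simp add: two_id_def comp1_def hcomp_def)
qed

lemma two_functor_two_comp:
  assumes "two_category K" "two_functor K M F" "two_functor M N G"
  shows "two_functor K N (two_comp K G F)"
proof -
  have c: "\<And>a b. \<lbrakk>a \<in> Ob2 K; b \<in> Ob2 K\<rbrakk> \<Longrightarrow> category (Hom2 K a b)" and i: "\<And>a. a \<in> Ob2 K \<Longrightarrow> Id2 K a \<in> Obj (Hom2 K a a)"
    and f: "\<And>a b c. \<lbrakk>a \<in> Ob2 K; b \<in> Ob2 K; c \<in> Ob2 K\<rbrakk> \<Longrightarrow> is_functor (Hom2 K b c \<times>\<^sub>C Hom2 K a b) (Hom2 K a c) (Comp2 K a b c)"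
    using assms(1) by (simp_all add: two_category_def)
  have F: "\<And>a. a \<in> Ob2 K \<Longrightarrow> F0 F a \<in> Ob2 M" "\<And>a b. \<lbrakk>a \<in> Ob2 K; b \<in> Ob2 K\<rbrakk> \<Longrightarrow> is_functor (Hom2 K a b) (Hom2 M (F0 F a) (F0 F b)) (FH F a b)"
    "\<And>a. a \<in> Ob2 K \<Longrightarrow> Fo (FH F a a) (Id2 K a) = Id2 M (F0 F a)"
    "\<And>a b c f g. \<lbrakk>a \<in> Ob2 K; b \<in> Ob2 K; c \<in> Ob2 K; f \<in> Obj (Hom2 K a b); g \<in> Obj (Hom2 K b c)\<rbrakk> \<Longrightarrow>
        Fo (FH F a c) (comp1 K a b c g f) = comp1 M (F0 F a) (F0 F b) (F0 F c) (Fo (FH F b c) g) (Fo (FH F a b) f)"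
    "\<And>a b c f g. \<lbrakk>a \<in> Ob2 K; b \<in> Ob2 K; c \<in> Ob2 K; f \<in> Arr (Hom2 K a b); g \<in> Arr (Hom2 K b c)\<rbrakk> \<Longrightarrow>
        Fa (FH F a c) (hcomp K a b c g f) = hcomp M (F0 F a) (F0 F b) (F0 F c) (Fa (FH F b c) g) (Fa (FH F a b) f)"
    using assms(2) by (simp_all add: two_functor_def)
  have G: "\<And>a. a \<in> Ob2 M \<Longrightarrow> F0 G a \<in> Ob2 N" "\<And>a b. \<lbrakk>a \<in> Ob2 M; b \<in> Ob2 M\<rbrakk> \<Longrightarrow> is_functor (Hom2 M a b) (Hom2 N (F0 G a) (F0 G b)) (FH G a b)"
    "\<And>a. a \<in> Ob2 M \<Longrightarrow> Fo (FH G a a) (Id2 M a) = Id2 N (F0 G a)"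
    "\<And>a b c f g. \<lbrakk>a \<in> Ob2 M; b \<in> Ob2 M; c \<in> Ob2 M; f \<in> Obj (Hom2 M a b); g \<in> Obj (Hom2 M b c)\<rbrakk> \<Longrightarrow>
        Fo (FH G a c) (comp1 M a b c g f) = comp1 N (F0 G a) (F0 G b) (F0 G c) (Fo (FH G b c) g) (Fo (FH G a b) f)"
    "\<And>a b c f g. \<lbrakk>a \<in> Ob2 M; b \<in> Ob2 M; c \<in> Ob2 M; f \<in> Arr (Hom2 M a b); g \<in> Arr (Hom2 M b c)\<rbrakk> \<Longrightarrow>
        Fa (FH G a c) (hcomp M a b c g f) = hcomp N (F0 G a) (F0 G b) (F0 G c) (Fa (FH G b c) g) (Fa (FH G a b) f)"
    using assms(3) by (simp_all add: two_functor_def)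
  have o: "comp1 K a b c g f \<in> Obj (Hom2 K a c)" if "a \<in> Ob2 K" "b \<in> Ob2 K" "c \<in> Ob2 K" "f \<in> Obj (Hom2 K a b)" "g \<in> Obj (Hom2 K b c)" for a b c f g
    using functor_simps(1)[OF f[OF that(1-3)], of "(g, f)"] that by (simp add: comp1_def)
  have h: "hcomp K a b c g f \<in> Arr (Hom2 K a c)" if "a \<in> Ob2 K" "b \<in> Ob2 K" "c \<in> Ob2 K" "f \<in> Arr (Hom2 K a b)" "g \<in> Arr (Hom2 K b c)" for a b c f g
    using functor_simps(2)[OF f[OF that(1-3)], of "(g, f)"] that by (simp add: hcomp_def)
  show ?thesis unfolding two_functor_def two_comp_def
    using i F(1) G(1) o h functor_simps(1,2)[OF F(2)] is_functor_comp[OF c F(2) G(2)]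
    by (simp add: F(3-5) G(3-5))
qed

section \<open>Invertible 2-cells between fibred functors\<close>

lemma fib_2cell_iso:
  assumes A: "category A" and fib: "fibration A (fst q) (snd q)" "fibration A (fst q') (snd q')"
    and a: "(F, G, t) \<in> Arr (conc_hom fst (\<lambda>F. F) (fibred_functor A) (vertical_nat_trans A) q q')"
    and i: "\<And>e. e \<in> Obj (fst q) \<Longrightarrow> is_iso (fst q') (t e)"
  shows "is_iso (conc_hom fst (\<lambda>F. F) (fibred_functor A) (vertical_nat_trans A) q q') (F, G, t)"
proof -
  have E: "category (fst q)" "category (fst q')" and p: "is_functor (fst q) A (snd q)" "is_functor (fst q') A (snd q')"
    using fib by (auto simp: fibration_def)
  have F: "fibred_functor A q q' F" and G: "fibred_functor A q q' G" and n: "nat_trans (fst q) (fst q') F G t"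
    and v: "\<And>e. e \<in> Obj (fst q) \<Longrightarrow> Fa (snd q') (t e) = Idn A (Fo (snd q) e)"
    using a by (auto simp: vertical_nat_trans_iff)
  note F' = fibred_functorD(1,2)[OF F] and G' = fibred_functorD(1,2)[OF G]
  note [simp] = A E nat_transD(4-6)[OF n] F'(2) G'(2) v functor_base[OF F'(1)] functor_base[OF G'(1)] functor_base[OF p(1)] functor_base[OF p(2)]
  have inv [simp]: "inv_arr (fst q') (t e) \<in> Arr (fst q')" "Dom (fst q') (inv_arr (fst q') (t e)) = Fo G e"
    "Cod (fst q') (inv_arr (fst q') (t e)) = Fo F e" "inv_arr (fst q') (t e) \<cdot>\<^bsub>fst q'\<^esub> t e = Idn (fst q') (Fo F e)"
    "t e \<cdot>\<^bsub>fst q'\<^esub> inv_arr (fst q') (t e) = Idn (fst q') (Fo G e)" if "e \<in> Obj (fst q)" for e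
    using inv_arr[OF i[OF that]] that by auto
  note inv4 = inv(4)[THEN reassoc] and inv5 = inv(5)[THEN reassoc]
  let ?s = "\<lambda>e\<in>Obj (fst q). inv_arr (fst q') (t e)"
  have "nat_trans (fst q) (fst q') G F ?s"
  proof (rule nat_transI)
    fix f assume f [simp]: "f \<in> Arr (fst q)"
    show "?s (Cod (fst q) f) \<cdot>\<^bsub>fst q'\<^esub> Fa G f = Fa F f \<cdot>\<^bsub>fst q'\<^esub> ?s (Dom (fst q) f)"
    proof (rule iso_mono[OF E(2) i[of "Cod (fst q) f"]])
      show "t (Cod (fst q) f) \<cdot>\<^bsub>fst q'\<^esub> (?s (Cod (fst q) f) \<cdot>\<^bsub>fst q'\<^esub> Fa G f) =
        t (Cod (fst q) f) \<cdot>\<^bsub>fst q'\<^esub> (Fa F f \<cdot>\<^bsub>fst q'\<^esub> ?s (Dom (fst q) f))"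
        using nat_transD(7)[OF n f, THEN reassoc, of "inv_arr (fst q') (t (Dom (fst q) f))"] by (simp add: inv5)
    qed auto
  qed (use F'(1) G'(1) in auto)
  moreover have "Fa (snd q') (inv_arr (fst q') (t e)) = Idn A (Fo (snd q) e)" if e: "e \<in> Obj (fst q)" for e
    using functor_simps(6)[OF p(2), of "t e" "inv_arr (fst q') (t e)"] e by simp
  ultimately have "vertical_nat_trans A q q' G F ?s" by (simp add: vertical_nat_trans_iff)
  then show ?thesis
    using a F G by (intro is_isoI[of _ _ F G "(G, F, ?s)"]) (simp_all cong: restrict_cong)
qed

lemma fib_2cell_isoD:
  assumes i: "is_iso (conc_hom fst (\<lambda>F. F) (fibred_functor A) (vertical_nat_trans A) q q') (F, G, t)" and e: "e \<in> Obj (fst q)"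
  shows "is_iso (fst q') (t e)"
proof -
  let ?H = "conc_hom fst (\<lambda>F. F) (fibred_functor A) (vertical_nat_trans A) q q'"
  obtain s where s: "inv_arr ?H (F, G, t) = (G, F, s)" using inv_arr(2,3)[OF i] by (cases "inv_arr ?H (F, G, t)") auto
  note j = inv_arr[OF i, unfolded s]
  have n: "nat_trans (fst q) (fst q') F G t" "nat_trans (fst q) (fst q') G F s" using j(1,6) by (auto simp: vertical_nat_trans_iff)
  have "(\<lambda>x\<in>Obj (fst q). s x \<cdot>\<^bsub>fst q'\<^esub> t x) = (\<lambda>x\<in>Obj (fst q). Idn (fst q') (Fo F x))"
    "(\<lambda>x\<in>Obj (fst q). t x \<cdot>\<^bsub>fst q'\<^esub> s x) = (\<lambda>x\<in>Obj (fst q). Idn (fst q') (Fo G x))" using j(4,5) by simp_all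
  from fun_cong[OF this(1), of e] fun_cong[OF this(2), of e]
  have "s e \<cdot>\<^bsub>fst q'\<^esub> t e = Idn (fst q') (Fo F e)" "t e \<cdot>\<^bsub>fst q'\<^esub> s e = Idn (fst q') (Fo G e)"
    using e by simp_all
  then show ?thesis
    using nat_transD(4-6)[OF n(1) e] nat_transD(4-6)[OF n(2) e] by (intro is_isoI[of _ _ "Fo F e" "Fo G e" "s e"]) auto
qed

section \<open>Pseudonaturality of the unit\<close>

definition unit_cell :: "'u ucat \<Rightarrow> 'u univ \<Rightarrow> 'u ucat \<times> 'u uftor \<Rightarrow> 'u ucat \<times> 'u uftor \<Rightarrow> 'u uftor \<Rightarrow> 'u univ \<Rightarrow> 'u univ" where
  "unit_cell A z q q' F = (\<lambda>e\<in>Obj (fst q). uarrow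
     (Fo (emf_1cell A (Tp A z q) (Tp A z q') (Tp_1cell A z q q' F)) (Fo (pcompar A (fib_padj A z q)) e))
     (Fo (pcompar A (fib_padj A z q')) (Fo F e)) (Idn A (Fo (snd q) e)) (fib_mate A z q q' F e))"

context pruned_map
begin

abbreviation "R \<equiv> emf_1cell A (Tp A z (E, p)) (Tp A z (E', p')) (Tp_1cell A z (E, p) (E', p') F)"
abbreviation "K \<equiv> pcompar A S.PD"
abbreviation "K' \<equiv> pcompar A S'.PD"

lemma Tp_1cell_eq: "Tp_1cell A z (E, p) (E', p') F = (V, M.\<delta>)"
  by (simp add: Tp_1cell_def fib_padj_def)

lemma unit_cell_eq: "e \<in> Obj E \<Longrightarrow> unit_cell A z (E, p) (E', p') F e = uarrow (Fo R (Fo K e)) (Fo K' (Fo F e)) (Idn A (Fo p e)) (\<sigma> e)"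
  by (simp add: unit_cell_def fib_padj_def)

lemma R_functor: "is_functor (emf_cat A S.T) (emf_cat A S'.T) R"
  using M.emf_1cell_functor by (simp add: Tp_1cell_eq)

lemma K_functor: "is_functor E (emf_cat A S.T) K" "is_functor E' (emf_cat A S'.T) K'"
  using S.K.pcompar_functor S'.K.pcompar_functor by simp_all

lemma unit_cell_Arr: "e \<in> Obj E \<Longrightarrow> unit_cell A z (E, p) (E', p') F e \<in> Arr (emf_cat A S'.T)"
  using M.mate_comparison[of e] by (simp add: unit_cell_eq Tp_1cell_eq del: emf_ArrI S.K.pcompar_simps(1) S'.K.pcompar_simps(1))

lemma unit_cell_iso:
  assumes e: "e \<in> Obj E"
  shows "is_iso (emf_cat A S'.T) (unit_cell A z (E, p) (E', p') F e)"
  by (rule S'.T.emf_isoI[OF unit_cell_Arr[OF e]]) (use e \<sigma>_iso in \<open>simp_all add: unit_cell_eq\<close>)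

lemma R_K_Fa:
  assumes u: "u \<in> Arr E"
  shows "Fa R (Fa K u) = uarrow (Fo R (Fo K (Dom E u))) (Fo R (Fo K (Cod E u))) (Fa p u) (Fa F (Fa S.I u))"
  using u M.emf_1cell_Fa[of "Fa K u"] functor_simps(2)[OF K_functor(1) u]
  by (simp add: Tp_1cell_eq del: emf_ArrI S.K.pcompar_simps(1) M.emf_1cell_Fo)

lemma unit_cell_nat_trans:
  "vertical_nat_trans A (E, p) (emf A S'.T) (ftor_comp E R K) (ftor_comp E K' F) (unit_cell A z (E, p) (E', p') F)"
  unfolding vertical_nat_trans_iff emf_def fst_conv snd_conv
proof (intro conjI ballI)
  fix e assume e: "e \<in> Obj E"
  show "Fa (emf_proj A S'.T) (unit_cell A z (E, p) (E', p') F e) = Idn A (Fo p e)"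
    using unit_cell_Arr[OF e] e by (simp add: unit_cell_eq del: emf_ArrI)
next
  show "nat_trans E (emf_cat A S'.T) (ftor_comp E R K) (ftor_comp E K' F) (unit_cell A z (E, p) (E', p') F)"
  proof (rule nat_transI)
    show "unit_cell A z (E, p) (E', p') F \<in> extensional (Obj E)" by (simp add: unit_cell_def)
    show "is_functor E (emf_cat A S'.T) (ftor_comp E R K)" "is_functor E (emf_cat A S'.T) (ftor_comp E K' F)"
      using is_functor_comp[OF S.E K_functor(1) R_functor] is_functor_comp[OF S.E FD(1) K_functor(2)] .
    show "arr (emf_cat A S'.T) (unit_cell A z (E, p) (E', p') F e) (Fo (ftor_comp E R K) e) (Fo (ftor_comp E K' F) e)" if "e \<in> Obj E" for e
      using that unit_cell_Arr[OF that] by (simp add: unit_cell_eq del: emf_ArrI S.K.pcompar_simps(1) S'.K.pcompar_simps(1))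
    fix u assume u: "u \<in> Arr E"
    show "unit_cell A z (E, p) (E', p') F (Cod E u) \<cdot>\<^bsub>emf_cat A S'.T\<^esub> Fa (ftor_comp E R K) u =
       Fa (ftor_comp E K' F) u \<cdot>\<^bsub>emf_cat A S'.T\<^esub> unit_cell A z (E, p) (E', p') F (Dom E u)"
      using u \<sigma>_nat[OF u] by (simp add: unit_cell_eq R_K_Fa del: S.K.pcompar_simps S'.K.pcompar_simps(1))
  qed
qed

end

text \<open>On carriers this is the equation of \<open>fib_mate_2cell\<close>; on parameters only
  identities occur.\<close>

lemma unit_cell_2cell:
  assumes "pruned_map A z E p E' p' F" "pruned_map A z E p E' p' G" and t: "vertical_nat_trans A (E, p) (E', p') F G t"
    and e: "e \<in> Obj E"
  defines "R \<equiv> \<lambda>F. emf_1cell A (Tp A z (E, p)) (Tp A z (E', p')) (Tp_1cell A z (E, p) (E', p') F)"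
  defines "k \<equiv> Fo (pcompar A (fib_padj A z (E, p))) e"
  shows "Fa (pcompar A (fib_padj A z (E', p'))) (t e) \<cdot>\<^bsub>emf_cat A (Tp A z (E', p'))\<^esub> unit_cell A z (E, p) (E', p') F e =
     unit_cell A z (E, p) (E', p') G e \<cdot>\<^bsub>emf_cat A (Tp A z (E', p'))\<^esub> uarrow (Fo (R F) k) (Fo (R G) k) (Idn A (Fo p e)) (t (Fo (iR A z E p) e))"
proof -
  interpret F: pruned_map A z E p E' p' F by fact
  interpret G: pruned_map A z E p E' p' G by fact
  have n: "nat_trans E E' F G t" and v: "Fa p' (t e) = Idn A (Fo p e)"
    using t e by (auto simp: vertical_nat_trans_iff)
  note [simp] = nat_transD(4-6)[OF n e] v e
  show ?thesis unfolding R_def k_def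
    using fib_mate_2cell(1)[OF assms(1-3) e]
    by (simp add: fib_padj_def F.unit_cell_eq G.unit_cell_eq del: F.S.K.pcompar_simps(1) F.S'.K.pcompar_simps(1))
qed

lemma unit_cell_id:
  assumes "pruned_fib A z E p" "e \<in> Obj E"
  shows "unit_cell A z (E, p) (E, p) (ftor_id E) e = Idn (emf_cat A (Tp A z (E, p))) (Fo (pcompar A (fib_padj A z (E, p))) e)"
proof -
  interpret pruned_fib A z E p by fact
  have k: "Fo (pcompar A PD) e \<in> Obj (emf_cat A T)" using functor_simps(1)[OF K.pcompar_functor] assms(2) by simp
  have kk: "par (Fo (pcompar A PD) e) = Fo p e" "car (Fo (pcompar A PD) e) = Fo I e" using assms(2) by auto
  show ?thesis using k kk assms(2) emf_1cell_id[OF T_axioms]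
    by (simp add: unit_cell_def fib_padj_def Tp_1cell_id[OF assms(1)] del: K.pcompar_simps(1) emf_ObjI)
qed

text \<open>On carriers the right-hand side is the pasted formula for \<sigma> from
  \<open>Tp_1cell_comp\<close>; sources and targets match because the Eilenberg--Moore construction
  is strict on composites.\<close>

lemma unit_cell_comp:
  assumes "pruned_map A z E p E' p' F" "pruned_map A z E' p' E'' p'' G" and e: "e \<in> Obj E"
  shows "unit_cell A z (E, p) (E'', p'') (ftor_comp E G F) e = unit_cell A z (E', p') (E'', p'') G (Fo F e) \<cdot>\<^bsub>emf_cat A (Tp A z (E'', p''))\<^esub>
    Fa (emf_1cell A (Tp A z (E', p')) (Tp A z (E'', p'')) (Tp_1cell A z (E', p') (E'', p'') G)) (unit_cell A z (E, p) (E', p') F e)"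
proof -
  interpret F: pruned_map A z E p E' p' F by fact
  interpret G: pruned_map A z E' p' E'' p'' G by fact
  have c: "pm_1cell A F.S.T F.S'.T (Tp_1cell A z (E, p) (E', p') F)" "pm_1cell A F.S'.T G.S'.T (Tp_1cell A z (E', p') (E'', p'') G)"
    using F.M.mate_1cell G.M.mate_1cell by (simp_all add: F.Tp_1cell_eq G.Tp_1cell_eq)
  have u: "Fa G.R (unit_cell A z (E, p) (E', p') F e) = uarrow (Fo G.R (Fo F.R (Fo F.K e))) (Fo G.R (Fo F.K' (Fo F e))) (Idn A (Fo p e)) (Fa G (F.\<sigma> e))"
    using G.M.emf_1cell_Fa[of "unit_cell A z (E, p) (E', p') F e"] F.unit_cell_Arr[OF e] e
    by (simp add: G.Tp_1cell_eq F.unit_cell_eq del: emf_ArrI G.M.emf_1cell_Fo F.S.K.pcompar_simps(1) F.S'.K.pcompar_simps(1))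
  have k: "Fo F.K e \<in> Obj (emf_cat A F.S.T)" using functor_simps(1)[OF F.K_functor(1) e] .
  show ?thesis
    unfolding u
    using e k emf_1cell_comp[OF F.S.T_axioms F.S'.T_axioms G.S'.T_axioms c]
    by (simp add: unit_cell_def fib_padj_def Tp_1cell_comp[OF assms(1,2)] del: F.S.K.pcompar_simps(1) F.S'.K.pcompar_simps(1) G.S'.K.pcompar_simps(1) emf_ObjI)
qed

definition unit_pnt ::
  "'u ucat \<Rightarrow> 'u univ \<Rightarrow> ('u ucat \<times> 'u uftor, 'u uftor, 'u uftor, 'u uftor \<times> 'u uftor \<times> ('u univ \<Rightarrow> 'u univ)) pnt" where
  "unit_pnt A z = \<lparr>N0 = (\<lambda>q. pcompar A (fib_padj A z q)),
     N1 = (\<lambda>q q' F. (ftor_comp (fst q) (emf_1cell A (Tp A z q) (Tp A z q') (Tp_1cell A z q q' F)) (pcompar A (fib_padj A z q)),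
        ftor_comp (fst q) (pcompar A (fib_padj A z q')) F, unit_cell A z q q' F))\<rparr>"

lemma emf_2functor_simps [simp]:
  "F0 (emf_2functor A z) = emf A"
  "pm_1cell A P Q w \<Longrightarrow> Fo (FH (emf_2functor A z) P Q) w = emf_1cell A P Q w"
  "\<lbrakk>pm_1cell A P Q v; pm_1cell A P Q w; pm_2cell A P Q v w \<nu>\<rbrakk> \<Longrightarrow> Fa (FH (emf_2functor A z) P Q) (v, w, \<nu>) =
     (emf_1cell A P Q v, emf_1cell A P Q w, \<lambda>s\<in>Obj (emf_cat A P).
        uarrow (Fo (emf_1cell A P Q v) s) (Fo (emf_1cell A P Q w) s) (Idn A (par s)) (\<nu> (car s)))"
  by (simp_all add: emf_2functor_def PrMnd_conc)

lemma Tp_2functor_simps [simp]: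
  "F0 (Tp_2functor A z) = Tp A z"
  "fibred_functor A q q' F \<Longrightarrow> Fo (FH (Tp_2functor A z) q q') F = Tp_1cell A z q q' F"
  "\<lbrakk>fibred_functor A q q' F; fibred_functor A q q' G; vertical_nat_trans A q q' F G t\<rbrakk> \<Longrightarrow>
     Fa (FH (Tp_2functor A z) q q') (F, G, t) = (Tp_1cell A z q q' F, Tp_1cell A z q q' G, restrict t (Obj (fibre A (fst q) (snd q) z)))"
  by (simp_all add: Tp_2functor_def)

lemma fst_emf [simp]: "fst (emf A P) = emf_cat A P" "snd (emf A P) = emf_proj A P"
  by (simp_all add: emf_def)

text \<open>The coherence laws hold at each component by the preceding lemmas on
  \<open>unit_cell\<close>. What is added here is the typing, and the removal of the identity
  2-cells that whiskering inserts on either side.\<close>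

lemma unit_pseudonatural:
  assumes A: "category A" and z: "initial A z"
  shows "pseudonatural (PrFib A z) (PrFib A z) (two_id (PrFib A z))
    (two_comp (PrFib A z) (emf_2functor A z) (Tp_2functor A z)) (unit_pnt A z)"
proof -
  let ?Ob = "{(E, p). pruned A z E p}" and ?K = "PrFib A z"
  interpret C: conc2 ?Ob fst "\<lambda>F. F" "fibred_functor A" "vertical_nat_trans A" "\<lambda>q. ftor_id (fst q)" "\<lambda>a b c g f. ftor_comp (fst a) g f"
    by (rule fib_conc2[OF A]) (auto simp: pruned_def)
  interpret C': conc2 "{P. pruned_monad A z P}" Carr fst "pm_1cell A" "pm_2cell A" "mnd_id A" "mnd_cmp A"
    by (rule mnd_conc2) (use pruned_monad_axioms[OF A] in auto)
  have K: "?K = C.K" by (simp add: PrFib_conc fib_conc_def)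
  have tc: "two_category ?K" unfolding K by (rule C.two_category)
  note qI = pruned_fibI[OF A z] and mI = pruned_mapI[OF A z]
  have RL: "Fo (FH (two_comp ?K (emf_2functor A z) (Tp_2functor A z)) q q') F = emf_1cell A (Tp A z q) (Tp A z q') (Tp_1cell A z q q' F)"
    if "q \<in> ?Ob" "q' \<in> ?Ob" "fibred_functor A q q' F" for q q' F
  proof -
    interpret pruned_map A z "fst q" "snd q" "fst q'" "snd q'" F by (rule mI[OF that])
    show ?thesis using that M.mate_1cell Tp_1cell_eq by (simp add: two_comp_def K)
  qed
  have RLa: "Fa (FH (two_comp ?K (emf_2functor A z) (Tp_2functor A z)) q q') (F, G, t) =
     (emf_1cell A (Tp A z q) (Tp A z q') (Tp_1cell A z q q' F), emf_1cell A (Tp A z q) (Tp A z q') (Tp_1cell A z q q' G),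
      \<lambda>s\<in>Obj (emf_cat A (Tp A z q)). uarrow (Fo (emf_1cell A (Tp A z q) (Tp A z q') (Tp_1cell A z q q' F)) s)
         (Fo (emf_1cell A (Tp A z q) (Tp A z q') (Tp_1cell A z q q' G)) s) (Idn A (par s)) (restrict t (Obj (fibre A (fst q) (snd q) z)) (car s)))"
    if "q \<in> ?Ob" "q' \<in> ?Ob" "fibred_functor A q q' F" "fibred_functor A q q' G" "vertical_nat_trans A q q' F G t" for q q' F G t
  proof -
    interpret F: pruned_map A z "fst q" "snd q" "fst q'" "snd q'" F by (rule mI[OF that(1-3)])
    interpret G: pruned_map A z "fst q" "snd q" "fst q'" "snd q'" G by (rule mI[OF that(1,2,4)])
    have "pm_2cell A (Tp A z q) (Tp A z q') (Tp_1cell A z q q' F) (Tp_1cell A z q q' G) (restrict t (Obj (fibre A (fst q) (snd q) z)))"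
      using fib_mate_2cell(2)[OF F.pruned_map_axioms G.pruned_map_axioms, of t] that(5) by simp
    then show ?thesis using that F.M.mate_1cell F.Tp_1cell_eq G.M.mate_1cell G.Tp_1cell_eq by (simp add: two_comp_def K del: restrict_apply)
  qed
  have N0: "N0 (unit_pnt A z) q = pcompar A (fib_padj A z q)" for q by (simp add: unit_pnt_def)
  have N1: "N1 (unit_pnt A z) q q' F = (ftor_comp (fst q) (emf_1cell A (Tp A z q) (Tp A z q') (Tp_1cell A z q q' F)) (pcompar A (fib_padj A z q)),
        ftor_comp (fst q) (pcompar A (fib_padj A z q')) F, unit_cell A z q q' F)" for q q' F by (simp add: unit_pnt_def)
  have F0: "F0 (two_id ?K) q = q" "F0 (two_comp ?K (emf_2functor A z) (Tp_2functor A z)) q = emf A (Tp A z q)" for q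
    by (simp_all add: two_id_def two_comp_def)
  have FHi: "fibred_functor A q q' F \<Longrightarrow> Fo (FH (two_id ?K) q q') F = F" "\<alpha> \<in> Arr (C.H q q') \<Longrightarrow> Fa (FH (two_id ?K) q q') \<alpha> = \<alpha>" for q q' F \<alpha>
    by (simp_all add: two_id_def K)
  have ub: "fibred_functor A q (emf A (Tp A z q)) (pcompar A (fib_padj A z q))" if "q \<in> ?Ob" for q
    using pruned_fib.unit_fibred[OF qI[OF that]] by (simp add: fib_padj_def)
  have em: "emf A (Tp A z q) \<in> ?Ob" if "q \<in> ?Ob" for q
  proof -
    have q: "q \<in> Ob2 ?K" using that by (simp add: K)
    have 1: "F0 (Tp_2functor A z) q \<in> Ob2 (PrMnd A z)"
      using Tp_two_functor[OF A z] q unfolding two_functor_def by blast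
    have "F0 (emf_2functor A z) (F0 (Tp_2functor A z) q) \<in> Ob2 ?K"
      using emf_two_functor[OF A z] 1 unfolding two_functor_def by blast
    then show ?thesis by (simp add: K)
  qed
  have Rf: "fibred_functor A (emf A (Tp A z q)) (emf A (Tp A z q')) (emf_1cell A (Tp A z q) (Tp A z q') (Tp_1cell A z q q' F))"
    if "q \<in> ?Ob" "q' \<in> ?Ob" "fibred_functor A q q' F" for q q' F
  proof -
    interpret pruned_map A z "fst q" "snd q" "fst q'" "snd q'" F by (rule mI[OF that])
    show ?thesis using M.emf_1cell_fibred Tp_1cell_eq by simp
  qed
  have uc: "vertical_nat_trans A q (emf A (Tp A z q')) (ftor_comp (fst q) (emf_1cell A (Tp A z q) (Tp A z q') (Tp_1cell A z q q' F)) (pcompar A (fib_padj A z q)))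
        (ftor_comp (fst q) (pcompar A (fib_padj A z q')) F) (unit_cell A z q q' F)"
     "e \<in> Obj (fst q) \<Longrightarrow> is_iso (emf_cat A (Tp A z q')) (unit_cell A z q q' F e)"
     "e \<in> Obj (fst q) \<Longrightarrow> unit_cell A z q q' F e \<in> Arr (emf_cat A (Tp A z q'))"
     "e \<in> Obj (fst q) \<Longrightarrow> uarr_dom (unit_cell A z q q' F e) = Fo (emf_1cell A (Tp A z q) (Tp A z q') (Tp_1cell A z q q' F)) (Fo (pcompar A (fib_padj A z q)) e)"
     "e \<in> Obj (fst q) \<Longrightarrow> uarr_cod (unit_cell A z q q' F e) = Fo (pcompar A (fib_padj A z q')) (Fo F e)"
    if "q \<in> ?Ob" "q' \<in> ?Ob" "fibred_functor A q q' F" for q q' F e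
  proof -
    interpret pruned_map A z "fst q" "snd q" "fst q'" "snd q'" F by (rule mI[OF that])
    show "vertical_nat_trans A q (emf A (Tp A z q')) (ftor_comp (fst q) (emf_1cell A (Tp A z q) (Tp A z q') (Tp_1cell A z q q' F)) (pcompar A (fib_padj A z q)))
        (ftor_comp (fst q) (pcompar A (fib_padj A z q')) F) (unit_cell A z q q' F)"
      using unit_cell_nat_trans by (simp add: fib_padj_def)
    show "e \<in> Obj (fst q) \<Longrightarrow> is_iso (emf_cat A (Tp A z q')) (unit_cell A z q q' F e)"
      "e \<in> Obj (fst q) \<Longrightarrow> unit_cell A z q q' F e \<in> Arr (emf_cat A (Tp A z q'))"
      using unit_cell_iso[of e] unit_cell_Arr[of e] by simp_all
  qed (simp_all add: unit_cell_def)
  have fibr: "fibration A (fst q) (snd q)" if "q \<in> ?Ob" for q using that by (auto simp: pruned_def)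
  have Ec: "category (fst q)" if "q \<in> ?Ob" for q using C.cat[OF that] .
  show ?thesis
    unfolding pseudonatural_def N0 N1 F0
  proof (intro conjI ballI)
    show "two_functor ?K ?K (two_id ?K)" by (rule two_functor_two_id[OF tc])
    show "two_functor ?K ?K (two_comp ?K (emf_2functor A z) (Tp_2functor A z))"
      by (rule two_functor_two_comp[OF tc Tp_two_functor[OF A z] emf_two_functor[OF A z]])
    show "pcompar A (fib_padj A z q) \<in> Obj (Hom2 ?K q (emf A (Tp A z q)))" if "q \<in> Ob2 ?K" for q
      using ub that by (simp add: K)
  next
    fix q q' F assume "q \<in> Ob2 ?K" "q' \<in> Ob2 ?K" "F \<in> Obj (Hom2 ?K q q')"
    then have q: "q \<in> ?Ob" "q' \<in> ?Ob" and F: "fibred_functor A q q' F" by (simp_all add: K)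
    have a: "fibred_functor A q (emf A (Tp A z q')) (ftor_comp (fst q) (emf_1cell A (Tp A z q) (Tp A z q') (Tp_1cell A z q q' F)) (pcompar A (fib_padj A z q)))"
       "fibred_functor A q (emf A (Tp A z q')) (ftor_comp (fst q) (pcompar A (fib_padj A z q')) F)"
      using C.cmp(1)[OF q(1) em[OF q(1)] em[OF q(2)] ub[OF q(1)] Rf[OF q F]] C.cmp(1)[OF q em[OF q(2)] F ub[OF q(2)]] by simp_all
    show "(ftor_comp (fst q) (emf_1cell A (Tp A z q) (Tp A z q') (Tp_1cell A z q q' F)) (pcompar A (fib_padj A z q)),
        ftor_comp (fst q) (pcompar A (fib_padj A z q')) F, unit_cell A z q q' F) \<in> hom (Hom2 ?K q (emf A (Tp A z q')))
      (comp1 ?K q (emf A (Tp A z q)) (emf A (Tp A z q')) (Fo (FH (two_comp ?K (emf_2functor A z) (Tp_2functor A z)) q q') F) (pcompar A (fib_padj A z q)))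
      (comp1 ?K q q' (emf A (Tp A z q')) (pcompar A (fib_padj A z q')) (Fo (FH (two_id ?K) q q') F))"
      unfolding RL[OF q F] FHi(1)[OF F] using a uc(1)[OF q F] ub[OF q(1)] ub[OF q(2)] F Rf[OF q F] by (simp add: K)
    show "is_iso (Hom2 ?K q (emf A (Tp A z q'))) (ftor_comp (fst q) (emf_1cell A (Tp A z q) (Tp A z q') (Tp_1cell A z q q' F)) (pcompar A (fib_padj A z q)),
        ftor_comp (fst q) (pcompar A (fib_padj A z q')) F, unit_cell A z q q' F)"
      unfolding K conc_simps(2)
      by (rule fib_2cell_iso[OF A fibr[OF q(1)] fibr[OF em[OF q(2)]]]) (use a uc(1)[OF q F] uc(2)[OF q F] in simp_all)
  next
    fix q q' \<alpha> assume "q \<in> Ob2 ?K" "q' \<in> Ob2 ?K" "\<alpha> \<in> Arr (Hom2 ?K q q')"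
    then obtain F G t where q: "q \<in> ?Ob" "q' \<in> ?Ob" and \<alpha>: "\<alpha> = (F, G, t)" and F: "fibred_functor A q q' F" and G: "fibred_functor A q q' G"
      and t: "vertical_nat_trans A q q' F G t" by (cases \<alpha>) (auto simp: K)
    interpret F: pruned_map A z "fst q" "snd q" "fst q'" "snd q'" F by (rule mI[OF q F])
    interpret G: pruned_map A z "fst q" "snd q" "fst q'" "snd q'" G by (rule mI[OF q G])
    let ?R = "\<lambda>F. emf_1cell A (Tp A z q) (Tp A z q') (Tp_1cell A z q q' F)" and ?k = "pcompar A (fib_padj A z q)" and ?k' = "pcompar A (fib_padj A z q')"
    let ?r = "\<lambda>s\<in>Obj (emf_cat A (Tp A z q)). uarrow (Fo (?R F) s) (Fo (?R G) s) (Idn A (par s)) (restrict t (Obj (fibre A (fst q) (snd q) z)) (car s))"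
    have \<alpha>A: "\<alpha> \<in> Arr (C.H q q')" using \<alpha> F G t by simp
    have rc: "vertical_nat_trans A (emf A (Tp A z q)) (emf A (Tp A z q')) (?R F) (?R G) ?r"
      using emf_2cell_vertical[OF F.M.pm1_axioms G.M.pm1_axioms, of "restrict t (Obj (fibre A (fst q) (snd q) z))"]
        fib_mate_2cell(2)[OF F.pruned_map_axioms G.pruned_map_axioms, of t] t F.Tp_1cell_eq G.Tp_1cell_eq by simp
    have ii: "vertical_nat_trans A q (emf A (Tp A z q)) ?k ?k (\<lambda>x\<in>Obj (fst q). Idn (emf_cat A (Tp A z q)) (Fo ?k x))"
      "vertical_nat_trans A q' (emf A (Tp A z q')) ?k' ?k' (\<lambda>x\<in>Obj (fst q'). Idn (emf_cat A (Tp A z q')) (Fo ?k' x))"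
      using C.id2[OF q(1) em[OF q(1)] ub[OF q(1)]] C.id2[OF q(2) em[OF q(2)] ub[OF q(2)]] by simp_all
    have kf: "is_functor (fst q) (emf_cat A (Tp A z q)) ?k" "is_functor (fst q') (emf_cat A (Tp A z q')) ?k'"
      using fibred_functorD(1)[OF ub[OF q(1)]] fibred_functorD(1)[OF ub[OF q(2)]] by simp_all
    have Rff: "is_functor (emf_cat A (Tp A z q)) (emf_cat A (Tp A z q')) (?R F)" using fibred_functorD(1)[OF Rf[OF q F]] by simp
    have catT: "category (emf_cat A (Tp A z q))" "category (emf_cat A (Tp A z q'))" using Ec[OF em[OF q(1)]] Ec[OF em[OF q(2)]] by simp_all
    have n: "nat_trans (fst q) (fst q') F G t" using t by (simp add: vertical_nat_trans_iff)
    \<comment> \<open>The components in the form in which horizontal composition produces them.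
      Stripped of the whiskering identities, this is \<open>unit_cell_2cell\<close>.\<close>
    have key: "((\<lambda>x\<in>Obj (fst q'). Idn (emf_cat A (Tp A z q')) (Fo ?k' x)) (Fo G x) \<cdot>\<^bsub>emf_cat A (Tp A z q')\<^esub> Fa ?k' (t x)) \<cdot>\<^bsub>emf_cat A (Tp A z q')\<^esub> unit_cell A z q q' F x =
      unit_cell A z q q' G x \<cdot>\<^bsub>emf_cat A (Tp A z q')\<^esub> (?r (Fo ?k x) \<cdot>\<^bsub>emf_cat A (Tp A z q')\<^esub> Fa (?R F) ((\<lambda>x\<in>Obj (fst q). Idn (emf_cat A (Tp A z q)) (Fo ?k x)) x))"
      if x: "x \<in> Obj (fst q)" for x
    proof -
      note [simp] = x nat_transD(4-6)[OF n x] functor_simps[OF kf(1)] functor_simps[OF kf(2)] functor_simps[OF Rff] catT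
      have 1: "(\<lambda>x\<in>Obj (fst q'). Idn (emf_cat A (Tp A z q')) (Fo ?k' x)) (Fo G x) \<cdot>\<^bsub>emf_cat A (Tp A z q')\<^esub> Fa ?k' (t x) = Fa ?k' (t x)"
        using cat_simps(10)[OF catT(2), of "Fa ?k' (t x)" "Fo ?k' (Fo G x)"] by (simp del: emf_cat_simps)
      have par: "par (Fo ?k x) = Fo (snd q) x" "car (Fo ?k x) = Fo (iR A z (fst q) (snd q)) x"
        using F.S.K.pcompar_simps(1)[of x] by (simp_all add: fib_padj_def)
      have rx: "?r (Fo ?k x) = uarrow (Fo (?R F) (Fo ?k x)) (Fo (?R G) (Fo ?k x)) (Idn A (Fo (snd q) x)) (t (Fo (iR A z (fst q) (snd q)) x))"
        by (simp add: par)
      have ra: "?r (Fo ?k x) \<in> Arr (emf_cat A (Tp A z q'))" "Dom (emf_cat A (Tp A z q')) (?r (Fo ?k x)) = Fo (?R F) (Fo ?k x)"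
        using rc nat_transD(4,5)[of "emf_cat A (Tp A z q)" "emf_cat A (Tp A z q')" "?R F" "?R G" ?r "Fo ?k x"]
        by (simp_all add: vertical_nat_trans_iff del: emf_cat_simps restrict_apply)
      have 2: "?r (Fo ?k x) \<cdot>\<^bsub>emf_cat A (Tp A z q')\<^esub> Fa (?R F) ((\<lambda>x\<in>Obj (fst q). Idn (emf_cat A (Tp A z q)) (Fo ?k x)) x) = ?r (Fo ?k x)"
        using cat_simps(9)[OF catT(2) ra(1), of "Fo (?R F) (Fo ?k x)"] ra(2) functor_simps(5)[OF Rff, of "Fo ?k x"]
        by (simp del: emf_cat_simps)
      show ?thesis unfolding 1 2 unfolding rx
        by (rule unit_cell_2cell[OF F.pruned_map_axioms G.pruned_map_axioms, of t x, unfolded prod.collapse, OF t x])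
    qed
    have 1: "hcomp ?K q q' (emf A (Tp A z q')) (id2cell ?K q' (emf A (Tp A z q')) ?k') (F, G, t) =
       (ftor_comp (fst q) ?k' F, ftor_comp (fst q) ?k' G, \<lambda>x\<in>Obj (fst q). (\<lambda>x\<in>Obj (fst q'). Idn (emf_cat A (Tp A z q')) (Fo ?k' x)) (Fo G x) \<cdot>\<^bsub>emf_cat A (Tp A z q')\<^esub> Fa ?k' (t x))"
      using ub[OF q(2)] ii F G t by (simp add: K del: restrict_apply emf_cat_simps)
    have 2: "hcomp ?K q (emf A (Tp A z q)) (emf A (Tp A z q')) (?R F, ?R G, ?r) (id2cell ?K q (emf A (Tp A z q)) ?k) =
       (ftor_comp (fst q) (?R F) ?k, ftor_comp (fst q) (?R G) ?k, \<lambda>x\<in>Obj (fst q). ?r (Fo ?k x) \<cdot>\<^bsub>emf_cat A (Tp A z q')\<^esub> Fa (?R F) ((\<lambda>x\<in>Obj (fst q). Idn (emf_cat A (Tp A z q)) (Fo ?k x)) x))"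
      using ub[OF q(1)] ii Rf[OF q F] Rf[OF q G] rc by (simp add: K del: restrict_apply emf_cat_simps)
    have ra: "Fa (FH (two_comp ?K (emf_2functor A z) (Tp_2functor A z)) q q') \<alpha> = (?R F, ?R G, ?r)" unfolding \<alpha> by (rule RLa[OF q F G t])
    have da: "Dom (Hom2 ?K q q') \<alpha> = F" "Cod (Hom2 ?K q q') \<alpha> = G" unfolding \<alpha> K by simp_all
    show "hcomp ?K q q' (emf A (Tp A z q')) (id2cell ?K q' (emf A (Tp A z q')) ?k') (Fa (FH (two_id ?K) q q') \<alpha>) \<cdot>\<^bsub>Hom2 ?K q (emf A (Tp A z q'))\<^esub>
       (ftor_comp (fst q) (?R (Dom (Hom2 ?K q q') \<alpha>)) ?k, ftor_comp (fst q) ?k' (Dom (Hom2 ?K q q') \<alpha>), unit_cell A z q q' (Dom (Hom2 ?K q q') \<alpha>)) =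
       (ftor_comp (fst q) (?R (Cod (Hom2 ?K q q') \<alpha>)) ?k, ftor_comp (fst q) ?k' (Cod (Hom2 ?K q q') \<alpha>), unit_cell A z q q' (Cod (Hom2 ?K q q') \<alpha>))
       \<cdot>\<^bsub>Hom2 ?K q (emf A (Tp A z q'))\<^esub>
       hcomp ?K q (emf A (Tp A z q)) (emf A (Tp A z q')) (Fa (FH (two_comp ?K (emf_2functor A z) (Tp_2functor A z)) q q') \<alpha>) (id2cell ?K q (emf A (Tp A z q)) ?k)"
      unfolding ra da FHi(2)[OF \<alpha>A] unfolding \<alpha> unfolding 1 2 unfolding K conc_simps(2) conc_hom_simps(6) prod.inject fst_emf
      using key by (intro conjI refl restrict_ext) (simp del: emf_cat_simps restrict_apply add: restrict_apply')
  next
    fix q assume "q \<in> Ob2 ?K"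
    then have q: "q \<in> ?Ob" by (simp add: K)
    let ?k = "pcompar A (fib_padj A z q)"
    interpret pruned_fib A z "fst q" "snd q" by (rule qI[OF q])
    have "unit_cell A z q q (ftor_id (fst q)) = (\<lambda>x\<in>Obj (fst q). Idn (emf_cat A (Tp A z q)) (Fo ?k x))"
    proof (rule extensionalityI[OF _ restrict_extensional])
      show "unit_cell A z q q (ftor_id (fst q)) \<in> extensional (Obj (fst q))" by (simp add: unit_cell_def)
      fix x assume x: "x \<in> Obj (fst q)"
      show "unit_cell A z q q (ftor_id (fst q)) x = (\<lambda>x\<in>Obj (fst q). Idn (emf_cat A (Tp A z q)) (Fo ?k x)) x"
        using unit_cell_id[OF pruned_fib_axioms x, unfolded prod.collapse] x by (simp del: emf_cat_simps)
    qed
    moreover have "ftor_comp (fst q) (emf_1cell A (Tp A z q) (Tp A z q) (Tp_1cell A z q q (ftor_id (fst q)))) ?k = ?k"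
      using Tp_1cell_id(1)[OF pruned_fib_axioms] emf_1cell_id[OF T_axioms] ftor_comp_id(2)[OF fibred_functorD(1)[OF ub[OF q]]] by simp
    moreover have "ftor_comp (fst q) ?k (ftor_id (fst q)) = ?k" using ftor_comp_id(1)[OF fibred_functorD(1)[OF ub[OF q]]] .
    ultimately show "(ftor_comp (fst q) (emf_1cell A (Tp A z q) (Tp A z q) (Tp_1cell A z q q (Id2 ?K q))) ?k,
        ftor_comp (fst q) ?k (Id2 ?K q), unit_cell A z q q (Id2 ?K q)) = id2cell ?K q (emf A (Tp A z q)) ?k"
      by (simp add: K del: emf_cat_simps)
  next
    fix a b c F G assume "a \<in> Ob2 ?K" "b \<in> Ob2 ?K" "c \<in> Ob2 ?K" "F \<in> Obj (Hom2 ?K a b)" "G \<in> Obj (Hom2 ?K b c)"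
    then have q: "a \<in> ?Ob" "b \<in> ?Ob" "c \<in> ?Ob" and F: "fibred_functor A a b F" and G: "fibred_functor A b c G" by (simp_all add: K)
    interpret F: pruned_map A z "fst a" "snd a" "fst b" "snd b" F by (rule mI[OF q(1,2) F])
    interpret G: pruned_map A z "fst b" "snd b" "fst c" "snd c" G by (rule mI[OF q(2,3) G])
    let ?R = "\<lambda>a b F. emf_1cell A (Tp A z a) (Tp A z b) (Tp_1cell A z a b F)" and ?k = "\<lambda>q. pcompar A (fib_padj A z q)"
    let ?c = "emf_cat A (Tp A z c)"
    have kf: "is_functor (fst q) (emf_cat A (Tp A z q)) (?k q)" if "q \<in> ?Ob" for q
      using fibred_functorD(1)[OF ub[OF that]] by simp
    have Rff: "is_functor (emf_cat A (Tp A z b)) ?c (?R b c G)" "is_functor (emf_cat A (Tp A z a)) (emf_cat A (Tp A z b)) (?R a b F)"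
      using fibred_functorD(1)[OF Rf[OF q(2,3) G]] fibred_functorD(1)[OF Rf[OF q(1,2) F]] by simp_all
    have catT: "category ?c" "category (emf_cat A (Tp A z b))" using Ec[OF em[OF q(3)]] Ec[OF em[OF q(2)]] by simp_all
    have f1: "fibred_functor A b (emf A (Tp A z c)) (ftor_comp (fst b) (?R b c G) (?k b))" "fibred_functor A b (emf A (Tp A z c)) (ftor_comp (fst b) (?k c) G)"
      "fibred_functor A a (emf A (Tp A z b)) (ftor_comp (fst a) (?R a b F) (?k a))" "fibred_functor A a (emf A (Tp A z b)) (ftor_comp (fst a) (?k b) F)"
      using C.cmp(1)[OF q(2) em[OF q(2)] em[OF q(3)] ub[OF q(2)] Rf[OF q(2,3) G]] C.cmp(1)[OF q(2,3) em[OF q(3)] G ub[OF q(3)]]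
        C.cmp(1)[OF q(1) em[OF q(1)] em[OF q(2)] ub[OF q(1)] Rf[OF q(1,2) F]] C.cmp(1)[OF q(1,2) em[OF q(2)] F ub[OF q(2)]] by simp_all
    have ii: "vertical_nat_trans A a b F F (\<lambda>x\<in>Obj (fst a). Idn (fst b) (Fo F x))"
      "vertical_nat_trans A (emf A (Tp A z b)) (emf A (Tp A z c)) (?R b c G) (?R b c G) (\<lambda>x\<in>Obj (emf_cat A (Tp A z b)). Idn ?c (Fo (?R b c G) x))"
      using C.id2[OF q(1,2) F] C.id2[OF em[OF q(2)] em[OF q(3)] Rf[OF q(2,3) G]] by simp_all
    have 1: "hcomp ?K a b (emf A (Tp A z c)) (ftor_comp (fst b) (?R b c G) (?k b), ftor_comp (fst b) (?k c) G, unit_cell A z b c G) (id2cell ?K a b F) =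
       (ftor_comp (fst a) (ftor_comp (fst b) (?R b c G) (?k b)) F, ftor_comp (fst a) (ftor_comp (fst b) (?k c) G) F,
        \<lambda>x\<in>Obj (fst a). unit_cell A z b c G (Fo F x) \<cdot>\<^bsub>?c\<^esub> Fa (ftor_comp (fst b) (?R b c G) (?k b)) ((\<lambda>x\<in>Obj (fst a). Idn (fst b) (Fo F x)) x))"
      using f1 ii F uc(1)[OF q(2,3) G] by (simp add: K del: restrict_apply emf_cat_simps)
    have 2: "hcomp ?K a (emf A (Tp A z b)) (emf A (Tp A z c)) (id2cell ?K (emf A (Tp A z b)) (emf A (Tp A z c)) (?R b c G))
       (ftor_comp (fst a) (?R a b F) (?k a), ftor_comp (fst a) (?k b) F, unit_cell A z a b F) =
       (ftor_comp (fst a) (?R b c G) (ftor_comp (fst a) (?R a b F) (?k a)), ftor_comp (fst a) (?R b c G) (ftor_comp (fst a) (?k b) F),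
        \<lambda>x\<in>Obj (fst a). (\<lambda>x\<in>Obj (emf_cat A (Tp A z b)). Idn ?c (Fo (?R b c G) x)) (Fo (ftor_comp (fst a) (?k b) F) x) \<cdot>\<^bsub>?c\<^esub> Fa (?R b c G) (unit_cell A z a b F x))"
      using f1 ii Rf[OF q(2,3) G] uc(1)[OF q(1,2) F] by (simp add: K del: restrict_apply emf_cat_simps)
    \<comment> \<open>The composite of the two whiskered cells computed in \<open>1\<close> and
      \<open>2\<close>. Stripped of the identities in them, the claim is
      \<open>unit_cell_comp\<close>.\<close>
    have key: "unit_cell A z a c (ftor_comp (fst a) G F) = (\<lambda>x\<in>Obj (fst a).
       (\<lambda>x\<in>Obj (fst a). unit_cell A z b c G (Fo F x) \<cdot>\<^bsub>?c\<^esub> Fa (ftor_comp (fst b) (?R b c G) (?k b)) ((\<lambda>x\<in>Obj (fst a). Idn (fst b) (Fo F x)) x)) x \<cdot>\<^bsub>?c\<^esub>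
       (\<lambda>x\<in>Obj (fst a). (\<lambda>x\<in>Obj (emf_cat A (Tp A z b)). Idn ?c (Fo (?R b c G) x)) (Fo (ftor_comp (fst a) (?k b) F) x) \<cdot>\<^bsub>?c\<^esub> Fa (?R b c G) (unit_cell A z a b F x)) x)"
    proof (rule extensionalityI[OF _ restrict_extensional])
      fix x assume x: "x \<in> Obj (fst a)"
      note u = uc(3-5)[OF q(1,2) F x] and v = uc(3-5)[OF q(2,3) G, of "Fo F x"]
      have Fx: "Fo F x \<in> Obj (fst b)" using x by simp
      have kx: "Fo (?k b) (Fo F x) \<in> Obj (emf_cat A (Tp A z b))" using functor_simps(1)[OF kf[OF q(2)] Fx] .
      have w: "Fa (?R b c G) (unit_cell A z a b F x) \<in> Arr ?c" "Cod ?c (Fa (?R b c G) (unit_cell A z a b F x)) = Fo (?R b c G) (Fo (?k b) (Fo F x))"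
        using functor_simps(2,4)[OF Rff(1) u(1)] u(3) by (simp_all del: emf_ArrI)
      have i1: "Idn ?c (Fo (?R b c G) (Fo (?k b) (Fo F x))) \<cdot>\<^bsub>?c\<^esub> Fa (?R b c G) (unit_cell A z a b F x) = Fa (?R b c G) (unit_cell A z a b F x)"
        by (rule cat_simps(10)[OF catT(1) w])
      have "Fa (?R b c G) (Fa (?k b) (Idn (fst b) (Fo F x))) = Idn ?c (Fo (?R b c G) (Fo (?k b) (Fo F x)))"
        unfolding functor_simps(5)[OF kf[OF q(2)] Fx] by (rule functor_simps(5)[OF Rff(1) kx])
      moreover have "unit_cell A z b c G (Fo F x) \<cdot>\<^bsub>?c\<^esub> Idn ?c (Fo (?R b c G) (Fo (?k b) (Fo F x))) = unit_cell A z b c G (Fo F x)"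
        by (rule cat_simps(9)[OF catT(1) v(1)[OF Fx]]) (use v(2)[OF Fx] in simp)
      ultimately show "unit_cell A z a c (ftor_comp (fst a) G F) x = (\<lambda>x\<in>Obj (fst a).
       (\<lambda>x\<in>Obj (fst a). unit_cell A z b c G (Fo F x) \<cdot>\<^bsub>?c\<^esub> Fa (ftor_comp (fst b) (?R b c G) (?k b)) ((\<lambda>x\<in>Obj (fst a). Idn (fst b) (Fo F x)) x)) x \<cdot>\<^bsub>?c\<^esub>
       (\<lambda>x\<in>Obj (fst a). (\<lambda>x\<in>Obj (emf_cat A (Tp A z b)). Idn ?c (Fo (?R b c G) x)) (Fo (ftor_comp (fst a) (?k b) F) x) \<cdot>\<^bsub>?c\<^esub> Fa (?R b c G) (unit_cell A z a b F x)) x) x"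
        using x Fx kx i1 unit_cell_comp[OF F.pruned_map_axioms G.pruned_map_axioms x] by (simp del: emf_cat_simps)
    qed (simp add: unit_cell_def)
    have e1: "?R a c (ftor_comp (fst a) G F) = ftor_comp (emf_cat A (Tp A z a)) (?R b c G) (?R a b F)"
      using Tp_1cell_comp(1)[OF F.pruned_map_axioms G.pruned_map_axioms] F.M.mate_1cell G.M.mate_1cell F.Tp_1cell_eq G.Tp_1cell_eq
        emf_1cell_comp[OF F.S.T_axioms F.S'.T_axioms G.S'.T_axioms, of "Tp_1cell A z a b F" "Tp_1cell A z b c G"] by simp
    have e2: "ftor_comp (fst a) (?R a c (ftor_comp (fst a) G F)) (?k a) = ftor_comp (fst a) (?R b c G) (ftor_comp (fst a) (?R a b F) (?k a))"
      "ftor_comp (fst a) (?k c) (ftor_comp (fst a) G F) = ftor_comp (fst a) (ftor_comp (fst b) (?k c) G) F"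
      unfolding e1 by (rule ftor_comp_assoc[OF kf[OF q(1)]], rule ftor_comp_assoc[OF F.FD(1), symmetric])
    have e0: "comp1 ?K a b c G F = ftor_comp (fst a) G F" using F G by (simp add: K)
    show "(ftor_comp (fst a) (?R a c (comp1 ?K a b c G F)) (?k a), ftor_comp (fst a) (?k c) (comp1 ?K a b c G F), unit_cell A z a c (comp1 ?K a b c G F)) =
       hcomp ?K a b (emf A (Tp A z c)) (ftor_comp (fst b) (?R b c G) (?k b), ftor_comp (fst b) (?k c) G, unit_cell A z b c G)
         (id2cell ?K a b (Fo (FH (two_id ?K) a b) F)) \<cdot>\<^bsub>Hom2 ?K a (emf A (Tp A z c))\<^esub>
       hcomp ?K a (emf A (Tp A z b)) (emf A (Tp A z c)) (id2cell ?K (emf A (Tp A z b)) (emf A (Tp A z c))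
           (Fo (FH (two_comp ?K (emf_2functor A z) (Tp_2functor A z)) b c) G))
         (ftor_comp (fst a) (?R a b F) (?k a), ftor_comp (fst a) (?k b) F, unit_cell A z a b F)"
      unfolding e0 RL[OF q(2,3) G] FHi(1)[OF F] 1 2 unfolding K conc_simps(2) conc_hom_simps(6) prod.inject fst_emf
      using e2 key by (intro conjI) auto
  qed
qed


section \<open>The universal property of the unit\<close>

locale emf_map = pruned_fib A z E p + S: param_monad_axioms A S for A z E p S +
  fixes F
  assumes F: "fibred_functor A (E, p) (emf A S) F"
begin

lemmas FD = fibred_functorD[OF F, simplified]

lemma F_Obj [simp]: "e \<in> Obj E \<Longrightarrow> Fo F e \<in> Obj (emf_cat A S)" "e \<in> Obj E \<Longrightarrow> par (Fo F e) = Fo p e"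
  using FD(2) functor_simps(1)[OF FD(1)] by auto

lemma F_Arr [simp]:
  assumes "u \<in> Arr E"
  shows "Fa F u \<in> Arr (emf_cat A S)" "uarr_dom (Fa F u) = Fo F (Dom E u)" "uarr_cod (Fa F u) = Fo F (Cod E u)"
    "uarr_fst (Fa F u) = Fa p u" "uarr_snd (Fa F u) \<in> Arr (Carr S)"
    "Dom (Carr S) (uarr_snd (Fa F u)) = car (Fo F (Dom E u))" "Cod (Carr S) (uarr_snd (Fa F u)) = car (Fo F (Cod E u))"
proof -
  show *: "Fa F u \<in> Arr (emf_cat A S)" "uarr_dom (Fa F u) = Fo F (Dom E u)" "uarr_cod (Fa F u) = Fo F (Cod E u)"
    using functor_simps(2-4)[OF FD(1) assms] by (simp_all del: emf_ArrI)
  show "uarr_fst (Fa F u) = Fa p u" using FD(3)[OF assms] * by (simp del: emf_ArrI)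
  show "uarr_snd (Fa F u) \<in> Arr (Carr S)"
    "Dom (Carr S) (uarr_snd (Fa F u)) = car (Fo F (Dom E u))" "Cod (Carr S) (uarr_snd (Fa F u)) = car (Fo F (Cod E u))"
    using emf_ArrD(6-8)[OF *(1)] * by simp_all
qed

lemma F_comp [simp]:
  "\<lbrakk>u \<in> Arr E; v \<in> Arr E; Cod E u = Dom E v\<rbrakk> \<Longrightarrow> uarr_snd (Fa F (v \<cdot>\<^bsub>E\<^esub> u)) = uarr_snd (Fa F v) \<cdot>\<^bsub>Carr S\<^esub> uarr_snd (Fa F u)"
  using functor_simps(6)[OF FD(1)] by simp

lemma F_idn [simp]: "e \<in> Obj E \<Longrightarrow> uarr_snd (Fa F (Idn E e)) = Idn (Carr S) (car (Fo F e))"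
  using functor_simps(5)[OF FD(1)] by simp

definition V where "V = \<lparr>Fo = (\<lambda>x\<in>Obj E0. car (Fo F x)), Fa = (\<lambda>u\<in>Arr E0. uarr_snd (Fa F u))\<rparr>"
text \<open>The second adjunction is now that of free algebras, whose functor to the carriers is
  \<open>car\<close> and not a reindexing. The lift itself therefore compares
  \<open>V (i\<^sub>R e)\<close>, the carrier of \<open>F (i\<^sub>R e)\<close>, with the carrier of
  \<open>F e\<close>.\<close>

definition \<sigma> where "\<sigma> e = uarr_snd (Fa F (lft e))"

lemma V_simps [simp]: "\<lbrakk>x \<in> Obj E; Fo p x = z\<rbrakk> \<Longrightarrow> Fo V x = car (Fo F x)"
  "\<lbrakk>u \<in> Arr E; Fa p u = Idn A z\<rbrakk> \<Longrightarrow> Fa V u = uarr_snd (Fa F u)"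
  by (simp_all add: V_def)

lemma V: "is_functor E0 (Carr S) V"
proof (rule functorI)
  show "Fo V x \<in> Obj (Carr S)" if "x \<in> Obj E0" for x using that emf_ObjD(2)[OF F_Obj(1), of x] by simp
qed (simp_all add: V_def)

lemma \<sigma>_nat: 
  assumes "u \<in> Arr E"
  shows "\<sigma> (Cod E u) \<cdot>\<^bsub>Carr S\<^esub> uarr_snd (Fa F (Fa I u)) = uarr_snd (Fa F u) \<cdot>\<^bsub>Carr S\<^esub> \<sigma> (Dom E u)"
proof -
  have "uarr_snd (Fa F (lft (Cod E u) \<cdot>\<^bsub>E\<^esub> Fa I u)) = uarr_snd (Fa F u) \<cdot>\<^bsub>Carr S\<^esub> \<sigma> (Dom E u)"
    using assms by (simp add: \<sigma>_def)
  then show ?thesis using assms F_comp[of "Fa I u" "lft (Cod E u)"] by (simp add: \<sigma>_def del: F_comp)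
qed

text \<open>Cartesian arrows of an Eilenberg--Moore fibration are invertible on carriers, and
  \<open>F\<close> preserves cartesian arrows.\<close>

lemma \<sigma>_iso: "e \<in> Obj E \<Longrightarrow> is_iso (Carr S) (\<sigma> e)"
  unfolding \<sigma>_def using S.emf_cartesianD FD(4)[OF lft_cartesian] by simp

lemma padj_map: "padj_map A PD (emf_adj A S) F V \<sigma>"
proof (intro padj_map.intro padj_map_axioms.intro par_adj S.par_adj_emf)
  show "is_functor (AE PD) (AE (emf_adj A S)) F" "is_functor (AX PD) (AX (emf_adj A S)) V" using FD(1) V by simp_all
  show "is_iso (AX (emf_adj A S)) (\<sigma> e)" if "e \<in> Obj (AE PD)" for e using \<sigma>_iso that by simp
  show "\<sigma> (Cod (AE PD) v) \<cdot>\<^bsub>AX (emf_adj A S)\<^esub> Fa V (Fa (AU PD) v) = Fa (AU (emf_adj A S)) (Fa F v) \<cdot>\<^bsub>AX (emf_adj A S)\<^esub> \<sigma> (Dom (AE PD) v)"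
    if "v \<in> Arr (AE PD)" for v using \<sigma>_nat that by simp
qed (simp_all add: \<sigma>_def)

end

sublocale emf_map \<subseteq> M: padj_map A "pruned_adj A z E p" "emf_adj A S" F V \<sigma> by (rule padj_map)

text \<open>A 1-cell \<open>(V, \<delta>)\<close> from \<open>T\<^sup>p\<close> to \<open>S\<close>;
  the functor \<open>R\<close> after \<open>K\<close> is its transpose.\<close>

locale tr_cell = pruned_fib A z E p + S: param_monad_axioms A S + pm1 A "Tp A z (E, p)" S V \<delta> for A z E p S V \<delta>
begin

abbreviation "K \<equiv> pcompar A PD"
abbreviation "R \<equiv> emf_1cell A T S (V, \<delta>)"

lemma V0: "is_functor E0 (Carr S) V" using V by simp

lemmas [simp] = functor_simps[OF V0, simplified]

lemma K_functor: "is_functor E (emf_cat A T) K"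
  using K.pcompar_functor by simp

lemma K_Obj: "e \<in> Obj E \<Longrightarrow> Fo K e \<in> Obj (emf_cat A T)" "e \<in> Obj E \<Longrightarrow> par (Fo K e) = Fo p e" "e \<in> Obj E \<Longrightarrow> car (Fo K e) = Fo I e"
  using functor_simps(1)[OF K_functor] by auto

lemma RK_Obj: "e \<in> Obj E \<Longrightarrow> Fo R (Fo K e) \<in> Obj (emf_cat A S)" "e \<in> Obj E \<Longrightarrow> par (Fo R (Fo K e)) = Fo p e"
  "e \<in> Obj E \<Longrightarrow> car (Fo R (Fo K e)) = Fo V (Fo I e)"
proof -
  assume e: "e \<in> Obj E"
  show "Fo R (Fo K e) \<in> Obj (emf_cat A S)" by (rule functor_simps(1)[OF emf_1cell_functor K_Obj(1)[OF e]])
  show "par (Fo R (Fo K e)) = Fo p e" "car (Fo R (Fo K e)) = Fo V (Fo I e)"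
    unfolding emf_1cell_Fo[OF K_Obj(1)[OF e]] using K_Obj(2,3)[OF e] by simp_all
qed

lemma RK_Fa: "u \<in> Arr E \<Longrightarrow> Fa R (Fa K u) = uarrow (Fo R (Fo K (Dom E u))) (Fo R (Fo K (Cod E u))) (Fa p u) (Fa V (Fa I u))"
  using functor_simps(2)[OF K_functor] by (simp del: emf_ArrI emf_1cell_Fo K.pcompar_simps(1))

text \<open>Closure of cartesian functors under composition, taken from \<open>fib_conc2\<close>
  with just the three fibrations involved as objects.\<close>

lemma RK_fibred: "fibred_functor A (E, p) (emf A S) (ftor_comp E R K)"
proof -
  interpret C: conc2 "{(E, p), emf A T, emf A S}" fst "\<lambda>F. F" "fibred_functor A" "vertical_nat_trans A" "\<lambda>q. ftor_id (fst q)" "\<lambda>a b c g f. ftor_comp (fst a) g f"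
    by (rule fib_conc2[OF A]) (use fib T.emf_fibration S.emf_fibration in auto)
  show ?thesis using C.cmp(1)[of "(E, p)" "emf A T" "emf A S" K R] unit_fibred emf_1cell_fibred by simp
qed

end

section \<open>Transposition on 2-cells\<close>

locale tr_2cell = v: tr_cell A z E p S V \<delta> + w: tr_cell A z E p S W \<gamma> for A z E p S V \<delta> W \<gamma>
begin

text \<open>\<open>x\<close> is isomorphic to \<open>i\<^sub>R x\<close> by the lift, and naturality
  at the lift transports the component at \<open>i\<^sub>R x\<close> to the one at
  \<open>x\<close>.\<close>

lemma cell_ext:
  assumes "nat_trans v.E0 (Carr S) V W \<nu>" "nat_trans v.E0 (Carr S) V W \<nu>'" "\<And>e. e \<in> Obj E \<Longrightarrow> \<nu> (Fo v.I e) = \<nu>' (Fo v.I e)"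
  shows "\<nu> = \<nu>'"
proof (rule extensionalityI[OF nat_transD(3)[OF assms(1)] nat_transD(3)[OF assms(2)]])
  fix x assume x: "x \<in> Obj v.E0"
  then have l: "v.lft x \<in> Arr v.E0" "Dom E (v.lft x) = Fo v.I x" "Cod E (v.lft x) = x"
    using inv_arr(6)[OF v.lft_iso, of x] by simp_all
  note n = nat_transD(7)[OF assms(1) l(1)] and n' = nat_transD(7)[OF assms(2) l(1)]
  have i: "is_iso (Carr S) (Fa V (v.lft x))" using functor_iso[OF v.E0 v.V0 v.lft_iso] x by simp
  show "\<nu> x = \<nu>' x"
    by (rule iso_epi[OF v.S.X i])
      (use n n' l x assms(3)[of x] nat_transD(4,5)[OF assms(1), of x] nat_transD(4,5)[OF assms(2), of x] in simp_all)
qed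

text \<open>Over the initial fibre the lift \<open>lft x : i\<^sub>R x \<rightarrow> x\<close> is invertible, and conjugating by it turns the
  components of \<open>\<tau>\<close> into a natural transformation \<open>\<nu>\<close> on the fibre. As \<open>i\<^sub>R (lft e)\<close> is the lift at
  \<open>i\<^sub>R e\<close>, its component at \<open>i\<^sub>R e\<close> is that of \<open>\<tau>\<close> at \<open>e\<close>.\<close>

lemma cell_full:
  assumes t: "vertical_nat_trans A (E, p) (emf A S) (ftor_comp E v.R v.K) (ftor_comp E w.R w.K) \<tau>"
  obtains \<nu> where "pm_2cell A v.T S (V, \<delta>) (W, \<gamma>) \<nu>" "\<And>e. e \<in> Obj E \<Longrightarrow> \<nu> (Fo v.I e) = uarr_snd (\<tau> e)"
proof -
  let ?I = "v.I" and ?l = "v.lft"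
  define t where "t e = uarr_snd (\<tau> e)" for e
  have n: "nat_trans E (emf_cat A S) (ftor_comp E v.R v.K) (ftor_comp E w.R w.K) \<tau>"
    and vt: "\<And>e. e \<in> Obj E \<Longrightarrow> Fa (emf_proj A S) (\<tau> e) = Idn A (Fo p e)"
    using t by (auto simp: vertical_nat_trans_iff simp del: emf_ArrI)
  have \<tau>: "\<tau> e \<in> Arr (emf_cat A S)" "uarr_dom (\<tau> e) = Fo v.R (Fo v.K e)" "uarr_cod (\<tau> e) = Fo w.R (Fo w.K e)"
    "uarr_fst (\<tau> e) = Idn A (Fo p e)" if "e \<in> Obj E" for e
    using nat_transD(4-6)[OF n that] vt[OF that] that by (simp_all del: emf_ArrI v.K.pcompar_simps v.emf_1cell_Fo w.emf_1cell_Fo)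
  have t [simp]: "t e \<in> Arr (Carr S)" "Dom (Carr S) (t e) = Fo V (Fo ?I e)" "Cod (Carr S) (t e) = Fo W (Fo ?I e)" if "e \<in> Obj E" for e
    unfolding t_def using emf_ArrD(6-8)[OF \<tau>(1)[OF that]] \<tau>(2,3)[OF that] v.RK_Obj(3)[OF that] w.RK_Obj(3)[OF that] by simp_all
  \<comment> \<open>The algebra-map law of the components of \<tau>; it is used later at the sums
    \<open>AS v.PD a x\<close>.\<close>
  have alg: "t e \<cdot>\<^bsub>Carr S\<^esub> (Fa V (Fa ?I (pcounit A v.PD e)) \<cdot>\<^bsub>Carr S\<^esub> \<delta> (Fo p e, Fo ?I e)) =
     (Fa W (Fa ?I (pcounit A v.PD e)) \<cdot>\<^bsub>Carr S\<^esub> \<gamma> (Fo p e, Fo ?I e)) \<cdot>\<^bsub>Carr S\<^esub> Fa (PFun S) (Idn A (Fo p e), t e)" if e: "e \<in> Obj E" for e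
    using emf_ArrD(9)[OF \<tau>(1)[OF e]] e v.K_Obj(1)[OF e] unfolding t_def \<tau>(2-4)[OF e] v.emf_1cell_Fo[OF v.K_Obj(1)[OF e]] w.emf_1cell_Fo[OF w.K_Obj(1)[OF e]]
    by (simp del: emf_ObjI cat_assoc)
  have tn: "t (Cod E u) \<cdot>\<^bsub>Carr S\<^esub> Fa V (Fa ?I u) = Fa W (Fa ?I u) \<cdot>\<^bsub>Carr S\<^esub> t (Dom E u)" if u: "u \<in> Arr E" for u
    using arg_cong[OF nat_transD(7)[OF n u], of uarr_snd] u v.RK_Fa[OF u] w.RK_Fa[OF u] by (simp add: t_def del: v.emf_1cell_Fa w.emf_1cell_Fa v.K.pcompar_simps)
  have l: "?l x \<in> Arr v.E0" "Fa p (?l x) = Idn A z" "Dom E (?l x) = Fo ?I x" "Cod E (?l x) = x" "is_iso v.E0 (?l x)" if "x \<in> Obj E" "Fo p x = z" for x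
    using inv_arr(6)[OF v.lft_iso[OF that]] that v.lft_iso[OF that] by simp_all
  define \<nu> where "\<nu> = (\<lambda>x\<in>Obj v.E0. Fa W (?l x) \<cdot>\<^bsub>Carr S\<^esub> (t x \<cdot>\<^bsub>Carr S\<^esub> Fa V (inv_arr v.E0 (?l x))))"
  have j: "inv_arr v.E0 (?l x) \<in> Arr E" "Fa p (inv_arr v.E0 (?l x)) = Idn A z" "Dom E (inv_arr v.E0 (?l x)) = x" "Cod E (inv_arr v.E0 (?l x)) = Fo ?I x"
    "inv_arr v.E0 (?l x) \<cdot>\<^bsub>E\<^esub> ?l x = Idn E (Fo ?I x)" if "x \<in> Obj E" "Fo p x = z" for x
    using inv_arr(1-5)[OF l(5)[OF that]] l(3,4)[OF that] by simp_all
  have \<nu> [simp]: "\<nu> x \<in> Arr (Carr S)" "Dom (Carr S) (\<nu> x) = Fo V x" "Cod (Carr S) (\<nu> x) = Fo W x" if "x \<in> Obj E" "Fo p x = z" for x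
    using that j[OF that] l[OF that] by (simp_all add: \<nu>_def)
  have \<nu>l: "\<nu> x \<cdot>\<^bsub>Carr S\<^esub> Fa V (?l x) = Fa W (?l x) \<cdot>\<^bsub>Carr S\<^esub> t x" if x: "x \<in> Obj E" "Fo p x = z" for x
  proof -
    have "Fa V (inv_arr v.E0 (?l x)) \<cdot>\<^bsub>Carr S\<^esub> Fa V (?l x) = Idn (Carr S) (Fo V (Fo ?I x))"
      using functor_simps(6)[OF v.V0, of "?l x" "inv_arr v.E0 (?l x)"] l[OF x] j[OF x] x by simp
    then show ?thesis using x j[OF x] l[OF x] by (simp add: \<nu>_def)
  qed
  have \<nu>I: "\<nu> (Fo ?I e) = t e" if e: "e \<in> Obj E" for e
  proof -
    have e': "Fo ?I e \<in> Obj E" "Fo p (Fo ?I e) = z" using e by simp_all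
    note l' = l[OF e']
    \<comment> \<open>To reindex the arrow \<open>?l e\<close> is to factor \<open>?l e\<close>
      after \<open>?l (i\<^sub>R e)\<close> through the lift at \<open>e\<close>, which is
      \<open>?l e\<close> again; the factor is therefore \<open>?l (i\<^sub>R e)\<close>.\<close>
    have "Fa ?I (?l e) = ?l (Fo ?I e)"
      by (rule v.lft_cancel[of e]) (use e e' l' in simp_all)
    then have "t e \<cdot>\<^bsub>Carr S\<^esub> Fa V (?l (Fo ?I e)) = \<nu> (Fo ?I e) \<cdot>\<^bsub>Carr S\<^esub> Fa V (?l (Fo ?I e))"
      using tn[of "?l e"] e \<nu>l[OF e'] by simp
    moreover have "is_iso (Carr S) (Fa V (?l (Fo ?I e)))" using functor_iso[OF v.E0 v.V0 l'(5)] .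
    ultimately show ?thesis by (intro iso_epi[OF v.S.X, of "Fa V (?l (Fo ?I e))" "\<nu> (Fo ?I e)" "t e"]) (use e e' l' in simp_all)
  qed
  have \<nu>n: "\<nu> (Cod E u) \<cdot>\<^bsub>Carr S\<^esub> Fa V u = Fa W u \<cdot>\<^bsub>Carr S\<^esub> \<nu> (Dom E u)" if u: "u \<in> Arr E" "Fa p u = Idn A z" for u
  proof -
    have d: "Dom E u \<in> Obj E" "Fo p (Dom E u) = z" "Cod E u \<in> Obj E" "Fo p (Cod E u) = z" using u by simp_all
    note ld = l[OF d(1,2)] and lc = l[OF d(3,4)]
    have e: "?l (Cod E u) \<cdot>\<^bsub>E\<^esub> Fa ?I u = u \<cdot>\<^bsub>E\<^esub> ?l (Dom E u)" using u by simp
    have V: "Fa V (?l (Cod E u)) \<cdot>\<^bsub>Carr S\<^esub> Fa V (Fa ?I u) = Fa V u \<cdot>\<^bsub>Carr S\<^esub> Fa V (?l (Dom E u))"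
      "Fa W (?l (Cod E u)) \<cdot>\<^bsub>Carr S\<^esub> Fa W (Fa ?I u) = Fa W u \<cdot>\<^bsub>Carr S\<^esub> Fa W (?l (Dom E u))"
      using arg_cong[OF e, of "Fa V"] arg_cong[OF e, of "Fa W"]
        functor_simps(6)[OF v.V0, of "Fa ?I u" "?l (Cod E u)"] functor_simps(6)[OF v.V0, of "?l (Dom E u)" u]
        functor_simps(6)[OF w.V0, of "Fa ?I u" "?l (Cod E u)"] functor_simps(6)[OF w.V0, of "?l (Dom E u)" u] u ld lc
      by (simp_all del: v.iR_simps(5))
    have k: "(\<nu> (Cod E u) \<cdot>\<^bsub>Carr S\<^esub> Fa V u) \<cdot>\<^bsub>Carr S\<^esub> Fa V (?l (Dom E u)) = (Fa W u \<cdot>\<^bsub>Carr S\<^esub> \<nu> (Dom E u)) \<cdot>\<^bsub>Carr S\<^esub> Fa V (?l (Dom E u))"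
      using u ld lc d V(1)[symmetric] \<nu>l[OF d(1,2)] \<nu>l[OF d(3,4), THEN reassoc, of "Fa V (Fa ?I u)"] tn[OF u(1)] V(2)[THEN reassoc, of "t (Dom E u)"]
      by simp
    show ?thesis
      by (rule iso_epi[OF v.S.X functor_iso[OF v.E0 v.V0 ld(5)] _ _ _ _ k]) (use u ld lc d in simp_all)
  qed
  have "nat_trans v.E0 (Carr S) V W \<nu>"
    by (rule nat_transI) (use v.V0 w.V0 \<nu>n in \<open>simp_all add: \<nu>_def[THEN arg_cong, of "\<lambda>x. x \<in> extensional (Obj v.E0)"]\<close>)
  moreover have "\<nu> (Fo (PFun v.T) (a, x)) \<cdot>\<^bsub>Carr S\<^esub> \<delta> (a, x) = \<gamma> (a, x) \<cdot>\<^bsub>Carr S\<^esub> Fa (PFun S) (Idn A a, \<nu> x)"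
    if a: "a \<in> Obj A" and x: "x \<in> Obj v.E0" for a x
  proof -
    \<comment> \<open>The algebra law at the sum \<open>?S\<close> is a law at the carrier
      \<open>m\<close> with multiplications inserted. Precomposing with \<open>T\<close> of the unit
      at \<open>x\<close> and using naturality on both sides, the multiplications cancel and the law
      at \<open>x\<close> remains.\<close>
    let ?S = "AS v.PD a x" and ?\<eta> = "PUnit v.T (a, x)" and ?\<mu> = "PMult v.T (a, x)"
    have x': "x \<in> Obj E" "Fo p x = z" using x by simp_all
    have S: "?S \<in> Obj E" "Fo p ?S = a" "Fo v.I ?S = Fo (PFun v.T) (a, x)" "Fa v.I (pcounit A v.PD ?S) = ?\<mu>"
      using v.T_simps[OF a x'] a x' by simp_all
    define m where "m = Fo (PFun v.T) (a, x)"
    have m: "m \<in> Obj v.E0" "Fo (PFun v.T) (a, x) = m" unfolding m_def S(3)[symmetric] using S(1) by simp_all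
    have un: "arr v.E0 ?\<eta> x m" and mu: "arr v.E0 ?\<mu> (Fo (PFun v.T) (a, m)) m"
      using v.T.unit[OF a, of x] v.T.mult[OF a, of x] x m by simp_all
    have tS: "\<nu> m = t ?S" using \<nu>I[OF S(1)] S(3) m(2) by simp
    have tt: "arr (Carr S) (\<nu> m) (Fo V m) (Fo W m)" using m by simp
    have alg': "\<nu> m \<cdot>\<^bsub>Carr S\<^esub> (Fa V ?\<mu> \<cdot>\<^bsub>Carr S\<^esub> \<delta> (a, m)) = (Fa W ?\<mu> \<cdot>\<^bsub>Carr S\<^esub> \<gamma> (a, m)) \<cdot>\<^bsub>Carr S\<^esub> Fa (PFun S) (Idn A a, \<nu> m)"
      using alg[OF S(1)] unfolding S(2,3,4) m(2) tS .
    have d1: "\<delta> (a, m) \<cdot>\<^bsub>Carr S\<^esub> Fa (PFun S) (Idn A a, Fa V ?\<eta>) = Fa V (Fa (PFun v.T) (Idn A a, ?\<eta>)) \<cdot>\<^bsub>Carr S\<^esub> \<delta> (a, x)"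
      using v.\<delta>_nat[of "Idn A a" ?\<eta> a x] un a by simp
    have d2: "\<gamma> (a, m) \<cdot>\<^bsub>Carr S\<^esub> Fa (PFun S) (Idn A a, Fa W ?\<eta>) = Fa W (Fa (PFun v.T) (Idn A a, ?\<eta>)) \<cdot>\<^bsub>Carr S\<^esub> \<gamma> (a, x)"
      using w.\<delta>_nat[of "Idn A a" ?\<eta> a x] un a by simp
    have r: "?\<mu> \<cdot>\<^bsub>E\<^esub> Fa (PFun v.T) (Idn A a, ?\<eta>) = Idn E m" using v.T.unit_right[OF a, of x] x m by simp
    let ?f = "Fa (PFun v.T) (Idn A a, ?\<eta>)" and ?g = "Fa (PFun S) (Idn A a, Fa V ?\<eta>)" and ?h = "Fa (PFun S) (Idn A a, Fa W ?\<eta>)"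
      and ?k = "Fa (PFun S) (Idn A a, \<nu> x)"
    have f: "arr v.E0 ?f m (Fo (PFun v.T) (a, m))" using functor_simps(2-4)[OF v.T.T, of "(Idn A a, ?\<eta>)"] un a m by simp
    have Vr: "Fa V ?\<mu> \<cdot>\<^bsub>Carr S\<^esub> Fa V ?f = Idn (Carr S) (Fo V m)" "Fa W ?\<mu> \<cdot>\<^bsub>Carr S\<^esub> Fa W ?f = Idn (Carr S) (Fo W m)"
      using functor_simps(5)[OF v.V0 m(1)] functor_simps(5)[OF w.V0 m(1)] functor_simps(6)[OF v.V0, of ?f ?\<mu>] functor_simps(6)[OF w.V0, of ?f ?\<mu>] f mu r
      by simp_all
    have nn: "\<nu> m \<cdot>\<^bsub>Carr S\<^esub> Fa V ?\<eta> = Fa W ?\<eta> \<cdot>\<^bsub>Carr S\<^esub> \<nu> x" using \<nu>n[of ?\<eta>] un by simp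
    have sn: "Fa (PFun S) (Idn A a, \<nu> m) \<cdot>\<^bsub>Carr S\<^esub> ?g = ?h \<cdot>\<^bsub>Carr S\<^esub> ?k"
      using v.S.T_comp[of "Idn A a" "Fa V ?\<eta>" "Idn A a" "\<nu> m"] v.S.T_comp[of "Idn A a" "\<nu> x" "Idn A a" "Fa W ?\<eta>"] nn a m x' un by simp
    have dm: "arr (Carr S) (\<delta> (a, m)) (Fo (PFun S) (a, Fo V m)) (Fo V (Fo (PFun v.T) (a, m)))"
      "arr (Carr S) (\<gamma> (a, m)) (Fo (PFun S) (a, Fo W m)) (Fo W (Fo (PFun v.T) (a, m)))"
      "arr (Carr S) (\<delta> (a, x)) (Fo (PFun S) (a, Fo V x)) (Fo V m)"
      "arr (Carr S) (\<gamma> (a, x)) (Fo (PFun S) (a, Fo W x)) (Fo W m)"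
      using v.\<delta>[OF a, of m] w.\<delta>[OF a, of m] v.\<delta>[OF a, of x] w.\<delta>[OF a, of x] m x by simp_all
    have ag: "arr (Carr S) ?g (Fo (PFun S) (a, Fo V x)) (Fo (PFun S) (a, Fo V m))" "arr (Carr S) ?h (Fo (PFun S) (a, Fo W x)) (Fo (PFun S) (a, Fo W m))"
      "arr (Carr S) ?k (Fo (PFun S) (a, Fo V x)) (Fo (PFun S) (a, Fo W x))"
      "arr (Carr S) (Fa (PFun S) (Idn A a, \<nu> m)) (Fo (PFun S) (a, Fo V m)) (Fo (PFun S) (a, Fo W m))"
      using functor_simps(2-4)[OF v.S.T] un a m x' by simp_all
    have VV: "arr (Carr S) (Fa V ?\<mu>) (Fo V (Fo (PFun v.T) (a, m))) (Fo V m)" "arr (Carr S) (Fa W ?\<mu>) (Fo W (Fo (PFun v.T) (a, m))) (Fo W m)"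
      "arr (Carr S) (Fa V ?f) (Fo V m) (Fo V (Fo (PFun v.T) (a, m)))" "arr (Carr S) (Fa W ?f) (Fo W m) (Fo W (Fo (PFun v.T) (a, m)))"
      using functor_simps(2-4)[OF v.V0] functor_simps(2-4)[OF w.V0] mu f by simp_all
    note [simp del] = v.S.T_comp
    have "\<nu> m \<cdot>\<^bsub>Carr S\<^esub> \<delta> (a, x) = (\<nu> m \<cdot>\<^bsub>Carr S\<^esub> (Fa V ?\<mu> \<cdot>\<^bsub>Carr S\<^esub> \<delta> (a, m))) \<cdot>\<^bsub>Carr S\<^esub> ?g"
      using tt dm ag VV d1 Vr(1)[THEN reassoc, of "\<delta> (a, x)"] by simp
    also have "\<dots> = Fa W ?\<mu> \<cdot>\<^bsub>Carr S\<^esub> (\<gamma> (a, m) \<cdot>\<^bsub>Carr S\<^esub> (?h \<cdot>\<^bsub>Carr S\<^esub> ?k))"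
      unfolding alg' using dm ag VV sn by simp
    also have "\<dots> = \<gamma> (a, x) \<cdot>\<^bsub>Carr S\<^esub> ?k"
      using dm ag VV d2[THEN reassoc, of ?k] Vr(2)[THEN reassoc, of "\<gamma> (a, x) \<cdot>\<^bsub>Carr S\<^esub> ?k"] by simp
    finally show ?thesis unfolding m(2) .
  qed

  ultimately have "pm_2cell A v.T S (V, \<delta>) (W, \<gamma>) \<nu>" by (simp add: pm_2cell_iff)
  then show thesis using that \<nu>I t_def by metis
qed

end

context emf_map
begin

abbreviation "W \<equiv> emf_1cell A T S (V, M.\<delta>)"

lemma tr_cell: "tr_cell A z E p S V M.\<delta>"
  using M.mate_1cell by unfold_locales simp

text \<open>The family \<sigma> read as algebra maps over identities. It exhibits \<open>F\<close>,
  up to isomorphism, as the transpose of the 1-cell \<open>(V, M.\<delta>)\<close>.\<close>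

definition factor_cell where
  "factor_cell = (\<lambda>e\<in>Obj E. uarrow (Fo W (Fo (pcompar A PD) e)) (Fo F e) (Idn A (Fo p e)) (\<sigma> e))"

lemma unit_factor:
  "(ftor_comp E W (pcompar A PD), F, factor_cell) \<in> Arr (conc_hom fst (\<lambda>F. F) (fibred_functor A) (vertical_nat_trans A) (E, p) (emf A S))"
  "is_iso (conc_hom fst (\<lambda>F. F) (fibred_functor A) (vertical_nat_trans A) (E, p) (emf A S)) (ftor_comp E W (pcompar A PD), F, factor_cell)"
proof -
  interpret tr_cell A z E p S V M.\<delta> by (rule tr_cell)
  have a: "factor_cell e \<in> Arr (emf_cat A S)" if e: "e \<in> Obj E" for e
    using M.mate_comparison[of e] S.emf_adj_pcompar e by (simp add: factor_cell_def del: emf_ArrI K.pcompar_simps)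
  have c: "uarr_dom (factor_cell e) = Fo W (Fo K e)" "uarr_cod (factor_cell e) = Fo F e" "uarr_fst (factor_cell e) = Idn A (Fo p e)"
    "uarr_snd (factor_cell e) = \<sigma> e" if "e \<in> Obj E" for e
    using that by (simp_all add: factor_cell_def)
  have "nat_trans E (emf_cat A S) (ftor_comp E W K) F factor_cell"
  proof (rule nat_transI)
    show "is_functor E (emf_cat A S) (ftor_comp E W K)" "is_functor E (emf_cat A S) F"
      using fibred_functorD(1)[OF RK_fibred] FD(1) by simp_all
    show "factor_cell \<in> extensional (Obj E)" by (simp add: factor_cell_def)
    show "arr (emf_cat A S) (factor_cell e) (Fo (ftor_comp E W K) e) (Fo F e)" if "e \<in> Obj E" for e
      using a[OF that] c[OF that] that by (simp del: emf_ArrI K.pcompar_simps)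
    fix u assume u: "u \<in> Arr E"
    show "factor_cell (Cod E u) \<cdot>\<^bsub>emf_cat A S\<^esub> Fa (ftor_comp E W K) u = Fa F u \<cdot>\<^bsub>emf_cat A S\<^esub> factor_cell (Dom E u)"
      using u RK_Fa[OF u] c \<sigma>_nat[OF u] by (simp del: emf_1cell_Fa K.pcompar_simps)
  qed
  then show *: "(ftor_comp E W K, F, factor_cell) \<in> Arr (conc_hom fst (\<lambda>F. F) (fibred_functor A) (vertical_nat_trans A) (E, p) (emf A S))"
    using RK_fibred F a c by (simp add: vertical_nat_trans_iff del: emf_ArrI)
  show "is_iso (conc_hom fst (\<lambda>F. F) (fibred_functor A) (vertical_nat_trans A) (E, p) (emf A S)) (ftor_comp E W K, F, factor_cell)"
    by (rule fib_2cell_iso[OF A _ _ *]) (use fib S.emf_fibration S.emf_isoI[OF a] c \<sigma>_iso in simp_all)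
qed

end

section \<open>Transposition along the unit is an equivalence\<close>

lemma transpose_functor:
  assumes K: "two_category K" and F: "is_functor (Hom2 M (F0 L a) x) (Hom2 K (F0 R (F0 L a)) (F0 R x)) (FH R (F0 L a) x)"
    and ob: "a \<in> Ob2 K" "F0 R (F0 L a) \<in> Ob2 K" "F0 R x \<in> Ob2 K" and \<eta>: "N0 \<eta> a \<in> Obj (Hom2 K a (F0 R (F0 L a)))" and M: "category (Hom2 M (F0 L a) x)"
  shows "is_functor (Hom2 M (F0 L a) x) (Hom2 K a (F0 R x)) (transpose K M L R \<eta> a x)"
proof -
  let ?H = "Hom2 K a (F0 R (F0 L a))" and ?G = "Hom2 K (F0 R (F0 L a)) (F0 R x)"
  have C: "is_functor (?G \<times>\<^sub>C ?H) (Hom2 K a (F0 R x)) (Comp2 K a (F0 R (F0 L a)) (F0 R x))" and H: "category ?H"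
    using K ob by (simp_all add: two_category_def)
  note c = functor_simps[OF C] and f = functor_simps[OF F]
  show ?thesis
  proof (rule functorI)
    fix \<alpha> \<beta> assume "\<alpha> \<in> Arr (Hom2 M (F0 L a) x)" "\<beta> \<in> Arr (Hom2 M (F0 L a) x)" "Cod (Hom2 M (F0 L a) x) \<alpha> = Dom (Hom2 M (F0 L a) x) \<beta>"
    then show "Fa (transpose K M L R \<eta> a x) (\<beta> \<cdot>\<^bsub>Hom2 M (F0 L a) x\<^esub> \<alpha>) =
      Fa (transpose K M L R \<eta> a x) \<beta> \<cdot>\<^bsub>Hom2 K a (F0 R x)\<^esub> Fa (transpose K M L R \<eta> a x) \<alpha>"
      using f H M \<eta> c(6)[of "(Fa (FH R (F0 L a) x) \<alpha>, Idn ?H (N0 \<eta> a))" "(Fa (FH R (F0 L a) x) \<beta>, Idn ?H (N0 \<eta> a))"]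
      by (simp add: transpose_def hcomp_def id2cell_def)
  next
    fix g assume "g \<in> Obj (Hom2 M (F0 L a) x)"
    then show "Fa (transpose K M L R \<eta> a x) (Idn (Hom2 M (F0 L a) x) g) = Idn (Hom2 K a (F0 R x)) (Fo (transpose K M L R \<eta> a x) g)"
      using f M \<eta> c(5)[of "(Fo (FH R (F0 L a) x) g, N0 \<eta> a)"] by (simp add: transpose_def hcomp_def id2cell_def comp1_def)
  qed (use f H M \<eta> c(1-4) in \<open>simp_all add: transpose_def hcomp_def id2cell_def comp1_def\<close>)
qed

lemma tr_cellI:
  "\<lbrakk>category A; initial A z; q \<in> {(E, p). pruned A z E p}; param_monad_axioms A S; pm_1cell A (Tp A z q) S w\<rbrakk> \<Longrightarrow>
     tr_cell A z (fst q) (snd q) S (fst w) (snd w)"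
  using pruned_fibI[of A z q] pruned_fib.T_axioms[of A z "fst q" "snd q"] pm1I[of A "Tp A z q" S w]
  by (simp add: tr_cell_def)

lemma emf_mapI:
  "\<lbrakk>category A; initial A z; q \<in> {(E, p). pruned A z E p}; param_monad_axioms A S; fibred_functor A q (emf A S) F\<rbrakk> \<Longrightarrow>
     emf_map A z (fst q) (snd q) S F"
  using pruned_fibI[of A z q] by (simp add: emf_map_def emf_map_axioms_def)

text \<open>Faithfulness comes from \<open>cell_ext\<close>, fullness from \<open>cell_full\<close>,
  and essential surjectivity from \<open>unit_factor\<close>, with the mate of the given cartesian
  functor as preimage.\<close>

lemma transpose_equivalence:
  assumes A: "category A" and z: "initial A z" and q: "q \<in> {(E, p). pruned A z E p}" and S: "S \<in> {P. pruned_monad A z P}"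
  shows "equivalence_functor (Hom2 (PrMnd A z) (Tp A z q) S) (Hom2 (PrFib A z) q (emf A S))
    (transpose (PrFib A z) (PrMnd A z) (Tp_2functor A z) (emf_2functor A z) (unit_pnt A z) q S)"
proof -
  let ?Ob = "{(E, p). pruned A z E p}" and ?K = "PrFib A z" and ?k = "pcompar A (fib_padj A z q)" and ?T = "Tp A z q"
  let ?tr = "transpose (PrFib A z) (PrMnd A z) (Tp_2functor A z) (emf_2functor A z) (unit_pnt A z) q S"
  let ?R = "emf_1cell A ?T S"
  interpret C: conc2 ?Ob fst "\<lambda>F. F" "fibred_functor A" "vertical_nat_trans A" "\<lambda>q. ftor_id (fst q)" "\<lambda>a b c g f. ftor_comp (fst a) g f"
    by (rule fib_conc2[OF A]) (auto simp: pruned_def)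
  interpret C': conc2 "{P. pruned_monad A z P}" Carr fst "pm_1cell A" "pm_2cell A" "mnd_id A" "mnd_cmp A"
    by (rule mnd_conc2) (use pruned_monad_axioms[OF A] in auto)
  interpret P: pruned_fib A z "fst q" "snd q" by (rule pruned_fibI[OF A z q])
  interpret S: param_monad_axioms A S using pruned_monad_axioms[OF A] S by auto
  have K: "?K = C.K" "PrMnd A z = C'.K" by (simp_all add: PrFib_conc fib_conc_def PrMnd_conc)
  have T: "?T \<in> {P. pruned_monad A z P}" using P.T_pruned by simp
  have em: "emf A P \<in> ?Ob" if "P \<in> {P. pruned_monad A z P}" for P
    using emf_two_functor[OF A z] that unfolding two_functor_def by (simp add: K)
  have N0: "N0 (unit_pnt A z) q = ?k" by (simp add: unit_pnt_def)
  have ub: "fibred_functor A q (emf A ?T) ?k" using P.unit_fibred by (simp add: fib_padj_def)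
  have kk: "pcompar A P.PD = ?k" by (simp add: fib_padj_def)
  have trc: "tr_cell A z (fst q) (snd q) S (fst w) (snd w)" if "pm_1cell A ?T S w" for w
    by (rule tr_cellI[OF A z q S.param_monad_axioms_axioms that])
  have Rf: "fibred_functor A (emf A ?T) (emf A S) (?R w)" if "pm_1cell A ?T S w" for w
  proof -
    interpret tr_cell A z "fst q" "snd q" S "fst w" "snd w" by (rule trc[OF that])
    show ?thesis using emf_1cell_fibred by simp
  qed
  have trF: "Fo ?tr w = ftor_comp (fst q) (?R w) ?k" if "pm_1cell A ?T S w" for w
    using that ub Rf[OF that] by (simp add: transpose_def N0 K)
  \<comment> \<open>Whiskering with the unit evaluates a 2-cell at the objects
    \<open>i\<^sub>R e\<close>; the identity inserted by the whiskering is removed here.\<close>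
  have trA: "Fa ?tr (v, w, \<nu>) = (ftor_comp (fst q) (?R v) ?k, ftor_comp (fst q) (?R w) ?k,
      \<lambda>e\<in>Obj (fst q). uarrow (Fo (?R v) (Fo ?k e)) (Fo (?R w) (Fo ?k e)) (Idn A (Fo (snd q) e)) (\<nu> (Fo P.I e)))"
    if *: "pm_1cell A ?T S v" "pm_1cell A ?T S w" "pm_2cell A ?T S v w \<nu>" for v w \<nu>
  proof -
    interpret v: tr_cell A z "fst q" "snd q" S "fst v" "snd v" by (rule trc[OF *(1)])
    interpret w: tr_cell A z "fst q" "snd q" S "fst w" "snd w" by (rule trc[OF *(2)])
    let ?s = "\<lambda>s\<in>Obj (emf_cat A ?T). uarrow (Fo (?R v) s) (Fo (?R w) s) (Idn A (par s)) (\<nu> (car s))"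
    have s: "vertical_nat_trans A (emf A ?T) (emf A S) (?R v) (?R w) ?s"
      using emf_2cell_vertical[OF v.pm1_axioms w.pm1_axioms, of \<nu>] *(3) by simp
    have i: "vertical_nat_trans A q (emf A ?T) ?k ?k (\<lambda>x\<in>Obj (fst q). Idn (emf_cat A ?T) (Fo ?k x))"
      using C.id2[OF q em[OF T] ub] by simp
    have "?s (Fo ?k e) \<cdot>\<^bsub>emf_cat A S\<^esub> Fa (?R v) (Idn (emf_cat A ?T) (Fo ?k e)) =
      uarrow (Fo (?R v) (Fo ?k e)) (Fo (?R w) (Fo ?k e)) (Idn A (Fo (snd q) e)) (\<nu> (Fo P.I e))" if e: "e \<in> Obj (fst q)" for e
    proof -
      have o: "Fo ?k e \<in> Obj (emf_cat A ?T)" "par (Fo ?k e) = Fo (snd q) e" "car (Fo ?k e) = Fo P.I e"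
        using v.K_Obj[OF e] kk by simp_all
      have c: "uarrow (Fo (?R v) (Fo ?k e)) (Fo (?R w) (Fo ?k e)) (Idn A (Fo (snd q) e)) (\<nu> (Fo P.I e)) \<in> Arr (emf_cat A S)"
        using emf_2cell_Arr[OF v.pm1_axioms w.pm1_axioms, of \<nu> "Fo ?k e"] *(3) o by (simp del: emf_ArrI emf_ObjI)
      have "Fa (?R v) (Idn (emf_cat A ?T) (Fo ?k e)) = Idn (emf_cat A S) (Fo (?R v) (Fo ?k e))"
        using functor_simps(5)[OF v.emf_1cell_functor[unfolded prod.collapse] o(1)] by simp
      then show ?thesis using cat_simps(9)[OF S.emf_category c, of "Fo (?R v) (Fo ?k e)"] o by (simp del: emf_ArrI emf_ObjI emf_cat_simps(3,4))
    qed
    note claim = this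
    let ?h = "\<lambda>e\<in>Obj (fst q). Idn (emf_cat A ?T) (Fo ?k e)"
    have 1: "hcomp ?K q (emf A ?T) (emf A S) (?R v, ?R w, ?s) (?k, ?k, ?h) =
        (ftor_comp (fst q) (?R v) ?k, ftor_comp (fst q) (?R w) ?k, \<lambda>e\<in>Obj (fst q). ?s (Fo ?k e) \<cdot>\<^bsub>emf_cat A S\<^esub> Fa (?R v) (?h e))"
      using ub Rf[OF *(1)] Rf[OF *(2)] s i by (simp add: K del: restrict_apply emf_cat_simps)
    have 2: "(\<lambda>e\<in>Obj (fst q). ?s (Fo ?k e) \<cdot>\<^bsub>emf_cat A S\<^esub> Fa (?R v) (?h e)) =
        (\<lambda>e\<in>Obj (fst q). uarrow (Fo (?R v) (Fo ?k e)) (Fo (?R w) (Fo ?k e)) (Idn A (Fo (snd q) e)) (\<nu> (Fo P.I e)))"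
      by (rule restrict_ext) (use claim in \<open>simp del: emf_cat_simps(3,4)\<close>)
    have "Fa ?tr (v, w, \<nu>) = hcomp ?K q (emf A ?T) (emf A S) (Fa (FH (emf_2functor A z) ?T S) (v, w, \<nu>)) (id2cell ?K q (emf A ?T) ?k)"
      using * by (simp add: transpose_def N0 K)
    also have "id2cell ?K q (emf A ?T) ?k = (?k, ?k, ?h)" by (simp add: K del: emf_cat_simps)
    finally show ?thesis unfolding emf_2functor_simps(3)[OF *] 1 2 .
  qed
  have HK: "Hom2 ?K = C.H" "Hom2 (PrMnd A z) = C'.H" by (simp_all add: K)
  have cM: "category (Hom2 (PrMnd A z) ?T S)" and cK: "category (Hom2 ?K q (emf A S))"
    using C'.category_hom[OF T S] C.category_hom[OF q em[OF S]] by (simp_all add: K)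
  have fH: "is_functor (Hom2 (PrMnd A z) ?T S) (Hom2 ?K (emf A ?T) (emf A S)) (FH (emf_2functor A z) ?T S)"
    using emf_two_functor[OF A z] T S unfolding two_functor_def by (simp add: K)
  have trf: "is_functor (Hom2 (PrMnd A z) ?T S) (Hom2 ?K q (emf A S)) ?tr"
    using transpose_functor[of ?K "PrMnd A z" "Tp_2functor A z" q S "emf_2functor A z" "unit_pnt A z"] C.two_category q em[OF T] em[OF S] fH cM ub
    by (simp add: K N0)
  show ?thesis
  proof (rule equivalence_functorI[OF cM cK full_faithfulI[OF trf]])
    fix v w \<alpha> \<beta> assume *: "v \<in> Obj (Hom2 (PrMnd A z) ?T S)" "w \<in> Obj (Hom2 (PrMnd A z) ?T S)"
      "arr (Hom2 (PrMnd A z) ?T S) \<alpha> v w" "arr (Hom2 (PrMnd A z) ?T S) \<beta> v w" "Fa ?tr \<alpha> = Fa ?tr \<beta>"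
    then obtain \<mu> \<nu> where \<alpha>: "\<alpha> = (v, w, \<mu>)" "\<beta> = (v, w, \<nu>)" by (cases \<alpha>; cases \<beta>) (auto simp: K)
    have vw: "pm_1cell A ?T S v" "pm_1cell A ?T S w" "pm_2cell A ?T S v w \<mu>" "pm_2cell A ?T S v w \<nu>" using * \<alpha> by (auto simp: K)
    interpret v: tr_cell A z "fst q" "snd q" S "fst v" "snd v" by (rule trc[OF vw(1)])
    interpret w: tr_cell A z "fst q" "snd q" S "fst w" "snd w" by (rule trc[OF vw(2)])
    interpret tr_2cell A z "fst q" "snd q" S "fst v" "snd v" "fst w" "snd w" ..
    have n: "nat_trans P.E0 (Carr S) (fst v) (fst w) \<mu>" "nat_trans P.E0 (Carr S) (fst v) (fst w) \<nu>"
      using vw(3,4) by (simp_all add: pm_2cell_iff)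
    have "\<mu> (Fo P.I e) = \<nu> (Fo P.I e)" if "e \<in> Obj (fst q)" for e
      using *(5) that trA[OF vw(1-3)] trA[OF vw(1,2,4)] \<alpha> by (auto dest!: fun_cong[of _ _ e])
    then show "\<alpha> = \<beta>" using cell_ext[OF n] \<alpha> by simp
  next
    fix v w \<gamma> assume *: "v \<in> Obj (Hom2 (PrMnd A z) ?T S)" "w \<in> Obj (Hom2 (PrMnd A z) ?T S)"
      "arr (Hom2 ?K q (emf A S)) \<gamma> (Fo ?tr v) (Fo ?tr w)"
    have vw: "pm_1cell A ?T S v" "pm_1cell A ?T S w" using * by (auto simp: K)
    obtain \<tau> where \<gamma>: "\<gamma> = (ftor_comp (fst q) (?R v) ?k, ftor_comp (fst q) (?R w) ?k, \<tau>)"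
      and t: "vertical_nat_trans A q (emf A S) (ftor_comp (fst q) (?R v) ?k) (ftor_comp (fst q) (?R w) ?k) \<tau>"
      using *(3) trF[OF vw(1)] trF[OF vw(2)] by (cases \<gamma>) (auto simp: K)
    interpret v: tr_cell A z "fst q" "snd q" S "fst v" "snd v" by (rule trc[OF vw(1)])
    interpret w: tr_cell A z "fst q" "snd q" S "fst w" "snd w" by (rule trc[OF vw(2)])
    interpret tr_2cell A z "fst q" "snd q" S "fst v" "snd v" "fst w" "snd w" ..
    obtain \<nu> where \<nu>: "pm_2cell A ?T S v w \<nu>" "\<And>e. e \<in> Obj (fst q) \<Longrightarrow> \<nu> (Fo P.I e) = uarr_snd (\<tau> e)"
      using cell_full[unfolded kk prod.collapse, OF t] by blast
    have "(\<lambda>e\<in>Obj (fst q). uarrow (Fo (?R v) (Fo ?k e)) (Fo (?R w) (Fo ?k e)) (Idn A (Fo (snd q) e)) (\<nu> (Fo P.I e))) = \<tau>"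
    proof (rule extensionalityI[OF restrict_extensional])
      have n: "nat_trans (fst q) (emf_cat A S) (ftor_comp (fst q) (?R v) ?k) (ftor_comp (fst q) (?R w) ?k) \<tau>"
        using t by (simp add: vertical_nat_trans_iff)
      show "\<tau> \<in> extensional (Obj (fst q))" using nat_transD(3)[OF n] .
      fix e assume e: "e \<in> Obj (fst q)"
      \<comment> \<open>Verticality fixes the parameter part of \<tau>, so \<tau> is determined by
        the carrier parts that \<nu> reproduces.\<close>
      have "uarr_fst (\<tau> e) = Idn A (Fo (snd q) e)"
        using t e emf_proj_simps(2)[OF nat_transD(4)[OF n e]] by (auto simp: vertical_nat_trans_iff)
      then show "(\<lambda>e\<in>Obj (fst q). uarrow (Fo (?R v) (Fo ?k e)) (Fo (?R w) (Fo ?k e)) (Idn A (Fo (snd q) e)) (\<nu> (Fo P.I e))) e = \<tau> e"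
        using emf_ArrD(10)[OF nat_transD(4)[OF n e]] nat_transD(5,6)[OF n e] \<nu>(2)[OF e] e by simp
    qed
    then show "\<exists>g. arr (Hom2 (PrMnd A z) ?T S) g v w \<and> Fa ?tr g = \<gamma>"
      using trA[OF vw \<nu>(1)] \<gamma> \<nu>(1) vw by (intro exI[of _ "(v, w, \<nu>)"]) (simp add: K)
  next
    show "ess_surj (Hom2 (PrMnd A z) ?T S) (Hom2 ?K q (emf A S)) ?tr"
      unfolding ess_surj_def
    proof
      fix F assume "F \<in> Obj (Hom2 ?K q (emf A S))"
      then have F: "fibred_functor A q (emf A S) F" by (simp add: K)
      interpret emf_map A z "fst q" "snd q" S F by (rule emf_mapI[OF A z q S.param_monad_axioms_axioms F])
      have c: "pm_1cell A ?T S (V, M.\<delta>)" using M.mate_1cell by simp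
      show "\<exists>c\<in>Obj (Hom2 (PrMnd A z) ?T S). \<exists>k. arr (Hom2 ?K q (emf A S)) k (Fo ?tr c) F \<and> is_iso (Hom2 ?K q (emf A S)) k"
        using unit_factor[unfolded kk prod.collapse] c trF[OF c]
        by (intro bexI[of _ "(V, M.\<delta>)"] exI[of _ "(ftor_comp (fst q) (?R (V, M.\<delta>)) ?k, F, factor_cell)"]) (simp_all add: HK)
    qed
  qed
qed


section \<open>Equivalences of fibrations\<close>

lemma full_faithful_nat_iso:
  assumes C: "category C" and D: "category D" and t: "nat_iso C D G F t" and F: "full_faithful C D F"
  shows "full_faithful C D G"
proof -
  have n: "nat_trans C D G F t" and i: "\<And>x. x \<in> Obj C \<Longrightarrow> is_iso D (t x)" using t by (auto simp: nat_iso_def)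
  note [simp] = C D nat_transD(4-6)[OF n] functor_base[OF nat_transD(1)[OF n]] functor_base[OF nat_transD(2)[OF n]]
  note n7 = nat_transD(7)[OF n]
  show ?thesis
  proof (rule full_faithfulI[OF nat_transD(1)[OF n]])
    fix x y g g' assume *: "x \<in> Obj C" "y \<in> Obj C" "arr C g x y" "arr C g' x y" "Fa G g = Fa G g'"
    have "Fa F g = Fa F g'"
      by (rule iso_epi[OF D i[OF *(1)]]) (use * n7[of g] n7[of g'] in simp_all)
    then show "g = g'" using full_faithfulD[OF F *(1,2), of "Fa F g"] * by auto
  next
    fix x y h assume *: "x \<in> Obj C" "y \<in> Obj C" "arr D h (Fo G x) (Fo G y)"
    note ix = inv_arr[OF i[OF *(1)]]
    obtain g where g: "arr C g x y" "Fa F g = t y \<cdot>\<^bsub>D\<^esub> (h \<cdot>\<^bsub>D\<^esub> inv_arr D (t x))"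
      using full_faithfulD[OF F *(1,2), of "t y \<cdot>\<^bsub>D\<^esub> (h \<cdot>\<^bsub>D\<^esub> inv_arr D (t x))"] * ix by auto
    have "Fa G g = h"
      by (rule iso_mono[OF D i[OF *(2)]]) (use * g n7[of g] ix in simp_all)
    then show "\<exists>g. arr C g x y \<and> Fa G g = h" using g by blast
  qed
qed

lemma full_faithful_cancel:
  assumes K: "is_functor C D K" and W: "full_faithful D E W" and WK: "full_faithful C E (ftor_comp C W K)"
  shows "full_faithful C D K"
proof (rule full_faithfulI[OF K])
  note [simp] = functor_base[OF K]
  have W': "is_functor D E W" using W by (simp add: full_faithful_def)
  note [simp] = functor_base[OF W']
  fix x y assume *: "x \<in> Obj C" "y \<in> Obj C"
  show "g = g'" if "arr C g x y" "arr C g' x y" "Fa K g = Fa K g'" for g g'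
    using full_faithfulD[OF WK *, of "Fa W (Fa K g)"] that * by auto
  show "\<exists>g. arr C g x y \<and> Fa K g = h" if h: "arr D h (Fo K x) (Fo K y)" for h
  proof -
    obtain g where g: "arr C g x y" "Fa W (Fa K g) = Fa W h" using full_faithfulD[OF WK *, of "Fa W h"] h * by auto
    then have "Fa K g = h" using full_faithfulD[OF W, of "Fo K x" "Fo K y" "Fa W h"] h * by auto
    with g show ?thesis by blast
  qed
qed

lemma full_faithful_iso:
  assumes C: "category C" and D: "category D" and F: "full_faithful C D F" and xy: "x \<in> Obj C" "y \<in> Obj C"
    and h: "arr D h (Fo F x) (Fo F y)" "is_iso D h"
  obtains k where "arr C k x y" "is_iso C k" "Fa F k = h"
proof -
  have F': "is_functor C D F" using F by (simp add: full_faithful_def)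
  note i = inv_arr[OF h(2)]
  obtain k where k: "arr C k x y" "Fa F k = h" using full_faithfulD[OF F xy h(1)] by auto
  obtain l where l: "arr C l y x" "Fa F l = inv_arr D h" using full_faithfulD[OF F xy(2,1), of "inv_arr D h"] i h by auto
  have "l \<cdot>\<^bsub>C\<^esub> k = Idn C x"
    using full_faithfulD[OF F xy(1,1), of "Idn D (Fo F x)"] functor_simps[OF F'] k l i h xy C D by auto
  moreover have "k \<cdot>\<^bsub>C\<^esub> l = Idn C y"
    using full_faithfulD[OF F xy(2,2), of "Idn D (Fo F y)"] functor_simps[OF F'] k l i h xy C D by auto
  ultimately have "is_iso C k" using is_isoI k(1) l(1) by metis
  with k that show thesis by blast
qed

text \<open>The factorization is found in the target and pulled back along \<open>F\<close>; its
  image in \<open>A\<close> is unchanged, as \<open>F\<close> commutes with the projections.\<close>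

lemma full_faithful_cartesian:
  assumes A: "category A" and fib: "fibration A (fst q) (snd q)" "fibration A (fst q') (snd q')"
    and F: "fibred_functor A q q' F" and ff: "full_faithful (fst q) (fst q') F" and \<phi>: "\<phi> \<in> Arr (fst q)"
    and c: "cartesian A (fst q') (snd q') (Fa F \<phi>)"
  shows "cartesian A (fst q) (snd q) \<phi>"
proof -
  have E: "category (fst q)" "category (fst q')" and p: "is_functor (fst q) A (snd q)" "is_functor (fst q') A (snd q')"
    using fib by (auto simp: fibration_def)
  note FD = fibred_functorD[OF F]
  note [simp] = A E FD(2,3) functor_simps[OF p(1)] functor_simps[OF p(2)] functor_simps[OF FD(1)] \<phi>
  have inj: "g = g'" if "g \<in> Arr (fst q)" "g' \<in> Arr (fst q)" "Dom (fst q) g = Dom (fst q) g'" "Cod (fst q) g = Cod (fst q) g'" "Fa F g = Fa F g'" for g g'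
    using full_faithfulD[OF ff, of "Dom (fst q) g" "Cod (fst q) g" "Fa F g"] that by auto
  show ?thesis
  proof (rule cartesianI[OF \<phi>])
    fix \<psi> h assume *: "\<psi> \<in> Arr (fst q)" "arr A h (Fo (snd q) (Dom (fst q) \<psi>)) (Fo (snd q) (Dom (fst q) \<phi>))"
      "Cod (fst q) \<psi> = Cod (fst q) \<phi>" "Fa (snd q) \<psi> = Fa (snd q) \<phi> \<cdot>\<^bsub>A\<^esub> h"
    obtain \<chi> where \<chi>: "arr (fst q') \<chi> (Fo F (Dom (fst q) \<psi>)) (Fo F (Dom (fst q) \<phi>))" "Fa (snd q') \<chi> = h" "Fa F \<phi> \<cdot>\<^bsub>fst q'\<^esub> \<chi> = Fa F \<psi>"
      using cartesianD(2)[OF c, of "Fa F \<psi>" h] * by auto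
    obtain g where g: "arr (fst q) g (Dom (fst q) \<psi>) (Dom (fst q) \<phi>)" "Fa F g = \<chi>"
      using full_faithfulD[OF ff _ _ \<chi>(1)] * by auto
    have "\<phi> \<cdot>\<^bsub>fst q\<^esub> g = \<psi>" by (rule inj) (use g * \<chi> in simp_all)
    moreover have "Fa (snd q) g = h" using FD(3)[of g] g \<chi>(2) by simp
    ultimately show "\<exists>\<chi>. arr (fst q) \<chi> (Dom (fst q) \<psi>) (Dom (fst q) \<phi>) \<and> Fa (snd q) \<chi> = h \<and> \<phi> \<cdot>\<^bsub>fst q\<^esub> \<chi> = \<psi>" using g(1) by blast
  next
    fix \<chi> \<chi>' assume *: "\<chi> \<in> Arr (fst q)" "\<chi>' \<in> Arr (fst q)" "Dom (fst q) \<chi> = Dom (fst q) \<chi>'" "Cod (fst q) \<chi> = Dom (fst q) \<phi>"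
      "Cod (fst q) \<chi>' = Dom (fst q) \<phi>" "Fa (snd q) \<chi> = Fa (snd q) \<chi>'" "\<phi> \<cdot>\<^bsub>fst q\<^esub> \<chi> = \<phi> \<cdot>\<^bsub>fst q\<^esub> \<chi>'"
    have "Fa F \<phi> \<cdot>\<^bsub>fst q'\<^esub> Fa F \<chi> = Fa F \<phi> \<cdot>\<^bsub>fst q'\<^esub> Fa F \<chi>'"
      using functor_simps(6)[OF FD(1) *(1) \<phi> *(4)] functor_simps(6)[OF FD(1) *(2) \<phi> *(5)] *(7) by metis
    then have "Fa F \<chi> = Fa F \<chi>'"
    proof (rule cartesian_mono[OF A E(2) p(2) c, rotated -1])
      show "Fa F \<chi> \<in> Arr (fst q')" "Fa F \<chi>' \<in> Arr (fst q')" using *(1,2) by simp_all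
      show "Dom (fst q') (Fa F \<chi>) = Dom (fst q') (Fa F \<chi>')" using *(1,2,3) by simp
      show "Cod (fst q') (Fa F \<chi>) = Dom (fst q') (Fa F \<phi>)" "Cod (fst q') (Fa F \<chi>') = Dom (fst q') (Fa F \<phi>)" using *(1,2,4,5) by simp_all
      show "Fa (snd q') (Fa F \<chi>) = Fa (snd q') (Fa F \<chi>')" using *(1,2,6) by simp
    qed
    then show "\<chi> = \<chi>'" using inj[OF *(1-3)] *(4,5) by simp
  qed
qed

text \<open>An isomorphism from \<open>F c\<close> to \<open>d\<close> need not be vertical.
  Reindexing \<open>c\<close> along the inverse of its image in \<open>A\<close> gives an
  isomorphism in the source whose image under \<open>F\<close> corrects this.\<close>

lemma fib_vertical_ess_surj:
  assumes A: "category A" and fib: "fibration A (fst q) (snd q)" "fibration A (fst q') (snd q')"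
    and F: "fibred_functor A q q' F" and es: "ess_surj (fst q) (fst q') F" and d: "d \<in> Obj (fst q')"
  shows "\<exists>e\<in>Obj (fst q). \<exists>k. arr (fst q') k (Fo F e) d \<and> is_iso (fst q') k \<and> Fa (snd q') k = Idn A (Fo (snd q') d)"
proof -
  have E: "category (fst q)" "category (fst q')" and p: "is_functor (fst q) A (snd q)" "is_functor (fst q') A (snd q')"
    using fib by (auto simp: fibration_def)
  note FD = fibred_functorD[OF F]
  obtain c k where c: "c \<in> Obj (fst q)" and k: "arr (fst q') k (Fo F c) d" "is_iso (fst q') k"
    using es d by (auto simp: ess_surj_def)
  note [simp] = A E FD(2,3) functor_simps[OF p(1)] functor_simps[OF p(2)] functor_simps[OF FD(1)] c k
  have pk: "is_iso A (Fa (snd q') k)" using functor_iso[OF E(2) p(2) k(2)] .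
  note i = inv_arr[OF pk]
  have l: "inv_arr A (Fa (snd q') k) \<in> Arr A" "Cod A (inv_arr A (Fa (snd q') k)) = Fo (snd q) c" using i by simp_all
  obtain \<phi> where \<phi>: "cartesian A (fst q) (snd q) \<phi>" "Cod (fst q) \<phi> = c" "Fa (snd q) \<phi> = inv_arr A (Fa (snd q') k)"
    using fib(1) c l unfolding fibration_def by blast
  note \<phi>A [simp] = cartesianD(1)[OF \<phi>(1)]
  have "is_iso (fst q) \<phi>" by (rule cartesian_iso[OF A E(1) p(1) \<phi>(1)]) (use \<phi> is_iso_inv[OF pk] in simp)
  then have "is_iso (fst q') (k \<cdot>\<^bsub>fst q'\<^esub> Fa F \<phi>)"
    using \<phi>(2) by (intro is_iso_comp[OF E(2) functor_iso[OF E(1) FD(1)] k(2)]) simp_all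
  moreover have "Fa (snd q') (k \<cdot>\<^bsub>fst q'\<^esub> Fa F \<phi>) = Idn A (Fo (snd q') d)" using \<phi>(2,3) i k(1) by simp
  ultimately show ?thesis using \<phi>(2) k(1) by (intro bexI[of _ "Dom (fst q) \<phi>"] exI[of _ "k \<cdot>\<^bsub>fst q'\<^esub> Fa F \<phi>"]) simp_all
qed

lemma isomorphic_sym:
  assumes "isomorphic C x y"
  shows "isomorphic C y x"
proof -
  obtain f where f: "arr C f x y" "is_iso C f" using assms by (auto simp: isomorphic_def)
  then show ?thesis using inv_arr(1-3)[OF f(2)] is_iso_inv[OF f(2)] by (auto simp: isomorphic_def intro!: bexI[of _ "inv_arr C f"])
qed

lemma fib_isomorphic_iff:
  assumes A: "category A" and fib: "fibration A (fst q) (snd q)" "fibration A (fst q') (snd q')"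
    and FG: "fibred_functor A q q' F" "fibred_functor A q q' G"
  shows "isomorphic (conc_hom fst (\<lambda>F. F) (fibred_functor A) (vertical_nat_trans A) q q') F G \<longleftrightarrow>
    (\<exists>t. nat_iso (fst q) (fst q') F G t \<and> (\<forall>e\<in>Obj (fst q). Fa (snd q') (t e) = Idn A (Fo (snd q) e)))"
    (is "isomorphic ?H F G \<longleftrightarrow> ?r")
proof
  assume "isomorphic ?H F G"
  then obtain t where t: "(F, G, t) \<in> Arr ?H" "is_iso ?H (F, G, t)" by (auto simp: isomorphic_def)
  then have "nat_iso (fst q) (fst q') F G t" using fib_2cell_isoD[OF t(2)] by (simp add: nat_iso_def vertical_nat_trans_iff)
  then show ?r using t(1) by (auto simp: vertical_nat_trans_iff)
next
  assume ?r
  then obtain t where t: "nat_iso (fst q) (fst q') F G t" "\<forall>e\<in>Obj (fst q). Fa (snd q') (t e) = Idn A (Fo (snd q) e)" by blast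
  then have a: "(F, G, t) \<in> Arr ?H" using FG by (simp add: vertical_nat_trans_iff nat_iso_def)
  moreover have "is_iso ?H (F, G, t)" by (rule fib_2cell_iso[OF A fib a]) (use t(1) in \<open>simp add: nat_iso_def\<close>)
  ultimately show "isomorphic ?H F G" unfolding isomorphic_def by (intro bexI[of _ "(F, G, t)"]) simp_all
qed

text \<open>An arbitrary quasi-inverse need not commute with the projections. Choosing the
  isomorphisms from \<open>F (g d)\<close> to \<open>d\<close> vertical repairs this, and the
  quasi-inverse preserves cartesian arrows because \<open>F\<close> reflects them.\<close>

lemma fib_internal_equivalence:
  assumes A: "category A" and Ob: "\<And>q. q \<in> Ob \<Longrightarrow> fibration A (fst q) (snd q)" and q: "q \<in> Ob" "q' \<in> Ob"
  shows "internal_equivalence (fib_conc A Ob) q q' F \<longleftrightarrow> fibred_functor A q q' F \<and> equivalence_functor (fst q) (fst q') F"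
proof -
  interpret C: conc2 Ob fst "\<lambda>F. F" "fibred_functor A" "vertical_nat_trans A" "\<lambda>q. ftor_id (fst q)" "\<lambda>a b c g f. ftor_comp (fst a) g f"
    by (rule fib_conc2[OF A Ob])
  have fib: "fibration A (fst q) (snd q)" "fibration A (fst q') (snd q')" using Ob q by simp_all
  have E [simp]: "category (fst q)" "category (fst q')" and p: "is_functor (fst q) A (snd q)" "is_functor (fst q') A (snd q')"
    using fib by (auto simp: fibration_def)
  have H: "Hom2 (fib_conc A Ob) = C.H" "Id2 (fib_conc A Ob) = (\<lambda>q. ftor_id (fst q))" by (simp_all add: fib_conc_def)
  \<comment> \<open>Isomorphic 1-cells become natural isomorphisms with vertical components; the
    first isomorphism is reversed to match the direction in
    \<open>equivalence_functor\<close>.\<close>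
  have eq: "internal_equivalence (fib_conc A Ob) q q' F \<longleftrightarrow> fibred_functor A q q' F \<and> (\<exists>G. fibred_functor A q' q G \<and>
     (\<exists>s. nat_iso (fst q) (fst q) (ftor_id (fst q)) (ftor_comp (fst q) G F) s \<and> (\<forall>e\<in>Obj (fst q). Fa (snd q) (s e) = Idn A (Fo (snd q) e))) \<and>
     (\<exists>t. nat_iso (fst q') (fst q') (ftor_comp (fst q') F G) (ftor_id (fst q')) t \<and> (\<forall>e\<in>Obj (fst q'). Fa (snd q') (t e) = Idn A (Fo (snd q') e))))"
    (is "_ \<longleftrightarrow> ?F \<and> (\<exists>G. ?G G \<and> ?s G \<and> ?t G)")
  proof -
    have "isomorphic (C.H q q) (comp1 (fib_conc A Ob) q q' q G F) (ftor_id (fst q)) \<longleftrightarrow> ?s G"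
      "isomorphic (C.H q' q') (comp1 (fib_conc A Ob) q' q q' F G) (ftor_id (fst q')) \<longleftrightarrow> ?t G" if "?F" "?G G" for G
    proof -
      have c: "fibred_functor A q q (ftor_comp (fst q) G F)" "fibred_functor A q' q' (ftor_comp (fst q') F G)"
        using C.cmp(1)[OF q(1,2,1) that] C.cmp(1)[OF q(2,1,2) that(2,1)] .
      have i: "fibred_functor A q q (ftor_id (fst q))" "fibred_functor A q' q' (ftor_id (fst q'))" using C.id1(1) q by simp_all
      have c1: "comp1 (fib_conc A Ob) q q' q G F = ftor_comp (fst q) G F" "comp1 (fib_conc A Ob) q' q q' F G = ftor_comp (fst q') F G"
        using that by (simp_all add: fib_conc_def)
      have "isomorphic (C.H q q) (ftor_comp (fst q) G F) (ftor_id (fst q)) \<longleftrightarrow> isomorphic (C.H q q) (ftor_id (fst q)) (ftor_comp (fst q) G F)"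
        by (rule iffI; rule isomorphic_sym)
      then show "isomorphic (C.H q q) (comp1 (fib_conc A Ob) q q' q G F) (ftor_id (fst q)) \<longleftrightarrow> ?s G"
        unfolding c1 using fib_isomorphic_iff[OF A fib(1) fib(1) i(1) c(1)] by (rule trans)
      show "isomorphic (C.H q' q') (comp1 (fib_conc A Ob) q' q q' F G) (ftor_id (fst q')) \<longleftrightarrow> ?t G"
        unfolding c1 by (rule fib_isomorphic_iff[OF A fib(2) fib(2) c(2) i(2)])
    qed
    then show ?thesis unfolding internal_equivalence_def H Bex_def conc_hom_simps(1) by (intro conj_cong ex_cong1 refl) assumption+
  qed
  show ?thesis
  proof
    assume "internal_equivalence (fib_conc A Ob) q q' F"
    then show "fibred_functor A q q' F \<and> equivalence_functor (fst q) (fst q') F"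
      unfolding eq equivalence_functor_def using fibred_functorD(1) by metis
  next
    assume *: "fibred_functor A q q' F \<and> equivalence_functor (fst q) (fst q') F"
    then have F: "fibred_functor A q q' F" and ff: "full_faithful (fst q) (fst q') F" and es: "ess_surj (fst q) (fst q') F"
      using equivalence_functorD[OF E] by auto
    note FD = fibred_functorD[OF F]
    obtain g k where gk: "\<And>d. d \<in> Obj (fst q') \<Longrightarrow> g d \<in> Obj (fst q)"
      "\<And>d. d \<in> Obj (fst q') \<Longrightarrow> arr (fst q') (k d) (Fo F (g d)) d" "\<And>d. d \<in> Obj (fst q') \<Longrightarrow> is_iso (fst q') (k d)"
      and kv: "\<And>d. d \<in> Obj (fst q') \<Longrightarrow> Fa (snd q') (k d) = Idn A (Fo (snd q') d)"
      using fib_vertical_ess_surj[OF A fib F es] by metis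
    obtain G s where G: "is_functor (fst q') (fst q) G" "\<And>d. d \<in> Obj (fst q') \<Longrightarrow> Fo G d = g d"
      "\<And>f. f \<in> Arr (fst q') \<Longrightarrow> Fa F (Fa G f) = inv_arr (fst q') (k (Cod (fst q') f)) \<cdot>\<^bsub>fst q'\<^esub> (f \<cdot>\<^bsub>fst q'\<^esub> k (Dom (fst q') f))"
      "nat_iso (fst q) (fst q) (ftor_id (fst q)) (ftor_comp (fst q) G F) s"
      "nat_iso (fst q') (fst q') (ftor_comp (fst q') F G) (ftor_id (fst q')) (restrict k (Obj (fst q')))"
      "\<And>c. c \<in> Obj (fst q) \<Longrightarrow> Fa F (s c) = inv_arr (fst q') (k (Fo F c))"
      using quasi_inverse[OF E ff gk] by metis
    note [simp] = A FD(2,3) functor_simps[OF FD(1)] functor_base[OF p(1)] functor_base[OF p(2)] functor_base[OF G(1)] gk kv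
    have iv: "inv_arr (fst q') (k d) \<in> Arr (fst q')" "Dom (fst q') (inv_arr (fst q') (k d)) = d"
      "Cod (fst q') (inv_arr (fst q') (k d)) = Fo F (g d)" "Fa (snd q') (inv_arr (fst q') (k d)) = Idn A (Fo (snd q') d)"
      if d: "d \<in> Obj (fst q')" for d
    proof -
      note i = inv_arr[OF gk(3)[OF d]]
      show *: "inv_arr (fst q') (k d) \<in> Arr (fst q')" "Dom (fst q') (inv_arr (fst q') (k d)) = d" "Cod (fst q') (inv_arr (fst q') (k d)) = Fo F (g d)"
        using i gk(2)[OF d] by simp_all
      have "Fo (snd q') (Fo F (g d)) = Fo (snd q') d"
        using functor_simps(3)[OF p(2), of "k d"] kv[OF d] gk(2)[OF d] d by simp
      then show "Fa (snd q') (inv_arr (fst q') (k d)) = Idn A (Fo (snd q') d)"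
        using functor_simps(6)[OF p(2), of "inv_arr (fst q') (k d)" "k d"] i(5) * gk(2)[OF d] kv[OF d] d functor_simps(2-4)[OF p(2), of "inv_arr (fst q') (k d)"] by simp
    qed
    have pg: "Fo (snd q) (g d) = Fo (snd q') d" if d: "d \<in> Obj (fst q')" for d
      using functor_simps(3)[OF p(2), of "k d"] kv[OF d] gk(1,2)[OF d] d by simp
    have pG: "Fa (snd q) (Fa G f) = Fa (snd q') f" if f: "f \<in> Arr (fst q')" for f
    proof -
      have "Fa (snd q) (Fa G f) = Fa (snd q') (Fa F (Fa G f))" using f by simp
      also have "\<dots> = Fa (snd q') f"
        unfolding G(3)[OF f] using f iv(1-3)[of "Cod (fst q') f"] iv(4)[of "Cod (fst q') f"] functor_simps(6)[OF p(2)] by simp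
      finally show ?thesis .
    qed
    \<comment> \<open>\<open>F (G \<phi>)\<close> is \<phi> composed with isomorphisms on both
      sides, hence cartesian.\<close>
    have GC: "cartesian A (fst q) (snd q) (Fa G \<phi>)" if c: "cartesian A (fst q') (snd q') \<phi>" for \<phi>
    proof (rule full_faithful_cartesian[OF A fib F ff])
      note \<phi> = cartesianD(1)[OF c]
      show "Fa G \<phi> \<in> Arr (fst q)" using \<phi> by simp
      have k: "cartesian A (fst q') (snd q') (k (Dom (fst q') \<phi>))" "cartesian A (fst q') (snd q') (inv_arr (fst q') (k (Cod (fst q') \<phi>)))"
        by (rule iso_cartesian[OF A E(2) p(2) gk(3)] iso_cartesian[OF A E(2) p(2) is_iso_inv[OF gk(3)]]; use \<phi> in simp)+
      show "cartesian A (fst q') (snd q') (Fa F (Fa G \<phi>))" unfolding G(3)[OF \<phi>]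
        by (intro cartesian_comp[OF A E(2) p(2)] k c) (use \<phi> iv in simp_all)
    qed
    have "ftor_comp (fst q') (snd q) G = snd q'"
      by (rule ftor_eqI[of _ "Obj (fst q')" _ "Arr (fst q')"]) (use functor_ext[OF p(2)] pg pG G(2) in simp_all)
    then have GG: "fibred_functor A q' q G" using G(1) GC by (simp add: fibred_functor_iff)
    have "Fa (snd q) (s e) = Idn A (Fo (snd q) e)" if e: "e \<in> Obj (fst q)" for e
    proof -
      have n: "nat_trans (fst q) (fst q) (ftor_id (fst q)) (ftor_comp (fst q) G F) s" using G(4) by (simp add: nat_iso_def)
      have "Fa (snd q) (s e) = Fa (snd q') (Fa F (s e))" using nat_transD(4)[OF n e] by simp
      then show ?thesis using G(6)[OF e] e iv(4)[of "Fo F e"] by simp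
    qed
    then show "internal_equivalence (fib_conc A Ob) q q' F" unfolding eq
      using F GG G(4,5) by (intro conjI exI[of _ G]) auto
  qed
qed


section \<open>Recognizing Eilenberg--Moore fibrations\<close>

lemma full_faithful_inj:
  assumes "category C" "full_faithful C D F" "g \<in> Arr C" "g' \<in> Arr C" "Dom C g = Dom C g'" "Cod C g = Cod C g'" "Fa F g = Fa F g'"
  shows "g = g'"
proof -
  have F: "is_functor C D F" using assms(2) by (simp add: full_faithful_def)
  have "\<exists>!k. arr C k (Dom C g') (Cod C g') \<and> Fa F k = Fa F g'"
    by (rule full_faithfulD[OF assms(2)]) (use assms(1,4) functor_simps[OF F] in simp_all)
  then show ?thesis using assms by blast
qed

text \<open>An invertible \<delta> can be cancelled from the algebra-map equation in the target, and
  what remains is the \<open>V\<close>-image of the equation in the source.\<close>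

lemma (in pm1) emf_1cell_full_faithful:
  assumes ff: "full_faithful (Carr P) (Carr Q) V"
    and i: "\<And>a x. \<lbrakk>a \<in> Obj A; x \<in> Obj (Carr P)\<rbrakk> \<Longrightarrow> is_iso (Carr Q) (\<delta> (a, x))"
  shows "full_faithful (emf_cat A P) (emf_cat A Q) (emf_1cell A P Q (V, \<delta>))"
proof (rule full_faithfulI[OF emf_1cell_functor])
  fix s t u v assume *: "s \<in> Obj (emf_cat A P)" "t \<in> Obj (emf_cat A P)" "arr (emf_cat A P) u s t" "arr (emf_cat A P) v s t"
    "Fa (emf_1cell A P Q (V, \<delta>)) u = Fa (emf_1cell A P Q (V, \<delta>)) v"
  then have e: "uarr_fst u = uarr_fst v" "Fa V (uarr_snd u) = Fa V (uarr_snd v)"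
    using emf_1cell_Fa[of u] emf_1cell_Fa[of v] by (simp_all del: emf_1cell_Fo emf_ArrI)
  have uv: "u \<in> Arr (emf_cat A P)" "v \<in> Arr (emf_cat A P)" "uarr_dom u = s" "uarr_cod u = t" "uarr_dom v = s" "uarr_cod v = t" using * by auto
  have "uarr_snd u = uarr_snd v"
    using full_faithfulD[OF ff, of "car s" "car t" "Fa V (uarr_snd u)"] emf_ArrD(6-8)[OF uv(1)] emf_ArrD(6-8)[OF uv(2)] uv(3-) e(2)
      emf_ObjD(2)[OF *(1)] emf_ObjD(2)[OF *(2)] by auto
  then show "u = v" using emf_eqI[OF uv(1,2)] uv(3-) e(1) by simp
next
  fix s t h assume s: "s \<in> Obj (emf_cat A P)" and t: "t \<in> Obj (emf_cat A P)"
    and h: "arr (emf_cat A Q) h (Fo (emf_1cell A P Q (V, \<delta>)) s) (Fo (emf_1cell A P Q (V, \<delta>)) t)"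
  have hA: "h \<in> Arr (emf_cat A Q)" and hd: "uarr_dom h = Fo (emf_1cell A P Q (V, \<delta>)) s" "uarr_cod h = Fo (emf_1cell A P Q (V, \<delta>)) t"
    using h by (auto simp del: emf_1cell_Fo)
  note s' [simp] = emf_ObjD(1-5)[OF s] and t' [simp] = emf_ObjD(1-5)[OF t]
  let ?f = "uarr_fst h"
  have h1: "?f \<in> Arr A" "Dom A ?f = par s" "Cod A ?f = par t" "uarr_snd h \<in> Arr (Carr Q)" "Dom (Carr Q) (uarr_snd h) = Fo V (car s)"
    "Cod (Carr Q) (uarr_snd h) = Fo V (car t)"
    "uarr_snd h \<cdot>\<^bsub>Carr Q\<^esub> (Fa V (str s) \<cdot>\<^bsub>Carr Q\<^esub> \<delta> (par s, car s)) = (Fa V (str t) \<cdot>\<^bsub>Carr Q\<^esub> \<delta> (par t, car t)) \<cdot>\<^bsub>Carr Q\<^esub> Fa (PFun Q) (?f, uarr_snd h)"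
    using emf_ArrD(3-9)[OF hA] hd s t by (simp_all del: cat_assoc)
  note [simp] = h1(1-3)
  obtain g where g: "arr (Carr P) g (car s) (car t)" "Fa V g = uarr_snd h"
    using full_faithfulD[OF ff, of "car s" "car t" "uarr_snd h"] h1 by auto
  note [simp] = g(1)
  have "g \<cdot>\<^bsub>Carr P\<^esub> str s = str t \<cdot>\<^bsub>Carr P\<^esub> Fa (PFun P) (?f, g)"
  proof -
    have "(Fa V g \<cdot>\<^bsub>Carr Q\<^esub> Fa V (str s)) \<cdot>\<^bsub>Carr Q\<^esub> \<delta> (par s, car s) =
      (Fa V (str t) \<cdot>\<^bsub>Carr Q\<^esub> Fa V (Fa (PFun P) (?f, g))) \<cdot>\<^bsub>Carr Q\<^esub> \<delta> (par s, car s)"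
      using h1(7) \<delta>_nat[of ?f g "par s" "car s"] by (simp add: g(2)[symmetric])
    then have "Fa V g \<cdot>\<^bsub>Carr Q\<^esub> Fa V (str s) = Fa V (str t) \<cdot>\<^bsub>Carr Q\<^esub> Fa V (Fa (PFun P) (?f, g))"
      by (rule iso_epi[OF Q.X i, rotated -1]) simp_all
    then have "Fa V (g \<cdot>\<^bsub>Carr P\<^esub> str s) = Fa V (str t \<cdot>\<^bsub>Carr P\<^esub> Fa (PFun P) (?f, g))" by simp
    then show ?thesis
      by (rule full_faithful_inj[OF P.X ff, rotated -1]) simp_all
  qed
  then have a: "uarrow s t ?f g \<in> Arr (emf_cat A P)" using s t by simp
  then have "Fa (emf_1cell A P Q (V, \<delta>)) (uarrow s t ?f g) = h"
    using emf_1cell_Fa[OF a] emf_ArrD(10)[OF hA] hd g(2) by (simp del: emf_1cell_Fo emf_ArrI)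
  then show "\<exists>g. arr (emf_cat A P) g s t \<and> Fa (emf_1cell A P Q (V, \<delta>)) g = h"
    using a by (intro exI[of _ "uarrow s t ?f g"]) (simp del: emf_ArrI)
qed

text \<open>Since \<open>F\<close> is essentially surjective, the free object at \<open>V x\<close> is of the form \<open>F e\<close> up to isomorphism;
  the universal property of \<open>AS D a x\<close>, transported along \<open>F\<close>, then provides an inverse of \<open>can a x\<close>.\<close>

lemma (in padj_map) mate_iso:
  assumes ff: "full_faithful (AE D) (AE D') F" and es: "ess_surj (AE D) (AE D') F" and Vf: "full_faithful (AX D) (AX D') V"
    and a [simp]: "a \<in> Obj A" and x [simp]: "x \<in> Obj (AX D)"
  shows "is_iso (AX D') (\<delta> (a, x))"
proof -
  let ?M = "AE D'" and ?s = "AS D a x" and ?L = "AS D' a (Fo V x)" and ?c = "can a x" and ?U = "Fa (AU D')" and ?N = "AN D' a (Fo V x)"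
  have L: "?L \<in> Obj ?M" by simp
  obtain e k where e [simp]: "e \<in> Obj (AE D)" and k: "arr ?M k (Fo F e) ?L" "is_iso ?M k"
    using bspec[OF es[unfolded ess_surj_def] L] by blast
  note k' [simp] = k(1)[THEN conjunct1] k(1)[THEN conjunct2, THEN conjunct1] k(1)[THEN conjunct2, THEN conjunct2]
  note ki = inv_arr[OF k(2)]
  let ?i = "inv_arr ?M k"
  have i [simp]: "?i \<in> Arr ?M" "Dom ?M ?i = ?L" "Cod ?M ?i = Fo F e" using ki k(1) by simp_all
  have Pi [simp]: "Fa (AP D') ?i \<in> Arr A" "Dom A (Fa (AP D') ?i) = a" "Cod A (Fa (AP D') ?i) = Fo (AP D) e" by simp_all
  note j = inv_arr[OF \<sigma>_iso[OF e]]
  note [simp] = j(1-3)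
  \<comment> \<open>The generator of the free object, carried to \<open>F e\<close> by the inverse
    of \<open>k\<close> and then through the inverse of \<open>\<sigma> e\<close>, is an arrow
    between \<open>V\<close>-images, so fullness of \<open>V\<close> provides \<open>r\<close>. Its
    extension \<open>h\<close> yields the candidate inverse \<open>d\<close> of
    \<open>can a x\<close>.\<close>
  obtain r where r: "arr (AX D) r x (Fo (AU D) e)" "Fa V r = inv_arr (AX D') (\<sigma> e) \<cdot>\<^bsub>AX D'\<^esub> (?U ?i \<cdot>\<^bsub>AX D'\<^esub> ?N)"
    using full_faithfulD[OF Vf x, of "Fo (AU D) e" "inv_arr (AX D') (\<sigma> e) \<cdot>\<^bsub>AX D'\<^esub> (?U ?i \<cdot>\<^bsub>AX D'\<^esub> ?N)"] by auto
  define h where "h = pext D a x e (Fa (AP D') ?i) r"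
  have h [simp]: "h \<in> Arr (AE D)" "Dom (AE D) h = ?s" "Cod (AE D) h = e" "Fa (AP D) h = Fa (AP D') ?i"
    and hr: "Fa (AU D) h \<cdot>\<^bsub>AX D\<^esub> AN D a x = r"
    unfolding h_def using r(1) by simp_all
  have Vh: "Fa V (Fa (AU D) h) \<cdot>\<^bsub>AX D'\<^esub> Fa V (AN D a x) = Fa V r"
    using functor_simps(6)[OF V, of "AN D a x" "Fa (AU D) h"] hr by simp
  define d where "d = k \<cdot>\<^bsub>?M\<^esub> Fa F h"
  have d [simp]: "d \<in> Arr ?M" "Dom ?M d = Fo F ?s" "Cod ?M d = ?L" unfolding d_def by simp_all
  have Pk: "Fa (AP D') k \<cdot>\<^bsub>A\<^esub> Fa (AP D') ?i = Idn A a" and Uk: "?U k \<cdot>\<^bsub>AX D'\<^esub> ?U ?i = Idn (AX D') (Fo (AU D') ?L)"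
    using functor_simps(6)[OF D'.p, of ?i k] functor_simps(6)[OF D'.U, of ?i k] ki(5) by simp_all
  have Pd: "Fa (AP D') d = Idn A a" unfolding d_def using Pk by simp
  \<comment> \<open>\<open>d\<close> after \<open>can a x\<close> fixes the generator of the free
    object, which makes this composite an identity.\<close>
  have key: "?U d \<cdot>\<^bsub>AX D'\<^esub> (?U ?c \<cdot>\<^bsub>AX D'\<^esub> ?N) = ?N"
  proof -
    have "?U d \<cdot>\<^bsub>AX D'\<^esub> (?U ?c \<cdot>\<^bsub>AX D'\<^esub> ?N) = ?U k \<cdot>\<^bsub>AX D'\<^esub> ((?U (Fa F h) \<cdot>\<^bsub>AX D'\<^esub> \<sigma> ?s) \<cdot>\<^bsub>AX D'\<^esub> Fa V (AN D a x))"
      unfolding d_def by simp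
    also have "\<dots> = ?U k \<cdot>\<^bsub>AX D'\<^esub> (\<sigma> e \<cdot>\<^bsub>AX D'\<^esub> Fa V r)"
      using \<sigma>_nat'[of h ?s] Vh by simp
    also have "\<dots> = ?U k \<cdot>\<^bsub>AX D'\<^esub> (?U ?i \<cdot>\<^bsub>AX D'\<^esub> ?N)"
      unfolding r(2) using j(5)[THEN reassoc, of "?U ?i \<cdot>\<^bsub>AX D'\<^esub> ?N"] by simp
    also have "\<dots> = ?N" using Uk[THEN reassoc, of ?N] by simp
    finally show ?thesis .
  qed
  have dc: "d \<cdot>\<^bsub>?M\<^esub> ?c = Idn ?M ?L"
    by (rule D'.pext_eqI[of _ _ a "Fo V x"]) (use key in \<open>simp_all add: Pd\<close>)
  \<comment> \<open>The other composite is an endomorphism of \<open>F ?s\<close>, hence the image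
    of some \<open>w\<close>. By \<open>key\<close> and faithfulness of \<open>V\<close>,
    \<open>w\<close> fixes the generator \<open>AN D a x\<close>, so it is an identity.\<close>
  obtain w where w: "arr (AE D) w ?s ?s" "Fa F w = ?c \<cdot>\<^bsub>?M\<^esub> d"
    using full_faithfulD[OF ff, of ?s ?s "?c \<cdot>\<^bsub>?M\<^esub> d"] by auto
  note w' [simp] = w(1)[THEN conjunct1] w(1)[THEN conjunct2, THEN conjunct1] w(1)[THEN conjunct2, THEN conjunct2]
  have "w = Idn (AE D) ?s"
  proof (rule D.pext_eqI[of _ _ a x])
    show "Fa (AP D) w = Fa (AP D) (Idn (AE D) ?s)" using F_Fa[OF w'(1)] w(2) Pd by simp
    have "\<sigma> ?s \<cdot>\<^bsub>AX D'\<^esub> (Fa V (Fa (AU D) w) \<cdot>\<^bsub>AX D'\<^esub> Fa V (AN D a x)) = (?U (Fa F w) \<cdot>\<^bsub>AX D'\<^esub> \<sigma> ?s) \<cdot>\<^bsub>AX D'\<^esub> Fa V (AN D a x)"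
      using \<sigma>_nat'[of w ?s] by simp
    also have "\<dots> = ?U ?c \<cdot>\<^bsub>AX D'\<^esub> (?U d \<cdot>\<^bsub>AX D'\<^esub> (?U ?c \<cdot>\<^bsub>AX D'\<^esub> ?N))" unfolding w(2) by simp
    also have "\<dots> = ?U ?c \<cdot>\<^bsub>AX D'\<^esub> ?N" unfolding key ..
    also have "\<dots> = \<sigma> ?s \<cdot>\<^bsub>AX D'\<^esub> Fa V (AN D a x)" by simp
    finally have "Fa V (Fa (AU D) w) \<cdot>\<^bsub>AX D'\<^esub> Fa V (AN D a x) = Fa V (AN D a x)"
      by (rule \<sigma>_cancel) simp_all
    then have "Fa V (Fa (AU D) w \<cdot>\<^bsub>AX D\<^esub> AN D a x) = Fa V (AN D a x)" by simp
    then have "Fa (AU D) w \<cdot>\<^bsub>AX D\<^esub> AN D a x = AN D a x"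
      by (rule full_faithful_inj[OF D.X Vf, rotated -1]) simp_all
    then show "Fa (AU D) w \<cdot>\<^bsub>AX D\<^esub> AN D a x = Fa (AU D) (Idn (AE D) ?s) \<cdot>\<^bsub>AX D\<^esub> AN D a x" by simp
  qed simp_all
  then have "?c \<cdot>\<^bsub>?M\<^esub> d = Idn ?M (Fo F ?s)" using w(2) by simp
  with dc have "is_iso ?M ?c" by (intro is_isoI[of ?c ?M ?L "Fo F ?s" d]) simp_all
  then have "is_iso (AX D') (\<sigma> ?s \<cdot>\<^bsub>AX D'\<^esub> \<delta> (a, x))" using functor_iso[OF D'.E D'.U] by simp
  then show ?thesis by (rule iso_left[OF D'.X \<sigma>_iso, rotated]) (simp_all add: D.M_Fo)
qed

locale emf_equiv = emf_map A z E p S F for A z E p S F +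
  assumes ff: "full_faithful E (emf_cat A S) F" and es: "ess_surj E (emf_cat A S) F"
    and unit_iso: "\<And>x. x \<in> Obj (Carr S) \<Longrightarrow> is_iso (Carr S) (PUnit S (z, x))"
begin

lemma V_full_faithful: "full_faithful E0 (Carr S) V"
proof (rule full_faithfulI[OF V])
  fix x y u v assume *: "x \<in> Obj E0" "y \<in> Obj E0" "arr E0 u x y" "arr E0 v x y" "Fa V u = Fa V v"
  then have uv: "u \<in> Arr E" "v \<in> Arr E" "Fa p u = Idn A z" "Fa p v = Idn A z" "Dom E u = Dom E v" "Cod E u = Cod E v" by auto
  have "Fa F u = Fa F v"
    by (rule emf_eqI[OF F_Arr(1) F_Arr(1)]) (use uv *(5) in simp_all)
  then show "u = v" using full_faithfulD[OF ff, of x y "Fa F u"] * functor_simps(1)[OF FD(1)] by auto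
next
  fix x y g assume *: "x \<in> Obj E0" "y \<in> Obj E0" "arr (Carr S) g (Fo V x) (Fo V y)"
  then have xy: "x \<in> Obj E" "y \<in> Obj E" "Fo p x = z" "Fo p y = z" by simp_all
  have "uarrow (Fo F x) (Fo F y) (init_arr A z (par (Fo F y))) g \<in> Arr (emf_cat A S)"
    by (rule S.initial_algebra_morphism[OF z unit_iso]) (use * xy in simp_all)
  \<comment> \<open>The parameter part is an endomorphism of \<open>z\<close>, hence an identity; so
    the preimage under \<open>F\<close> will be vertical.\<close>
  moreover have "init_arr A z (par (Fo F y)) = Idn A z" using initial_unique[OF z A, of "init_arr A z z" "Idn A z"] init_arr[OF z zA] xy by simp
  ultimately obtain v where v: "arr E v x y" "Fa F v = uarrow (Fo F x) (Fo F y) (Idn A z) g"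
    using full_faithfulD[OF ff xy(1,2), of "uarrow (Fo F x) (Fo F y) (Idn A z) g"] xy by (auto simp del: emf_ArrI)
  have "Fa p v = Idn A z" using F_Arr(4)[of v] v by simp
  then show "\<exists>g'. arr E0 g' x y \<and> Fa V g' = g" using v by (intro exI[of _ v]) simp
qed

text \<open>\<open>W\<close> is full and faithful and \<open>W \<circ> \<eta>\<^sub>p \<cong> F\<close>, so \<open>\<eta>\<^sub>p\<close> is full, faithful and essentially surjective.\<close>

lemma unit_equivalence: "equivalence_functor E (emf_cat A T) (pcompar A PD)"
proof -
  interpret tr_cell A z E p S V M.\<delta> by (rule tr_cell)
  have Wf: "full_faithful (emf_cat A T) (emf_cat A S) W"
  proof (rule emf_1cell_full_faithful)
    show "full_faithful (Carr T) (Carr S) V" using V_full_faithful by simp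
    show "is_iso (Carr S) (M.\<delta> (a, x))" if "a \<in> Obj A" "x \<in> Obj (Carr T)" for a x
      using M.mate_iso[of a x] ff es V_full_faithful that by simp
  qed
  have n: "nat_trans E (emf_cat A S) (ftor_comp E W K) F factor_cell"
    using unit_factor(1) by (simp add: vertical_nat_trans_iff)
  have i: "is_iso (emf_cat A S) (factor_cell e)" if "e \<in> Obj E" for e
    using fib_2cell_isoD[OF unit_factor(2)] that by simp
  have "full_faithful E (emf_cat A S) (ftor_comp E W K)"
    by (rule full_faithful_nat_iso[OF E S.emf_category _ ff, where t = factor_cell]) (use n i in \<open>unfold nat_iso_def, blast\<close>)
  then have Kf: "full_faithful E (emf_cat A T) K" by (rule full_faithful_cancel[OF K_functor Wf])
  moreover have "ess_surj E (emf_cat A T) K"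
    unfolding ess_surj_def
  proof
    fix y assume y: "y \<in> Obj (emf_cat A T)"
    have "Fo W y \<in> Obj (emf_cat A S)" using functor_simps(1)[OF emf_1cell_functor y] .
    then obtain e k where e: "e \<in> Obj E" and k: "arr (emf_cat A S) k (Fo F e) (Fo W y)" "is_iso (emf_cat A S) k"
      using es unfolding ess_surj_def by blast
    have c: "arr (emf_cat A S) (factor_cell e) (Fo W (Fo K e)) (Fo F e)"
      using nat_transD(4-6)[OF n e] e by (simp del: emf_cat_simps emf_ArrI K.pcompar_simps emf_1cell_Fo)
    \<comment> \<open>This joins \<open>W (K e)\<close> to \<open>F e\<close> and \<open>F e\<close>
      to \<open>W y\<close>; full faithfulness of \<open>W\<close> reflects the composite to an
      isomorphism from \<open>K e\<close> to \<open>y\<close>.\<close>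
    have "is_iso (emf_cat A S) (k \<cdot>\<^bsub>emf_cat A S\<^esub> factor_cell e)"
      by (rule is_iso_comp[OF S.emf_category i[OF e] k(2)]) (use c k(1) in metis)
    moreover have "arr (emf_cat A S) (k \<cdot>\<^bsub>emf_cat A S\<^esub> factor_cell e) (Fo W (Fo K e)) (Fo W y)"
      using c k(1) cat_simps(6-8)[OF S.emf_category, of "factor_cell e" k] by metis
    ultimately obtain l where "arr (emf_cat A T) l (Fo K e) y" "is_iso (emf_cat A T) l"
      using full_faithful_iso[OF T.emf_category S.emf_category Wf K_Obj(1)[OF e] y] by metis
    then show "\<exists>c\<in>Obj E. \<exists>k. arr (emf_cat A T) k (Fo K c) y \<and> is_iso (emf_cat A T) k" using e by blast
  qed
  ultimately show ?thesis by (rule equivalence_functorI[OF E T.emf_category])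
qed

end

text \<open>In one direction \<open>P\<close> is \<open>T\<^sup>p\<close> itself, with the unit as
  equivalence. In the other, an equivalence in \<open>Fib A\<close> is a cartesian functor that is
  an equivalence of categories, and this is the situation of \<open>emf_equiv\<close>.\<close>

lemma (in pruned_fib) unit_equivalence_iff:
  "(\<exists>P. param_monad A P \<and> isomorphic_monads (Carr P) (monad_at A P z) (id_monad (Carr P)) \<and> equivalent (Fib A) (E, p) (emf A P)) \<longleftrightarrow>
     equivalence_functor E (emf_cat A T) (pcompar A PD)"
proof
  assume "\<exists>P. param_monad A P \<and> isomorphic_monads (Carr P) (monad_at A P z) (id_monad (Carr P)) \<and> equivalent (Fib A) (E, p) (emf A P)"
  then obtain P F where P: "param_monad A P" "isomorphic_monads (Carr P) (monad_at A P z) (id_monad (Carr P))"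
    and F: "internal_equivalence (Fib A) (E, p) (emf A P) F" by (auto simp: equivalent_def)
  interpret P: param_monad_axioms A P by (rule param_monad_axiomsI[OF A P(1)])
  have F': "fibred_functor A (E, p) (emf A P) F" "equivalence_functor E (emf_cat A P) F"
    using F fib_internal_equivalence[OF A, of "{(E, p). fibration A E p}" "(E, p)" "emf A P" F] fib P.emf_fibration
    unfolding Fib_conc by (auto simp: emf_def)
  interpret emf_equiv A z E p P F
    by unfold_locales (use F' equivalence_functorD[OF E P.emf_category F'(2)] P.unit_iso[OF zA P(2)] in simp_all)
  show "equivalence_functor E (emf_cat A T) (pcompar A PD)" by (rule unit_equivalence)
next
  assume "equivalence_functor E (emf_cat A T) (pcompar A PD)"
  then have "internal_equivalence (Fib A) (E, p) (emf A T) (pcompar A PD)"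
    using fib_internal_equivalence[OF A, of "{(E, p). fibration A E p}" "(E, p)" "emf A T"] fib T.emf_fibration unit_fibred
    unfolding Fib_conc by (auto simp: emf_def)
  then show "\<exists>P. param_monad A P \<and> isomorphic_monads (Carr P) (monad_at A P z) (id_monad (Carr P)) \<and> equivalent (Fib A) (E, p) (emf A P)"
    using T.param_monad T_pruned by (intro exI[of _ T]) (auto simp: pruned_monad_def equivalent_def)
qed

text \<open>Since \<open>emf_to_em\<close> is an isomorphism, the clause on
  \<open>comparison\<close> determines the unit completely. The criterion is stated both for the
  underlying functor and inside \<open>PrFib A z\<close>; the two notions of equivalence agree
  because a quasi-inverse can be chosen fibred.\<close>

theorem theorem5p13:
  fixes A :: "'u ucat" and z :: "'u univ"
  assumes "category A" and "initial A z"
  shows "\<exists>L \<eta>.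
     biadjunction (PrFib A z) (PrMnd A z) L (emf_2functor A z) \<eta> \<and>
     (\<forall>q\<in>Ob2 (PrFib A z). F0 L q = Tp A z q) \<and>
     (\<forall>E p. (E, p) \<in> Ob2 (PrFib A z) \<longrightarrow>
        fibred_functor A (E, p) (emf A (Tp A z (E, p))) (N0 \<eta> (E, p)) \<and>
        adjunction (A \<times>\<^sub>C fibre A E p z) E (pL_plus_i A z E p) (p_iR A z E p)
          (sum_unit A z E p) (sum_counit A z E p) \<and>
        cat_isomorphism (emf_cat A (Tp A z (E, p)))
          (em_cat (A \<times>\<^sub>C fibre A E p z) (sum_monad A z E p)) (emf_to_em A z (E, p)) \<and>
        ftor_comp E (emf_to_em A z (E, p)) (N0 \<eta> (E, p)) =
          comparison E (p_iR A z E p) (sum_counit A z E p) \<and>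
        (equivalence_functor E (emf_cat A (Tp A z (E, p))) (N0 \<eta> (E, p)) \<longleftrightarrow>
          (\<exists>P. param_monad A P \<and>
             isomorphic_monads (Carr P) (monad_at A P z) (id_monad (Carr P)) \<and>
             equivalent (Fib A) (E, p) (emf A P))) \<and>
        (internal_equivalence (PrFib A z) (E, p) (emf A (Tp A z (E, p))) (N0 \<eta> (E, p)) \<longleftrightarrow>
          (\<exists>P. param_monad A P \<and>
             isomorphic_monads (Carr P) (monad_at A P z) (id_monad (Carr P)) \<and>
             equivalent (Fib A) (E, p) (emf A P))))"
proof (rule exI[of _ "Tp_2functor A z"], rule exI[of _ "unit_pnt A z"], intro conjI allI impI ballI)
  note Az = assms
  interpret C: conc2 "{(E, p). pruned A z E p}" fst "\<lambda>F. F" "fibred_functor A" "vertical_nat_trans A" "\<lambda>q. ftor_id (fst q)" "\<lambda>a b c g f. ftor_comp (fst a) g f"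
    by (rule fib_conc2[OF Az(1)]) (auto simp: pruned_def)
  interpret C': conc2 "{P. pruned_monad A z P}" Carr fst "pm_1cell A" "pm_2cell A" "mnd_id A" "mnd_cmp A"
    by (rule mnd_conc2) (use pruned_monad_axioms[OF Az(1)] in auto)
  have Ob: "Ob2 (PrFib A z) = {(E, p). pruned A z E p}" "Ob2 (PrMnd A z) = {P. pruned_monad A z P}"
    by (simp_all add: PrFib_conc fib_conc_def PrMnd_conc)
  show "biadjunction (PrFib A z) (PrMnd A z) (Tp_2functor A z) (emf_2functor A z) (unit_pnt A z)"
    unfolding biadjunction_def
  proof (intro conjI ballI)
    show "two_category (PrFib A z)" "two_category (PrMnd A z)"
      using C.two_category C'.two_category by (simp_all add: PrFib_conc fib_conc_def PrMnd_conc)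
    show "equivalence_functor (Hom2 (PrMnd A z) (F0 (Tp_2functor A z) q) S) (Hom2 (PrFib A z) q (F0 (emf_2functor A z) S))
       (transpose (PrFib A z) (PrMnd A z) (Tp_2functor A z) (emf_2functor A z) (unit_pnt A z) q S)"
      if "q \<in> Ob2 (PrFib A z)" "S \<in> Ob2 (PrMnd A z)" for q S
      using transpose_equivalence[OF Az] that unfolding Ob by simp
  qed (rule Tp_two_functor[OF Az] emf_two_functor[OF Az] unit_pseudonatural[OF Az])+
  show "F0 (Tp_2functor A z) q = Tp A z q" for q by simp
  fix E p assume "(E, p) \<in> Ob2 (PrFib A z)"
  then have pr: "pruned A z E p" by (simp add: Ob)
  interpret pruned_fib A z E p by unfold_locales (rule Az pr)+
  have N0: "N0 (unit_pnt A z) (E, p) = pcompar A PD" by (simp add: unit_pnt_def fib_padj_def)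
  show "fibred_functor A (E, p) (emf A T) (N0 (unit_pnt A z) (E, p))" unfolding N0 by (rule unit_fibred)
  show "adjunction (A \<times>\<^sub>C E0) E (pL_plus_i A z E p) (p_iR A z E p) (sum_unit A z E p) (sum_counit A z E p)" by (rule sum_adjunction)
  show "cat_isomorphism (emf_cat A T) (em_cat (A \<times>\<^sub>C E0) (sum_monad A z E p)) (emf_to_em A z (E, p))" by (rule emf_to_em_iso)
  show "ftor_comp E (emf_to_em A z (E, p)) (N0 (unit_pnt A z) (E, p)) = comparison E (p_iR A z E p) (sum_counit A z E p)"
    unfolding N0 by (rule unit_comparison)
  show "equivalence_functor E (emf_cat A T) (N0 (unit_pnt A z) (E, p)) \<longleftrightarrow> (\<exists>P. param_monad A P \<and>
      isomorphic_monads (Carr P) (monad_at A P z) (id_monad (Carr P)) \<and> equivalent (Fib A) (E, p) (emf A P))"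
    unfolding N0 by (rule unit_equivalence_iff[symmetric])
  have em: "emf A T \<in> {(E, p). pruned A z E p}"
    using emf_two_functor[OF Az] T_pruned unfolding two_functor_def Ob by simp
  \<comment> \<open>\<open>PrFib A z\<close> is \<open>fib_conc\<close> over the pruned fibrations,
    so the description of internal equivalences applies to it directly.\<close>
  have "\<And>q. q \<in> {(E, p). pruned A z E p} \<Longrightarrow> fibration A (fst q) (snd q)" "(E, p) \<in> {(E, p). pruned A z E p}"
    using pr by (auto simp: pruned_def)
  from fib_internal_equivalence[OF A this em]
  have "internal_equivalence (PrFib A z) (E, p) (emf A T) (pcompar A PD) \<longleftrightarrow> equivalence_functor E (emf_cat A T) (pcompar A PD)"
    using unit_fibred unfolding PrFib_conc by simp
  then show "internal_equivalence (PrFib A z) (E, p) (emf A T) (N0 (unit_pnt A z) (E, p)) \<longleftrightarrow> (\<exists>P. param_monad A P \<and>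
      isomorphic_monads (Carr P) (monad_at A P z) (id_monad (Carr P)) \<and> equivalent (Fib A) (E, p) (emf A P))"
    unfolding N0 unit_equivalence_iff .
qed


end
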